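(* Let $k$ be a commutative ring, let $B$ be a Hopf algebra over $k$ and let $T$ be a faithfully flat $B$-Galois extension of $k$. Then there exist a Hopf algebra $A$, an algebra $Z$ and algebra morphisms $S_T:T\to Z^{\mathrm{op}}$ and $S_Z:Z\to T^{\mathrm{op}}$ such that $(A,B,T,Z)$ is a complete Hopf-Galois system (with generalized antipodes $S_T$ and $S_Z$). In particular, $(A,B,T,Z)$ and $(B,A,Z,T)$ are two Hopf-Galois systems.
   Context: $\otimes=\otimes_k$; algebras are associative and unital; a module also denotes its identity map; $m$ is multiplication, $u$ the unit; $\tau_{(X,Y)}:X\otimes Y\to Y\otimes X$ is the flip. A $B$-Galois extension of $k$ is a right $B$-comodule algebra $T$ (coaction $\beta_T:T\to T\otimes B$) whose coinvariants are $k$ and such that the canonical map $T\otimes T\to T\otimes B$, $x\otimes y\mapsto(x\otimes 1)\beta_T(y)$, is bijective. It is faithfully flat if $T$ is faithfully flat as a $k$-module. Hopf-Galois system. A Hopf-Galois system consists of four non-zero $k$-algebras $(A,B,T,Z)$ such that: (i) $A,B$ are bialgebras; (ii) $T$ is an $(A,B)$-bicomodule algebra with coactions $\alpha_T:T\to A\otimes T$, $\beta_T:T\to T\otimes B$; (iii) there are algebra morphisms $\gamma:A\to T\otimes Z$, $\delta:B\to Z\otimes T$ with $(\gamma\otimes T)\alpha_T=(T\otimes\delta)\beta_T$, $(A\otimes\gamma)\Delta_A=(\alpha_T\otimes Z)\gamma$, $(\delta\otimes B)\Delta_B=(Z\otimes\beta_T)\delta$; (iv) there is a linear map $S_Z:Z\to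 T$ with $m_T(T\otimes S_Z)\gamma=u_T\varepsilon_A$ and $m_T(S_Z\otimes T)\delta=u_T\varepsilon_B$. Then $A$ and $B$ are automatically Hopf algebras, with antipodes $S_A,S_B$. Complete Hopf-Galois system. $(A,B,T,Z)$ with maps $\alpha_T,\beta_T$, $\lambda_Z:Z\to B\otimes Z$, $\rho_Z:Z\to Z\otimes A$, $\gamma,\delta$, $S_T:T\to Z$, $S_Z:Z\to T$ is a complete Hopf-Galois system if: $(A,B,T,Z)$ with $(\alpha_T,\beta_T,\gamma,\delta,S_Z)$ is a Hopf-Galois system; $(B,A,Z,T)$ with $(\lambda_Z,\rho_Z,\delta,\gamma,S_T)$ is a Hopf-Galois system (here $\delta:B\to Z\otimes T$ plays the role of "$\gamma$" and $\gamma:A\to T\otimes Z$ the role of "$\delta$"); and $(\beta_T\otimes Z)\gamma=(T\otimes\lambda_Z)\gamma$, $(\rho_Z\otimes T)\delta=(Z\otimes\alpha_T)\delta$, $\tau_{(Z,T)}(S_T\otimes S_Z)\gamma=\gamma S_A$, $\tau_{(T,Z)}(S_Z\otimes S_T)\delta=\delta S_B$, $\tau_{(A,Z)}(S_A\otimes S_T)\alpha_T=\rho_Z S_T$, $\tau_{(Z,B)}(S_T\otimes S_B)\beta_T=\lambda_Z S_T$, $\tau_{(B,T)}(S_B\otimes S_Z)\lambda_Z=\beta_T S_Z$, $\tau_{(T,A)}(S_Z\otimes S_A)\rho_Z=\alpha_T S_Z$. In the corollary, $\beta_T$ is the given coaction of $B$ on $T$. *)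

theory Defs
  imports "HOL-Algebra.Module" "HOL-Algebra.AbelCoset"
begin

section \<open>Linear maps, algebras\<close>

text \<open>Maps are only ever compared on carriers; their values outside are irrelevant.\<close>

definition lin_map ::
  "('k, 'r) ring_scheme \<Rightarrow> ('k, 'm, 'x) module_scheme \<Rightarrow> ('k, 'n, 'y) module_scheme \<Rightarrow> ('m \<Rightarrow> 'n) set"
  where "lin_map k M N = {f \<in> carrier M \<rightarrow> carrier N.
     (\<forall>x \<in> carrier M. \<forall>y \<in> carrier M. f (x \<oplus>\<^bsub>M\<^esub> y) = f x \<oplus>\<^bsub>N\<^esub> f y) \<and>
     (\<forall>a \<in> carrier k. \<forall>x \<in> carrier M. f (a \<odot>\<^bsub>M\<^esub> x) = a \<odot>\<^bsub>N\<^esub> f x)}"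

text \<open>Associative unital algebras; the library's \<open>algebra\<close> is the commutative case.\<close>

locale k_algebra = module k A + ring A
  for k :: "('k, 'r) ring_scheme" and A :: "('k, 'a, 'x) module_scheme" (structure) +
  assumes smult_mult_left:
    "\<lbrakk>c \<in> carrier k; x \<in> carrier A; y \<in> carrier A\<rbrakk> \<Longrightarrow> (c \<odot> x) \<otimes> y = c \<odot> (x \<otimes> y)"
    and smult_mult_right:
    "\<lbrakk>c \<in> carrier k; x \<in> carrier A; y \<in> carrier A\<rbrakk> \<Longrightarrow> x \<otimes> (c \<odot> y) = c \<odot> (x \<otimes> y)"

definition alg_hom ::
  "('k, 'r) ring_scheme \<Rightarrow> ('k, 'a, 'x) module_scheme \<Rightarrow> ('k, 'b, 'y) module_scheme \<Rightarrow> ('a \<Rightarrow> 'b) set"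
  where "alg_hom k A B = lin_map k A B \<inter> ring_hom A B"

definition opp :: "('k, 'a, 'x) module_scheme \<Rightarrow> ('k, 'a, 'x) module_scheme"
  where "opp A = A\<lparr>mult := (\<lambda>x y. y \<otimes>\<^bsub>A\<^esub> x)\<rparr>"

definition base_module :: "('k, 'r) ring_scheme \<Rightarrow> ('k, 'k) module"
  where "base_module k = \<lparr>carrier = carrier k, mult = mult k, one = one k,
     zero = zero k, add = add k, smult = mult k\<rparr>"

definition unit_map :: "('k, 'a, 'x) module_scheme \<Rightarrow> 'k \<Rightarrow> 'a"
  where "unit_map A c = c \<odot>\<^bsub>A\<^esub> \<one>\<^bsub>A\<^esub>"


section \<open>Tensor products over \<open>k\<close>\<close>

text \<open>
  \<open>M \<boxtimes>\<^bsub>k\<^esub> N\<close> is the free module on \<open>carrier M \<times> carrier N\<close> modulo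
  the submodule generated by the bilinearity relations, so its elements are cosets.
\<close>

definition free_module :: "('k, 'r) ring_scheme \<Rightarrow> 's set \<Rightarrow> ('k, 's \<Rightarrow> 'k) module"
  where "free_module k S =
    \<lparr>carrier = {\<phi>. (\<forall>s. \<phi> s \<in> carrier k) \<and> (\<forall>s. s \<notin> S \<longrightarrow> \<phi> s = \<zero>\<^bsub>k\<^esub>) \<and> finite {s. \<phi> s \<noteq> \<zero>\<^bsub>k\<^esub>}},
     mult = undefined, one = undefined,
     zero = (\<lambda>s. \<zero>\<^bsub>k\<^esub>), add = (\<lambda>\<phi> \<psi> s. \<phi> s \<oplus>\<^bsub>k\<^esub> \<psi> s),
     smult = (\<lambda>c \<phi> s. c \<otimes>\<^bsub>k\<^esub> \<phi> s)\<rparr>"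

definition free_gen :: "('k, 'r) ring_scheme \<Rightarrow> 's \<Rightarrow> 's \<Rightarrow> 'k"
  where "free_gen k s = (\<lambda>t. if t = s then \<one>\<^bsub>k\<^esub> else \<zero>\<^bsub>k\<^esub>)"

definition tensor_free ::
  "('k, 'r) ring_scheme \<Rightarrow> ('k, 'm, 'x) module_scheme \<Rightarrow> ('k, 'n, 'y) module_scheme
    \<Rightarrow> ('k, 'm \<times> 'n \<Rightarrow> 'k) module"
  where "tensor_free k M N = free_module k (carrier M \<times> carrier N)"

definition tensor_rel_gens ::
  "('k, 'r) ring_scheme \<Rightarrow> ('k, 'm, 'x) module_scheme \<Rightarrow> ('k, 'n, 'y) module_scheme
    \<Rightarrow> ('m \<times> 'n \<Rightarrow> 'k) set"
  where "tensor_rel_gens k M N = (let F = tensor_free k M N; e = (\<lambda>x y. free_gen k (x, y)) in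
     {e (x \<oplus>\<^bsub>M\<^esub> x') y \<ominus>\<^bsub>F\<^esub> (e x y \<oplus>\<^bsub>F\<^esub> e x' y) | x x' y.
        x \<in> carrier M \<and> x' \<in> carrier M \<and> y \<in> carrier N} \<union>
     {e x (y \<oplus>\<^bsub>N\<^esub> y') \<ominus>\<^bsub>F\<^esub> (e x y \<oplus>\<^bsub>F\<^esub> e x y') | x y y'.
        x \<in> carrier M \<and> y \<in> carrier N \<and> y' \<in> carrier N} \<union>
     {e (c \<odot>\<^bsub>M\<^esub> x) y \<ominus>\<^bsub>F\<^esub> c \<odot>\<^bsub>F\<^esub> e x y | c x y.
        c \<in> carrier k \<and> x \<in> carrier M \<and> y \<in> carrier N} \<union>
     {e x (c \<odot>\<^bsub>N\<^esub> y) \<ominus>\<^bsub>F\<^esub> c \<odot>\<^bsub>F\<^esub> e x y | c x y.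
        c \<in> carrier k \<and> x \<in> carrier M \<and> y \<in> carrier N})"

definition tensor_rel ::
  "('k, 'r) ring_scheme \<Rightarrow> ('k, 'm, 'x) module_scheme \<Rightarrow> ('k, 'n, 'y) module_scheme
    \<Rightarrow> ('m \<times> 'n \<Rightarrow> 'k) set"
  where "tensor_rel k M N =
    \<Inter>{H. submodule H k (tensor_free k M N) \<and> tensor_rel_gens k M N \<subseteq> H}"

definition tensor_coset ::
  "('k, 'r) ring_scheme \<Rightarrow> ('k, 'm, 'x) module_scheme \<Rightarrow> ('k, 'n, 'y) module_scheme
    \<Rightarrow> ('m \<times> 'n \<Rightarrow> 'k) \<Rightarrow> ('m \<times> 'n \<Rightarrow> 'k) set"
  where "tensor_coset k M N \<phi> = tensor_rel k M N +>\<^bsub>tensor_free k M N\<^esub> \<phi>"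

definition pure ::
  "('k, 'r) ring_scheme \<Rightarrow> ('k, 'm, 'x) module_scheme \<Rightarrow> ('k, 'n, 'y) module_scheme
    \<Rightarrow> 'm \<Rightarrow> 'n \<Rightarrow> ('m \<times> 'n \<Rightarrow> 'k) set"
  where "pure k M N x y = tensor_coset k M N (free_gen k (x, y))"

text \<open>
  \<open>tensor_lift k P f\<close> is the linear map into \<open>P\<close> on a tensor product that is induced by a
  bilinear map \<open>f\<close>: it sends the class of \<open>\<Sum>\<^sub>p \<phi> p \<cdot> p\<close> to \<open>\<Sum>\<^sub>p \<phi> p \<cdot> f p\<close>. For bilinear \<open>f\<close> this does
  not depend on the chosen representative \<open>\<phi>\<close>.
\<close>

definition tensor_lift ::
  "('k, 'r) ring_scheme \<Rightarrow> ('k, 'p, 'z) module_scheme \<Rightarrow> ('m \<times> 'n \<Rightarrow> 'p)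
    \<Rightarrow> ('m \<times> 'n \<Rightarrow> 'k) set \<Rightarrow> 'p"
  where "tensor_lift k P f u = (let \<phi> = (SOME \<phi>. \<phi> \<in> u) in
     finsum P (\<lambda>p. \<phi> p \<odot>\<^bsub>P\<^esub> f p) {p. \<phi> p \<noteq> \<zero>\<^bsub>k\<^esub>})"

definition tensor_module ::
  "('k, 'r) ring_scheme \<Rightarrow> ('k, 'm, 'x) module_scheme \<Rightarrow> ('k, 'n, 'y) module_scheme
    \<Rightarrow> ('k, ('m \<times> 'n \<Rightarrow> 'k) set) module"
  where "tensor_module k M N = (let F = tensor_free k M N; K = tensor_rel k M N in
    \<lparr>carrier = a_rcosets\<^bsub>F\<^esub> K, mult = undefined, one = undefined,
     zero = K, add = (\<lambda>u v. u <+>\<^bsub>F\<^esub> v),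
     smult = (\<lambda>c u. \<Union>\<phi>\<in>u. tensor_coset k M N (c \<odot>\<^bsub>F\<^esub> \<phi>))\<rparr>)"

text \<open>
  The product \<open>(x \<otimes> y)(x' \<otimes> y') = xx' \<otimes> yy'\<close> is included in the record; it is
  meaningful when both factors are algebras and plays no role when they are just modules.
\<close>

definition tensor ::
  "('k, 'r) ring_scheme \<Rightarrow> ('k, 'm, 'x) module_scheme \<Rightarrow> ('k, 'n, 'y) module_scheme
    \<Rightarrow> ('k, ('m \<times> 'n \<Rightarrow> 'k) set) module" (infixl \<open>\<boxtimes>\<index>\<close> 75)
  where "tensor k M N = (tensor_module k M N)
    \<lparr>mult := (\<lambda>u v. tensor_lift k (tensor_module k M N) (\<lambda>(x, y).
        tensor_lift k (tensor_module k M N) (\<lambda>(x', y').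
          pure k M N (x \<otimes>\<^bsub>M\<^esub> x') (y \<otimes>\<^bsub>N\<^esub> y')) v) u),
     one := pure k M N \<one>\<^bsub>M\<^esub> \<one>\<^bsub>N\<^esub>\<rparr>"

text \<open>\<open>tensor_map k M' N' f g\<close> is \<open>f \<otimes> g\<close> with target \<open>M' \<otimes> N'\<close>.\<close>

definition tensor_map ::
  "('k, 'r) ring_scheme \<Rightarrow> ('k, 'm1, 'x) module_scheme \<Rightarrow> ('k, 'n1, 'y) module_scheme
    \<Rightarrow> ('m \<Rightarrow> 'm1) \<Rightarrow> ('n \<Rightarrow> 'n1) \<Rightarrow> ('m \<times> 'n \<Rightarrow> 'k) set \<Rightarrow> ('m1 \<times> 'n1 \<Rightarrow> 'k) set"
  where "tensor_map k M' N' f g =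
    tensor_lift k (M' \<boxtimes>\<^bsub>k\<^esub> N') (\<lambda>(x, y). pure k M' N' (f x) (g y))"

text \<open>The canonical isomorphism \<open>(M \<otimes> N) \<otimes> P \<rightarrow> M \<otimes> (N \<otimes> P)\<close>.\<close>

definition tensor_assoc ::
  "('k, 'r) ring_scheme \<Rightarrow> ('k, 'm, 'x) module_scheme \<Rightarrow> ('k, 'n, 'y) module_scheme
    \<Rightarrow> ('k, 'p, 'z) module_scheme
    \<Rightarrow> (('m \<times> 'n \<Rightarrow> 'k) set \<times> 'p \<Rightarrow> 'k) set \<Rightarrow> ('m \<times> ('n \<times> 'p \<Rightarrow> 'k) set \<Rightarrow> 'k) set"
  where "tensor_assoc k M N P =
    tensor_lift k (M \<boxtimes>\<^bsub>k\<^esub> (N \<boxtimes>\<^bsub>k\<^esub> P)) (\<lambda>(u, z).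
      tensor_lift k (M \<boxtimes>\<^bsub>k\<^esub> (N \<boxtimes>\<^bsub>k\<^esub> P)) (\<lambda>(x, y).
        pure k M (N \<boxtimes>\<^bsub>k\<^esub> P) x (pure k N P y z)) u)"

text \<open>The flip \<open>M \<otimes> N \<rightarrow> N \<otimes> M\<close>.\<close>

definition flip ::
  "('k, 'r) ring_scheme \<Rightarrow> ('k, 'm, 'x) module_scheme \<Rightarrow> ('k, 'n, 'y) module_scheme
    \<Rightarrow> ('m \<times> 'n \<Rightarrow> 'k) set \<Rightarrow> ('n \<times> 'm \<Rightarrow> 'k) set"
  where "flip k M N = tensor_lift k (N \<boxtimes>\<^bsub>k\<^esub> M) (\<lambda>(x, y). pure k N M y x)"

definition mult_map ::
  "('k, 'r) ring_scheme \<Rightarrow> ('k, 'a, 'x) module_scheme \<Rightarrow> ('a \<times> 'a \<Rightarrow> 'k) set \<Rightarrow> 'a"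
  where "mult_map k A = tensor_lift k A (\<lambda>(x, y). x \<otimes>\<^bsub>A\<^esub> y)"

text \<open>\<open>M \<simeq> k \<otimes> M\<close> and \<open>M \<simeq> M \<otimes> k\<close>, in the direction towards \<open>M\<close>.\<close>

definition left_unitor ::
  "('k, 'r) ring_scheme \<Rightarrow> ('k, 'm, 'x) module_scheme \<Rightarrow> ('k \<times> 'm \<Rightarrow> 'k) set \<Rightarrow> 'm"
  where "left_unitor k M = tensor_lift k M (\<lambda>(c, x). c \<odot>\<^bsub>M\<^esub> x)"

definition right_unitor ::
  "('k, 'r) ring_scheme \<Rightarrow> ('k, 'm, 'x) module_scheme \<Rightarrow> ('m \<times> 'k \<Rightarrow> 'k) set \<Rightarrow> 'm"
  where "right_unitor k M = tensor_lift k M (\<lambda>(x, c). c \<odot>\<^bsub>M\<^esub> x)"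


section \<open>Faithful flatness\<close>

definition exact_at ::
  "('k, 'l, 'x) module_scheme \<Rightarrow> ('k, 'm, 'y) module_scheme \<Rightarrow> ('k, 'n, 'z) module_scheme
    \<Rightarrow> ('l \<Rightarrow> 'm) \<Rightarrow> ('m \<Rightarrow> 'n) \<Rightarrow> bool"
  where "exact_at L M N f g \<longleftrightarrow> f ` carrier L = a_kernel M N g"

text \<open>
  A sequence \<open>L \<rightarrow> M \<rightarrow> N\<close> of \<open>k\<close>-modules is exact iff
  \<open>T \<otimes> L \<rightarrow> T \<otimes> M \<rightarrow> T \<otimes> N\<close> is. A HOL formula cannot quantify over all types, so
  the test modules have their carriers in an explicit type \<open>'u\<close>. As soon as \<open>'k set\<close> embeds
  into \<open>'u\<close>, this is the usual unrestricted notion: up to isomorphism \<open>'u\<close> then contains all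
  ideals \<open>I\<close> of \<open>k\<close> and all \<open>k/I\<close>, and \<open>T\<close> is faithfully flat iff all \<open>T \<otimes> I \<rightarrow> T \<otimes> k\<close> are
  injective and \<open>T \<otimes> k/I \<noteq> 0\<close> for all proper \<open>I\<close>.
\<close>

definition faithfully_flat ::
  "'u itself \<Rightarrow> ('k, 'r) ring_scheme \<Rightarrow> ('k, 't, 'x) module_scheme \<Rightarrow> bool"
  where "faithfully_flat U k T \<longleftrightarrow> module k T \<and>
    (\<forall>(L :: ('k, 'u) module) (M :: ('k, 'u) module) (N :: ('k, 'u) module).
      \<forall>f \<in> lin_map k L M. \<forall>g \<in> lin_map k M N.
        module k L \<longrightarrow> module k M \<longrightarrow> module k N \<longrightarrow>
        (exact_at L M N f g \<longleftrightarrow>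
         exact_at (T \<boxtimes>\<^bsub>k\<^esub> L) (T \<boxtimes>\<^bsub>k\<^esub> M) (T \<boxtimes>\<^bsub>k\<^esub> N)
           (tensor_map k T M id f) (tensor_map k T N id g)))"

text \<open>
  A type for test modules large enough to hold a copy of every submodule and quotient of every
  iterated tensor product of modules with carriers in \<open>'t\<close>, \<open>'b\<close> and \<open>'k\<close>: such modules are
  subquotients of free modules on sets of words.
\<close>

type_synonym ('k, 't, 'b) test_carrier = "(('t + 'b) list \<Rightarrow> 'k) set"


section \<open>Bialgebras, Hopf algebras, comodule algebras\<close>

record ('k, 'a) bialg = "('k, 'a) module" +
  comult :: "'a \<Rightarrow> ('a \<times> 'a \<Rightarrow> 'k) set"
  counit :: "'a \<Rightarrow> 'k"

locale bialgebra = k_algebra k A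
  for k :: "('k, 'r) ring_scheme" and A :: "('k, 'a, 'x) bialg_scheme" +
  assumes comult_hom: "comult A \<in> alg_hom k A (A \<boxtimes>\<^bsub>k\<^esub> A)"
    and counit_hom: "counit A \<in> alg_hom k A (base_module k)"
    and coassoc: "\<forall>a \<in> carrier A.
      tensor_assoc k A A A (tensor_map k (A \<boxtimes>\<^bsub>k\<^esub> A) A (comult A) id (comult A a)) =
      tensor_map k A (A \<boxtimes>\<^bsub>k\<^esub> A) id (comult A) (comult A a)"
    and counit_left: "\<forall>a \<in> carrier A.
      left_unitor k A (tensor_map k (base_module k) A (counit A) id (comult A a)) = a"
    and counit_right: "\<forall>a \<in> carrier A.
      right_unitor k A (tensor_map k A (base_module k) id (counit A) (comult A a)) = a"

definition is_antipode ::
  "('k, 'r) ring_scheme \<Rightarrow> ('k, 'a, 'x) bialg_scheme \<Rightarrow> ('a \<Rightarrow> 'a) \<Rightarrow> bool"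
  where "is_antipode k A S \<longleftrightarrow> S \<in> lin_map k A A \<and>
    (\<forall>a \<in> carrier A.
      mult_map k A (tensor_map k A A S id (comult A a)) = unit_map A (counit A a) \<and>
      mult_map k A (tensor_map k A A id S (comult A a)) = unit_map A (counit A a))"

definition hopf_algebra :: "('k, 'r) ring_scheme \<Rightarrow> ('k, 'a, 'x) bialg_scheme \<Rightarrow> bool"
  where "hopf_algebra k A \<longleftrightarrow> bialgebra k A \<and> (\<exists>S. is_antipode k A S)"

text \<open>Antipodes are unique on the carrier, so the choice below is harmless.\<close>

definition antipode :: "('k, 'r) ring_scheme \<Rightarrow> ('k, 'a, 'x) bialg_scheme \<Rightarrow> 'a \<Rightarrow> 'a"
  where "antipode k A = (SOME S. is_antipode k A S)"

locale right_comodule_algebra =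
  fixes k :: "('k, 'r) ring_scheme" and B :: "('k, 'b, 'x) bialg_scheme"
    and T :: "('k, 't, 'y) module_scheme" and \<beta> :: "'t \<Rightarrow> ('t \<times> 'b \<Rightarrow> 'k) set"
  assumes right_bialgebra: "bialgebra k B"
    and right_algebra: "k_algebra k T"
    and right_coaction_hom: "\<beta> \<in> alg_hom k T (T \<boxtimes>\<^bsub>k\<^esub> B)"
    and right_coaction_coassoc: "\<forall>t \<in> carrier T.
      tensor_assoc k T B B (tensor_map k (T \<boxtimes>\<^bsub>k\<^esub> B) B \<beta> id (\<beta> t)) =
      tensor_map k T (B \<boxtimes>\<^bsub>k\<^esub> B) id (comult B) (\<beta> t)"
    and right_coaction_counit: "\<forall>t \<in> carrier T.
      right_unitor k T (tensor_map k T (base_module k) id (counit B) (\<beta> t)) = t"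

locale left_comodule_algebra =
  fixes k :: "('k, 'r) ring_scheme" and A :: "('k, 'a, 'x) bialg_scheme"
    and T :: "('k, 't, 'y) module_scheme" and \<alpha> :: "'t \<Rightarrow> ('a \<times> 't \<Rightarrow> 'k) set"
  assumes left_bialgebra: "bialgebra k A"
    and left_algebra: "k_algebra k T"
    and left_coaction_hom: "\<alpha> \<in> alg_hom k T (A \<boxtimes>\<^bsub>k\<^esub> T)"
    and left_coaction_coassoc: "\<forall>t \<in> carrier T.
      tensor_assoc k A A T (tensor_map k (A \<boxtimes>\<^bsub>k\<^esub> A) T (comult A) id (\<alpha> t)) =
      tensor_map k A (A \<boxtimes>\<^bsub>k\<^esub> T) id \<alpha> (\<alpha> t)"
    and left_coaction_counit: "\<forall>t \<in> carrier T.
      left_unitor k T (tensor_map k (base_module k) T (counit A) id (\<alpha> t)) = t"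

locale bicomodule_algebra =
  left_comodule_algebra k A T \<alpha> + right_comodule_algebra k B T \<beta>
  for k :: "('k, 'r) ring_scheme" and A :: "('k, 'a, 'x) bialg_scheme"
    and B :: "('k, 'b, 'y) bialg_scheme" and T :: "('k, 't, 'z) module_scheme"
    and \<alpha> :: "'t \<Rightarrow> ('a \<times> 't \<Rightarrow> 'k) set" and \<beta> :: "'t \<Rightarrow> ('t \<times> 'b \<Rightarrow> 'k) set" +
  assumes coactions_commute: "\<forall>t \<in> carrier T.
      tensor_assoc k A T B (tensor_map k (A \<boxtimes>\<^bsub>k\<^esub> T) B \<alpha> id (\<beta> t)) =
      tensor_map k A (T \<boxtimes>\<^bsub>k\<^esub> B) id \<beta> (\<alpha> t)"


section \<open>Galois extensions and Hopf-Galois systems\<close>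

definition coinvariants ::
  "('k, 'r) ring_scheme \<Rightarrow> ('k, 'b, 'x) bialg_scheme \<Rightarrow> ('k, 't, 'y) module_scheme
    \<Rightarrow> ('t \<Rightarrow> ('t \<times> 'b \<Rightarrow> 'k) set) \<Rightarrow> 't set"
  where "coinvariants k B T \<beta> = {t \<in> carrier T. \<beta> t = pure k T B t \<one>\<^bsub>B\<^esub>}"

definition canonical_map ::
  "('k, 'r) ring_scheme \<Rightarrow> ('k, 'b, 'x) bialg_scheme \<Rightarrow> ('k, 't, 'y) module_scheme
    \<Rightarrow> ('t \<Rightarrow> ('t \<times> 'b \<Rightarrow> 'k) set) \<Rightarrow> ('t \<times> 't \<Rightarrow> 'k) set \<Rightarrow> ('t \<times> 'b \<Rightarrow> 'k) set"
  where "canonical_map k B T \<beta> =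
    tensor_lift k (T \<boxtimes>\<^bsub>k\<^esub> B) (\<lambda>(x, y). pure k T B x \<one>\<^bsub>B\<^esub> \<otimes>\<^bsub>T \<boxtimes>\<^bsub>k\<^esub> B\<^esub> \<beta> y)"

text \<open>That the coinvariants are \<open>k\<close> means that the unit map identifies \<open>k\<close> with them.\<close>

locale galois_extension = right_comodule_algebra k B T \<beta>
  for k :: "('k, 'r) ring_scheme" and B :: "('k, 'b, 'x) bialg_scheme"
    and T :: "('k, 't, 'y) module_scheme" and \<beta> :: "'t \<Rightarrow> ('t \<times> 'b \<Rightarrow> 'k) set" +
  assumes coinvariants_base: "bij_betw (unit_map T) (carrier k) (coinvariants k B T \<beta>)"
    and canonical_bij:
      "bij_betw (canonical_map k B T \<beta>) (carrier (T \<boxtimes>\<^bsub>k\<^esub> T)) (carrier (T \<boxtimes>\<^bsub>k\<^esub> B))"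

locale hopf_galois_system = bicomodule_algebra k A B T \<alpha> \<beta>
  for k :: "('k, 'r) ring_scheme" and A :: "('k, 'a, 'x) bialg_scheme"
    and B :: "('k, 'b, 'y) bialg_scheme" and T :: "('k, 't, 'v) module_scheme"
    and Z :: "('k, 'z, 'w) module_scheme"
    and \<alpha> :: "'t \<Rightarrow> ('a \<times> 't \<Rightarrow> 'k) set" and \<beta> :: "'t \<Rightarrow> ('t \<times> 'b \<Rightarrow> 'k) set"
    and \<gamma> :: "'a \<Rightarrow> ('t \<times> 'z \<Rightarrow> 'k) set" and \<delta> :: "'b \<Rightarrow> ('z \<times> 't \<Rightarrow> 'k) set"
    and S\<^sub>Z :: "'z \<Rightarrow> 't" +
  assumes Z_algebra: "k_algebra k Z"
    and nonzero: "carrier A \<noteq> {\<zero>\<^bsub>A\<^esub>}" "carrier B \<noteq> {\<zero>\<^bsub>B\<^esub>}"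
      "carrier T \<noteq> {\<zero>\<^bsub>T\<^esub>}" "carrier Z \<noteq> {\<zero>\<^bsub>Z\<^esub>}"
    and gamma_hom: "\<gamma> \<in> alg_hom k A (T \<boxtimes>\<^bsub>k\<^esub> Z)"
    and delta_hom: "\<delta> \<in> alg_hom k B (Z \<boxtimes>\<^bsub>k\<^esub> T)"
    and gamma_alpha: "\<forall>t \<in> carrier T.
      tensor_assoc k T Z T (tensor_map k (T \<boxtimes>\<^bsub>k\<^esub> Z) T \<gamma> id (\<alpha> t)) =
      tensor_map k T (Z \<boxtimes>\<^bsub>k\<^esub> T) id \<delta> (\<beta> t)"
    and gamma_comult: "\<forall>a \<in> carrier A.
      tensor_map k A (T \<boxtimes>\<^bsub>k\<^esub> Z) id \<gamma> (comult A a) =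
      tensor_assoc k A T Z (tensor_map k (A \<boxtimes>\<^bsub>k\<^esub> T) Z \<alpha> id (\<gamma> a))"
    and delta_comult: "\<forall>b \<in> carrier B.
      tensor_assoc k Z T B (tensor_map k (Z \<boxtimes>\<^bsub>k\<^esub> T) B \<delta> id (comult B b)) =
      tensor_map k Z (T \<boxtimes>\<^bsub>k\<^esub> B) id \<beta> (\<delta> b)"
    and S_linear: "S\<^sub>Z \<in> lin_map k Z T"
    and S_gamma: "\<forall>a \<in> carrier A.
      mult_map k T (tensor_map k T T id S\<^sub>Z (\<gamma> a)) = unit_map T (counit A a)"
    and S_delta: "\<forall>b \<in> carrier B.
      mult_map k T (tensor_map k T T S\<^sub>Z id (\<delta> b)) = unit_map T (counit B b)"

text \<open>
  \<open>A\<close> and \<open>B\<close> are automatically Hopf algebras here, so \<open>antipode\<close> denotes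
  their antipodes.
\<close>

locale complete_hopf_galois_system =
  fixes k :: "('k, 'r) ring_scheme" and A :: "('k, 'a, 'x) bialg_scheme"
    and B :: "('k, 'b, 'y) bialg_scheme" and T :: "('k, 't, 'v) module_scheme"
    and Z :: "('k, 'z, 'w) module_scheme"
    and \<alpha> :: "'t \<Rightarrow> ('a \<times> 't \<Rightarrow> 'k) set" and \<beta> :: "'t \<Rightarrow> ('t \<times> 'b \<Rightarrow> 'k) set"
    and lam\<^sub>Z :: "'z \<Rightarrow> ('b \<times> 'z \<Rightarrow> 'k) set" and \<rho>\<^sub>Z :: "'z \<Rightarrow> ('z \<times> 'a \<Rightarrow> 'k) set"
    and \<gamma> :: "'a \<Rightarrow> ('t \<times> 'z \<Rightarrow> 'k) set" and \<delta> :: "'b \<Rightarrow> ('z \<times> 't \<Rightarrow> 'k) set"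
    and S\<^sub>T :: "'t \<Rightarrow> 'z" and S\<^sub>Z :: "'z \<Rightarrow> 't"
  assumes system_T: "hopf_galois_system k A B T Z \<alpha> \<beta> \<gamma> \<delta> S\<^sub>Z"
    and system_Z: "hopf_galois_system k B A Z T lam\<^sub>Z \<rho>\<^sub>Z \<delta> \<gamma> S\<^sub>T"
    and beta_gamma: "\<forall>a \<in> carrier A.
      tensor_assoc k T B Z (tensor_map k (T \<boxtimes>\<^bsub>k\<^esub> B) Z \<beta> id (\<gamma> a)) =
      tensor_map k T (B \<boxtimes>\<^bsub>k\<^esub> Z) id lam\<^sub>Z (\<gamma> a)"
    and rho_delta: "\<forall>b \<in> carrier B.
      tensor_assoc k Z A T (tensor_map k (Z \<boxtimes>\<^bsub>k\<^esub> A) T \<rho>\<^sub>Z id (\<delta> b)) =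
      tensor_map k Z (A \<boxtimes>\<^bsub>k\<^esub> T) id \<alpha> (\<delta> b)"
    and gamma_antipode: "\<forall>a \<in> carrier A.
      flip k Z T (tensor_map k Z T S\<^sub>T S\<^sub>Z (\<gamma> a)) = \<gamma> (antipode k A a)"
    and delta_antipode: "\<forall>b \<in> carrier B.
      flip k T Z (tensor_map k T Z S\<^sub>Z S\<^sub>T (\<delta> b)) = \<delta> (antipode k B b)"
    and rho_S: "\<forall>t \<in> carrier T.
      flip k A Z (tensor_map k A Z (antipode k A) S\<^sub>T (\<alpha> t)) = \<rho>\<^sub>Z (S\<^sub>T t)"
    and lambda_S: "\<forall>t \<in> carrier T.
      flip k Z B (tensor_map k Z B S\<^sub>T (antipode k B) (\<beta> t)) = lam\<^sub>Z (S\<^sub>T t)"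
    and beta_S: "\<forall>z \<in> carrier Z.
      flip k B T (tensor_map k B T (antipode k B) S\<^sub>Z (lam\<^sub>Z z)) = \<beta> (S\<^sub>Z z)"
    and alpha_S: "\<forall>z \<in> carrier Z.
      flip k T A (tensor_map k T A S\<^sub>Z (antipode k A) (\<rho>\<^sub>Z z)) = \<alpha> (S\<^sub>Z z)"

end

theory Submission
  imports Defs
begin

text \<open>
  Write \<open>t\<^sub>0 \<otimes> t\<^sub>1\<close> for the coaction of \<open>B\<close> on \<open>T\<close>, \<open>can\<close> for the canonical map and
  \<open>\<tau>(b) = can\<^sup>-\<^sup>1(1 \<otimes> b)\<close> for the translation map \<open>B \<rightarrow> T \<otimes> T\<close>. The idea is to build a cogroupoid with
  two objects 1 and 2 whose cohom algebras are \<open>C(1,1) = A\<close>, \<open>C(1,2) = T\<close>, \<open>C(2,1) = Z\<close>, \<open>C(2,2) = B\<close>.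
  The column \<open>C(-,2)\<close> is given; the column \<open>C(-,1)\<close> is obtained from it by faithfully flat descent.

  For a right \<open>B\<close>-comodule algebra \<open>X\<close> (here \<open>T\<close> and \<open>B\<close>) the map
  \<open>x \<otimes> y \<mapsto> x\<^sub>0 \<otimes> \<tau>(x\<^sub>1) y\<close> from \<open>X \<otimes> T\<close> to \<open>(X \<otimes> T) \<otimes> T\<close> is a descent datum, because of the cocycle
  identity \<open>tau_cocycle\<close>. Let \<open>F(X)\<close> be the set of all \<open>u\<close> that it sends to \<open>u \<otimes> 1\<close>. It is a
  subalgebra of \<open>X \<otimes> T\<^sup>o\<^sup>p\<close>, and flatness of \<open>T\<close> makes \<open>F(X) \<otimes> T \<rightarrow> X \<otimes> T\<close>, \<open>a \<otimes> t \<mapsto> a t\<close>, bijective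
  (\<open>phi_bij\<close>). The preimage of \<open>x \<otimes> 1\<close> defines an algebra map \<open>\<kappa> : X \<rightarrow> F(X) \<otimes> T\<close>. It is universal:
  every \<open>B\<close>-colinear map \<open>g : X \<rightarrow> N \<otimes> T\<close> is \<open>(f \<otimes> T)\<kappa>\<close> for exactly one linear \<open>f : F(X) \<rightarrow> N\<close>, and \<open>f\<close> is an
  algebra map if \<open>g\<close> is (\<open>kappa_universal\<close>, \<open>kappa_universal_hom\<close>, \<open>kappa_unique\<close>).

  Put \<open>A = F(T)\<close> and \<open>Z = F(B)\<close>, with \<open>\<alpha>\<close> and \<open>\<delta>\<close> the maps \<open>\<kappa>\<close> for \<open>T\<close> and \<open>B\<close>. Universality yields all
  other structure maps: each of \<open>\<Delta>\<^sub>A\<close>, \<open>\<gamma>\<close>, \<open>\<rho>\<^sub>Z\<close>, \<open>\<lambda>\<^sub>Z\<close> is the map on \<open>F(X)\<close> for which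
  one coassociativity law ending at object 2 holds (\<open>kappa_comult_exists\<close>). The eight coassociativity
  laws that end at object 1 then follow from the eight that end at 2 by a single argument
  (\<open>kappa_coassoc_transfer\<close>), and the counit laws likewise.

  For an algebra \<open>R\<close> the modules \<open>Hom(C(x,y), R)\<close> with convolution form a linear category with
  objects 1 and 2. A generalized antipode is an inverse of an identity map in such a category. The
  identity of \<open>T\<close> is inverted by \<open>S\<^sub>Z = \<epsilon> \<otimes> T\<close>, so in the category of \<open>R \<otimes> T\<close> the objects 1 and 2 are
  isomorphic; composing with \<open>\<kappa>\<close>, an algebra map out of an algebra whose identity is invertible, shows
  that the identity of \<open>F(X)\<close> is invertible with values in \<open>F(X) \<otimes> T\<close>. Uniqueness of inverses shows that the
  inverse satisfies the descent condition, so it takes values in \<open>F(X)\<close> (\<open>antipode_exists\<close>). This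
  gives \<open>S\<^sub>T\<close> and the antipode of \<open>A\<close>. Each of the six compatibilities of antipodes with
  comultiplications says that two maps are both inverse to the same comultiplication
  (\<open>antipode_anticomult\<close>).

  Faithful flatness is only available for test modules in a fixed type; all modules that occur have
  carriers that embed into this type (\<open>small_tensor\<close>).
\<close>

section \<open>Linear maps\<close>


locale base_ring = R?: cring k for k :: "('k, 'r) ring_scheme" (structure)

lemma lin_mapI:
  assumes "\<And>x. x \<in> carrier M \<Longrightarrow> f x \<in> carrier N"
    and "\<And>x y. x \<in> carrier M \<Longrightarrow> y \<in> carrier M \<Longrightarrow> f (x \<oplus>\<^bsub>M\<^esub> y) = f x \<oplus>\<^bsub>N\<^esub> f y"
    and "\<And>a x. a \<in> carrier k \<Longrightarrow> x \<in> carrier M \<Longrightarrow> f (a \<odot>\<^bsub>M\<^esub> x) = a \<odot>\<^bsub>N\<^esub> f x"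
  shows "f \<in> lin_map k M N"
  using assms by (auto simp: lin_map_def)

lemma lin_closed: "f \<in> lin_map k M N \<Longrightarrow> x \<in> carrier M \<Longrightarrow> f x \<in> carrier N"
  by (auto simp: lin_map_def)

lemma lin_add: "f \<in> lin_map k M N \<Longrightarrow> x \<in> carrier M \<Longrightarrow> y \<in> carrier M
    \<Longrightarrow> f (x \<oplus>\<^bsub>M\<^esub> y) = f x \<oplus>\<^bsub>N\<^esub> f y"
  by (auto simp: lin_map_def)

lemma lin_smult: "f \<in> lin_map k M N \<Longrightarrow> a \<in> carrier k \<Longrightarrow> x \<in> carrier M
    \<Longrightarrow> f (a \<odot>\<^bsub>M\<^esub> x) = a \<odot>\<^bsub>N\<^esub> f x"
  by (auto simp: lin_map_def)

lemma lin_id [simp]: "(\<lambda>x. x) \<in> lin_map k M M" "id \<in> lin_map k M M"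
  by (auto simp: lin_map_def)

lemma lin_comp: "f \<in> lin_map k M N \<Longrightarrow> g \<in> lin_map k L M \<Longrightarrow> (\<lambda>x. f (g x)) \<in> lin_map k L N"
  by (auto simp: lin_map_def Pi_def)

lemma lin_cong:
  assumes "module k M" "f \<in> lin_map k M N" "\<And>x. x \<in> carrier M \<Longrightarrow> f x = g x"
  shows "g \<in> lin_map k M N"
proof -
  interpret module k M by fact
  have e: "g x = f x" if "x \<in> carrier M" for x using assms(3) that by simp
  show ?thesis using assms(2) e by (auto simp: lin_map_def)
qed

lemma lin_zero:
  assumes "module k M" "module k N" "f \<in> lin_map k M N"
  shows "f \<zero>\<^bsub>M\<^esub> = \<zero>\<^bsub>N\<^esub>"
proof -
  interpret M: module k M by fact
  interpret N: module k N by fact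
  have "f (\<zero>\<^bsub>k\<^esub> \<odot>\<^bsub>M\<^esub> \<zero>\<^bsub>M\<^esub>) = \<zero>\<^bsub>k\<^esub> \<odot>\<^bsub>N\<^esub> f \<zero>\<^bsub>M\<^esub>"
    by (rule lin_smult[OF assms(3)]) auto
  then show ?thesis using lin_closed[OF assms(3), of "\<zero>\<^bsub>M\<^esub>"] by simp
qed

lemma lin_neg:
  assumes "module k M" "module k N" "f \<in> lin_map k M N" "x \<in> carrier M"
  shows "f (\<ominus>\<^bsub>M\<^esub> x) = \<ominus>\<^bsub>N\<^esub> f x"
proof -
  interpret M: module k M by fact
  interpret N: module k N by fact
  have "f (\<ominus>\<^bsub>M\<^esub> x) \<oplus>\<^bsub>N\<^esub> f x = \<zero>\<^bsub>N\<^esub>"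
    using lin_add[OF assms(3), of "\<ominus>\<^bsub>M\<^esub> x" x] lin_zero[OF assms(1-3)] assms(4) by (simp add: M.l_neg)
  then show ?thesis using assms lin_closed[OF assms(3)] by (simp add: N.minus_equality)
qed

lemma lin_sub:
  assumes "module k M" "module k N" "f \<in> lin_map k M N" "x \<in> carrier M" "y \<in> carrier M"
  shows "f (x \<ominus>\<^bsub>M\<^esub> y) = f x \<ominus>\<^bsub>N\<^esub> f y"
proof -
  interpret M: module k M by fact
  show ?thesis using assms lin_neg[OF assms(1-3)] lin_add[OF assms(3)] by (simp add: a_minus_def)
qed

lemma lin_finsum:
  assumes "module k M" "module k N" "f \<in> lin_map k M N" "finite I" "g \<in> I \<rightarrow> carrier M"
  shows "f (finsum M g I) = finsum N (\<lambda>i. f (g i)) I"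
proof -
  interpret M: module k M by fact
  interpret N: module k N by fact
  show ?thesis using assms(4,5)
  proof (induct rule: finite_induct)
    case empty then show ?case using lin_zero[OF assms(1-3)] by simp
  next
    case (insert x F)
    then have "(\<lambda>i. f (g i)) \<in> F \<rightarrow> carrier N" "f (g x) \<in> carrier N" "finsum M g F \<in> carrier M"
      using lin_closed[OF assms(3)] by auto
    with insert show ?case using lin_add[OF assms(3)] by (auto simp: Pi_def)
  qed
qed

lemma lin_zero_map:
  assumes "module k N" shows "(\<lambda>x. \<zero>\<^bsub>N\<^esub>) \<in> lin_map k M N"
proof -
  interpret N: module k N by fact
  show ?thesis by (auto simp: lin_map_def)
qed

lemma lin_plus:
  assumes "module k N" "f \<in> lin_map k M N" "g \<in> lin_map k M N"
  shows "(\<lambda>x. f x \<oplus>\<^bsub>N\<^esub> g x) \<in> lin_map k M N"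
proof -
  interpret N: module k N by fact
  show ?thesis
    by (rule lin_mapI) (auto simp: lin_closed[OF assms(2)] lin_closed[OF assms(3)] lin_add[OF assms(2)]
        lin_add[OF assms(3)] lin_smult[OF assms(2)] lin_smult[OF assms(3)] N.smult_r_distr N.a_ac)
qed

lemma lin_smult_map:
  assumes "module k N" "f \<in> lin_map k M N" "c \<in> carrier k"
  shows "(\<lambda>x. c \<odot>\<^bsub>N\<^esub> f x) \<in> lin_map k M N"
proof -
  interpret N: module k N by fact
  have *: "c \<odot>\<^bsub>N\<^esub> (a \<odot>\<^bsub>N\<^esub> y) = a \<odot>\<^bsub>N\<^esub> (c \<odot>\<^bsub>N\<^esub> y)" if "a \<in> carrier k" "y \<in> carrier N" for a y
    using that assms(3) by (metis N.smult_assoc1 N.R.m_comm)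
  show ?thesis
    by (rule lin_mapI) (auto simp: lin_closed[OF assms(2)] lin_add[OF assms(2)]
        lin_smult[OF assms(2)] N.smult_r_distr assms(3) *)
qed

lemma lin_neg_map:
  assumes "module k N" "f \<in> lin_map k M N"
  shows "(\<lambda>x. \<ominus>\<^bsub>N\<^esub> f x) \<in> lin_map k M N"
proof -
  interpret N: module k N by fact
  show ?thesis
    by (rule lin_mapI) (auto simp: lin_closed[OF assms(2)] lin_add[OF assms(2)]
        lin_smult[OF assms(2)] N.smult_r_minus N.minus_add)
qed

lemma lin_diff:
  assumes "module k N" "f \<in> lin_map k M N" "g \<in> lin_map k M N"
  shows "(\<lambda>x. f x \<ominus>\<^bsub>N\<^esub> g x) \<in> lin_map k M N"
  using lin_plus[OF assms(1,2) lin_neg_map[OF assms(1,3)]] by (simp add: a_minus_def)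

lemma lin_inv_into:
  assumes "module k M" "module k N" "f \<in> lin_map k M N" "bij_betw f (carrier M) (carrier N)"
  shows "inv_into (carrier M) f \<in> lin_map k N M"
proof -
  interpret M: module k M by fact
  interpret N: module k N by fact
  let ?g = "inv_into (carrier M) f"
  have g: "?g y \<in> carrier M" "f (?g y) = y" if "y \<in> carrier N" for y
    using that assms(4) by (auto simp: bij_betw_def inv_into_into f_inv_into_f)
  have inj: "x = x'" if "f x = f x'" "x \<in> carrier M" "x' \<in> carrier M" for x x'
    using that assms(4) by (auto simp: bij_betw_def inj_on_def)
  show ?thesis
  proof (rule lin_mapI)
    fix x y assume xy: "x \<in> carrier N" "y \<in> carrier N"
    show "?g (x \<oplus>\<^bsub>N\<^esub> y) = ?g x \<oplus>\<^bsub>M\<^esub> ?g y"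
      by (rule inj) (use xy g in \<open>auto simp: lin_add[OF assms(3)]\<close>)
  next
    fix a x assume x: "a \<in> carrier k" "x \<in> carrier N"
    show "?g (a \<odot>\<^bsub>N\<^esub> x) = a \<odot>\<^bsub>M\<^esub> ?g x"
      by (rule inj) (use x g in \<open>auto simp: lin_smult[OF assms(3)]\<close>)
  qed (use g in auto)
qed

section \<open>Free modules\<close>

definition lin_ext :: "('k, 'r) ring_scheme \<Rightarrow> ('k, 'p, 'z) module_scheme \<Rightarrow> ('s \<Rightarrow> 'p) \<Rightarrow> ('s \<Rightarrow> 'k) \<Rightarrow> 'p"
  where "lin_ext k P f \<phi> = finsum P (\<lambda>p. \<phi> p \<odot>\<^bsub>P\<^esub> f p) {p. \<phi> p \<noteq> \<zero>\<^bsub>k\<^esub>}"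

context base_ring begin

lemma free_module_sel [simp]:
  "carrier (free_module k S) = {\<phi>. (\<forall>s. \<phi> s \<in> carrier k) \<and> (\<forall>s. s \<notin> S \<longrightarrow> \<phi> s = \<zero>) \<and> finite {s. \<phi> s \<noteq> \<zero>}}"
  "zero (free_module k S) = (\<lambda>s. \<zero>)"
  "add (free_module k S) = (\<lambda>\<phi> \<psi> s. \<phi> s \<oplus> \<psi> s)"
  "smult (free_module k S) = (\<lambda>c \<phi> s. c \<otimes> \<phi> s)"
  by (auto simp: free_module_def)

lemma free_module_module: "module k (free_module k S)"
proof (rule moduleI)
  have fin: "finite {s. \<phi> s \<oplus> \<psi> s \<noteq> \<zero>}" if "finite {s. \<phi> s \<noteq> \<zero>}" "finite {s. \<psi> s \<noteq> \<zero>}" for \<phi> \<psi> :: "_ \<Rightarrow> 'k"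
    by (rule finite_subset[of _ "{s. \<phi> s \<noteq> \<zero>} \<union> {s. \<psi> s \<noteq> \<zero>}"]) (use that in auto)
  have fin': "finite {s. c \<otimes> \<phi> s \<noteq> \<zero>}" if "finite {s. \<phi> s \<noteq> \<zero>}" "c \<in> carrier k" for \<phi> :: "_ \<Rightarrow> 'k" and c
    by (rule finite_subset[of _ "{s. \<phi> s \<noteq> \<zero>}"]) (use that in auto)
  have neg: "\<exists>y\<in>carrier (free_module k S). y \<oplus>\<^bsub>free_module k S\<^esub> x = \<zero>\<^bsub>free_module k S\<^esub>"
    if "x \<in> carrier (free_module k S)" for x
  proof (rule bexI[of _ "\<lambda>s. \<ominus> x s"])
    have "finite {s. \<ominus> x s \<noteq> \<zero>}"
      by (rule finite_subset[of _ "{s. x s \<noteq> \<zero>}"]) (use that in auto)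
    with that show "(\<lambda>s. \<ominus> x s) \<in> carrier (free_module k S)" by auto
  qed (use that in \<open>auto simp: R.l_neg\<close>)
  show "abelian_group (free_module k S)"
    by (rule abelian_groupI) (use fin neg in \<open>auto simp: R.a_ac\<close>)
  show "a \<odot>\<^bsub>free_module k S\<^esub> x \<in> carrier (free_module k S)"
    if "a \<in> carrier k" "x \<in> carrier (free_module k S)" for a x using that fin' by auto
qed (auto simp: R.l_distr R.r_distr R.m_assoc R.is_cring)

lemma lin_ext_superset:
  assumes "module k P" "finite I" "{p. \<phi> p \<noteq> \<zero>} \<subseteq> I" "\<And>p. p \<in> I \<Longrightarrow> f p \<in> carrier P" "\<And>p. \<phi> p \<in> carrier k"
  shows "lin_ext k P f \<phi> = finsum P (\<lambda>p. \<phi> p \<odot>\<^bsub>P\<^esub> f p) I"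
proof -
  interpret P: module k P by fact
  show ?thesis unfolding lin_ext_def
    by (rule P.add.finprod_mono_neutral_cong_left) (use assms in auto)
qed

lemma lin_ext_lin:
  assumes "module k P" "\<And>s. s \<in> S \<Longrightarrow> f s \<in> carrier P"
  shows "lin_ext k P f \<in> lin_map k (free_module k S) P"
proof -
  interpret P: module k P by fact
  have sup: "{s. \<phi> s \<noteq> \<zero>} \<subseteq> S" if "\<phi> \<in> carrier (free_module k S)" for \<phi> using that by auto
  show ?thesis
  proof (rule lin_mapI)
    fix \<phi> assume \<phi>: "\<phi> \<in> carrier (free_module k S)"
    then show "lin_ext k P f \<phi> \<in> carrier P" unfolding lin_ext_def
      by (intro P.finsum_closed) (use assms in auto)
  next
    fix \<phi> \<psi> assume \<phi>: "\<phi> \<in> carrier (free_module k S)" and \<psi>: "\<psi> \<in> carrier (free_module k S)"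
    let ?I = "{s. \<phi> s \<noteq> \<zero>} \<union> {s. \<psi> s \<noteq> \<zero>}"
    have I: "finite ?I" "?I \<subseteq> S" using \<phi> \<psi> by auto
    have "lin_ext k P f (\<phi> \<oplus>\<^bsub>free_module k S\<^esub> \<psi>) = finsum P (\<lambda>p. (\<phi> p \<oplus> \<psi> p) \<odot>\<^bsub>P\<^esub> f p) ?I"
      by (subst lin_ext_superset[where I="?I"]) (use I \<phi> \<psi> assms in auto)
    also have "\<dots> = finsum P (\<lambda>p. \<phi> p \<odot>\<^bsub>P\<^esub> f p \<oplus>\<^bsub>P\<^esub> \<psi> p \<odot>\<^bsub>P\<^esub> f p) ?I"
      by (rule P.finsum_cong') (use I \<phi> \<psi> assms in \<open>auto simp: P.smult_l_distr\<close>)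
    also have "\<dots> = finsum P (\<lambda>p. \<phi> p \<odot>\<^bsub>P\<^esub> f p) ?I \<oplus>\<^bsub>P\<^esub> finsum P (\<lambda>p. \<psi> p \<odot>\<^bsub>P\<^esub> f p) ?I"
      by (rule P.finsum_addf) (use I \<phi> \<psi> assms in auto)
    also have "\<dots> = lin_ext k P f \<phi> \<oplus>\<^bsub>P\<^esub> lin_ext k P f \<psi>"
      by (subst (1 2) lin_ext_superset[where I="?I"]) (use I \<phi> \<psi> assms in auto)
    finally show "lin_ext k P f (\<phi> \<oplus>\<^bsub>free_module k S\<^esub> \<psi>) = lin_ext k P f \<phi> \<oplus>\<^bsub>P\<^esub> lin_ext k P f \<psi>" .
  next
    fix a \<phi> assume a: "a \<in> carrier k" and \<phi>: "\<phi> \<in> carrier (free_module k S)"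
    let ?I = "{s. \<phi> s \<noteq> \<zero>}"
    have I: "finite ?I" "?I \<subseteq> S" using \<phi> by auto
    have "lin_ext k P f (a \<odot>\<^bsub>free_module k S\<^esub> \<phi>) = finsum P (\<lambda>p. (a \<otimes> \<phi> p) \<odot>\<^bsub>P\<^esub> f p) ?I"
      by (subst lin_ext_superset[where I="?I"]) (use I \<phi> a assms in auto)
    also have "\<dots> = finsum P (\<lambda>p. a \<odot>\<^bsub>P\<^esub> (\<phi> p \<odot>\<^bsub>P\<^esub> f p)) ?I"
      by (rule P.finsum_cong') (use I \<phi> a assms in \<open>auto simp: P.smult_assoc1\<close>)
    also have "\<dots> = a \<odot>\<^bsub>P\<^esub> lin_ext k P f \<phi>" unfolding lin_ext_def
      by (subst P.finsum_smult_ldistr) (use I \<phi> a assms in auto)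
    finally show "lin_ext k P f (a \<odot>\<^bsub>free_module k S\<^esub> \<phi>) = a \<odot>\<^bsub>P\<^esub> lin_ext k P f \<phi>" .
  qed
qed

lemma free_gen_closed: "s \<in> S \<Longrightarrow> free_gen k s \<in> carrier (free_module k S)"
  by (auto simp: free_gen_def)

lemma lin_ext_gen:
  assumes "module k P" "f s \<in> carrier P"
  shows "lin_ext k P f (free_gen k s) = f s"
proof -
  interpret P: module k P by fact
  have "lin_ext k P f (free_gen k s) = finsum P (\<lambda>p. free_gen k s p \<odot>\<^bsub>P\<^esub> f p) {s}"
    by (rule lin_ext_superset) (use assms in \<open>auto simp: free_gen_def\<close>)
  then show ?thesis using assms by (simp add: free_gen_def)
qed

lemma free_module_induct [consumes 1, case_names zero gen add]:
  assumes \<phi>: "\<phi> \<in> carrier (free_module k S)"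
    and zero: "Q (\<lambda>s. \<zero>)"
    and gen: "\<And>c s. c \<in> carrier k \<Longrightarrow> s \<in> S \<Longrightarrow> Q (c \<odot>\<^bsub>free_module k S\<^esub> free_gen k s)"
    and add: "\<And>\<phi> \<psi>. \<phi> \<in> carrier (free_module k S) \<Longrightarrow> \<psi> \<in> carrier (free_module k S) \<Longrightarrow>
      Q \<phi> \<Longrightarrow> Q \<psi> \<Longrightarrow> Q (\<phi> \<oplus>\<^bsub>free_module k S\<^esub> \<psi>)"
  shows "Q \<phi>"
proof -
  have "\<forall>\<phi>. finite I \<longrightarrow> \<phi> \<in> carrier (free_module k S) \<longrightarrow> {s. \<phi> s \<noteq> \<zero>} \<subseteq> I \<longrightarrow> Q \<phi>" if "finite I" for I
    using that
  proof (induct I rule: finite_induct)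
    case empty
    have "\<phi> = (\<lambda>s. \<zero>)" if "{s. \<phi> s \<noteq> \<zero>} \<subseteq> {}" for \<phi> :: "_ \<Rightarrow> 'k" using that by auto
    then show ?case using zero by auto
  next
    case (insert i I)
    show ?case
    proof (intro allI impI)
      fix \<phi> assume \<phi>: "\<phi> \<in> carrier (free_module k S)" and sub: "{s. \<phi> s \<noteq> \<zero>} \<subseteq> insert i I"
      let ?\<psi> = "\<phi>(i := \<zero>)"
      have fin: "finite {s. ?\<psi> s \<noteq> \<zero>}"
        by (rule finite_subset[of _ "{s. \<phi> s \<noteq> \<zero>}"]) (use \<phi> in auto)
      have \<psi>: "?\<psi> \<in> carrier (free_module k S)" using \<phi> fin by (auto simp: fun_upd_def[abs_def] split: if_splits)
      have "{s. ?\<psi> s \<noteq> \<zero>} \<subseteq> I" using sub by auto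
      then have Q: "Q ?\<psi>" using \<psi> insert by blast
      show "Q \<phi>"
      proof (cases "i \<in> S")
        case True
        have "\<phi> = (\<phi> i \<odot>\<^bsub>free_module k S\<^esub> free_gen k i) \<oplus>\<^bsub>free_module k S\<^esub> ?\<psi>"
          using \<phi> by (auto simp: free_gen_def)
        moreover have "\<phi> i \<odot>\<^bsub>free_module k S\<^esub> free_gen k i \<in> carrier (free_module k S)"
          using module.smult_closed[OF free_module_module _ free_gen_closed[OF True]] \<phi> by auto
        moreover have "\<phi> i \<in> carrier k" using \<phi> by auto
        ultimately show ?thesis using add[OF _ \<psi> gen[OF _ True] Q, of "\<phi> i"] by (simp only:)
      next
        case False
        then have "?\<psi> = \<phi>" using \<phi> by auto
        then show ?thesis using Q by simp
      qed
    qed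
  qed
  from this[of "{s. \<phi> s \<noteq> \<zero>}"] \<phi> show ?thesis by auto
qed

end

section \<open>Tensor products and their universal property\<close>


definition bilin :: "('k, 'r) ring_scheme \<Rightarrow> ('k, 'm, 'x) module_scheme \<Rightarrow> ('k, 'n, 'y) module_scheme
    \<Rightarrow> ('k, 'p, 'z) module_scheme \<Rightarrow> ('m \<Rightarrow> 'n \<Rightarrow> 'p) \<Rightarrow> bool"
  where "bilin k M N P f \<longleftrightarrow> (\<forall>y. y \<in> carrier N \<longrightarrow> (\<lambda>x. f x y) \<in> lin_map k M P) \<and>
    (\<forall>x. x \<in> carrier M \<longrightarrow> (\<lambda>y. f x y) \<in> lin_map k N P)"

text \<open>
  The linear map induced by a bilinear \<open>f\<close>. A term \<open>tlift k M N P (\<lambda>x y. f x y) u\<close> is Sweedler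
  notation: it reads \<open>\<Sum> f(x, y)\<close> for \<open>u = \<Sum> x \<otimes> y\<close>. The values of \<open>f\<close> outside the carriers are cut off so that
  the congruence rule below has no side conditions and rewriting under the binder can use that the
  bound variables lie in the carriers.
\<close>

definition tlift :: "('k, 'r) ring_scheme \<Rightarrow> ('k, 'm, 'x) module_scheme \<Rightarrow> ('k, 'n, 'y) module_scheme
    \<Rightarrow> ('k, 'p, 'z) module_scheme \<Rightarrow> ('m \<Rightarrow> 'n \<Rightarrow> 'p) \<Rightarrow> ('m \<times> 'n \<Rightarrow> 'k) set \<Rightarrow> 'p"
  where "tlift k M N P f u = tensor_lift k P
    (\<lambda>p. if p \<in> carrier M \<times> carrier N then f (fst p) (snd p) else undefined) u"

lemma tlift_cong [cong]:
  assumes "u = v" "\<And>x y. x \<in> carrier M \<Longrightarrow> y \<in> carrier N \<Longrightarrow> f x y = g x y"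
  shows "tlift k M N P f u = tlift k M N P g v"
proof -
  have "(\<lambda>p. if p \<in> carrier M \<times> carrier N then f (fst p) (snd p) else undefined) =
    (\<lambda>p. if p \<in> carrier M \<times> carrier N then g (fst p) (snd p) else undefined)"
    by (rule ext) (use assms in auto)
  then show ?thesis using assms(1) by (simp only: tlift_def)
qed

lemma bilinI:
  assumes "\<And>y. y \<in> carrier N \<Longrightarrow> (\<lambda>x. f x y) \<in> lin_map k M P"
    "\<And>x. x \<in> carrier M \<Longrightarrow> (\<lambda>y. f x y) \<in> lin_map k N P"
  shows "bilin k M N P f"
  using assms by (auto simp: bilin_def)

lemma bilin_left: "bilin k M N P f \<Longrightarrow> y \<in> carrier N \<Longrightarrow> (\<lambda>x. f x y) \<in> lin_map k M P"
  by (auto simp: bilin_def)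

lemma bilin_right: "bilin k M N P f \<Longrightarrow> x \<in> carrier M \<Longrightarrow> f x \<in> lin_map k N P"
  by (auto simp: bilin_def)

lemma bilin_closed: "bilin k M N P f \<Longrightarrow> x \<in> carrier M \<Longrightarrow> y \<in> carrier N \<Longrightarrow> f x y \<in> carrier P"
  by (rule lin_closed[OF bilin_right])

lemma module_diff_eq_zero:
  assumes "module k P" "x \<in> carrier P" "y \<in> carrier P"
  shows "x \<ominus>\<^bsub>P\<^esub> y = \<zero>\<^bsub>P\<^esub> \<longleftrightarrow> x = y"
proof -
  interpret P: module k P by fact
  show ?thesis
  proof
    assume "x \<ominus>\<^bsub>P\<^esub> y = \<zero>\<^bsub>P\<^esub>"
    then have "(x \<ominus>\<^bsub>P\<^esub> y) \<oplus>\<^bsub>P\<^esub> y = y" using assms by simp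
    then show "x = y" using assms by (simp add: a_minus_def P.a_assoc P.l_neg)
  qed (use assms in \<open>simp add: a_minus_def P.r_neg\<close>)
qed

lemma finsum_swap:
  assumes "abelian_monoid P" "finite I" "finite J" "\<And>i j. i \<in> I \<Longrightarrow> j \<in> J \<Longrightarrow> f i j \<in> carrier P"
  shows "finsum P (\<lambda>i. finsum P (f i) J) I = finsum P (\<lambda>j. finsum P (\<lambda>i. f i j) I) J"
proof -
  interpret P: abelian_monoid P by fact
  show ?thesis using assms(2,4)
  proof (induct I rule: finite_induct)
    case empty then show ?case by simp
  next
    case (insert i I)
    have "finsum P (\<lambda>i. finsum P (f i) J) (insert i I)
      = finsum P (f i) J \<oplus>\<^bsub>P\<^esub> finsum P (\<lambda>i. finsum P (f i) J) I"
      by (rule P.finsum_insert) (use insert in \<open>auto intro!: P.finsum_closed\<close>)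
    also have "\<dots> = finsum P (\<lambda>j. f i j \<oplus>\<^bsub>P\<^esub> finsum P (\<lambda>i. f i j) I) J"
      using insert by (subst P.finsum_addf) (auto intro!: P.finsum_closed)
    also have "\<dots> = finsum P (\<lambda>j. finsum P (\<lambda>i. f i j) (insert i I)) J"
      by (rule P.finsum_cong') (use insert in \<open>auto intro!: P.finsum_closed\<close>)
    finally show ?case .
  qed
qed

text \<open>
  The concrete construction of \<open>M \<otimes> N\<close> as a quotient, in preparation of its universal property.
\<close>

locale tensor_pair = base_ring k + M: module k M + N: module k N
  for k :: "('k, 'r) ring_scheme" (structure) and M :: "('k, 'm, 'x) module_scheme"
    and N :: "('k, 'n, 'y) module_scheme"
begin

abbreviation "F \<equiv> tensor_free k M N"
abbreviation "K \<equiv> tensor_rel k M N"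
abbreviation "q \<equiv> tensor_coset k M N"

lemma F_eq: "F = free_module k (carrier M \<times> carrier N)" by (simp add: tensor_free_def)

lemma F_module: "module k F" by (simp add: F_eq free_module_module)

sublocale F: module k F by (rule F_module)

lemma e_closed [simp]: "x \<in> carrier M \<Longrightarrow> y \<in> carrier N \<Longrightarrow> free_gen k (x, y) \<in> carrier F"
  unfolding F_eq by (rule free_gen_closed) auto

lemma gens_sub: "tensor_rel_gens k M N \<subseteq> carrier F"
  unfolding tensor_rel_gens_def Let_def by (auto simp del: free_module_sel)

lemma K_sub: "K \<subseteq> carrier F"
  unfolding tensor_rel_def using F.carrier_is_submodule gens_sub by auto

lemma K_submodule: "submodule K k F"
proof (rule F.submoduleI)
  note E = module.submoduleE[OF F_module]
  have zero: "\<zero>\<^bsub>F\<^esub> \<in> H" if "submodule H k F" for H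
    using that by (metis submodule.axioms(1) subgroup.one_closed monoid.simps(2))
  show "K \<subseteq> carrier F" by (rule K_sub)
  show "\<zero>\<^bsub>F\<^esub> \<in> K" using zero by (auto simp: tensor_rel_def)
  show "\<ominus>\<^bsub>F\<^esub> a \<in> K" if "a \<in> K" for a using that E(3) by (auto simp: tensor_rel_def)
  show "a \<oplus>\<^bsub>F\<^esub> b \<in> K" if "a \<in> K" "b \<in> K" for a b using that E(5) by (auto simp: tensor_rel_def)
  show "a \<odot>\<^bsub>F\<^esub> x \<in> K" if "a \<in> carrier k" "x \<in> K" for a x
    using that E(4) by (auto simp: tensor_rel_def)
qed

lemma K_gens: "r \<in> tensor_rel_gens k M N \<Longrightarrow> r \<in> K"
  by (auto simp: tensor_rel_def)

sublocale K: abelian_subgroup K F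
  by (rule abelian_subgroupI3) (auto intro!: additive_subgroup.intro submodule.axioms(1)[OF K_submodule] F.abelian_group_axioms)

lemma q_eq: assumes "\<phi> \<in> carrier F" "\<psi> \<in> carrier F" shows "q \<phi> = q \<psi> \<longleftrightarrow> \<phi> \<ominus>\<^bsub>F\<^esub> \<psi> \<in> K"
proof
  assume "q \<phi> = q \<psi>"
  then have "\<phi> \<in> q \<psi>" using K.a_rcos_self[OF assms(1)] by (simp add: tensor_coset_def)
  then show "\<phi> \<ominus>\<^bsub>F\<^esub> \<psi> \<in> K" using K.a_rcos_module[OF assms(2,1)] by (simp add: tensor_coset_def a_minus_def)
next
  assume "\<phi> \<ominus>\<^bsub>F\<^esub> \<psi> \<in> K"
  then have "\<phi> \<in> K +>\<^bsub>F\<^esub> \<psi>" using K.a_rcos_module[OF assms(2,1)] by (simp add: a_minus_def)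
  then show "q \<phi> = q \<psi>" using K.a_repr_independence'[OF _ assms(2)] by (simp add: tensor_coset_def)
qed

lemma tensor_sel: "carrier (M \<boxtimes> N) = q ` carrier F" "zero (M \<boxtimes> N) = q \<zero>\<^bsub>F\<^esub>"
  by (auto simp: tensor_def tensor_module_def Let_def A_RCOSETS_def' tensor_coset_def
    K.a_subset F.a_coset_add_zero)

lemma tensor_add: "\<phi> \<in> carrier F \<Longrightarrow> \<psi> \<in> carrier F \<Longrightarrow> q \<phi> \<oplus>\<^bsub>M \<boxtimes> N\<^esub> q \<psi> = q (\<phi> \<oplus>\<^bsub>F\<^esub> \<psi>)"
  by (simp add: tensor_def tensor_module_def Let_def tensor_coset_def K.a_rcos_sum)

lemma tensor_smult:
  assumes "c \<in> carrier k" "\<phi> \<in> carrier F"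
  shows "c \<odot>\<^bsub>M \<boxtimes> N\<^esub> q \<phi> = q (c \<odot>\<^bsub>F\<^esub> \<phi>)"
proof -
  have 1: "q (c \<odot>\<^bsub>F\<^esub> \<psi>) = q (c \<odot>\<^bsub>F\<^esub> \<phi>)" if "\<psi> \<in> q \<phi>" for \<psi>
  proof -
    have \<psi>: "\<psi> \<in> carrier F" using that assms K.a_elemrcos_carrier by (auto simp: tensor_coset_def)
    have "\<psi> \<ominus>\<^bsub>F\<^esub> \<phi> \<in> K" using that \<psi> assms(2) K.a_rcos_module[OF assms(2) \<psi>] by (simp add: tensor_coset_def a_minus_def)
    then have "c \<odot>\<^bsub>F\<^esub> (\<psi> \<ominus>\<^bsub>F\<^esub> \<phi>) \<in> K" using submodule.smult_closed[OF K_submodule] assms by blast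
    moreover have "c \<odot>\<^bsub>F\<^esub> (\<psi> \<ominus>\<^bsub>F\<^esub> \<phi>) = c \<odot>\<^bsub>F\<^esub> \<psi> \<ominus>\<^bsub>F\<^esub> c \<odot>\<^bsub>F\<^esub> \<phi>"
      using assms \<psi> by (simp add: a_minus_def F.smult_r_distr F.smult_r_minus)
    ultimately show ?thesis using q_eq assms \<psi> by simp
  qed
  have 2: "\<phi> \<in> q \<phi>" using K.a_rcos_self assms by (simp add: tensor_coset_def)
  have "(\<Union>\<psi>\<in>q \<phi>. q (c \<odot>\<^bsub>F\<^esub> \<psi>)) = q (c \<odot>\<^bsub>F\<^esub> \<phi>)"
  proof (rule SUP_eq_const)
    show "q \<phi> \<noteq> {}" using 2 by blast
  qed (rule 1)
  then show ?thesis by (simp add: tensor_def tensor_module_def Let_def)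
qed

lemma tensor_module': "module k (M \<boxtimes> N)"
proof (rule moduleI)
  have neg: "\<exists>y\<in>carrier (M \<boxtimes> N). y \<oplus>\<^bsub>M \<boxtimes> N\<^esub> x = \<zero>\<^bsub>M \<boxtimes> N\<^esub>" if x: "x \<in> carrier (M \<boxtimes> N)" for x
  proof -
    obtain \<phi> where \<phi>: "x = q \<phi>" "\<phi> \<in> carrier F" using x unfolding tensor_sel by blast
    show ?thesis by (rule bexI[of _ "q (\<ominus>\<^bsub>F\<^esub> \<phi>)"])
      (use \<phi> in \<open>simp_all only: tensor_sel tensor_add F.l_neg F.a_inv_closed imageI\<close>)
  qed
  show "abelian_group (M \<boxtimes> N)"
  proof (rule abelian_groupI)
    fix x y z assume "x \<in> carrier (M \<boxtimes> N)" "y \<in> carrier (M \<boxtimes> N)" "z \<in> carrier (M \<boxtimes> N)"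
    then obtain \<phi> \<psi> \<chi> where *: "x = q \<phi>" "\<phi> \<in> carrier F" "y = q \<psi>" "\<psi> \<in> carrier F" "z = q \<chi>" "\<chi> \<in> carrier F"
      unfolding tensor_sel by blast
    show "x \<oplus>\<^bsub>M \<boxtimes> N\<^esub> y \<oplus>\<^bsub>M \<boxtimes> N\<^esub> z = x \<oplus>\<^bsub>M \<boxtimes> N\<^esub> (y \<oplus>\<^bsub>M \<boxtimes> N\<^esub> z)"
      using *(2,4,6) unfolding *(1,3,5) by (simp only: tensor_add F.a_assoc F.add.m_closed)
  next
    fix x y assume "x \<in> carrier (M \<boxtimes> N)" "y \<in> carrier (M \<boxtimes> N)"
    then obtain \<phi> \<psi> where *: "x = q \<phi>" "\<phi> \<in> carrier F" "y = q \<psi>" "\<psi> \<in> carrier F"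
      unfolding tensor_sel by blast
    show "x \<oplus>\<^bsub>M \<boxtimes> N\<^esub> y \<in> carrier (M \<boxtimes> N)"
      using *(2,4) unfolding *(1,3) by (simp only: tensor_add tensor_sel F.add.m_closed imageI)
    show "x \<oplus>\<^bsub>M \<boxtimes> N\<^esub> y = y \<oplus>\<^bsub>M \<boxtimes> N\<^esub> x"
      using *(2,4) F.a_comm[OF *(2,4)] unfolding *(1,3) by (simp only: tensor_add)
  next
    show "\<zero>\<^bsub>M \<boxtimes> N\<^esub> \<in> carrier (M \<boxtimes> N)" by (simp only: tensor_sel F.zero_closed imageI)
  next
    fix x assume x: "x \<in> carrier (M \<boxtimes> N)"
    then obtain \<phi> where *: "x = q \<phi>" "\<phi> \<in> carrier F" unfolding tensor_sel by blast
    show "\<zero>\<^bsub>M \<boxtimes> N\<^esub> \<oplus>\<^bsub>M \<boxtimes> N\<^esub> x = x" using *(2) unfolding *(1) by (simp only: tensor_sel tensor_add F.l_zero F.zero_closed)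
    show "\<exists>y\<in>carrier (M \<boxtimes> N). y \<oplus>\<^bsub>M \<boxtimes> N\<^esub> x = \<zero>\<^bsub>M \<boxtimes> N\<^esub>" by (rule neg[OF x])
  qed
next
  fix a x y assume a: "a \<in> carrier k" and "x \<in> carrier (M \<boxtimes> N)" "y \<in> carrier (M \<boxtimes> N)"
  then obtain \<phi> \<psi> where *: "x = q \<phi>" "\<phi> \<in> carrier F" "y = q \<psi>" "\<psi> \<in> carrier F"
    unfolding tensor_sel by blast
  note cl = a *(2,4) F.smult_closed R.a_closed R.m_closed F.add.m_closed
  show "a \<odot>\<^bsub>M \<boxtimes> N\<^esub> (x \<oplus>\<^bsub>M \<boxtimes> N\<^esub> y) = a \<odot>\<^bsub>M \<boxtimes> N\<^esub> x \<oplus>\<^bsub>M \<boxtimes> N\<^esub> a \<odot>\<^bsub>M \<boxtimes> N\<^esub> y"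
    unfolding *(1,3) by (simp only: cl tensor_add tensor_smult F.smult_r_distr)
next
  fix a b x assume a: "a \<in> carrier k" and b: "b \<in> carrier k" and "x \<in> carrier (M \<boxtimes> N)"
  then obtain \<phi> where *: "x = q \<phi>" "\<phi> \<in> carrier F" unfolding tensor_sel by blast
  note cl = a b *(2) F.smult_closed R.a_closed R.m_closed F.add.m_closed
  show "(a \<oplus> b) \<odot>\<^bsub>M \<boxtimes> N\<^esub> x = a \<odot>\<^bsub>M \<boxtimes> N\<^esub> x \<oplus>\<^bsub>M \<boxtimes> N\<^esub> b \<odot>\<^bsub>M \<boxtimes> N\<^esub> x"
    unfolding *(1) by (simp only: cl tensor_add tensor_smult F.smult_l_distr)
  show "a \<otimes> b \<odot>\<^bsub>M \<boxtimes> N\<^esub> x = a \<odot>\<^bsub>M \<boxtimes> N\<^esub> (b \<odot>\<^bsub>M \<boxtimes> N\<^esub> x)"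
    unfolding *(1) by (simp only: cl tensor_smult F.smult_assoc1)
next
  fix a x assume a: "a \<in> carrier k" and "x \<in> carrier (M \<boxtimes> N)"
  then obtain \<phi> where *: "x = q \<phi>" "\<phi> \<in> carrier F" unfolding tensor_sel by blast
  show "a \<odot>\<^bsub>M \<boxtimes> N\<^esub> x \<in> carrier (M \<boxtimes> N)"
    using a *(2) unfolding *(1) by (simp only: tensor_sel tensor_smult F.smult_closed imageI)
next
  fix x assume "x \<in> carrier (M \<boxtimes> N)"
  then obtain \<phi> where *: "x = q \<phi>" "\<phi> \<in> carrier F" unfolding tensor_sel by blast
  show "\<one> \<odot>\<^bsub>M \<boxtimes> N\<^esub> x = x"
    using *(2) unfolding *(1) by (simp only: tensor_smult R.one_closed F.smult_one)
qed (rule R.is_cring)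

lemma q_eq_if_gens: "\<phi> \<in> carrier F \<Longrightarrow> \<psi> \<in> carrier F \<Longrightarrow> \<phi> \<ominus>\<^bsub>F\<^esub> \<psi> \<in> tensor_rel_gens k M N \<Longrightarrow> q \<phi> = q \<psi>"
  using q_eq K_gens by blast

lemma pure_bilin': "bilin k M N (M \<boxtimes> N) (pure k M N)"
proof -
  have add1: "pure k M N (x \<oplus>\<^bsub>M\<^esub> x') y = pure k M N x y \<oplus>\<^bsub>M \<boxtimes> N\<^esub> pure k M N x' y"
    if "x \<in> carrier M" "x' \<in> carrier M" "y \<in> carrier N" for x x' y
    unfolding pure_def
    by (subst tensor_add, (use that in simp)+, rule q_eq_if_gens)
      (use that in \<open>auto simp: tensor_rel_gens_def Let_def\<close>)
  have add2: "pure k M N x (y \<oplus>\<^bsub>N\<^esub> y') = pure k M N x y \<oplus>\<^bsub>M \<boxtimes> N\<^esub> pure k M N x y'"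
    if "x \<in> carrier M" "y \<in> carrier N" "y' \<in> carrier N" for x y y'
    unfolding pure_def
    by (subst tensor_add, (use that in simp)+, rule q_eq_if_gens)
      (use that in \<open>auto simp: tensor_rel_gens_def Let_def\<close>)
  have smult1: "pure k M N (c \<odot>\<^bsub>M\<^esub> x) y = c \<odot>\<^bsub>M \<boxtimes> N\<^esub> pure k M N x y"
    if "c \<in> carrier k" "x \<in> carrier M" "y \<in> carrier N" for c x y
    unfolding pure_def
    by (subst tensor_smult, (use that in simp)+, rule q_eq_if_gens)
      (use that in \<open>auto simp: tensor_rel_gens_def Let_def\<close>)
  have smult2: "pure k M N x (c \<odot>\<^bsub>N\<^esub> y) = c \<odot>\<^bsub>M \<boxtimes> N\<^esub> pure k M N x y"
    if "c \<in> carrier k" "x \<in> carrier M" "y \<in> carrier N" for c x y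
    unfolding pure_def
    by (subst tensor_smult, (use that in simp)+, rule q_eq_if_gens)
      (use that in \<open>auto simp: tensor_rel_gens_def Let_def\<close>)
  have closed: "pure k M N x y \<in> carrier (M \<boxtimes> N)" if "x \<in> carrier M" "y \<in> carrier N" for x y
    unfolding pure_def tensor_sel using that by simp
  show ?thesis
    by (intro bilinI lin_mapI) (simp_all add: add1 add2 smult1 smult2 closed)
qed

lemma representative:
  assumes "u \<in> carrier (M \<boxtimes> N)"
  shows "(SOME \<phi>. \<phi> \<in> u) \<in> carrier F" "q (SOME \<phi>. \<phi> \<in> u) = u"
proof -
  obtain \<phi> where \<phi>: "u = q \<phi>" "\<phi> \<in> carrier F" using assms by (auto simp: tensor_sel)
  then have "\<phi> \<in> u" using K.a_rcos_self by (simp add: tensor_coset_def)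
  then have s: "(SOME \<phi>. \<phi> \<in> u) \<in> u" by (rule someI[of "\<lambda>\<phi>. \<phi> \<in> u"])
  then show "(SOME \<phi>. \<phi> \<in> u) \<in> carrier F" using \<phi> K.a_elemrcos_carrier by (auto simp: tensor_coset_def)
  show "q (SOME \<phi>. \<phi> \<in> u) = u"
    using K.a_repr_independence'[OF _ \<phi>(2)] s \<phi>(1) by (simp add: tensor_coset_def)
qed

lemma tensor_induct' [consumes 1, case_names zero pure add]:
  assumes u: "u \<in> carrier (M \<boxtimes> N)"
    and zero: "Q \<zero>\<^bsub>M \<boxtimes> N\<^esub>"
    and pure: "\<And>x y. x \<in> carrier M \<Longrightarrow> y \<in> carrier N \<Longrightarrow> Q (pure k M N x y)"
    and add: "\<And>u v. u \<in> carrier (M \<boxtimes> N) \<Longrightarrow> v \<in> carrier (M \<boxtimes> N) \<Longrightarrow> Q u \<Longrightarrow> Q v \<Longrightarrow> Q (u \<oplus>\<^bsub>M \<boxtimes> N\<^esub> v)"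
  shows "Q u"
proof -
  obtain \<phi> where \<phi>: "u = q \<phi>" "\<phi> \<in> carrier (free_module k (carrier M \<times> carrier N))"
    using u by (auto simp: tensor_sel F_eq simp del: free_module_sel)
  have "Q (q \<phi>)" using \<phi>(2)
  proof (induct rule: free_module_induct)
    case zero
    have "q (\<lambda>s. \<zero>) = \<zero>\<^bsub>M \<boxtimes> N\<^esub>" by (simp add: tensor_sel F_eq)
    then show ?case using assms(2) by simp
  next
    case (gen c s)
    then obtain x y where s: "s = (x, y)" "x \<in> carrier M" "y \<in> carrier N" by auto
    have "q (c \<odot>\<^bsub>F\<^esub> free_gen k s) = pure k M N (c \<odot>\<^bsub>M\<^esub> x) y"
      using gen s lin_smult[OF bilin_left[OF pure_bilin']] by (simp add: tensor_smult[symmetric] pure_def)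
    then show ?case using pure[of "c \<odot>\<^bsub>M\<^esub> x" y] gen s by (simp add: F_eq[symmetric])
  next
    case (add \<phi> \<psi>)
    then show ?case using assms(4)[of "q \<phi>" "q \<psi>"] unfolding F_eq[symmetric]
      by (simp add: tensor_add[symmetric] tensor_sel)
  qed
  then show ?thesis using \<phi>(1) by simp
qed

text \<open>
  The representative of a tensor that \<open>tensor_lift\<close> chooses, and its support. Since the choice does not depend on
  \<open>f\<close>, additivity in \<open>f\<close>, interchange of two sums and compatibility with linear maps hold for arbitrary
  functions \<open>f\<close> with values in the target; bilinearity is only needed to change the representative.
\<close>

definition "rep_coeff u = (SOME \<phi>. \<phi> \<in> u)"
definition "rep_supp u = {p. rep_coeff u p \<noteq> \<zero>}"

lemma rep_coeff: 
  assumes "u \<in> carrier (M \<boxtimes> N)"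
  shows "finite (rep_supp u)" "rep_supp u \<subseteq> carrier M \<times> carrier N" "rep_coeff u p \<in> carrier k"
    "x \<in> rep_supp u \<Longrightarrow> fst x \<in> carrier M" "x \<in> rep_supp u \<Longrightarrow> snd x \<in> carrier N"
proof -
  have r: "rep_coeff u \<in> carrier (free_module k (carrier M \<times> carrier N))" using representative(1)[OF assms] by (simp add: rep_coeff_def F_eq)
  show "finite (rep_supp u)" using r by (simp add: rep_supp_def)
  have "\<forall>p. rep_coeff u p \<in> carrier k" using r unfolding free_module_sel by blast
  then show "rep_coeff u p \<in> carrier k" by blast
  show *: "rep_supp u \<subseteq> carrier M \<times> carrier N" using representative(1)[OF assms] by (auto simp: rep_coeff_def rep_supp_def F_eq)
  show "x \<in> rep_supp u \<Longrightarrow> fst x \<in> carrier M" "x \<in> rep_supp u \<Longrightarrow> snd x \<in> carrier N" using * by auto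
qed

lemma tlift_rep:
  assumes "module k P" "u \<in> carrier (M \<boxtimes> N)" "\<And>x y. x \<in> carrier M \<Longrightarrow> y \<in> carrier N \<Longrightarrow> f x y \<in> carrier P"
  shows "tlift k M N P f u = finsum P (\<lambda>p. rep_coeff u p \<odot>\<^bsub>P\<^esub> f (fst p) (snd p)) (rep_supp u)"
    "tensor_lift k P (\<lambda>(x, y). f x y) u = finsum P (\<lambda>p. rep_coeff u p \<odot>\<^bsub>P\<^esub> f (fst p) (snd p)) (rep_supp u)"
proof -
  interpret P: module k P by fact
  show "tlift k M N P f u = finsum P (\<lambda>p. rep_coeff u p \<odot>\<^bsub>P\<^esub> f (fst p) (snd p)) (rep_supp u)"
    unfolding tlift_def tensor_lift_def Let_def rep_coeff_def[symmetric] rep_supp_def[symmetric]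
    by (rule P.finsum_cong') (use rep_coeff[OF assms(2)] assms(3) in auto)
  show "tensor_lift k P (\<lambda>(x, y). f x y) u = finsum P (\<lambda>p. rep_coeff u p \<odot>\<^bsub>P\<^esub> f (fst p) (snd p)) (rep_supp u)"
    unfolding tlift_def tensor_lift_def Let_def rep_coeff_def[symmetric] rep_supp_def[symmetric]
    by (rule P.finsum_cong') (use rep_coeff[OF assms(2)] assms(3) in auto)
qed

lemma tlift_closed':
  assumes "module k P" "u \<in> carrier (M \<boxtimes> N)" "\<And>x y. x \<in> carrier M \<Longrightarrow> y \<in> carrier N \<Longrightarrow> f x y \<in> carrier P"
  shows "tlift k M N P f u \<in> carrier P"
proof -
  interpret P: module k P by fact
  show ?thesis by (subst tlift_rep(1)[OF assms]) (use rep_coeff[OF assms(2)] assms(3) in \<open>auto intro!: P.finsum_closed\<close>)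
qed

lemma tlift_push':
  assumes "module k P" "module k P'" "u \<in> carrier (M \<boxtimes> N)" "h \<in> lin_map k P P'"
    "\<And>x y. x \<in> carrier M \<Longrightarrow> y \<in> carrier N \<Longrightarrow> f x y \<in> carrier P"
  shows "h (tlift k M N P f u) = tlift k M N P' (\<lambda>x y. h (f x y)) u"
proof -
  interpret P: module k P by fact
  interpret P': module k P' by fact
  have "h (tlift k M N P f u) = finsum P' (\<lambda>p. h (rep_coeff u p \<odot>\<^bsub>P\<^esub> f (fst p) (snd p))) (rep_supp u)"
    by (subst tlift_rep(1)[OF assms(1,3,5)], assumption+, subst lin_finsum[OF assms(1,2,4)])
       (use rep_coeff[OF assms(3)] assms(5) in auto)
  also have "\<dots> = finsum P' (\<lambda>p. rep_coeff u p \<odot>\<^bsub>P'\<^esub> h (f (fst p) (snd p))) (rep_supp u)"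
    by (rule P'.finsum_cong') (use rep_coeff[OF assms(3)] assms(5) lin_smult[OF assms(4)] lin_closed[OF assms(4)] in auto)
  finally show ?thesis using lin_closed[OF assms(4)] assms(5)
    by (subst tlift_rep(1)[OF assms(2,3)]) auto
qed

lemma tlift_lin_fun':
  assumes "module k P" "module k L" "u \<in> carrier (M \<boxtimes> N)"
    "\<And>a b. a \<in> carrier M \<Longrightarrow> b \<in> carrier N \<Longrightarrow> (\<lambda>x. f x a b) \<in> lin_map k L P"
  shows "(\<lambda>x. tlift k M N P (f x) u) \<in> lin_map k L P"
proof -
  interpret P: module k P by fact
  interpret L: module k L by fact
  note r = rep_coeff[OF assms(3)]
  have cl: "f x a b \<in> carrier P" if "x \<in> carrier L" "a \<in> carrier M" "b \<in> carrier N" for x a b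
    using lin_closed[OF assms(4)] that by auto
  have add: "f (x \<oplus>\<^bsub>L\<^esub> y) a b = f x a b \<oplus>\<^bsub>P\<^esub> f y a b" if "x \<in> carrier L" "y \<in> carrier L" "a \<in> carrier M" "b \<in> carrier N" for x y a b
    using lin_add[OF assms(4)] that by auto
  have sm: "f (c \<odot>\<^bsub>L\<^esub> x) a b = c \<odot>\<^bsub>P\<^esub> f x a b" if "x \<in> carrier L" "c \<in> carrier k" "a \<in> carrier M" "b \<in> carrier N" for x c a b
    using lin_smult[OF assms(4)] that by auto
  have s: "tlift k M N P (f x) u = finsum P (\<lambda>p. rep_coeff u p \<odot>\<^bsub>P\<^esub> f x (fst p) (snd p)) (rep_supp u)"
    if "x \<in> carrier L" for x by (rule tlift_rep(1)) (use assms cl that in auto)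
  show ?thesis
  proof (rule lin_mapI)
    show "tlift k M N P (f x) u \<in> carrier P" if "x \<in> carrier L" for x
      by (rule tlift_closed') (use assms cl that in auto)
  next
    fix x y assume xy: "x \<in> carrier L" "y \<in> carrier L"
    have "tlift k M N P (f (x \<oplus>\<^bsub>L\<^esub> y)) u =
      finsum P (\<lambda>p. rep_coeff u p \<odot>\<^bsub>P\<^esub> f x (fst p) (snd p) \<oplus>\<^bsub>P\<^esub> rep_coeff u p \<odot>\<^bsub>P\<^esub> f y (fst p) (snd p)) (rep_supp u)"
      unfolding s[OF L.add.m_closed[OF xy]]
      by (rule P.finsum_cong') (use xy cl r in \<open>simp_all add: add P.smult_r_distr Pi_def del: split_paired_All\<close>)
    also have "\<dots> = tlift k M N P (f x) u \<oplus>\<^bsub>P\<^esub> tlift k M N P (f y) u"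
      unfolding s[OF xy(1)] s[OF xy(2)] by (rule P.finsum_addf) (use xy cl r in auto)
    finally show "tlift k M N P (f (x \<oplus>\<^bsub>L\<^esub> y)) u = tlift k M N P (f x) u \<oplus>\<^bsub>P\<^esub> tlift k M N P (f y) u" .
  next
    fix c x assume c: "c \<in> carrier k" "x \<in> carrier L"
    have *: "a \<odot>\<^bsub>P\<^esub> (c \<odot>\<^bsub>P\<^esub> y) = c \<odot>\<^bsub>P\<^esub> (a \<odot>\<^bsub>P\<^esub> y)" if "a \<in> carrier k" "y \<in> carrier P" for a y
      using that c by (metis P.smult_assoc1 R.m_comm)
    have "tlift k M N P (f (c \<odot>\<^bsub>L\<^esub> x)) u = finsum P (\<lambda>p. c \<odot>\<^bsub>P\<^esub> (rep_coeff u p \<odot>\<^bsub>P\<^esub> f x (fst p) (snd p))) (rep_supp u)"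
      unfolding s[OF L.smult_closed[OF c]]
      by (rule P.finsum_cong') (use c cl r in \<open>simp_all add: sm * Pi_def del: split_paired_All\<close>)
    also have "\<dots> = c \<odot>\<^bsub>P\<^esub> tlift k M N P (f x) u"
      unfolding s[OF c(2)] by (rule P.finsum_smult_ldistr[symmetric]) (use c cl r in auto)
    finally show "tlift k M N P (f (c \<odot>\<^bsub>L\<^esub> x)) u = c \<odot>\<^bsub>P\<^esub> tlift k M N P (f x) u" .
  qed
qed

text \<open>
  Independence of the representative: the relations lie in the kernel of the linear extension of a
  bilinear map, so this kernel contains the submodule that they generate.
\<close>

lemma tlift_q:
  assumes P: "module k P" and f: "bilin k M N P f" and \<phi>: "\<phi> \<in> carrier F"
  shows "tlift k M N P f (q \<phi>) = lin_ext k P (\<lambda>(x, y). f x y) \<phi>"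
proof -
  interpret P: module k P by fact
  let ?h = "lin_ext k P (\<lambda>(x, y). f x y)"
  have cl: "(case s of (x, y) \<Rightarrow> f x y) \<in> carrier P" if "s \<in> carrier M \<times> carrier N" for s
    using that bilin_closed[OF f] by auto
  have h: "?h \<in> lin_map k F P" unfolding F_eq by (rule lin_ext_lin[OF P cl])
  have gen: "?h (free_gen k (x, y)) = f x y" if "x \<in> carrier M" "y \<in> carrier N" for x y
    using lin_ext_gen[OF P, of "\<lambda>(x, y). f x y" "(x,y)"] bilin_closed[OF f] that by auto
  let ?H = "{\<phi> \<in> carrier F. ?h \<phi> = \<zero>\<^bsub>P\<^esub>}"
  have H: "submodule ?H k F"
    by (rule F.submoduleI)
      (auto simp: lin_zero[OF F_module P h] lin_neg[OF F_module P h] lin_add[OF h] lin_smult[OF h])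
  have "tensor_rel_gens k M N \<subseteq> ?H"
  proof
    fix r assume r: "r \<in> tensor_rel_gens k M N"
    have mm: "x \<ominus>\<^bsub>P\<^esub> x = \<zero>\<^bsub>P\<^esub>" if "x \<in> carrier P" for x using that by (simp add: a_minus_def P.r_neg)
    have "?h r = \<zero>\<^bsub>P\<^esub>" using r unfolding tensor_rel_gens_def Let_def
      by (auto simp: lin_sub[OF F_module P h] lin_add[OF h] lin_smult[OF h] gen bilin_closed[OF f]
        lin_add[OF bilin_left[OF f]] lin_add[OF bilin_right[OF f]]
        lin_smult[OF bilin_left[OF f]] lin_smult[OF bilin_right[OF f]] mm)
    then show "r \<in> ?H" using gens_sub r by blast
  qed
  with H have KH: "K \<subseteq> ?H" unfolding tensor_rel_def by auto
  have qc: "q \<phi> \<in> carrier (M \<boxtimes> N)" using \<phi> by (simp add: tensor_sel)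
  let ?\<psi> = "SOME \<psi>. \<psi> \<in> q \<phi>"
  have "tlift k M N P f (q \<phi>) = tensor_lift k P (\<lambda>(x, y). f x y) (q \<phi>)"
    using tlift_rep[OF P qc bilin_closed[OF f]] by simp
  also have "\<dots> = ?h ?\<psi>" by (simp add: tensor_lift_def lin_ext_def Let_def)
  also have "?\<psi> \<ominus>\<^bsub>F\<^esub> \<phi> \<in> K" using representative[OF qc] \<phi> q_eq by blast
  then have "?h (?\<psi> \<ominus>\<^bsub>F\<^esub> \<phi>) = \<zero>\<^bsub>P\<^esub>" using KH by blast
  then have "?h ?\<psi> = ?h \<phi>" using representative[OF qc] \<phi> lin_closed[OF h]
    by (simp add: lin_sub[OF F_module P h] module_diff_eq_zero[OF P])
  finally show ?thesis .
qed

lemma tlift_lin':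
  assumes P: "module k P" and f: "bilin k M N P f"
  shows "tlift k M N P f \<in> lin_map k (M \<boxtimes> N) P"
proof -
  interpret P: module k P by fact
  have cl: "(case s of (x, y) \<Rightarrow> f x y) \<in> carrier P" if "s \<in> carrier M \<times> carrier N" for s
    using that bilin_closed[OF f] by auto
  have h: "lin_ext k P (\<lambda>(x, y). f x y) \<in> lin_map k F P" unfolding F_eq by (rule lin_ext_lin[OF P cl])
  show ?thesis
    by (rule lin_mapI) (auto simp: tensor_sel tlift_q[OF P f] tensor_add tensor_smult lin_closed[OF h] lin_add[OF h] lin_smult[OF h])
qed

lemma tlift_pure':
  assumes P: "module k P" and f: "bilin k M N P f" and "x \<in> carrier M" "y \<in> carrier N"
  shows "tlift k M N P f (pure k M N x y) = f x y"
  unfolding pure_def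
  by (subst tlift_q[OF P f], use assms in simp, subst lin_ext_gen[OF P])
    (use assms bilin_closed[OF f] in auto)

end


context base_ring begin

lemma tensor_pairI: "module k M \<Longrightarrow> module k N \<Longrightarrow> tensor_pair k M N"
  by (intro tensor_pair.intro base_ring_axioms)

lemma tensor_module_module [simp]: "module k M \<Longrightarrow> module k N \<Longrightarrow> module k (M \<boxtimes> N)"
  by (rule tensor_pair.tensor_module'[OF tensor_pairI])

lemma pure_bilin: "module k M \<Longrightarrow> module k N \<Longrightarrow> bilin k M N (M \<boxtimes> N) (pure k M N)"
  by (rule tensor_pair.pure_bilin'[OF tensor_pairI])

lemma pure_closed [simp]:
  "module k M \<Longrightarrow> module k N \<Longrightarrow> x \<in> carrier M \<Longrightarrow> y \<in> carrier N \<Longrightarrow> pure k M N x y \<in> carrier (M \<boxtimes> N)"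
  by (rule bilin_closed[OF pure_bilin])

lemma lin_bilin_left: "bilin k M N P f \<Longrightarrow> g \<in> lin_map k L M \<Longrightarrow> y \<in> carrier N \<Longrightarrow> (\<lambda>x. f (g x) y) \<in> lin_map k L P"
  by (rule lin_comp[OF bilin_left])

lemma lin_bilin_right: "bilin k M N P f \<Longrightarrow> g \<in> lin_map k L N \<Longrightarrow> y \<in> carrier M \<Longrightarrow> (\<lambda>x. f y (g x)) \<in> lin_map k L P"
  by (rule lin_comp[OF bilin_right])

lemma lin_pure_left [simp]: "module k M \<Longrightarrow> module k N \<Longrightarrow> g \<in> lin_map k L M \<Longrightarrow> y \<in> carrier N
    \<Longrightarrow> (\<lambda>x. pure k M N (g x) y) \<in> lin_map k L (M \<boxtimes> N)"
  by (rule lin_bilin_left[OF pure_bilin])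

lemma lin_pure_right [simp]: "module k M \<Longrightarrow> module k N \<Longrightarrow> g \<in> lin_map k L N \<Longrightarrow> y \<in> carrier M
    \<Longrightarrow> (\<lambda>x. pure k M N y (g x)) \<in> lin_map k L (M \<boxtimes> N)"
  by (rule lin_bilin_right[OF pure_bilin])

lemma tensor_induct [consumes 3, case_names zero pure add]:
  assumes "module k M" "module k N" "u \<in> carrier (M \<boxtimes> N)"
    and "Q \<zero>\<^bsub>M \<boxtimes> N\<^esub>"
    and "\<And>x y. x \<in> carrier M \<Longrightarrow> y \<in> carrier N \<Longrightarrow> Q (pure k M N x y)"
    and "\<And>u v. u \<in> carrier (M \<boxtimes> N) \<Longrightarrow> v \<in> carrier (M \<boxtimes> N) \<Longrightarrow> Q u \<Longrightarrow> Q v \<Longrightarrow> Q (u \<oplus>\<^bsub>M \<boxtimes> N\<^esub> v)"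
  shows "Q u"
  by (rule tensor_pair.tensor_induct'[OF tensor_pairI]) (use assms in auto)

lemma tensor_ext:
  assumes "module k M" "module k N" "module k P" "f \<in> lin_map k (M \<boxtimes> N) P" "g \<in> lin_map k (M \<boxtimes> N) P"
    "\<And>x y. x \<in> carrier M \<Longrightarrow> y \<in> carrier N \<Longrightarrow> f (pure k M N x y) = g (pure k M N x y)"
    "u \<in> carrier (M \<boxtimes> N)"
  shows "f u = g u"
  using assms(1,2,7)
proof (induct rule: tensor_induct)
  case zero then show ?case using lin_zero[OF _ assms(3,4)] lin_zero[OF _ assms(3,5)] assms(1,2) by simp
qed (use assms lin_add[OF assms(4)] lin_add[OF assms(5)] in auto)

lemma tlift_closed [simp]:
  "module k M \<Longrightarrow> module k N \<Longrightarrow> module k P \<Longrightarrow> u \<in> carrier (M \<boxtimes> N) \<Longrightarrow>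
    (\<And>x y. x \<in> carrier M \<Longrightarrow> y \<in> carrier N \<Longrightarrow> f x y \<in> carrier P) \<Longrightarrow> tlift k M N P f u \<in> carrier P"
  by (rule tensor_pair.tlift_closed'[OF tensor_pairI])

lemma tlift_push:
  "module k M \<Longrightarrow> module k N \<Longrightarrow> module k P \<Longrightarrow> module k P' \<Longrightarrow> h \<in> lin_map k P P' \<Longrightarrow> u \<in> carrier (M \<boxtimes> N) \<Longrightarrow>
    (\<And>x y. x \<in> carrier M \<Longrightarrow> y \<in> carrier N \<Longrightarrow> f x y \<in> carrier P) \<Longrightarrow>
    h (tlift k M N P f u) = tlift k M N P' (\<lambda>x y. h (f x y)) u"
  by (rule tensor_pair.tlift_push'[OF tensor_pairI])

lemma tlift_lin_fun [simp]:
  "module k M \<Longrightarrow> module k N \<Longrightarrow> module k P \<Longrightarrow> module k L \<Longrightarrow> u \<in> carrier (M \<boxtimes> N) \<Longrightarrow>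
    (\<And>a b. a \<in> carrier M \<Longrightarrow> b \<in> carrier N \<Longrightarrow> (\<lambda>x. f x a b) \<in> lin_map k L P) \<Longrightarrow>
    (\<lambda>x. tlift k M N P (f x) u) \<in> lin_map k L P"
  by (rule tensor_pair.tlift_lin_fun'[OF tensor_pairI])

lemma tlift_lin:
  "module k M \<Longrightarrow> module k N \<Longrightarrow> module k P \<Longrightarrow> bilin k M N P f \<Longrightarrow> tlift k M N P f \<in> lin_map k (M \<boxtimes> N) P"
  by (rule tensor_pair.tlift_lin'[OF tensor_pairI])

lemma tlift_lin_arg [simp]:
  "module k M \<Longrightarrow> module k N \<Longrightarrow> module k P \<Longrightarrow> g \<in> lin_map k L (M \<boxtimes> N) \<Longrightarrow> bilin k M N P f \<Longrightarrow>
    (\<lambda>x. tlift k M N P f (g x)) \<in> lin_map k L P"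
  by (rule lin_comp[OF tlift_lin])

lemma tlift_pure [simp]:
  "module k M \<Longrightarrow> module k N \<Longrightarrow> module k P \<Longrightarrow> x \<in> carrier M \<Longrightarrow> y \<in> carrier N \<Longrightarrow> bilin k M N P f \<Longrightarrow>
    tlift k M N P f (pure k M N x y) = f x y"
  by (rule tensor_pair.tlift_pure'[OF tensor_pairI])

lemma tlift_eta:
  assumes "module k M" "module k N" "u \<in> carrier (M \<boxtimes> N)"
  shows "tlift k M N (M \<boxtimes> N) (\<lambda>x y. pure k M N x y) u = u"
  by (rule tensor_ext[of M N "M \<boxtimes> N" _ "\<lambda>x. x", OF assms(1,2)]) (use assms in \<open>auto simp: bilin_def\<close>)

lemma tlift_tlift:
  "module k M \<Longrightarrow> module k N \<Longrightarrow> module k M' \<Longrightarrow> module k N' \<Longrightarrow> module k P \<Longrightarrow> bilin k M N P f \<Longrightarrow> u \<in> carrier (M' \<boxtimes> N') \<Longrightarrow>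
    (\<And>x y. x \<in> carrier M' \<Longrightarrow> y \<in> carrier N' \<Longrightarrow> g x y \<in> carrier (M \<boxtimes> N)) \<Longrightarrow>
    tlift k M N P f (tlift k M' N' (M \<boxtimes> N) g u) = tlift k M' N' P (\<lambda>x y. tlift k M N P f (g x y)) u"
  by (rule tlift_push[OF _ _ _ _ tlift_lin]) auto

lemma tlift_swap:
  assumes m: "module k M" "module k N" "module k M'" "module k N'" "module k P"
    and u: "u \<in> carrier (M \<boxtimes> N)" and v: "v \<in> carrier (M' \<boxtimes> N')"
    and f: "\<And>x y a b. x \<in> carrier M \<Longrightarrow> y \<in> carrier N \<Longrightarrow> a \<in> carrier M' \<Longrightarrow> b \<in> carrier N' \<Longrightarrow> f x y a b \<in> carrier P"
  shows "tlift k M N P (\<lambda>x y. tlift k M' N' P (\<lambda>a b. f x y a b) v) u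
    = tlift k M' N' P (\<lambda>a b. tlift k M N P (\<lambda>x y. f x y a b) u) v"
proof -
  interpret P: module k P by fact
  interpret U: tensor_pair k M N by (rule tensor_pairI) fact+
  interpret V: tensor_pair k M' N' by (rule tensor_pairI) fact+
  note ru = U.rep_coeff[OF u] and rv = V.rep_coeff[OF v]
  have f': "f (fst p) (snd p) (fst q) (snd q) \<in> carrier P" if "p \<in> U.rep_supp u" "q \<in> V.rep_supp v" for p q
    by (rule f) (use ru(4,5) rv(4,5) that in simp_all)
  have "tlift k M N P (\<lambda>x y. tlift k M' N' P (\<lambda>a b. f x y a b) v) u =
    finsum P (\<lambda>p. finsum P (\<lambda>q. V.rep_coeff v q \<odot>\<^bsub>P\<^esub> (U.rep_coeff u p \<odot>\<^bsub>P\<^esub> f (fst p) (snd p) (fst q) (snd q))) (V.rep_supp v)) (U.rep_supp u)"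
  proof (subst U.tlift_rep(1))
    have "U.rep_coeff u p \<odot>\<^bsub>P\<^esub> tlift k M' N' P (f (fst p) (snd p)) v =
        finsum P (\<lambda>q. V.rep_coeff v q \<odot>\<^bsub>P\<^esub> (U.rep_coeff u p \<odot>\<^bsub>P\<^esub> f (fst p) (snd p) (fst q) (snd q))) (V.rep_supp v)"
      if "p \<in> U.rep_supp u" for p
    proof -
      have "U.rep_coeff u p \<odot>\<^bsub>P\<^esub> tlift k M' N' P (f (fst p) (snd p)) v =
         tlift k M' N' P (\<lambda>a b. U.rep_coeff u p \<odot>\<^bsub>P\<^esub> f (fst p) (snd p) a b) v"
        by (rule tlift_push[OF m(3,4,5,5) lin_smult_map[OF m(5) lin_id(1)]])
          (use f ru that v in auto)
      also have "\<dots> = finsum P (\<lambda>q. V.rep_coeff v q \<odot>\<^bsub>P\<^esub> (U.rep_coeff u p \<odot>\<^bsub>P\<^esub> f (fst p) (snd p) (fst q) (snd q))) (V.rep_supp v)"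
        by (subst V.tlift_rep(1)) (use f ru that v m in auto)
      finally show ?thesis .
    qed
    then show "finsum P (\<lambda>p. U.rep_coeff u p \<odot>\<^bsub>P\<^esub> tlift k M' N' P (f (fst p) (snd p)) v) (U.rep_supp u) =
      finsum P (\<lambda>p. finsum P (\<lambda>q. V.rep_coeff v q \<odot>\<^bsub>P\<^esub> (U.rep_coeff u p \<odot>\<^bsub>P\<^esub> f (fst p) (snd p) (fst q) (snd q))) (V.rep_supp v)) (U.rep_supp u)"
      by (intro P.finsum_cong') (use f' ru rv in \<open>auto intro!: P.finsum_closed\<close>)
  qed (use m u v f in auto)
  also have "\<dots> = finsum P (\<lambda>q. finsum P (\<lambda>p. V.rep_coeff v q \<odot>\<^bsub>P\<^esub> (U.rep_coeff u p \<odot>\<^bsub>P\<^esub> f (fst p) (snd p) (fst q) (snd q))) (U.rep_supp u)) (V.rep_supp v)"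
    by (rule finsum_swap) (use f' ru rv in \<open>auto intro: P.abelian_monoid_axioms\<close>)
  also have "\<dots> = tlift k M' N' P (\<lambda>a b. tlift k M N P (\<lambda>x y. f x y a b) u) v"
  proof (subst V.tlift_rep(1))
    have "finsum P (\<lambda>p. V.rep_coeff v q \<odot>\<^bsub>P\<^esub> (U.rep_coeff u p \<odot>\<^bsub>P\<^esub> f (fst p) (snd p) (fst q) (snd q))) (U.rep_supp u) =
       V.rep_coeff v q \<odot>\<^bsub>P\<^esub> tlift k M N P (\<lambda>x y. f x y (fst q) (snd q)) u" if "q \<in> V.rep_supp v" for q
      by (subst U.tlift_rep(1), (use m u f rv that in auto)[3], rule P.finsum_smult_ldistr[symmetric])
        (use f' ru rv that in auto)
    then show "finsum P (\<lambda>q. finsum P (\<lambda>p. V.rep_coeff v q \<odot>\<^bsub>P\<^esub> (U.rep_coeff u p \<odot>\<^bsub>P\<^esub> f (fst p) (snd p) (fst q) (snd q))) (U.rep_supp u)) (V.rep_supp v)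
      = finsum P (\<lambda>q. V.rep_coeff v q \<odot>\<^bsub>P\<^esub> tlift k M N P (\<lambda>x y. f x y (fst q) (snd q)) u) (V.rep_supp v)"
      by (intro P.finsum_cong') (use f' ru rv m u f in \<open>auto intro!: P.finsum_closed\<close>)
  qed (use m u v f in auto)
  finally show ?thesis .
qed

lemma lin_smult_left:
  assumes "module k P" "e \<in> lin_map k L (base_module k)" "x \<in> carrier P"
  shows "(\<lambda>a. e a \<odot>\<^bsub>P\<^esub> x) \<in> lin_map k L P"
proof -
  interpret P: module k P by fact
  show ?thesis
    by (rule lin_mapI) (use lin_closed[OF assms(2)] lin_add[OF assms(2)] lin_smult[OF assms(2)] assms(3)
      in \<open>auto simp: base_module_def P.smult_l_distr P.smult_assoc1\<close>)
qed

lemma lin_smult_right: "module k P \<Longrightarrow> g \<in> lin_map k L P \<Longrightarrow> c \<in> carrier k \<Longrightarrow> (\<lambda>x. c \<odot>\<^bsub>P\<^esub> g x) \<in> lin_map k L P"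
  by (rule lin_smult_map)

lemma base_module_algebra: "k_algebra k (base_module k)"
proof -
  have g: "abelian_group (base_module k)"
    by (rule abelian_groupI) (auto simp: base_module_def R.a_ac intro: R.l_neg exI[of _ "\<ominus> _"] bexI[of _ "\<ominus> _"])
  have "module k (base_module k)"
    by (rule moduleI) (auto simp: g R.is_cring, auto simp: base_module_def R.l_distr R.r_distr R.m_assoc)
  moreover have "ring (base_module k)"
    by (rule ringI[OF g]) (auto simp: base_module_def R.l_distr R.r_distr R.m_assoc intro!: monoidI)
  ultimately show ?thesis
    by (auto intro!: k_algebra.intro k_algebra_axioms.intro) (auto simp: base_module_def R.m_ac)
qed

lemma base_module_module [simp]: "module k (base_module k)"
  by (rule k_algebra.axioms(1)[OF base_module_algebra])

lemma base_module_sel [simp]: "carrier (base_module k) = carrier k" "smult (base_module k) = mult k"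
  "mult (base_module k) = mult k" "one (base_module k) = one k" "zero (base_module k) = zero k" "add (base_module k) = add k"
  by (auto simp: base_module_def)

section \<open>Algebras and their tensor products\<close>

lemma k_algebra_module: "k_algebra k A \<Longrightarrow> module k A"
  by (rule k_algebra.axioms(1))

lemma mult_bilin: assumes "k_algebra k A" shows "bilin k A A A (mult A)"
proof -
  interpret A: k_algebra k A by fact
  show ?thesis
    by (intro bilinI lin_mapI) (auto simp: A.l_distr A.r_distr A.smult_mult_left A.smult_mult_right)
qed

lemma mult_closed: "k_algebra k A \<Longrightarrow> x \<in> carrier A \<Longrightarrow> y \<in> carrier A \<Longrightarrow> x \<otimes>\<^bsub>A\<^esub> y \<in> carrier A"
  by (rule bilin_closed[OF mult_bilin])

lemma mult_assoc: "k_algebra k A \<Longrightarrow> x \<in> carrier A \<Longrightarrow> y \<in> carrier A \<Longrightarrow> z \<in> carrier A \<Longrightarrow>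
   (x \<otimes>\<^bsub>A\<^esub> y) \<otimes>\<^bsub>A\<^esub> z = x \<otimes>\<^bsub>A\<^esub> (y \<otimes>\<^bsub>A\<^esub> z)"
  by (meson k_algebra.axioms(2) ring.ring_simprules(11))

lemma one_closed: "k_algebra k A \<Longrightarrow> \<one>\<^bsub>A\<^esub> \<in> carrier A"
  by (meson k_algebra.axioms(2) ring.ring_simprules(6))

lemma mult_one: "k_algebra k A \<Longrightarrow> x \<in> carrier A \<Longrightarrow> \<one>\<^bsub>A\<^esub> \<otimes>\<^bsub>A\<^esub> x = x"
   "k_algebra k A \<Longrightarrow> x \<in> carrier A \<Longrightarrow> x \<otimes>\<^bsub>A\<^esub> \<one>\<^bsub>A\<^esub> = x"
  by (simp_all add: k_algebra.axioms(2) ring.is_monoid monoid.l_one monoid.r_one)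

lemma lin_mult_left: "k_algebra k A \<Longrightarrow> g \<in> lin_map k L A \<Longrightarrow> y \<in> carrier A \<Longrightarrow> (\<lambda>x. g x \<otimes>\<^bsub>A\<^esub> y) \<in> lin_map k L A"
  by (rule lin_bilin_left[OF mult_bilin])

lemma lin_mult_right: "k_algebra k A \<Longrightarrow> g \<in> lin_map k L A \<Longrightarrow> y \<in> carrier A \<Longrightarrow> (\<lambda>x. y \<otimes>\<^bsub>A\<^esub> g x) \<in> lin_map k L A"
  by (rule lin_bilin_right[OF mult_bilin])

lemmas alg_simps = k_algebra_module mult_closed one_closed mult_one lin_mult_left lin_mult_right

lemma tensor_lift_eq:
  assumes "module k M" "module k N" "module k P" "u \<in> carrier (M \<boxtimes> N)"
    "\<And>x y. x \<in> carrier M \<Longrightarrow> y \<in> carrier N \<Longrightarrow> f x y \<in> carrier P"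
  shows "tensor_lift k P (\<lambda>(x, y). f x y) u = tlift k M N P f u"
proof -
  interpret U: tensor_pair k M N by (rule tensor_pairI) fact+
  show ?thesis using U.tlift_rep[OF assms(3-5)] by simp
qed

lemma tensor_lift_tensor: "tensor_lift k (tensor_module k M N) = tensor_lift k (M \<boxtimes> N)"
  by (intro ext) (simp add: tensor_lift_def finsum_def tensor_def)

lemma tensor_one: "\<one>\<^bsub>M \<boxtimes> N\<^esub> = pure k M N \<one>\<^bsub>M\<^esub> \<one>\<^bsub>N\<^esub>"
  by (simp add: tensor_def)

lemma tensor_mult_eq:
  assumes "k_algebra k M" "k_algebra k N" "u \<in> carrier (M \<boxtimes> N)" "v \<in> carrier (M \<boxtimes> N)"
  shows "u \<otimes>\<^bsub>M \<boxtimes> N\<^esub> v = tlift k M N (M \<boxtimes> N) (\<lambda>x y. tlift k M N (M \<boxtimes> N) (\<lambda>x' y'. pure k M N (x \<otimes>\<^bsub>M\<^esub> x') (y \<otimes>\<^bsub>N\<^esub> y')) v) u"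
proof -
  note [simp] = alg_simps[OF assms(1)] alg_simps[OF assms(2)]
  have "u \<otimes>\<^bsub>M \<boxtimes> N\<^esub> v = tensor_lift k (M \<boxtimes> N) (\<lambda>(x, y). tensor_lift k (M \<boxtimes> N) (\<lambda>(x', y'). pure k M N (x \<otimes>\<^bsub>M\<^esub> x') (y \<otimes>\<^bsub>N\<^esub> y')) v) u"
    by (subst tensor_def) (simp add: tensor_lift_tensor)
  also have "\<dots> = tlift k M N (M \<boxtimes> N) (\<lambda>x y. tensor_lift k (M \<boxtimes> N) (\<lambda>(x', y'). pure k M N (x \<otimes>\<^bsub>M\<^esub> x') (y \<otimes>\<^bsub>N\<^esub> y')) v) u"
    by (subst tensor_lift_eq[of M N]) (use assms(3,4) in \<open>simp_all add: tensor_lift_eq[of M N]\<close>)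
  also have "\<dots> = tlift k M N (M \<boxtimes> N) (\<lambda>x y. tlift k M N (M \<boxtimes> N) (\<lambda>x' y'. pure k M N (x \<otimes>\<^bsub>M\<^esub> x') (y \<otimes>\<^bsub>N\<^esub> y')) v) u"
    by (rule tlift_cong) (use assms(3,4) in \<open>simp_all add: tensor_lift_eq[of M N]\<close>)
  finally show ?thesis .
qed

lemma tensor_mult_pure:
  assumes "k_algebra k M" "k_algebra k N" "x \<in> carrier M" "y \<in> carrier N" "x' \<in> carrier M" "y' \<in> carrier N"
  shows "pure k M N x y \<otimes>\<^bsub>M \<boxtimes> N\<^esub> pure k M N x' y' = pure k M N (x \<otimes>\<^bsub>M\<^esub> x') (y \<otimes>\<^bsub>N\<^esub> y')"
proof -
  note [simp] = alg_simps[OF assms(1)] alg_simps[OF assms(2)]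
  show ?thesis using assms(3-) by (simp add: tensor_mult_eq[OF assms(1,2)] bilin_def)
qed

text \<open>
  All axioms are identities between linear maps in each factor, hence need only be checked on pure tensors.
\<close>

lemma tensor_algebra: assumes "k_algebra k M" "k_algebra k N" shows "k_algebra k (M \<boxtimes> N)"
proof -
  note [simp] = alg_simps[OF assms(1)] alg_simps[OF assms(2)]
  let ?T = "M \<boxtimes> N"
  have T: "module k ?T" by simp
  interpret T: module k ?T by simp
  note pm = tensor_mult_pure[OF assms]
  have bil: "bilin k ?T ?T ?T (mult ?T)"
    unfolding bilin_def
    by (intro conjI allI impI lin_cong[OF T _ tensor_mult_eq[OF assms, symmetric]]) (simp_all add: bilin_def)
  note [simp] = bilin_closed[OF bil] lin_bilin_left[OF bil] lin_bilin_right[OF bil]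
  have ext3: "f u = g u" if "f \<in> lin_map k ?T ?T" "g \<in> lin_map k ?T ?T" "u \<in> carrier ?T"
    "\<And>x y. x \<in> carrier M \<Longrightarrow> y \<in> carrier N \<Longrightarrow> f (pure k M N x y) = g (pure k M N x y)" for f g u
    by (rule tensor_ext[of M N ?T]) (use that in simp_all)
  have assoc: "(u \<otimes>\<^bsub>?T\<^esub> v) \<otimes>\<^bsub>?T\<^esub> w = u \<otimes>\<^bsub>?T\<^esub> (v \<otimes>\<^bsub>?T\<^esub> w)"
    if uvw: "u \<in> carrier ?T" "v \<in> carrier ?T" "w \<in> carrier ?T" for u v w
  proof (rule ext3[of "\<lambda>u. (u \<otimes>\<^bsub>?T\<^esub> v) \<otimes>\<^bsub>?T\<^esub> w" "\<lambda>u. u \<otimes>\<^bsub>?T\<^esub> (v \<otimes>\<^bsub>?T\<^esub> w)"])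
    fix x y assume x: "x \<in> carrier M" "y \<in> carrier N"
    show "(pure k M N x y \<otimes>\<^bsub>?T\<^esub> v) \<otimes>\<^bsub>?T\<^esub> w = pure k M N x y \<otimes>\<^bsub>?T\<^esub> (v \<otimes>\<^bsub>?T\<^esub> w)"
    proof (rule ext3[of "\<lambda>v. (pure k M N x y \<otimes>\<^bsub>?T\<^esub> v) \<otimes>\<^bsub>?T\<^esub> w" "\<lambda>v. pure k M N x y \<otimes>\<^bsub>?T\<^esub> (v \<otimes>\<^bsub>?T\<^esub> w)"])
      fix x' y' assume x': "x' \<in> carrier M" "y' \<in> carrier N"
      show "(pure k M N x y \<otimes>\<^bsub>?T\<^esub> pure k M N x' y') \<otimes>\<^bsub>?T\<^esub> w = pure k M N x y \<otimes>\<^bsub>?T\<^esub> (pure k M N x' y' \<otimes>\<^bsub>?T\<^esub> w)"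
        by (rule ext3[of "\<lambda>w. (pure k M N x y \<otimes>\<^bsub>?T\<^esub> pure k M N x' y') \<otimes>\<^bsub>?T\<^esub> w" "\<lambda>w. pure k M N x y \<otimes>\<^bsub>?T\<^esub> (pure k M N x' y' \<otimes>\<^bsub>?T\<^esub> w)"])
          (use uvw x x' in \<open>simp_all add: pm mult_assoc[OF assms(1)] mult_assoc[OF assms(2)]\<close>)
    qed (use uvw x in simp_all)
  qed (use uvw in simp_all)
  have l1: "\<one>\<^bsub>?T\<^esub> \<otimes>\<^bsub>?T\<^esub> u = u" if "u \<in> carrier ?T" for u
    by (rule ext3[of "\<lambda>u. \<one>\<^bsub>?T\<^esub> \<otimes>\<^bsub>?T\<^esub> u" "\<lambda>u. u"]) (use that in \<open>simp_all add: pm tensor_one\<close>)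
  have r1: "u \<otimes>\<^bsub>?T\<^esub> \<one>\<^bsub>?T\<^esub> = u" if "u \<in> carrier ?T" for u
    by (rule ext3[of "\<lambda>u. u \<otimes>\<^bsub>?T\<^esub> \<one>\<^bsub>?T\<^esub>" "\<lambda>u. u"]) (use that in \<open>simp_all add: pm tensor_one\<close>)
  have "ring ?T"
  proof (rule ringI)
    show "monoid ?T" by (rule monoidI) (simp_all add: assoc l1 r1, simp add: tensor_one)
  qed (simp_all add: T.abelian_group_axioms lin_add[OF bilin_left[OF bil]] lin_add[OF bilin_right[OF bil]])
  then show ?thesis
    by (intro k_algebra.intro T k_algebra_axioms.intro)
      (simp_all add: lin_smult[OF bilin_left[OF bil]] lin_smult[OF bilin_right[OF bil]])
qed

end

section \<open>Structural maps of tensor products\<close>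


text \<open>
  The common shape \<open>(D\<^sub>1 \<otimes> M\<^sub>3) D = (M\<^sub>1 \<otimes> D\<^sub>2) D'\<close> of coassociativity, coaction and compatibility laws, where
  \<open>D : X \<rightarrow> A \<otimes> M\<^sub>3\<close>, \<open>D\<^sub>1 : A \<rightarrow> M\<^sub>1 \<otimes> M\<^sub>2\<close>, \<open>D' : X \<rightarrow> M\<^sub>1 \<otimes> C\<close> and \<open>D\<^sub>2 : C \<rightarrow> M\<^sub>2 \<otimes> M\<^sub>3\<close>.
\<close>

definition coassoc where
  "coassoc k X M1 M2 M3 D D1 D' D2 \<longleftrightarrow> (\<forall>x \<in> carrier X.
     tensor_assoc k M1 M2 M3 (tensor_map k (tensor k M1 M2) M3 D1 id (D x)) =
     tensor_map k M1 (tensor k M2 M3) id D2 (D' x))"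

lemma alg_hom_lin: "f \<in> alg_hom k A B \<Longrightarrow> f \<in> lin_map k A B"
  by (simp add: alg_hom_def)

lemma alg_hom_mult: "f \<in> alg_hom k A B \<Longrightarrow> x \<in> carrier A \<Longrightarrow> y \<in> carrier A \<Longrightarrow> f (x \<otimes>\<^bsub>A\<^esub> y) = f x \<otimes>\<^bsub>B\<^esub> f y"
  by (simp add: alg_hom_def ring_hom_def)

lemma alg_hom_one: "f \<in> alg_hom k A B \<Longrightarrow> f \<one>\<^bsub>A\<^esub> = \<one>\<^bsub>B\<^esub>"
  by (simp add: alg_hom_def ring_hom_def)

lemma alg_homI:
  assumes "f \<in> lin_map k A B" "\<And>x y. x \<in> carrier A \<Longrightarrow> y \<in> carrier A \<Longrightarrow> f (x \<otimes>\<^bsub>A\<^esub> y) = f x \<otimes>\<^bsub>B\<^esub> f y"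
    "f \<one>\<^bsub>A\<^esub> = \<one>\<^bsub>B\<^esub>"
  shows "f \<in> alg_hom k A B"
  using assms by (auto simp: alg_hom_def ring_hom_def lin_closed[OF assms(1)] lin_add[OF assms(1)])

context base_ring begin

lemma tensor_map_eq:
  assumes "module k M" "module k N" "module k M'" "module k N'" "f \<in> lin_map k M M'" "g \<in> lin_map k N N'"
    "u \<in> carrier (M \<boxtimes> N)"
  shows "tensor_map k M' N' f g u = tlift k M N (M' \<boxtimes> N') (\<lambda>x y. pure k M' N' (f x) (g y)) u"
  unfolding tensor_map_def
  by (rule tensor_lift_eq) (use assms lin_closed[OF assms(5)] lin_closed[OF assms(6)] in auto)

lemma tensor_map_lin:
  assumes "module k M" "module k N" "module k M'" "module k N'" "f \<in> lin_map k M M'" "g \<in> lin_map k N N'"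
  shows "tensor_map k M' N' f g \<in> lin_map k (M \<boxtimes> N) (M' \<boxtimes> N')"
  by (rule lin_cong[OF _ _ tensor_map_eq[OF assms, symmetric]])
    (use assms lin_closed[OF assms(5)] lin_closed[OF assms(6)] in \<open>auto simp: bilin_def\<close>)

lemma tensor_map_pure:
  assumes "module k M" "module k N" "module k M'" "module k N'" "f \<in> lin_map k M M'" "g \<in> lin_map k N N'"
    "x \<in> carrier M" "y \<in> carrier N"
  shows "tensor_map k M' N' f g (pure k M N x y) = pure k M' N' (f x) (g y)"
  by (subst tensor_map_eq[OF assms(1-6)])
    (use assms lin_closed[OF assms(5)] lin_closed[OF assms(6)] in \<open>auto simp: bilin_def\<close>)

lemma tensor_assoc_eq:
  assumes "module k M" "module k N" "module k P" "u \<in> carrier ((M \<boxtimes> N) \<boxtimes> P)"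
  shows "tensor_assoc k M N P u = tlift k (M \<boxtimes> N) P (M \<boxtimes> (N \<boxtimes> P)) (\<lambda>v z.
    tlift k M N (M \<boxtimes> (N \<boxtimes> P)) (\<lambda>x y. pure k M (N \<boxtimes> P) x (pure k N P y z)) v) u"
proof -
  have *: "tensor_lift k (M \<boxtimes> (N \<boxtimes> P)) (\<lambda>(x, y). pure k M (N \<boxtimes> P) x (pure k N P y z)) v
    = tlift k M N (M \<boxtimes> (N \<boxtimes> P)) (\<lambda>x y. pure k M (N \<boxtimes> P) x (pure k N P y z)) v"
    if "v \<in> carrier (M \<boxtimes> N)" "z \<in> carrier P" for v z
    by (rule tensor_lift_eq) (use assms that in simp_all)
  show ?thesis unfolding tensor_assoc_def
    by (subst tensor_lift_eq[of "M \<boxtimes> N" P]) (use assms in \<open>simp_all add: *\<close>)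
qed

lemma flip_eq:
  assumes "module k M" "module k N" "u \<in> carrier (M \<boxtimes> N)"
  shows "flip k M N u = tlift k M N (N \<boxtimes> M) (\<lambda>x y. pure k N M y x) u"
  unfolding flip_def by (rule tensor_lift_eq) (use assms in auto)

lemma flip_lin: "module k M \<Longrightarrow> module k N \<Longrightarrow> flip k M N \<in> lin_map k (M \<boxtimes> N) (N \<boxtimes> M)"
  by (rule lin_cong[OF _ _ flip_eq[symmetric]]) (auto simp: bilin_def)

lemma flip_pure: "module k M \<Longrightarrow> module k N \<Longrightarrow> x \<in> carrier M \<Longrightarrow> y \<in> carrier N \<Longrightarrow>
    flip k M N (pure k M N x y) = pure k N M y x"
  by (subst flip_eq) (auto simp: bilin_def)

lemma flip_flip:
  assumes "module k M" "module k N" "u \<in> carrier (M \<boxtimes> N)"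
  shows "flip k N M (flip k M N u) = u"
  by (rule tensor_ext[of M N "M \<boxtimes> N" "\<lambda>u. flip k N M (flip k M N u)" "\<lambda>u. u"])
    (use assms in \<open>auto simp: flip_pure intro!: lin_comp[OF flip_lin flip_lin]\<close>)

lemma flip_bij: "module k M \<Longrightarrow> module k N \<Longrightarrow> bij_betw (flip k M N) (carrier (M \<boxtimes> N)) (carrier (N \<boxtimes> M))"
  by (rule bij_betwI[of _ _ _ "flip k N M"]) (auto simp: flip_flip intro!: lin_closed[OF flip_lin])

lemma mult_map_eq:
  assumes "k_algebra k A" "u \<in> carrier (A \<boxtimes> A)"
  shows "mult_map k A u = tlift k A A A (\<lambda>x y. x \<otimes>\<^bsub>A\<^esub> y) u"
  unfolding mult_map_def by (rule tensor_lift_eq) (use assms alg_simps[OF assms(1)] in auto)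

lemma left_unitor_eq:
  assumes "module k M" "u \<in> carrier (base_module k \<boxtimes> M)"
  shows "left_unitor k M u = tlift k (base_module k) M M (\<lambda>c x. c \<odot>\<^bsub>M\<^esub> x) u"
  unfolding left_unitor_def by (rule tensor_lift_eq) (use assms module.smult_closed[OF assms(1)] in auto)

lemma right_unitor_eq:
  assumes "module k M" "u \<in> carrier (M \<boxtimes> base_module k)"
  shows "right_unitor k M u = tlift k M (base_module k) M (\<lambda>x c. c \<odot>\<^bsub>M\<^esub> x) u"
  unfolding right_unitor_def by (rule tensor_lift_eq) (use assms module.smult_closed[OF assms(1)] in auto)

lemma smult_bilin: "module k M \<Longrightarrow> bilin k (base_module k) M M (\<lambda>c x. c \<odot>\<^bsub>M\<^esub> x)"
  by (auto simp: bilin_def intro: lin_smult_right lin_smult_left)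

lemma smult_bilin': "module k M \<Longrightarrow> bilin k M (base_module k) M (\<lambda>x c. c \<odot>\<^bsub>M\<^esub> x)"
  by (auto simp: bilin_def intro: lin_smult_right lin_smult_left)

lemma left_counit_eq:
  assumes "module k M" "module k C" "e \<in> lin_map k C (base_module k)" "u \<in> carrier (C \<boxtimes> M)"
  shows "left_unitor k M (tensor_map k (base_module k) M e id u) = tlift k C M M (\<lambda>c x. e c \<odot>\<^bsub>M\<^esub> x) u"
proof -
  note [simp] = assms lin_closed[OF assms(3), simplified]
  have "left_unitor k M (tensor_map k (base_module k) M e id u) =
     tlift k (base_module k) M M (\<lambda>c x. c \<odot>\<^bsub>M\<^esub> x) (tensor_map k (base_module k) M e id u)"
    by (rule left_unitor_eq) (auto intro!: lin_closed[OF tensor_map_lin[of C M]])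
  also have "\<dots> = tlift k (base_module k) M M (\<lambda>c x. c \<odot>\<^bsub>M\<^esub> x) (tlift k C M (base_module k \<boxtimes> M) (\<lambda>x y. pure k (base_module k) M (e x) y) u)"
    by (subst tensor_map_eq[of C M]) simp_all
  also have "\<dots> = tlift k C M M (\<lambda>x y. tlift k (base_module k) M M (\<lambda>c x. c \<odot>\<^bsub>M\<^esub> x) (pure k (base_module k) M (e x) y)) u"
    by (rule tlift_tlift) (simp_all add: smult_bilin)
  also have "\<dots> = tlift k C M M (\<lambda>c x. e c \<odot>\<^bsub>M\<^esub> x) u"
    by (rule tlift_cong) (simp_all add: smult_bilin)
  finally show ?thesis .
qed

lemma right_counit_eq:
  assumes "module k M" "module k C" "e \<in> lin_map k C (base_module k)" "u \<in> carrier (M \<boxtimes> C)"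
  shows "right_unitor k M (tensor_map k M (base_module k) id e u) = tlift k M C M (\<lambda>x c. e c \<odot>\<^bsub>M\<^esub> x) u"
proof -
  note [simp] = assms lin_closed[OF assms(3), simplified]
  have "right_unitor k M (tensor_map k M (base_module k) id e u) =
     tlift k M (base_module k) M (\<lambda>x c. c \<odot>\<^bsub>M\<^esub> x) (tensor_map k M (base_module k) id e u)"
    by (rule right_unitor_eq) (auto intro!: lin_closed[OF tensor_map_lin[of M C]])
  also have "\<dots> = tlift k M (base_module k) M (\<lambda>x c. c \<odot>\<^bsub>M\<^esub> x) (tlift k M C (M \<boxtimes> base_module k) (\<lambda>x y. pure k M (base_module k) x (e y)) u)"
    by (subst tensor_map_eq[of M C]) simp_all
  also have "\<dots> = tlift k M C M (\<lambda>x y. tlift k M (base_module k) M (\<lambda>x c. c \<odot>\<^bsub>M\<^esub> x) (pure k M (base_module k) x (e y))) u"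
    by (rule tlift_tlift) (simp_all add: smult_bilin')
  also have "\<dots> = tlift k M C M (\<lambda>x c. e c \<odot>\<^bsub>M\<^esub> x) u"
    by (rule tlift_cong) (simp_all add: smult_bilin')
  finally show ?thesis .
qed

lemma mult_map_tensor_map:
  assumes "k_algebra k A" "module k M" "module k N" "f \<in> lin_map k M A" "g \<in> lin_map k N A" "u \<in> carrier (M \<boxtimes> N)"
  shows "mult_map k A (tensor_map k A A f g u) = tlift k M N A (\<lambda>x y. f x \<otimes>\<^bsub>A\<^esub> g y) u"
proof -
  note [simp] = assms alg_simps[OF assms(1)] lin_closed[OF assms(4)] lin_closed[OF assms(5)]
  have "mult_map k A (tensor_map k A A f g u) = tlift k A A A (\<lambda>x y. x \<otimes>\<^bsub>A\<^esub> y) (tensor_map k A A f g u)"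
    by (rule mult_map_eq) (auto intro!: lin_closed[OF tensor_map_lin[of M N]])
  also have "\<dots> = tlift k A A A (\<lambda>x y. x \<otimes>\<^bsub>A\<^esub> y) (tlift k M N (A \<boxtimes> A) (\<lambda>x y. pure k A A (f x) (g y)) u)"
    by (subst tensor_map_eq[of M N]) simp_all
  also have "\<dots> = tlift k M N A (\<lambda>x y. tlift k A A A (\<lambda>x y. x \<otimes>\<^bsub>A\<^esub> y) (pure k A A (f x) (g y))) u"
    by (rule tlift_tlift) (simp_all add: bilin_def)
  also have "\<dots> = tlift k M N A (\<lambda>x y. f x \<otimes>\<^bsub>A\<^esub> g y) u"
    by (rule tlift_cong) (simp_all add: bilin_def)
  finally show ?thesis .
qed

lemma flip_tensor_map:
  assumes "module k M" "module k N" "module k M'" "module k N'" "f \<in> lin_map k M M'" "g \<in> lin_map k N N'" "u \<in> carrier (M \<boxtimes> N)"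
  shows "flip k M' N' (tensor_map k M' N' f g u) = tlift k M N (N' \<boxtimes> M') (\<lambda>x y. pure k N' M' (g y) (f x)) u"
proof -
  note [simp] = assms lin_closed[OF assms(5)] lin_closed[OF assms(6)]
  show ?thesis
    by (subst tensor_map_eq[of M N], simp_all, subst tlift_push[OF _ _ _ _ flip_lin], simp_all add: flip_pure)
qed

lemma coassoc_left_eq:
  assumes m: "module k A" "module k M1" "module k M2" "module k M3"
    and D1: "D1 \<in> lin_map k A (M1 \<boxtimes> M2)" and u: "u \<in> carrier (A \<boxtimes> M3)"
  shows "tensor_assoc k M1 M2 M3 (tensor_map k (M1 \<boxtimes> M2) M3 D1 id u) =
    tlift k A M3 (M1 \<boxtimes> (M2 \<boxtimes> M3)) (\<lambda>a z. tlift k M1 M2 (M1 \<boxtimes> (M2 \<boxtimes> M3)) (\<lambda>x y. pure k M1 (M2 \<boxtimes> M3) x (pure k M2 M3 y z)) (D1 a)) u"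
proof -
  note [simp] = m u D1 lin_closed[OF D1]
  let ?P = "M1 \<boxtimes> (M2 \<boxtimes> M3)"
  let ?f = "\<lambda>v z. tlift k M1 M2 ?P (\<lambda>x y. pure k M1 (M2 \<boxtimes> M3) x (pure k M2 M3 y z)) v"
  have f: "bilin k (M1 \<boxtimes> M2) M3 ?P ?f" by (auto simp: bilin_def)
  have "tensor_assoc k M1 M2 M3 (tensor_map k (M1 \<boxtimes> M2) M3 D1 id u) =
     tlift k (M1 \<boxtimes> M2) M3 ?P ?f (tensor_map k (M1 \<boxtimes> M2) M3 D1 id u)"
    by (rule tensor_assoc_eq) (auto intro!: lin_closed[OF tensor_map_lin[of A M3]])
  also have "\<dots> = tlift k (M1 \<boxtimes> M2) M3 ?P ?f (tlift k A M3 ((M1 \<boxtimes> M2) \<boxtimes> M3) (\<lambda>a z. pure k (M1 \<boxtimes> M2) M3 (D1 a) z) u)"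
    by (subst tensor_map_eq[of A M3]) simp_all
  also have "\<dots> = tlift k A M3 ?P (\<lambda>a z. tlift k (M1 \<boxtimes> M2) M3 ?P ?f (pure k (M1 \<boxtimes> M2) M3 (D1 a) z)) u"
    by (rule tlift_tlift) (simp_all add: f)
  also have "\<dots> = tlift k A M3 ?P (\<lambda>a z. ?f (D1 a) z) u"
    by (rule tlift_cong) (simp_all add: f)
  finally show ?thesis .
qed

lemma coassoc_right_eq:
  assumes m: "module k C" "module k M1" "module k M2" "module k M3"
    and D2: "D2 \<in> lin_map k C (M2 \<boxtimes> M3)" and u: "u \<in> carrier (M1 \<boxtimes> C)"
  shows "tensor_map k M1 (M2 \<boxtimes> M3) id D2 u =
    tlift k M1 C (M1 \<boxtimes> (M2 \<boxtimes> M3)) (\<lambda>x c. tlift k M2 M3 (M1 \<boxtimes> (M2 \<boxtimes> M3)) (\<lambda>y z. pure k M1 (M2 \<boxtimes> M3) x (pure k M2 M3 y z)) (D2 c)) u"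
proof -
  note [simp] = m u D2 lin_closed[OF D2]
  have "tensor_map k M1 (M2 \<boxtimes> M3) id D2 u = tlift k M1 C (M1 \<boxtimes> (M2 \<boxtimes> M3)) (\<lambda>x c. pure k M1 (M2 \<boxtimes> M3) x (D2 c)) u"
    by (subst tensor_map_eq[of M1 C]) simp_all
  also have "\<dots> = tlift k M1 C (M1 \<boxtimes> (M2 \<boxtimes> M3)) (\<lambda>x c. tlift k M2 M3 (M1 \<boxtimes> (M2 \<boxtimes> M3)) (\<lambda>y z. pure k M1 (M2 \<boxtimes> M3) x (pure k M2 M3 y z)) (D2 c)) u"
  proof (rule tlift_cong[OF refl])
    fix x c assume xc: "x \<in> carrier M1" "c \<in> carrier C"
    have "pure k M1 (M2 \<boxtimes> M3) x (tlift k M2 M3 (M2 \<boxtimes> M3) (\<lambda>y z. pure k M2 M3 y z) (D2 c)) =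
       tlift k M2 M3 (M1 \<boxtimes> (M2 \<boxtimes> M3)) (\<lambda>y z. pure k M1 (M2 \<boxtimes> M3) x (pure k M2 M3 y z)) (D2 c)"
      by (rule tlift_push[where h="pure k M1 (M2 \<boxtimes> M3) x"]) (use xc in simp_all)
    then show "pure k M1 (M2 \<boxtimes> M3) x (D2 c) = tlift k M2 M3 (M1 \<boxtimes> (M2 \<boxtimes> M3)) (\<lambda>y z. pure k M1 (M2 \<boxtimes> M3) x (pure k M2 M3 y z)) (D2 c)"
      using xc by (simp add: tlift_eta)
  qed
  finally show ?thesis .
qed

text \<open>
  The law as a rewriting rule for Sweedler sums, applicable under any trilinear expression.
\<close>

lemma coassocD:
  assumes co: "coassoc k X M1 M2 M3 D D1 D' D2"
    and m: "module k A" "module k C" "module k M1" "module k M2" "module k M3" "module k P"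
    and D: "D \<in> lin_map k X (A \<boxtimes> M3)" "D1 \<in> lin_map k A (M1 \<boxtimes> M2)" "D' \<in> lin_map k X (M1 \<boxtimes> C)" "D2 \<in> lin_map k C (M2 \<boxtimes> M3)"
    and x: "x \<in> carrier X"
    and f: "\<And>b c. b \<in> carrier M2 \<Longrightarrow> c \<in> carrier M3 \<Longrightarrow> (\<lambda>a. f a b c) \<in> lin_map k M1 P"
      "\<And>a c. a \<in> carrier M1 \<Longrightarrow> c \<in> carrier M3 \<Longrightarrow> (\<lambda>b. f a b c) \<in> lin_map k M2 P"
      "\<And>a b. a \<in> carrier M1 \<Longrightarrow> b \<in> carrier M2 \<Longrightarrow> (\<lambda>c. f a b c) \<in> lin_map k M3 P"
  shows "tlift k A M3 P (\<lambda>a z. tlift k M1 M2 P (\<lambda>x y. f x y z) (D1 a)) (D x) =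
    tlift k M1 C P (\<lambda>x c. tlift k M2 M3 P (\<lambda>y z. f x y z) (D2 c)) (D' x)"
proof -
  note [simp] = m D lin_closed[OF D(1)] lin_closed[OF D(2)] lin_closed[OF D(3)] lin_closed[OF D(4)] x f lin_closed[OF f(1)]
  let ?P = "M1 \<boxtimes> (M2 \<boxtimes> M3)"
  let ?h = "tlift k M1 (M2 \<boxtimes> M3) P (\<lambda>x w. tlift k M2 M3 P (\<lambda>y z. f x y z) w)"
  have b: "bilin k M1 (M2 \<boxtimes> M3) P (\<lambda>x w. tlift k M2 M3 P (\<lambda>y z. f x y z) w)"
    by (auto simp: bilin_def)
  have h: "?h \<in> lin_map k ?P P" by (rule tlift_lin) (simp_all add: b)
  have hp: "?h (pure k M1 (M2 \<boxtimes> M3) a (pure k M2 M3 b c)) = f a b c" if "a \<in> carrier M1" "b \<in> carrier M2" "c \<in> carrier M3" for a b c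
    by (subst tlift_pure) (use that b in \<open>auto simp: bilin_def\<close>)
  have "tlift k A M3 ?P (\<lambda>a z. tlift k M1 M2 ?P (\<lambda>x y. pure k M1 (M2 \<boxtimes> M3) x (pure k M2 M3 y z)) (D1 a)) (D x) =
    tlift k M1 C ?P (\<lambda>x c. tlift k M2 M3 ?P (\<lambda>y z. pure k M1 (M2 \<boxtimes> M3) x (pure k M2 M3 y z)) (D2 c)) (D' x)"
    using co x unfolding coassoc_def by (simp add: coassoc_left_eq[of A] coassoc_right_eq[of C])
  then have "?h (tlift k A M3 ?P (\<lambda>a z. tlift k M1 M2 ?P (\<lambda>x y. pure k M1 (M2 \<boxtimes> M3) x (pure k M2 M3 y z)) (D1 a)) (D x)) =
    ?h (tlift k M1 C ?P (\<lambda>x c. tlift k M2 M3 ?P (\<lambda>y z. pure k M1 (M2 \<boxtimes> M3) x (pure k M2 M3 y z)) (D2 c)) (D' x))"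
    by (rule arg_cong)
  moreover have "?h (tlift k A M3 ?P (\<lambda>a z. tlift k M1 M2 ?P (\<lambda>x y. pure k M1 (M2 \<boxtimes> M3) x (pure k M2 M3 y z)) (D1 a)) (D x))
    = tlift k A M3 P (\<lambda>a z. tlift k M1 M2 P (\<lambda>x y. f x y z) (D1 a)) (D x)"
    by (subst tlift_push[OF _ _ _ _ h], simp_all, rule tlift_cong[OF refl], subst tlift_push[OF _ _ _ _ h], simp_all add: hp)
  moreover have "?h (tlift k M1 C ?P (\<lambda>x c. tlift k M2 M3 ?P (\<lambda>y z. pure k M1 (M2 \<boxtimes> M3) x (pure k M2 M3 y z)) (D2 c)) (D' x))
    = tlift k M1 C P (\<lambda>x c. tlift k M2 M3 P (\<lambda>y z. f x y z) (D2 c)) (D' x)"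
    by (subst tlift_push[OF _ _ _ _ h], simp_all, rule tlift_cong[OF refl], subst tlift_push[OF _ _ _ _ h], simp_all add: hp)
  ultimately show ?thesis by simp
qed

lemma coassocI:
  assumes m: "module k A" "module k C" "module k M1" "module k M2" "module k M3"
    and D: "D \<in> lin_map k X (A \<boxtimes> M3)" "D1 \<in> lin_map k A (M1 \<boxtimes> M2)" "D' \<in> lin_map k X (M1 \<boxtimes> C)" "D2 \<in> lin_map k C (M2 \<boxtimes> M3)"
    and eq: "\<And>x. x \<in> carrier X \<Longrightarrow>
      tlift k A M3 (M1 \<boxtimes> (M2 \<boxtimes> M3)) (\<lambda>a z. tlift k M1 M2 (M1 \<boxtimes> (M2 \<boxtimes> M3)) (\<lambda>x y. pure k M1 (M2 \<boxtimes> M3) x (pure k M2 M3 y z)) (D1 a)) (D x) =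
    tlift k M1 C (M1 \<boxtimes> (M2 \<boxtimes> M3)) (\<lambda>x c. tlift k M2 M3 (M1 \<boxtimes> (M2 \<boxtimes> M3)) (\<lambda>y z. pure k M1 (M2 \<boxtimes> M3) x (pure k M2 M3 y z)) (D2 c)) (D' x)"
  shows "coassoc k X M1 M2 M3 D D1 D' D2"
  unfolding coassoc_def
  using eq by (simp add: m D lin_closed[OF D(1)] lin_closed[OF D(3)] coassoc_left_eq[of A] coassoc_right_eq[of C])

lemma opp_sel [simp]: "carrier (opp A) = carrier A" "add (opp A) = add A" "zero (opp A) = zero A"
  "one (opp A) = one A" "smult (opp A) = smult A" "x \<otimes>\<^bsub>opp A\<^esub> y = y \<otimes>\<^bsub>A\<^esub> x"
  by (auto simp: opp_def)

lemma opp_module: assumes "module k A" shows "module k (opp A)"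
proof -
  interpret A: module k A by fact
  have "abelian_group (opp A)"
    by (rule abelian_groupI) (auto simp: A.a_ac intro: A.l_neg exI bexI[of _ "\<ominus>\<^bsub>A\<^esub> _"])
  then show ?thesis
    by (rule moduleI[OF R.is_cring]) (auto simp: A.smult_l_distr A.smult_r_distr A.smult_assoc1)
qed

lemma opp_algebra: assumes "k_algebra k A" shows "k_algebra k (opp A)"
proof -
  interpret A: k_algebra k A by fact
  have m: "module k (opp A)" by (rule opp_module) (rule A.module_axioms)
  then have "ring (opp A)"
    by (intro ringI monoidI) (auto simp: A.m_assoc A.l_distr A.r_distr module_def)
  then show ?thesis
    by (intro k_algebra.intro m k_algebra_axioms.intro) (auto simp: A.smult_mult_left A.smult_mult_right)
qed

lemma tensor_free_opp: "tensor_free k M (opp N) = tensor_free k M N"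
  by (simp add: tensor_free_def)

lemma tensor_rel_opp: "tensor_rel k M (opp N) = tensor_rel k M N"
  by (simp add: tensor_rel_def tensor_rel_gens_def tensor_free_opp Let_def)

lemma tensor_coset_opp: "tensor_coset k M (opp N) = tensor_coset k M N"
  by (simp add: tensor_coset_def tensor_rel_opp tensor_free_opp fun_eq_iff)

lemma pure_opp [simp]: "pure k M (opp N) = pure k M N"
  by (simp add: pure_def tensor_coset_opp fun_eq_iff)

text \<open>
  Passing to the opposite algebra does not touch the module structure, so \<open>X \<otimes> T\<^sup>o\<^sup>p\<close> and \<open>X \<otimes> T\<close> are equal
  as modules and differ in the product only.
\<close>

lemma tensor_module_opp: "tensor_module k M (opp N) = tensor_module k M N"
  by (simp add: tensor_module_def tensor_rel_opp tensor_coset_opp tensor_free_opp Let_def)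

lemma tensor_opp_sel [simp]: "carrier (M \<boxtimes> opp N) = carrier (M \<boxtimes> N)" "add (M \<boxtimes> opp N) = add (M \<boxtimes> N)"
  "zero (M \<boxtimes> opp N) = zero (M \<boxtimes> N)" "one (M \<boxtimes> opp N) = one (M \<boxtimes> N)" "smult (M \<boxtimes> opp N) = smult (M \<boxtimes> N)"
  by (auto simp: tensor_def tensor_module_opp)

end

section \<open>Faithfully flat modules\<close>


lemma exact_iso:
  assumes f: "f \<in> lin_map k L M" and g: "g \<in> lin_map k M N"
    and m: "module k N" "module k N'"
    and a: "bij_betw a (carrier L) (carrier L')"
    and b: "bij_betw b (carrier M) (carrier M')"
    and c: "c \<in> lin_map k N N'" "bij_betw c (carrier N) (carrier N')"
    and s1: "\<And>x. x \<in> carrier L \<Longrightarrow> b (f x) = f' (a x)"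
    and s2: "\<And>y. y \<in> carrier M \<Longrightarrow> c (g y) = g' (b y)"
  shows "exact_at L M N f g \<longleftrightarrow> exact_at L' M' N' f' g'"
proof -
  interpret N: module k N by fact
  have 1: "f' ` carrier L' = b ` (f ` carrier L)"
  proof -
    have "carrier L' = a ` carrier L" using a by (simp add: bij_betw_def)
    then have "f' ` carrier L' = (\<lambda>x. f' (a x)) ` carrier L" by (simp add: image_image)
    also have "\<dots> = (\<lambda>x. b (f x)) ` carrier L" by (rule image_cong) (simp_all add: s1)
    finally show ?thesis by (simp add: image_image)
  qed
  have c0: "c z = \<zero>\<^bsub>N'\<^esub> \<longleftrightarrow> z = \<zero>\<^bsub>N\<^esub>" if "z \<in> carrier N" for z
    using inj_on_eq_iff[OF bij_betw_imp_inj_on[OF c(2)] that N.zero_closed] lin_zero[OF m c(1)] by simp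
  have 2: "a_kernel M' N' g' = b ` a_kernel M N g"
  proof -
    have M': "carrier M' = b ` carrier M" using b by (simp add: bij_betw_def)
    have "a_kernel M' N' g' = b ` {x \<in> carrier M. g' (b x) = \<zero>\<^bsub>N'\<^esub>}"
      unfolding a_kernel_def' M' by blast
    also have "{x \<in> carrier M. g' (b x) = \<zero>\<^bsub>N'\<^esub>} = a_kernel M N g"
      unfolding a_kernel_def' by (rule Collect_cong) (metis s2 c0 lin_closed[OF g])
    finally show ?thesis .
  qed
  have "inj_on b (carrier M)" using b by (simp add: bij_betw_def)
  then have "b ` (f ` carrier L) = b ` a_kernel M N g \<longleftrightarrow> f ` carrier L = a_kernel M N g"
    by (rule inj_on_image_eq_iff) (use lin_closed[OF f] in \<open>auto simp: a_kernel_def'\<close>)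
  then show ?thesis by (simp add: exact_at_def 1 2)
qed

text \<open>
  Faithful flatness can be applied to modules whose carriers inject into the type of test modules.
\<close>

definition small :: "'u itself \<Rightarrow> 'm set \<Rightarrow> bool"
  where "small U S \<longleftrightarrow> (\<exists>i :: 'm \<Rightarrow> 'u. inj_on i S)"

text \<open>
  The structure of \<open>M\<close> carried along an injection into the type of test modules.
\<close>

definition transport :: "('m \<Rightarrow> 'u) \<Rightarrow> ('k, 'm, 'x) module_scheme \<Rightarrow> ('k, 'u) module"
  where "transport i M = (let j = inv_into (carrier M) i in
    \<lparr>carrier = i ` carrier M, mult = undefined, one = undefined, zero = i \<zero>\<^bsub>M\<^esub>,
     add = (\<lambda>x y. i (j x \<oplus>\<^bsub>M\<^esub> j y)), smult = (\<lambda>c x. i (c \<odot>\<^bsub>M\<^esub> j x))\<rparr>)"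

lemma small_subset: "small U S \<Longrightarrow> S' \<subseteq> S \<Longrightarrow> small U S'"
  unfolding small_def using inj_on_subset by blast

text \<open>
  There are no more finite lists over an infinite type than elements: lists of a fixed length
  are dealt with by \<open>|U \<times> U| = |U|\<close>, and there are only countably many lengths.
\<close>

lemma infinite_lists_inj:
  includes cardinal_syntax
  assumes "infinite (UNIV :: 'u set)"
  shows "\<exists>e :: 'u list \<Rightarrow> 'u. inj e"
proof -
  let ?U = "UNIV :: 'u set"
  have len: "|{l :: 'u list. length l = n}| \<le>o |?U|" for n
  proof (induct n)
    case 0
    show ?case by (rule card_of_ordLeqI[of "\<lambda>_. undefined"]) (auto simp: inj_on_def)
  next
    case (Suc n)
    have "|{l :: 'u list. length l = Suc n}| \<le>o |?U \<times> {l :: 'u list. length l = n}|"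
    proof (rule card_of_ordLeqI)
      show "inj_on (\<lambda>l. (hd l, tl l)) {l :: 'u list. length l = Suc n}"
      proof (rule inj_onI)
        fix l l' :: "'u list"
        assume "l \<in> {l. length l = Suc n}" "l' \<in> {l. length l = Suc n}" "(hd l, tl l) = (hd l', tl l')"
        then show "l = l'" by (cases l; cases l') simp_all
      qed
    qed simp
    also have "|?U \<times> {l :: 'u list. length l = n}| \<le>o |?U|"
      by (rule card_of_Sigma_ordLeq_infinite[OF assms]) (use Suc card_of_mono1 in auto)
    finally show ?case .
  qed
  have "|UNIV :: 'u list set| \<le>o |SIGMA n : (UNIV :: nat set). {l :: 'u list. length l = n}|"
    by (rule card_of_ordLeqI[of "\<lambda>l. (length l, l)"]) (auto simp: inj_on_def)
  also have "|SIGMA n : (UNIV :: nat set). {l :: 'u list. length l = n}| \<le>o |?U|"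
    by (rule card_of_Sigma_ordLeq_infinite[OF assms]) (use len assms infinite_iff_card_of_nat in auto)
  finally show ?thesis using card_of_ordLeq[of "UNIV :: 'u list set" ?U] by auto
qed

context base_ring begin

lemma transport:
  assumes "module k M" "inj_on i (carrier M)"
  shows "module k (transport i M)" "i \<in> lin_map k M (transport i M)"
    "bij_betw i (carrier M) (carrier (transport i M))"
proof -
  interpret M: module k M by fact
  let ?j = "inv_into (carrier M) i"
  have j [simp]: "?j (i x) = x" if "x \<in> carrier M" for x using that assms(2) by simp
  have sel: "carrier (transport i M) = i ` carrier M" "zero (transport i M) = i \<zero>\<^bsub>M\<^esub>"
    "add (transport i M) = (\<lambda>x y. i (?j x \<oplus>\<^bsub>M\<^esub> ?j y))" "smult (transport i M) = (\<lambda>c x. i (c \<odot>\<^bsub>M\<^esub> ?j x))"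
    by (auto simp: transport_def Let_def)
  have g: "abelian_group (transport i M)"
  proof (rule abelian_groupI)
    fix x assume "x \<in> carrier (transport i M)"
    then obtain y where y: "x = i y" "y \<in> carrier M" by (auto simp: sel)
    then show "\<exists>z\<in>carrier (transport i M). z \<oplus>\<^bsub>transport i M\<^esub> x = \<zero>\<^bsub>transport i M\<^esub>"
      by (intro bexI[of _ "i (\<ominus>\<^bsub>M\<^esub> y)"]) (auto simp: sel M.l_neg)
  qed (auto simp: sel M.a_ac)
  show "module k (transport i M)"
    by (rule moduleI[OF R.is_cring g]) (auto simp: sel M.smult_l_distr M.smult_r_distr M.smult_assoc1)
  show "i \<in> lin_map k M (transport i M)"
    by (rule lin_mapI) (auto simp: sel)
  show "bij_betw i (carrier M) (carrier (transport i M))"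
    using assms(2) by (auto simp: bij_betw_def sel)
qed

lemma tensor_map_bij:
  assumes m: "module k M" "module k N" "module k M'" "module k N'" and f: "f \<in> lin_map k M M'" "bij_betw f (carrier M) (carrier M')"
    and g: "g \<in> lin_map k N N'" "bij_betw g (carrier N) (carrier N')"
  shows "bij_betw (tensor_map k M' N' f g) (carrier (M \<boxtimes> N)) (carrier (M' \<boxtimes> N'))"
proof (rule bij_betwI[of _ _ _ "tensor_map k M N (inv_into (carrier M) f) (inv_into (carrier N) g)"])
  let ?f = "inv_into (carrier M) f" and ?g = "inv_into (carrier N) g"
  note i = lin_inv_into[OF m(1,3) f] lin_inv_into[OF m(2,4) g]
  have l1: "tensor_map k M' N' f g \<in> lin_map k (M \<boxtimes> N) (M' \<boxtimes> N')" by (rule tensor_map_lin) fact+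
  have l2: "tensor_map k M N ?f ?g \<in> lin_map k (M' \<boxtimes> N') (M \<boxtimes> N)" by (rule tensor_map_lin) (fact | rule i)+
  have fi: "?f (f x) = x" if "x \<in> carrier M" for x using that f(2) by (auto simp: bij_betw_def)
  have gi: "?g (g x) = x" if "x \<in> carrier N" for x using that g(2) by (auto simp: bij_betw_def)
  have fi': "f (?f x) = x" if "x \<in> carrier M'" for x using that f(2) by (auto simp: bij_betw_def f_inv_into_f)
  have gi': "g (?g x) = x" if "x \<in> carrier N'" for x using that g(2) by (auto simp: bij_betw_def f_inv_into_f)
  show "tensor_map k M' N' f g \<in> carrier (M \<boxtimes> N) \<rightarrow> carrier (M' \<boxtimes> N')" using lin_closed[OF l1] by auto
  show "tensor_map k M N ?f ?g \<in> carrier (M' \<boxtimes> N') \<rightarrow> carrier (M \<boxtimes> N)" using lin_closed[OF l2] by auto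
  show "tensor_map k M N ?f ?g (tensor_map k M' N' f g u) = u" if "u \<in> carrier (M \<boxtimes> N)" for u
    by (rule tensor_ext[OF m(1,2) _ lin_comp[OF l2 l1], of "\<lambda>x. x"])
      (use that m f(1) g(1) i lin_closed[OF f(1)] lin_closed[OF g(1)] fi gi in \<open>auto simp: tensor_map_pure[of M N M' N'] tensor_map_pure[of M' N' M N]\<close>)
  show "tensor_map k M' N' f g (tensor_map k M N ?f ?g u) = u" if "u \<in> carrier (M' \<boxtimes> N')" for u
    by (rule tensor_ext[OF m(3,4) _ lin_comp[OF l1 l2], of "\<lambda>x. x"])
      (use that m f(1) g(1) i lin_closed[OF i(1)] lin_closed[OF i(2)] fi' gi' in \<open>auto simp: tensor_map_pure[of M N M' N'] tensor_map_pure[of M' N' M N]\<close>)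
qed

lemma tensor_map_square:
  assumes "module k T" "module k L" "module k M" "module k L'" "module k M'"
    and "f \<in> lin_map k L M" "b \<in> lin_map k M M'" "a \<in> lin_map k L L'" "f' \<in> lin_map k L' M'"
    and "\<And>x. x \<in> carrier L \<Longrightarrow> b (f x) = f' (a x)" "u \<in> carrier (T \<boxtimes> L)"
  shows "tensor_map k T M' id b (tensor_map k T M id f u) = tensor_map k T M' id f' (tensor_map k T L' id a u)"
  by (rule tensor_ext[of T L "T \<boxtimes> M'", OF _ _ _ lin_comp lin_comp])
    (use assms lin_closed[OF assms(6)] lin_closed[OF assms(8)] in
      \<open>auto simp: tensor_map_pure[of T L T M] tensor_map_pure[of T M T M'] tensor_map_pure[of T L T L'] tensor_map_pure[of T L' T M']
       intro!: tensor_map_lin\<close>)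

text \<open>
  Every tensor is a finite sum of pure tensors, so there are at most as many tensors as
  lists of pairs.
\<close>

lemma small_tensor:
  assumes inf: "infinite (UNIV :: 'u set)" and m: "module k M" "module k N"
    and s: "small (U :: 'u itself) (carrier M)" "small U (carrier N)"
  shows "small U (carrier (M \<boxtimes> N))"
proof -
  interpret P: module k "M \<boxtimes> N" using m by simp
  let ?A = "carrier M \<times> carrier N"
  define S where "S l = foldr (\<lambda>p u. pure k M N (fst p) (snd p) \<oplus>\<^bsub>M \<boxtimes> N\<^esub> u) l \<zero>\<^bsub>M \<boxtimes> N\<^esub>" for l
  have Sc: "S l \<in> carrier (M \<boxtimes> N)" if "l \<in> lists ?A" for l
    using that unfolding S_def by (induct l) (auto simp: m)
  have Sa: "S (l @ l') = S l \<oplus>\<^bsub>M \<boxtimes> N\<^esub> S l'" if "l \<in> lists ?A" "l' \<in> lists ?A" for l l'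
    using that(1)
  proof (induct l)
    case Nil show ?case using Sc[OF that(2)] by (simp add: S_def)
  next
    case (Cons p l)
    then have "pure k M N (fst p) (snd p) \<in> carrier (M \<boxtimes> N)" by (auto simp: m)
    then show ?case using Cons Sc[OF that(2)] Sc[of l] by (simp add: S_def P.a_assoc)
  qed
  have surj: "\<exists>l\<in>lists ?A. S l = u" if "u \<in> carrier (M \<boxtimes> N)" for u
    using m that
  proof (induct rule: tensor_induct)
    case zero show ?case by (rule bexI[of _ "[]"]) (auto simp: S_def)
  next
    case (pure x y) then show ?case by (intro bexI[of _ "[(x, y)]"]) (auto simp: S_def m)
  next
    case (add u v) then show ?case using Sa by (metis append_in_lists_conv)
  qed
  obtain e :: "'u list \<Rightarrow> 'u" where e: "inj e" using infinite_lists_inj[OF inf] by blast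
  obtain i :: "_ \<Rightarrow> 'u" where i: "inj_on i (carrier M)" using s by (auto simp: small_def)
  obtain j :: "_ \<Rightarrow> 'u" where j: "inj_on j (carrier N)" using s by (auto simp: small_def)
  let ?c = "\<lambda>p. e [i (fst p), j (snd p)]"
  have c: "inj_on ?c ?A" using i j by (auto simp: inj_on_def inj_eq[OF e])
  define r where "r u = (SOME l. l \<in> lists ?A \<and> S l = u)" for u
  have r: "r u \<in> lists ?A" "S (r u) = u" if "u \<in> carrier (M \<boxtimes> N)" for u
    using someI_ex[of "\<lambda>l. l \<in> lists ?A \<and> S l = u"] surj[OF that] by (auto simp: r_def)
  have "inj_on (\<lambda>u. e (map ?c (r u))) (carrier (M \<boxtimes> N))"
  proof (rule inj_onI)
    fix u v assume u: "u \<in> carrier (M \<boxtimes> N)" and v: "v \<in> carrier (M \<boxtimes> N)" and uv: "e (map ?c (r u)) = e (map ?c (r v))"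
    have "map ?c (r u) = map ?c (r v)" by (rule injD[OF e uv])
    from inj_onD[OF inj_on_map_lists[OF c] this r(1)[OF u] r(1)[OF v]]
    have "r u = r v" .
    then have "S (r u) = S (r v)" by (rule arg_cong)
    then show "u = v" unfolding r(2)[OF u] r(2)[OF v] .
  qed
  then show ?thesis by (auto simp: small_def)
qed

end

locale ff_module = base_ring k + T: module k T
  for k :: "('k, 'r) ring_scheme" (structure) and T :: "('k, 't, 'y) module_scheme" and U :: "'u itself" +
  assumes ff: "faithfully_flat U k T" and inf: "infinite (UNIV :: 'u set)"
begin

lemma T_module [simp]: "module k T" by (rule T.module_axioms)

lemma small_tensor' [simp]: "module k M \<Longrightarrow> module k N \<Longrightarrow> small U (carrier M) \<Longrightarrow> small U (carrier N) \<Longrightarrow> small U (carrier (M \<boxtimes> N))"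
  by (rule small_tensor[OF inf])

lemma ff_exact_left:
  assumes m: "module k L" "module k M" "module k N"
    and s: "small U (carrier L)" "small U (carrier M)" "small U (carrier N)"
    and f: "f \<in> lin_map k L M" and g: "g \<in> lin_map k M N"
  shows "exact_at L M N f g \<longleftrightarrow> exact_at (T \<boxtimes> L) (T \<boxtimes> M) (T \<boxtimes> N) (tensor_map k T M id f) (tensor_map k T N id g)"
proof -
  obtain a :: "_ \<Rightarrow> 'u" where a: "inj_on a (carrier L)" using s by (auto simp: small_def)
  obtain b :: "_ \<Rightarrow> 'u" where b: "inj_on b (carrier M)" using s by (auto simp: small_def)
  obtain c :: "_ \<Rightarrow> 'u" where c: "inj_on c (carrier N)" using s by (auto simp: small_def)
  note A = transport[OF m(1) a] and B = transport[OF m(2) b] and C = transport[OF m(3) c]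
  let ?L = "transport a L" and ?M = "transport b M" and ?N = "transport c N"
  let ?f = "\<lambda>x. b (f (inv_into (carrier L) a x))" and ?g = "\<lambda>x. c (g (inv_into (carrier M) b x))"
  have f': "?f \<in> lin_map k ?L ?M"
    by (intro lin_comp[OF B(2)] lin_comp[OF f] lin_inv_into m A)
  have g': "?g \<in> lin_map k ?M ?N"
    by (intro lin_comp[OF C(2)] lin_comp[OF g] lin_inv_into m B)
  have s1: "b (f x) = ?f (a x)" if "x \<in> carrier L" for x using that a by simp
  have s2: "c (g x) = ?g (b x)" if "x \<in> carrier M" for x using that b by simp
  have T: "bij_betw id (carrier T) (carrier T)" by simp
  have "exact_at L M N f g \<longleftrightarrow> exact_at ?L ?M ?N ?f ?g"
    by (rule exact_iso[OF f g m(3) C(1) A(3) B(3) C(2,3) s1 s2])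
  also have "\<dots> \<longleftrightarrow> exact_at (T \<boxtimes> ?L) (T \<boxtimes> ?M) (T \<boxtimes> ?N) (tensor_map k T ?M id ?f) (tensor_map k T ?N id ?g)"
    using ff f' g' A(1) B(1) C(1) unfolding faithfully_flat_def by blast
  also have "\<dots> \<longleftrightarrow> exact_at (T \<boxtimes> L) (T \<boxtimes> M) (T \<boxtimes> N) (tensor_map k T M id f) (tensor_map k T N id g)"
  proof (rule exact_iso[symmetric, of _ k, where a="tensor_map k T ?L id a" and b="tensor_map k T ?M id b" and c="tensor_map k T ?N id c"])
    show "tensor_map k T ?M id b (tensor_map k T M id f x) = tensor_map k T ?M id ?f (tensor_map k T ?L id a x)" if "x \<in> carrier (T \<boxtimes> L)" for x
      by (rule tensor_map_square) (use that m A B f f' s1 in auto)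
    show "tensor_map k T ?N id c (tensor_map k T N id g x) = tensor_map k T ?N id ?g (tensor_map k T ?M id b x)" if "x \<in> carrier (T \<boxtimes> M)" for x
      by (rule tensor_map_square) (use that m B C g g' s2 in auto)
  qed (use m A B C f g in \<open>auto intro!: tensor_map_lin tensor_map_bij\<close>)
  finally show ?thesis .
qed

text \<open>
  The definition of faithful flatness has \<open>T\<close> on the left; here \<open>T\<close> is a right factor,
  where it stays in all later constructions.
\<close>

lemma ff_exact:
  assumes m: "module k L" "module k M" "module k N"
    and s: "small U (carrier L)" "small U (carrier M)" "small U (carrier N)"
    and f: "f \<in> lin_map k L M" and g: "g \<in> lin_map k M N"
  shows "exact_at L M N f g \<longleftrightarrow> exact_at (L \<boxtimes> T) (M \<boxtimes> T) (N \<boxtimes> T) (tensor_map k M T f id) (tensor_map k N T g id)"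
proof -
  have sq: "flip k T M (tensor_map k T M id f x) = tensor_map k M T f id (flip k T L x)"
    if "f \<in> lin_map k L M" "module k L" "module k M" "x \<in> carrier (T \<boxtimes> L)"
    for f and L :: "('k, 'l1, 'l2) module_scheme" and M :: "('k, 'm1, 'm2) module_scheme" and x
    by (rule tensor_ext[of T L "M \<boxtimes> T", OF _ _ _ lin_comp lin_comp])
      (use that lin_closed[OF that(1)] in \<open>auto simp: tensor_map_pure[of T L T M] tensor_map_pure[of L T M T] flip_pure
       intro!: tensor_map_lin flip_lin\<close>)
  show ?thesis unfolding ff_exact_left[OF assms]
    by (rule exact_iso[of _ k, where a="flip k T L" and b="flip k T M" and c="flip k T N"])
      (simp_all add: m f g tensor_map_lin flip_bij flip_lin sq)
qed

text \<open>
  Injectivity of \<open>f\<close> is exactness of \<open>0 \<rightarrow> L \<rightarrow> M\<close>.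
\<close>

lemma ff_inj:
  assumes m: "module k L" "module k M"
    and s: "small U (carrier L)" "small U (carrier M)"
    and f: "f \<in> lin_map k L M"
  shows "inj_on f (carrier L) \<longleftrightarrow> inj_on (tensor_map k M T f id) (carrier (L \<boxtimes> T))"
proof -
  interpret L: module k L by fact
  let ?O = "L\<lparr>carrier := {\<zero>\<^bsub>L\<^esub>}\<rparr>"
  have "submodule {\<zero>\<^bsub>L\<^esub>} k L" by (rule L.submoduleI) auto
  then have O: "module k ?O" by (rule submodule.submodule_is_module) (rule m)
  have z: "(\<lambda>x. \<zero>\<^bsub>L\<^esub>) \<in> lin_map k ?O L" using m by (rule_tac lin_zero_map)
  have ker: "exact_at Q L M (\<lambda>x. \<zero>\<^bsub>L\<^esub>) f \<longleftrightarrow> inj_on f (carrier L)"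
    if "module k Q" "module k L" "module k M" "f \<in> lin_map k L M"
    for Q :: "('k, 'o1, 'o2) module_scheme" and L :: "('k, 'l1, 'l2) module_scheme" and M :: "('k, 'm1, 'm2) module_scheme" and f
  proof -
    interpret Q: module k Q by fact
    interpret L: module k L by fact
    interpret M: module k M by fact
    have "(\<lambda>x. \<zero>\<^bsub>L\<^esub>) ` carrier Q = {\<zero>\<^bsub>L\<^esub>}" by auto
    moreover have "{\<zero>\<^bsub>L\<^esub>} = a_kernel L M f \<longleftrightarrow> inj_on f (carrier L)"
    proof
      assume k: "{\<zero>\<^bsub>L\<^esub>} = a_kernel L M f"
      show "inj_on f (carrier L)"
      proof (rule inj_onI)
        fix x y assume xy: "x \<in> carrier L" "y \<in> carrier L" "f x = f y"
        have "f (x \<ominus>\<^bsub>L\<^esub> y) = f x \<ominus>\<^bsub>M\<^esub> f y" by (rule lin_sub) (use that xy in auto)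
        also have "\<dots> = \<zero>\<^bsub>M\<^esub>" using module_diff_eq_zero[OF that(3)] xy lin_closed[OF that(4)] by simp
        finally have "x \<ominus>\<^bsub>L\<^esub> y \<in> a_kernel L M f" using xy by (auto simp: a_kernel_def')
        then show "x = y" using k module_diff_eq_zero[OF that(2)] xy by auto
      qed
    next
      assume i: "inj_on f (carrier L)"
      show "{\<zero>\<^bsub>L\<^esub>} = a_kernel L M f"
        using lin_zero[OF that(2-4)] inj_onD[OF i] by (auto simp: a_kernel_def' intro: inj_onD[OF i])
    qed
    ultimately show ?thesis by (simp add: exact_at_def)
  qed
  have so: "small U (carrier ?O)" by (rule small_subset[OF s(1)]) simp
  have tz: "tensor_map k L T (\<lambda>x. \<zero>\<^bsub>L\<^esub>) id u = \<zero>\<^bsub>L \<boxtimes> T\<^esub>" if "u \<in> carrier (?O \<boxtimes> T)" for u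
  proof -
    have p: "pure k L T \<zero>\<^bsub>L\<^esub> y = \<zero>\<^bsub>L \<boxtimes> T\<^esub>" if "y \<in> carrier T" for y
      by (rule lin_zero[OF m(1) _ bilin_left[OF pure_bilin]]) (use m that in auto)
    show ?thesis
      by (rule tensor_ext[OF O T_module _ tensor_map_lin[OF O T_module m(1) T_module z lin_id(2)], of "\<lambda>u. \<zero>\<^bsub>L \<boxtimes> T\<^esub>"])
        (use that m in \<open>auto intro!: lin_zero_map simp: p tensor_map_pure[OF O T_module m(1) T_module z lin_id(2)]\<close>)
  qed
  have "inj_on f (carrier L) \<longleftrightarrow> exact_at ?O L M (\<lambda>x. \<zero>\<^bsub>L\<^esub>) f"
    using ker[OF O m f] by simp
  also have "\<dots> \<longleftrightarrow> exact_at (?O \<boxtimes> T) (L \<boxtimes> T) (M \<boxtimes> T) (tensor_map k L T (\<lambda>x. \<zero>\<^bsub>L\<^esub>) id) (tensor_map k M T f id)"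
    by (rule ff_exact[OF O m so s z f])
  also have "\<dots> \<longleftrightarrow> exact_at (?O \<boxtimes> T) (L \<boxtimes> T) (M \<boxtimes> T) (\<lambda>x. \<zero>\<^bsub>L \<boxtimes> T\<^esub>) (tensor_map k M T f id)"
    unfolding exact_at_def by (subst image_cong[OF refl tz]) simp_all
  also have "\<dots> \<longleftrightarrow> inj_on (tensor_map k M T f id) (carrier (L \<boxtimes> T))"
    by (rule ker) (use O m f in \<open>auto intro: tensor_map_lin\<close>)
  finally show ?thesis .
qed

end

section \<open>The translation map of a Galois extension\<close>


context base_ring begin

text \<open>
  The multiplicativity of a coaction or comultiplication in Sweedler notation: \<open>f(xy)\<close> expands to
  \<open>\<Sum> x\<^sub>0 y\<^sub>0 \<otimes> x\<^sub>1 y\<^sub>1\<close>.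
\<close>

lemma alg_hom_mult_tensor:
  assumes "k_algebra k X" "k_algebra k M" "k_algebra k N" "f \<in> alg_hom k X (M \<boxtimes> N)" "x \<in> carrier X" "y \<in> carrier X"
  shows "f (x \<otimes>\<^bsub>X\<^esub> y) = tlift k M N (M \<boxtimes> N) (\<lambda>a b. tlift k M N (M \<boxtimes> N) (\<lambda>a' b'. pure k M N (a \<otimes>\<^bsub>M\<^esub> a') (b \<otimes>\<^bsub>N\<^esub> b')) (f y)) (f x)"
  by (simp add: alg_hom_mult[OF assms(4-6)] tensor_mult_eq[OF assms(2,3)] assms lin_closed[OF alg_hom_lin[OF assms(4)]])

end

locale galois_ff = ff_module k T U + galois_extension k B T \<beta>
  for k :: "('k, 'r) ring_scheme" (structure) and B :: "('k, 'b, 'x) bialg_scheme"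
    and T :: "('k, 't, 'y) module_scheme" and \<beta> :: "'t \<Rightarrow> ('t \<times> 'b \<Rightarrow> 'k) set" and U :: "'u itself" +
  assumes small_k [simp]: "small U (carrier k)" and small_T [simp]: "small U (carrier T)" and small_B [simp]: "small U (carrier B)"
begin

abbreviation mult_T (infixl \<open>\<cdot>\<close> 70) where "x \<cdot> y \<equiv> x \<otimes>\<^bsub>T\<^esub> y"
abbreviation "\<Delta> \<equiv> comult B"
abbreviation "\<epsilon> \<equiv> counit B"

lemma T_algebra [simp]: "k_algebra k T" by (rule right_algebra)
lemma B_algebra [simp]: "k_algebra k B" using right_bialgebra by (simp add: bialgebra_def)
lemma B_module [simp]: "module k B" by (rule k_algebra_module[OF B_algebra])

lemmas [simp] = alg_simps[OF T_algebra] alg_simps[OF B_algebra]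
lemmas T_assoc = mult_assoc[OF T_algebra]

lemma beta_lin [simp]: "\<beta> \<in> lin_map k T (T \<boxtimes> B)" by (rule alg_hom_lin[OF right_coaction_hom])
lemma comult_hom: "\<Delta> \<in> alg_hom k B (B \<boxtimes> B)" by (rule bialgebra.comult_hom[OF right_bialgebra])
lemma counit_hom: "\<epsilon> \<in> alg_hom k B (base_module k)" by (rule bialgebra.counit_hom[OF right_bialgebra])
lemma comult_lin [simp]: "\<Delta> \<in> lin_map k B (B \<boxtimes> B)" by (rule alg_hom_lin[OF comult_hom])
lemma counit_lin [simp]: "\<epsilon> \<in> lin_map k B (base_module k)" by (rule alg_hom_lin[OF counit_hom])

lemmas [simp] = lin_closed[OF beta_lin] lin_closed[OF comult_lin] lin_closed[OF counit_lin, simplified]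
  lin_comp[OF beta_lin] lin_comp[OF comult_lin] lin_comp[OF counit_lin]

lemma B_smult [simp]: "c \<in> carrier k \<Longrightarrow> x \<in> carrier B \<Longrightarrow> c \<odot>\<^bsub>B\<^esub> x \<in> carrier B"
  by (rule module.smult_closed[OF B_module])

lemma beta_coassoc: "coassoc k T T B B \<beta> \<beta> \<beta> \<Delta>"
  using right_coaction_coassoc by (simp add: coassoc_def)

lemma comult_coassoc: "coassoc k B B B B \<Delta> \<Delta> \<Delta> \<Delta>"
  using bialgebra.coassoc[OF right_bialgebra] by (simp add: coassoc_def)

lemma beta_counit: "y \<in> carrier T \<Longrightarrow> tlift k T B T (\<lambda>t b. \<epsilon> b \<odot>\<^bsub>T\<^esub> t) (\<beta> y) = y"
  using right_coaction_counit by (simp add: right_counit_eq[of T B])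

lemma comult_counit_left: "b \<in> carrier B \<Longrightarrow> tlift k B B B (\<lambda>a b. \<epsilon> a \<odot>\<^bsub>B\<^esub> b) (\<Delta> b) = b"
  using bialgebra.counit_left[OF right_bialgebra] by (simp add: left_counit_eq[of B B])

lemma comult_counit_right: "b \<in> carrier B \<Longrightarrow> tlift k B B B (\<lambda>a b. \<epsilon> b \<odot>\<^bsub>B\<^esub> a) (\<Delta> b) = b"
  using bialgebra.counit_right[OF right_bialgebra] by (simp add: right_counit_eq[of B B])

abbreviation "can \<equiv> canonical_map k B T \<beta>"

lemma can_eq:
  assumes "u \<in> carrier (T \<boxtimes> T)"
  shows "can u = tlift k T T (T \<boxtimes> B) (\<lambda>x y. tlift k T B (T \<boxtimes> B) (\<lambda>t b. pure k T B (x \<cdot> t) b) (\<beta> y)) u"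
proof -
  have *: "pure k T B x \<one>\<^bsub>B\<^esub> \<otimes>\<^bsub>T \<boxtimes> B\<^esub> \<beta> y = tlift k T B (T \<boxtimes> B) (\<lambda>t b. pure k T B (x \<cdot> t) b) (\<beta> y)"
    if "x \<in> carrier T" "y \<in> carrier T" for x y
    using that by (simp add: tensor_mult_eq bilin_def)
  show ?thesis unfolding canonical_map_def
    by (subst tensor_lift_eq[of T T]) (use assms in \<open>simp_all add: *\<close>)
qed

lemma can_lin: "can \<in> lin_map k (T \<boxtimes> T) (T \<boxtimes> B)"
  by (rule lin_cong[OF _ _ can_eq[symmetric]]) (auto simp: bilin_def)

lemma can_pure: "x \<in> carrier T \<Longrightarrow> y \<in> carrier T \<Longrightarrow>
   can (pure k T T x y) = tlift k T B (T \<boxtimes> B) (\<lambda>t b. pure k T B (x \<cdot> t) b) (\<beta> y)"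
  by (simp add: can_eq bilin_def)

lemma can_inj: "can u = can v \<Longrightarrow> u \<in> carrier (T \<boxtimes> T) \<Longrightarrow> v \<in> carrier (T \<boxtimes> T) \<Longrightarrow> u = v"
  using canonical_bij by (auto simp: bij_betw_def inj_on_def)

text \<open>
  The translation map.
\<close>

definition "\<tau> b = inv_into (carrier (T \<boxtimes> T)) can (pure k T B \<one>\<^bsub>T\<^esub> b)"

lemma tau_lin [simp]: "\<tau> \<in> lin_map k B (T \<boxtimes> T)"
  unfolding \<tau>_def[abs_def] by (rule lin_comp[OF lin_inv_into[OF _ _ can_lin canonical_bij]]) auto

lemmas [simp] = lin_closed[OF tau_lin] lin_comp[OF tau_lin]

lemma can_tau: "b \<in> carrier B \<Longrightarrow> can (\<tau> b) = pure k T B \<one>\<^bsub>T\<^esub> b"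
  unfolding \<tau>_def using canonical_bij by (auto simp: bij_betw_def f_inv_into_f)

text \<open>
  \<open>\<Sum> f(p q\<^sub>0, q\<^sub>1) = f(1, b)\<close> for \<open>\<tau>(b) = \<Sum> p \<otimes> q\<close>: this is \<open>can(\<tau>(b)) = 1 \<otimes> b\<close> inside a bilinear expression.
\<close>

lemma can_tau':
  assumes P: "module k P" and b: "b \<in> carrier B"
    and f: "\<And>c. c \<in> carrier B \<Longrightarrow> (\<lambda>t. f t c) \<in> lin_map k T P" "\<And>t. t \<in> carrier T \<Longrightarrow> (\<lambda>c. f t c) \<in> lin_map k B P"
  shows "tlift k T T P (\<lambda>p q. tlift k T B P (\<lambda>t c. f (p \<cdot> t) c) (\<beta> q)) (\<tau> b) = f \<one>\<^bsub>T\<^esub> b"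
proof -
  have bf: "bilin k T B P f" using f by (rule bilinI)
  note [simp] = P b lin_closed[OF f(1)] bf f
  have "f \<one>\<^bsub>T\<^esub> b = tlift k T B P f (can (\<tau> b))" by (simp add: can_tau)
  also have "\<dots> = tlift k T T P (\<lambda>p q. tlift k T B P f (tlift k T B (T \<boxtimes> B) (\<lambda>t b. pure k T B (p \<cdot> t) b) (\<beta> q))) (\<tau> b)"
    by (simp add: can_eq tlift_tlift)
  also have "\<dots> = tlift k T T P (\<lambda>p q. tlift k T B P (\<lambda>t c. f (p \<cdot> t) c) (\<beta> q)) (\<tau> b)"
    by (rule tlift_cong) (simp_all add: tlift_tlift)
  finally show ?thesis ..
qed

lemma can_lmult:
  assumes "s \<in> carrier T" "u \<in> carrier (T \<boxtimes> T)"
  shows "can (tlift k T T (T \<boxtimes> T) (\<lambda>p q. pure k T T (s \<cdot> p) q) u) = tlift k T B (T \<boxtimes> B) (\<lambda>t b. pure k T B (s \<cdot> t) b) (can u)"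
  by (rule tensor_ext[of T T "T \<boxtimes> B" "\<lambda>u. can (tlift k T T (T \<boxtimes> T) (\<lambda>p q. pure k T T (s \<cdot> p) q) u)"])
    (use assms in \<open>simp_all add: bilin_def lin_comp[OF can_lin] can_lin can_pure tlift_tlift T_assoc\<close>)

text \<open>
  \<open>\<Sum> y\<^sub>0 \<tau>(y\<^sub>1) = 1 \<otimes> y\<close>, since both sides have the image \<open>y\<^sub>0 \<otimes> y\<^sub>1\<close> under \<open>can\<close>, which is linear in its left
  factor.
\<close>

lemma tau_beta:
  assumes y: "y \<in> carrier T"
  shows "tlift k T B (T \<boxtimes> T) (\<lambda>t b. tlift k T T (T \<boxtimes> T) (\<lambda>p q. pure k T T (t \<cdot> p) q) (\<tau> b)) (\<beta> y) = pure k T T \<one>\<^bsub>T\<^esub> y"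
proof (rule can_inj)
  note [simp] = y
  have "can (tlift k T B (T \<boxtimes> T) (\<lambda>t b. tlift k T T (T \<boxtimes> T) (\<lambda>p q. pure k T T (t \<cdot> p) q) (\<tau> b)) (\<beta> y))
    = tlift k T B (T \<boxtimes> B) (\<lambda>t b. can (tlift k T T (T \<boxtimes> T) (\<lambda>p q. pure k T T (t \<cdot> p) q) (\<tau> b))) (\<beta> y)"
    by (rule tlift_push[OF _ _ _ _ can_lin]) simp_all
  also have "\<dots> = tlift k T B (T \<boxtimes> B) (\<lambda>t b. pure k T B t b) (\<beta> y)"
    by (rule tlift_cong) (simp_all add: can_lmult can_tau bilin_def)
  finally show "can (tlift k T B (T \<boxtimes> T) (\<lambda>t b. tlift k T T (T \<boxtimes> T) (\<lambda>p q. pure k T T (t \<cdot> p) q) (\<tau> b)) (\<beta> y)) = can (pure k T T \<one>\<^bsub>T\<^esub> y)"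
    by (simp add: can_pure)
qed (use y in simp_all)

lemma tau_beta':
  assumes P: "module k P" and y: "y \<in> carrier T"
    and f: "\<And>c. c \<in> carrier T \<Longrightarrow> (\<lambda>t. f t c) \<in> lin_map k T P" "\<And>t. t \<in> carrier T \<Longrightarrow> (\<lambda>c. f t c) \<in> lin_map k T P"
  shows "tlift k T B P (\<lambda>t b. tlift k T T P (\<lambda>p q. f (t \<cdot> p) q) (\<tau> b)) (\<beta> y) = f \<one>\<^bsub>T\<^esub> y"
proof -
  have bf: "bilin k T T P f" using f by (rule bilinI)
  note [simp] = P y lin_closed[OF f(1)] bf f
  have "f \<one>\<^bsub>T\<^esub> y = tlift k T T P f (tlift k T B (T \<boxtimes> T) (\<lambda>t b. tlift k T T (T \<boxtimes> T) (\<lambda>p q. pure k T T (t \<cdot> p) q) (\<tau> b)) (\<beta> y))"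
    by (simp add: tau_beta)
  also have "\<dots> = tlift k T B P (\<lambda>t b. tlift k T T P (\<lambda>p q. f (t \<cdot> p) q) (\<tau> b)) (\<beta> y)"
    by (simp add: tlift_tlift)
  finally show ?thesis ..
qed

lemma T_smult_mult: "c \<in> carrier k \<Longrightarrow> x \<in> carrier T \<Longrightarrow> y \<in> carrier T \<Longrightarrow> x \<cdot> (c \<odot>\<^bsub>T\<^esub> y) = c \<odot>\<^bsub>T\<^esub> (x \<cdot> y)"
  by (rule k_algebra.smult_mult_right[OF T_algebra])

text \<open>
  Apply \<open>T \<otimes> \<epsilon>\<close> to \<open>can(\<tau>(b)) = 1 \<otimes> b\<close>.
\<close>

lemma tau_mult_map:
  assumes b: "b \<in> carrier B"
  shows "tlift k T T T (\<lambda>p q. p \<cdot> q) (\<tau> b) = \<epsilon> b \<odot>\<^bsub>T\<^esub> \<one>\<^bsub>T\<^esub>"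
proof -
  have "\<epsilon> b \<odot>\<^bsub>T\<^esub> \<one>\<^bsub>T\<^esub> = tlift k T T T (\<lambda>p q. tlift k T B T (\<lambda>t c. \<epsilon> c \<odot>\<^bsub>T\<^esub> (p \<cdot> t)) (\<beta> q)) (\<tau> b)"
    by (rule can_tau'[symmetric]) (simp_all add: b lin_smult_left lin_smult_right)
  also have "\<dots> = tlift k T T T (\<lambda>p q. p \<cdot> q) (\<tau> b)"
  proof (rule tlift_cong[OF refl])
    fix p q assume pq: "p \<in> carrier T" "q \<in> carrier T"
    have "p \<cdot> tlift k T B T (\<lambda>t c. \<epsilon> c \<odot>\<^bsub>T\<^esub> t) (\<beta> q) = tlift k T B T (\<lambda>t c. p \<cdot> (\<epsilon> c \<odot>\<^bsub>T\<^esub> t)) (\<beta> q)"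
      by (rule tlift_push[where h="\<lambda>x. p \<cdot> x"]) (use pq in simp_all)
    then show "tlift k T B T (\<lambda>t c. \<epsilon> c \<odot>\<^bsub>T\<^esub> (p \<cdot> t)) (\<beta> q) = p \<cdot> q"
      using pq by (simp add: T_smult_mult beta_counit)
  qed
  finally show ?thesis ..
qed

text \<open>
  The translation map is right colinear: \<open>\<tau>(b\<^sub>1) \<otimes> b\<^sub>2 = \<Sum> p \<otimes> q\<^sub>0 \<otimes> q\<^sub>1\<close>. It suffices to compare the images under
  \<open>can \<otimes> B\<close>, and both are \<open>1 \<otimes> b\<^sub>1 \<otimes> b\<^sub>2\<close>.
\<close>

lemma tau_coassoc: "coassoc k B T T B \<Delta> \<tau> \<tau> \<beta>"
proof (rule coassocI[of B T])
  fix b assume b [simp]: "b \<in> carrier B"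
  let ?P = "T \<boxtimes> (T \<boxtimes> B)" and ?Q = "T \<boxtimes> (B \<boxtimes> B)"
  (* ?c is can (x) B up to associativity, and ?d is its inverse, built from the translation map *)
  let ?c = "tlift k T (T \<boxtimes> B) ?Q (\<lambda>x w. tlift k T B ?Q (\<lambda>y z. tlift k T B ?Q (\<lambda>t b. pure k T (B \<boxtimes> B) (x \<cdot> t) (pure k B B b z)) (\<beta> y)) w)"
  let ?d = "tlift k T (B \<boxtimes> B) ?P (\<lambda>t w. tlift k B B ?P (\<lambda>b z. tlift k T T ?P (\<lambda>p q. pure k T (T \<boxtimes> B) (t \<cdot> p) (pure k T B q z)) (\<tau> b)) w)"
  have c: "?c \<in> lin_map k ?P ?Q" by (rule tlift_lin) (simp_all add: bilin_def)
  have d: "?d \<in> lin_map k ?Q ?P" by (rule tlift_lin) (simp_all add: bilin_def)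
  have cp: "?c (pure k T (T \<boxtimes> B) x (pure k T B y z)) = tlift k T B ?Q (\<lambda>t b. pure k T (B \<boxtimes> B) (x \<cdot> t) (pure k B B b z)) (\<beta> y)"
    if "x \<in> carrier T" "y \<in> carrier T" "z \<in> carrier B" for x y z using that by (simp add: bilin_def)
  have dp: "?d (pure k T (B \<boxtimes> B) x (pure k B B y z)) = tlift k T T ?P (\<lambda>p q. pure k T (T \<boxtimes> B) (x \<cdot> p) (pure k T B q z)) (\<tau> y)"
    if "x \<in> carrier T" "y \<in> carrier B" "z \<in> carrier B" for x y z using that by (simp add: bilin_def)
  have dc: "?d (?c w) = w" if "w \<in> carrier ?P" for w
  proof (rule tensor_ext[OF _ _ _ lin_comp[OF d c] lin_id(1) _ that])
    fix x v assume x: "x \<in> carrier T" and v: "v \<in> carrier (T \<boxtimes> B)"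
    show "?d (?c (pure k T (T \<boxtimes> B) x v)) = pure k T (T \<boxtimes> B) x v"
    proof (rule tensor_ext[OF _ _ _ _ _ _ v, of ?P "\<lambda>v. ?d (?c (pure k T (T \<boxtimes> B) x v))"])
      show "(\<lambda>v. ?d (?c (pure k T (T \<boxtimes> B) x v))) \<in> lin_map k (T \<boxtimes> B) ?P"
        by (rule lin_comp[OF d], rule lin_comp[OF c]) (use x in simp)
      fix y z assume yz: "y \<in> carrier T" "z \<in> carrier B"
      have "?d (?c (pure k T (T \<boxtimes> B) x (pure k T B y z))) = ?d (tlift k T B ?Q (\<lambda>t b. pure k T (B \<boxtimes> B) (x \<cdot> t) (pure k B B b z)) (\<beta> y))"
        by (subst cp) (use x yz in simp_all)
      also have "\<dots> = tlift k T B ?P (\<lambda>t b. tlift k T T ?P (\<lambda>p q. pure k T (T \<boxtimes> B) (x \<cdot> (t \<cdot> p)) (pure k T B q z)) (\<tau> b)) (\<beta> y)"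
        by (subst tlift_push[OF _ _ _ _ d], use x yz in simp_all, rule tlift_cong[OF refl], subst dp, use x yz in \<open>simp_all add: T_assoc\<close>)
      also have "\<dots> = pure k T (T \<boxtimes> B) (x \<cdot> \<one>\<^bsub>T\<^esub>) (pure k T B y z)"
        by (rule tau_beta'[where f="\<lambda>s q. pure k T (T \<boxtimes> B) (x \<cdot> s) (pure k T B q z)"]) (use x yz in simp_all)
      finally show "?d (?c (pure k T (T \<boxtimes> B) x (pure k T B y z))) = pure k T (T \<boxtimes> B) x (pure k T B y z)"
        using x by simp
    qed (use x in simp_all)
  qed simp_all
  let ?L = "tlift k B B ?P (\<lambda>a z. tlift k T T ?P (\<lambda>x y. pure k T (T \<boxtimes> B) x (pure k T B y z)) (\<tau> a)) (\<Delta> b)"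
  let ?R = "tlift k T T ?P (\<lambda>x c. tlift k T B ?P (\<lambda>y z. pure k T (T \<boxtimes> B) x (pure k T B y z)) (\<beta> c)) (\<tau> b)"
  have "?c ?L = tlift k B B ?Q (\<lambda>a z. tlift k T T ?Q (\<lambda>x y. ?c (pure k T (T \<boxtimes> B) x (pure k T B y z))) (\<tau> a)) (\<Delta> b)"
    by (subst tlift_push[OF _ _ _ _ c], simp_all del: tlift_pure, rule tlift_cong[OF refl], subst tlift_push[OF _ _ _ _ c], simp_all del: tlift_pure)
  also have "\<dots> = tlift k B B ?Q (\<lambda>a z. pure k T (B \<boxtimes> B) \<one>\<^bsub>T\<^esub> (pure k B B a z)) (\<Delta> b)"
  proof (rule tlift_cong[OF refl])
    fix a z assume az: "a \<in> carrier B" "z \<in> carrier B"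
    have "tlift k T T ?Q (\<lambda>x y. ?c (pure k T (T \<boxtimes> B) x (pure k T B y z))) (\<tau> a) =
      tlift k T T ?Q (\<lambda>x y. tlift k T B ?Q (\<lambda>t b. pure k T (B \<boxtimes> B) (x \<cdot> t) (pure k B B b z)) (\<beta> y)) (\<tau> a)"
      by (rule tlift_cong[OF refl], rule cp) (use az in simp_all)
    also have "\<dots> = pure k T (B \<boxtimes> B) \<one>\<^bsub>T\<^esub> (pure k B B a z)"
      by (rule can_tau'[where f="\<lambda>s b. pure k T (B \<boxtimes> B) s (pure k B B b z)"]) (use az in simp_all)
    finally show "tlift k T T ?Q (\<lambda>x y. ?c (pure k T (T \<boxtimes> B) x (pure k T B y z))) (\<tau> a) = pure k T (B \<boxtimes> B) \<one>\<^bsub>T\<^esub> (pure k B B a z)" .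
  qed
  finally have cL: "?c ?L = \<dots>" .
  have "?c ?R = tlift k T T ?Q (\<lambda>x c. tlift k T B ?Q (\<lambda>y z. ?c (pure k T (T \<boxtimes> B) x (pure k T B y z))) (\<beta> c)) (\<tau> b)"
    by (subst tlift_push[OF _ _ _ _ c], simp_all del: tlift_pure, rule tlift_cong[OF refl], subst tlift_push[OF _ _ _ _ c], simp_all del: tlift_pure)
  also have "\<dots> = tlift k T T ?Q (\<lambda>x c. tlift k T B ?Q (\<lambda>t w. tlift k B B ?Q (\<lambda>b z. pure k T (B \<boxtimes> B) (x \<cdot> t) (pure k B B b z)) (\<Delta> w)) (\<beta> c)) (\<tau> b)"
  proof (rule tlift_cong[OF refl])
    fix x c assume x: "x \<in> carrier T" "c \<in> carrier T"
    have "tlift k T B ?Q (\<lambda>y z. ?c (pure k T (T \<boxtimes> B) x (pure k T B y z))) (\<beta> c) =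
      tlift k T B ?Q (\<lambda>y z. tlift k T B ?Q (\<lambda>t b. pure k T (B \<boxtimes> B) (x \<cdot> t) (pure k B B b z)) (\<beta> y)) (\<beta> c)"
      by (rule tlift_cong[OF refl], rule cp) (use x in simp_all)
    also have "\<dots> = tlift k T B ?Q (\<lambda>t w. tlift k B B ?Q (\<lambda>b z. pure k T (B \<boxtimes> B) (x \<cdot> t) (pure k B B b z)) (\<Delta> w)) (\<beta> c)"
      by (rule coassocD[OF beta_coassoc]) (use x in simp_all)
    finally show "tlift k T B ?Q (\<lambda>y z. ?c (pure k T (T \<boxtimes> B) x (pure k T B y z))) (\<beta> c) = \<dots>" .
  qed
  also have "\<dots> = tlift k B B ?Q (\<lambda>a z. pure k T (B \<boxtimes> B) \<one>\<^bsub>T\<^esub> (pure k B B a z)) (\<Delta> b)"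
    by (rule can_tau'[where f="\<lambda>s w. tlift k B B ?Q (\<lambda>b z. pure k T (B \<boxtimes> B) s (pure k B B b z)) (\<Delta> w)"]) (simp_all add: bilin_def)
  finally have "?c ?L = ?c ?R" using cL by simp
  then have "?d (?c ?L) = ?d (?c ?R)" by (rule arg_cong)
  then show "?L = ?R" by (subst (asm) (1 2) dc) simp_all
qed simp_all

text \<open>
  The descent datum \<open>x \<otimes> y \<mapsto> x\<^sub>0 \<otimes> \<tau>(x\<^sub>1) y\<close> satisfies the cocycle condition because the sum of
  \<open>p \<otimes> q p' \<otimes> q'\<close> over \<open>\<tau>(b\<^sub>1) = p \<otimes> q\<close> and \<open>\<tau>(b\<^sub>2) = p' \<otimes> q'\<close> collapses to \<open>p \<otimes> 1 \<otimes> q\<close>: by colinearity it is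
  \<open>p \<otimes> q\<^sub>0 \<tau>(q\<^sub>1)\<close>.
\<close>

lemma tau_cocycle:
  assumes P: "module k P" and b: "b \<in> carrier B"
    and f: "\<And>b c. b \<in> carrier T \<Longrightarrow> c \<in> carrier T \<Longrightarrow> (\<lambda>a. f a b c) \<in> lin_map k T P"
      "\<And>a c. a \<in> carrier T \<Longrightarrow> c \<in> carrier T \<Longrightarrow> (\<lambda>b. f a b c) \<in> lin_map k T P"
      "\<And>a b. a \<in> carrier T \<Longrightarrow> b \<in> carrier T \<Longrightarrow> (\<lambda>c. f a b c) \<in> lin_map k T P"
  shows "tlift k B B P (\<lambda>b1 b2. tlift k T T P (\<lambda>p q. tlift k T T P (\<lambda>p' q'. f p (q \<cdot> p') q') (\<tau> b2)) (\<tau> b1)) (\<Delta> b)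
    = tlift k T T P (\<lambda>p q. f p \<one>\<^bsub>T\<^esub> q) (\<tau> b)"
proof -
  note [simp] = P b f lin_comp[OF f(1)] lin_comp[OF f(2)] lin_comp[OF f(3)] lin_closed[OF f(1)]
  have "tlift k B B P (\<lambda>b1 b2. tlift k T T P (\<lambda>p q. tlift k T T P (\<lambda>p' q'. f p (q \<cdot> p') q') (\<tau> b2)) (\<tau> b1)) (\<Delta> b)
    = tlift k T T P (\<lambda>p c. tlift k T B P (\<lambda>q b2. tlift k T T P (\<lambda>p' q'. f p (q \<cdot> p') q') (\<tau> b2)) (\<beta> c)) (\<tau> b)"
    by (rule coassocD[OF tau_coassoc]) (simp_all add: bilin_def)
  also have "\<dots> = tlift k T T P (\<lambda>p c. f p \<one>\<^bsub>T\<^esub> c) (\<tau> b)"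
    by (rule tlift_cong[OF refl], rule tau_beta') simp_all
  finally show ?thesis .
qed

lemma tau_one: "\<tau> \<one>\<^bsub>B\<^esub> = pure k T T \<one>\<^bsub>T\<^esub> \<one>\<^bsub>T\<^esub>"
  by (rule can_inj) (simp_all add: can_tau can_pure alg_hom_one[OF right_coaction_hom] tensor_one bilin_def)

text \<open>
  \<open>\<tau>\<close> is an algebra map into \<open>T\<^sup>o\<^sup>p \<otimes> T\<close>; under \<open>can\<close> the product telescopes from the inside.
\<close>

lemma tau_mult:
  assumes a: "a \<in> carrier B" and b: "b \<in> carrier B"
  shows "\<tau> (a \<otimes>\<^bsub>B\<^esub> b) = tlift k T T (T \<boxtimes> T) (\<lambda>p q. tlift k T T (T \<boxtimes> T) (\<lambda>p' q'. pure k T T (p' \<cdot> p) (q \<cdot> q')) (\<tau> b)) (\<tau> a)"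
    (is "_ = ?R")
proof (rule can_inj)
  note [simp] = a b
  let ?Q = "T \<boxtimes> B"
  have "can ?R = tlift k T T ?Q (\<lambda>p q. tlift k T T ?Q (\<lambda>p' q'. can (pure k T T (p' \<cdot> p) (q \<cdot> q'))) (\<tau> b)) (\<tau> a)"
    by (subst tlift_push[OF _ _ _ _ can_lin], simp_all, rule tlift_cong[OF refl], subst tlift_push[OF _ _ _ _ can_lin], simp_all)
  also have "\<dots> = tlift k T T ?Q (\<lambda>p q. tlift k T T ?Q (\<lambda>p' q'. tlift k T B ?Q (\<lambda>q0 q1. tlift k T B ?Q (\<lambda>q0' q1'.
      pure k T B ((p' \<cdot> (p \<cdot> q0)) \<cdot> q0') (q1 \<otimes>\<^bsub>B\<^esub> q1')) (\<beta> q')) (\<beta> q)) (\<tau> b)) (\<tau> a)"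
    by (simp add: can_pure alg_hom_mult_tensor[OF T_algebra T_algebra B_algebra right_coaction_hom] tlift_tlift bilin_def T_assoc)
  also have "\<dots> = tlift k T T ?Q (\<lambda>p' q'. tlift k T T ?Q (\<lambda>p q. tlift k T B ?Q (\<lambda>q0 q1. tlift k T B ?Q (\<lambda>q0' q1'.
      pure k T B ((p' \<cdot> (p \<cdot> q0)) \<cdot> q0') (q1 \<otimes>\<^bsub>B\<^esub> q1')) (\<beta> q')) (\<beta> q)) (\<tau> a)) (\<tau> b)"
    by (rule tlift_swap) simp_all
  also have "\<dots> = tlift k T T ?Q (\<lambda>p' q'. tlift k T B ?Q (\<lambda>q0' q1'. pure k T B ((p' \<cdot> \<one>\<^bsub>T\<^esub>) \<cdot> q0') (a \<otimes>\<^bsub>B\<^esub> q1')) (\<beta> q')) (\<tau> b)"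
    by (rule tlift_cong[OF refl], rule can_tau'[where f="\<lambda>s c. tlift k T B ?Q (\<lambda>q0' q1'. pure k T B ((_ \<cdot> s) \<cdot> q0') (c \<otimes>\<^bsub>B\<^esub> q1')) (\<beta> _)"]) simp_all
  also have "\<dots> = tlift k T T ?Q (\<lambda>p' q'. tlift k T B ?Q (\<lambda>q0' q1'. pure k T B (p' \<cdot> q0') (a \<otimes>\<^bsub>B\<^esub> q1')) (\<beta> q')) (\<tau> b)"
    by simp
  also have "\<dots> = pure k T B \<one>\<^bsub>T\<^esub> (a \<otimes>\<^bsub>B\<^esub> b)"
    by (rule can_tau') simp_all
  finally show "can (\<tau> (a \<otimes>\<^bsub>B\<^esub> b)) = can ?R" by (simp add: can_tau)
qed (use a b in simp_all)

end

section \<open>Faithfully flat descent\<close>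


context galois_ff begin

text \<open>
  \<open>N \<rightarrow> N \<otimes> T\<close> becomes split injective after tensoring with \<open>T\<close>, by multiplication of the two
  factors \<open>T\<close>.
\<close>

lemma pure_one_inj:
  assumes N: "module k N" and s: "small U (carrier N)" and n: "n \<in> carrier N" "n' \<in> carrier N"
    and eq: "pure k N T n \<one>\<^bsub>T\<^esub> = pure k N T n' \<one>\<^bsub>T\<^esub>"
  shows "n = n'"
proof -
  note [simp] = N
  let ?f = "\<lambda>n. pure k N T n \<one>\<^bsub>T\<^esub>"
  let ?r = "tlift k (N \<boxtimes> T) T (N \<boxtimes> T) (\<lambda>m s. tlift k N T (N \<boxtimes> T) (\<lambda>n t. pure k N T n (t \<cdot> s)) m)"
  have f: "?f \<in> lin_map k N (N \<boxtimes> T)" by simp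
  have r: "?r \<in> lin_map k ((N \<boxtimes> T) \<boxtimes> T) (N \<boxtimes> T)" by (rule tlift_lin) (simp_all add: bilin_def)
  have fl: "tensor_map k (N \<boxtimes> T) T ?f id \<in> lin_map k (N \<boxtimes> T) ((N \<boxtimes> T) \<boxtimes> T)" by (rule tensor_map_lin) simp_all
  have "?r (tensor_map k (N \<boxtimes> T) T ?f id w) = w" if "w \<in> carrier (N \<boxtimes> T)" for w
    by (rule tensor_ext[OF _ _ _ lin_comp[OF r fl] lin_id(1) _ that])
      (simp_all add: tensor_map_pure[of N T "N \<boxtimes> T" T] bilin_def)
  then have "inj_on (tensor_map k (N \<boxtimes> T) T ?f id) (carrier (N \<boxtimes> T))" by (rule inj_on_inverseI)
  then have "inj_on ?f (carrier N)" by (subst ff_inj[of N "N \<boxtimes> T"]) (simp_all add: s f)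
  then show ?thesis using eq n by (auto dest: inj_onD)
qed

text \<open>
  The descent sequence \<open>N \<rightarrow> N \<otimes> T \<rightrightarrows> N \<otimes> T \<otimes> T\<close> is exact, because multiplying the last two factors
  splits it after one more tensor product with \<open>T\<close>.
\<close>

lemma tensor_descent:
  assumes N: "module k N" and s: "small U (carrier N)" and u: "u \<in> carrier (N \<boxtimes> T)"
    and eq: "tlift k N T (N \<boxtimes> (T \<boxtimes> T)) (\<lambda>n t. pure k N (T \<boxtimes> T) n (pure k T T \<one>\<^bsub>T\<^esub> t)) u =
      tlift k N T (N \<boxtimes> (T \<boxtimes> T)) (\<lambda>n t. pure k N (T \<boxtimes> T) n (pure k T T t \<one>\<^bsub>T\<^esub>)) u"
  obtains n where "n \<in> carrier N" "u = pure k N T n \<one>\<^bsub>T\<^esub>"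
proof -
  note [simp] = N s
  let ?M = "N \<boxtimes> T" and ?P = "N \<boxtimes> (T \<boxtimes> T)"
  let ?f = "\<lambda>n. pure k N T n \<one>\<^bsub>T\<^esub>"
  let ?g1 = "tlift k N T ?P (\<lambda>n t. pure k N (T \<boxtimes> T) n (pure k T T \<one>\<^bsub>T\<^esub> t))"
  let ?g2 = "tlift k N T ?P (\<lambda>n t. pure k N (T \<boxtimes> T) n (pure k T T t \<one>\<^bsub>T\<^esub>))"
  let ?g = "\<lambda>u. ?g1 u \<ominus>\<^bsub>?P\<^esub> ?g2 u"
  have g1: "?g1 \<in> lin_map k ?M ?P" and g2: "?g2 \<in> lin_map k ?M ?P"
    by (rule tlift_lin; simp add: bilin_def)+
  have f: "?f \<in> lin_map k N ?M" by simp
  have g: "?g \<in> lin_map k ?M ?P" by (rule lin_diff) (simp_all add: g1 g2)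
  let ?F = "tensor_map k ?M T ?f id" and ?G = "tensor_map k ?P T ?g id"
  have F: "?F \<in> lin_map k (N \<boxtimes> T) (?M \<boxtimes> T)" by (rule tensor_map_lin) simp_all
  have G: "?G \<in> lin_map k (?M \<boxtimes> T) (?P \<boxtimes> T)" by (rule tensor_map_lin) (simp_all add: g)
  (* ?r splits the sequence after tensoring with T: it sends n (x) (a (x) b) (x) s to (n (x) a) (x) b s; ?m is the multiplication *)
  let ?r = "tlift k ?P T (?M \<boxtimes> T) (\<lambda>v s. tlift k N (T \<boxtimes> T) (?M \<boxtimes> T) (\<lambda>n x. tlift k T T (?M \<boxtimes> T) (\<lambda>a b. pure k ?M T (pure k N T n a) (b \<cdot> s)) x) v)"
  let ?m = "tlift k ?M T ?M (\<lambda>m s. tlift k N T ?M (\<lambda>n t. pure k N T n (t \<cdot> s)) m)"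
  have r: "?r \<in> lin_map k (?P \<boxtimes> T) (?M \<boxtimes> T)" by (rule tlift_lin) (simp_all add: bilin_def)
  have mm: "?m \<in> lin_map k (?M \<boxtimes> T) ?M" by (rule tlift_lin) (simp_all add: bilin_def)
  have rG: "?r (?G w) = ?F (?m w) \<ominus>\<^bsub>?M \<boxtimes> T\<^esub> w" if "w \<in> carrier (?M \<boxtimes> T)" for w
  proof (rule tensor_ext[OF _ _ _ lin_comp[OF r G] lin_diff[OF _ lin_comp[OF F mm] lin_id(1)] _ that])
    fix m s assume m: "m \<in> carrier ?M" and s: "s \<in> carrier T"
    note [simp] = s
    show "?r (?G (pure k ?M T m s)) = ?F (?m (pure k ?M T m s)) \<ominus>\<^bsub>?M \<boxtimes> T\<^esub> pure k ?M T m s"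
    proof (rule tensor_ext[of N T "?M \<boxtimes> T" "\<lambda>m. ?r (?G (pure k ?M T m s))"  "\<lambda>m. ?F (?m (pure k ?M T m s)) \<ominus>\<^bsub>?M \<boxtimes> T\<^esub> pure k ?M T m s"])
      show "(\<lambda>m. ?r (?G (pure k ?M T m s))) \<in> lin_map k ?M (?M \<boxtimes> T)"
        by (rule lin_comp[OF r], rule lin_comp[OF G]) simp
      show "(\<lambda>m. ?F (?m (pure k ?M T m s)) \<ominus>\<^bsub>?M \<boxtimes> T\<^esub> pure k ?M T m s) \<in> lin_map k ?M (?M \<boxtimes> T)"
        by (rule lin_diff, simp, rule lin_comp[OF F], rule lin_comp[OF mm]) simp_all
      fix n t assume [simp]: "n \<in> carrier N" "t \<in> carrier T"
      have g1p: "?g1 (pure k N T n t) = pure k N (T \<boxtimes> T) n (pure k T T \<one>\<^bsub>T\<^esub> t)" by (simp add: bilin_def)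
      have g2p: "?g2 (pure k N T n t) = pure k N (T \<boxtimes> T) n (pure k T T t \<one>\<^bsub>T\<^esub>)" by (simp add: bilin_def)
      let ?w1 = "pure k ?P T (pure k N (T \<boxtimes> T) n (pure k T T \<one>\<^bsub>T\<^esub> t)) s"
      let ?w2 = "pure k ?P T (pure k N (T \<boxtimes> T) n (pure k T T t \<one>\<^bsub>T\<^esub>)) s"
      have "?G (pure k ?M T (pure k N T n t) s) = pure k ?P T (?g (pure k N T n t)) s"
        by (subst tensor_map_pure[of ?M T ?P T]) (simp_all add: g)
      also have "\<dots> = pure k ?P T (pure k N (T \<boxtimes> T) n (pure k T T \<one>\<^bsub>T\<^esub> t) \<ominus>\<^bsub>?P\<^esub> pure k N (T \<boxtimes> T) n (pure k T T t \<one>\<^bsub>T\<^esub>)) s"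
        by (simp only: g1p g2p)
      also have "\<dots> = ?w1 \<ominus>\<^bsub>?P \<boxtimes> T\<^esub> ?w2"
        by (rule lin_sub[of k ?P "?P \<boxtimes> T" "\<lambda>m. pure k ?P T m s"]) simp_all
      finally have "?r (?G (pure k ?M T (pure k N T n t) s)) = ?r (?w1 \<ominus>\<^bsub>?P \<boxtimes> T\<^esub> ?w2)" by (rule arg_cong)
      also have "\<dots> = ?r ?w1 \<ominus>\<^bsub>?M \<boxtimes> T\<^esub> ?r ?w2" by (rule lin_sub[OF _ _ r]) simp_all
      also have "?r ?w1 = pure k ?M T (pure k N T n \<one>\<^bsub>T\<^esub>) (t \<cdot> s)" by (simp add: bilin_def)
      also have "?r ?w2 = pure k ?M T (pure k N T n t) s" by (simp add: bilin_def)
      also have "pure k ?M T (pure k N T n \<one>\<^bsub>T\<^esub>) (t \<cdot> s) = ?F (?m (pure k ?M T (pure k N T n t) s))"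
        by (simp add: bilin_def tensor_map_pure[of N T ?M T])
      finally show "?r (?G (pure k ?M T (pure k N T n t) s)) = ?F (?m (pure k ?M T (pure k N T n t) s)) \<ominus>\<^bsub>?M \<boxtimes> T\<^esub> pure k ?M T (pure k N T n t) s" .
    qed (use m in simp_all)
  qed simp_all
  interpret MT: module k "?M \<boxtimes> T" by simp
  have gf: "?g (?f n) = \<zero>\<^bsub>?P\<^esub>" if "n \<in> carrier N" for n
    using that by (simp add: bilin_def, subst module_diff_eq_zero[of k]) simp_all
  have "exact_at (N \<boxtimes> T) (?M \<boxtimes> T) (?P \<boxtimes> T) ?F ?G"
    unfolding exact_at_def a_kernel_def'
  proof (intro equalityI subsetI)
    fix w assume "w \<in> ?F ` carrier (N \<boxtimes> T)"
    then obtain v where v: "v \<in> carrier (N \<boxtimes> T)" "w = ?F v" by blast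
    have p0: "pure k ?P T \<zero>\<^bsub>?P\<^esub> s = \<zero>\<^bsub>?P \<boxtimes> T\<^esub>" if "s \<in> carrier T" for s
      by (rule lin_zero[of k ?P "?P \<boxtimes> T" "\<lambda>m. pure k ?P T m s"]) (use that in simp_all)
    have "?G (?F v) = \<zero>\<^bsub>?P \<boxtimes> T\<^esub>"
    proof (rule tensor_ext[OF _ _ _ lin_comp[OF G F] lin_zero_map _ v(1)])
      fix n s assume [simp]: "n \<in> carrier N" "s \<in> carrier T"
      have "?G (?F (pure k N T n s)) = ?G (pure k ?M T (?f n) s)"
        by (subst tensor_map_pure[of N T ?M T]) simp_all
      also have "\<dots> = pure k ?P T (?g (?f n)) s"
        by (subst tensor_map_pure[of ?M T ?P T]) (simp_all add: g)
      also have "\<dots> = \<zero>\<^bsub>?P \<boxtimes> T\<^esub>" by (subst gf) (simp_all add: p0)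
      finally show "?G (?F (pure k N T n s)) = \<zero>\<^bsub>?P \<boxtimes> T\<^esub>" .
    qed simp_all
    then show "w \<in> {x \<in> carrier (?M \<boxtimes> T). ?G x = \<zero>\<^bsub>?P \<boxtimes> T\<^esub>}"
      using v lin_closed[OF F] by simp
  next
    fix w assume "w \<in> {x \<in> carrier (?M \<boxtimes> T). ?G x = \<zero>\<^bsub>?P \<boxtimes> T\<^esub>}"
    then have w: "w \<in> carrier (?M \<boxtimes> T)" "?G w = \<zero>\<^bsub>?P \<boxtimes> T\<^esub>" by auto
    have "?F (?m w) \<ominus>\<^bsub>?M \<boxtimes> T\<^esub> w = ?r (?G w)" using rG[OF w(1)] by (rule sym)
    also have "\<dots> = \<zero>\<^bsub>?M \<boxtimes> T\<^esub>" unfolding w(2) by (rule lin_zero[OF _ _ r]) simp_all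
    finally have "?F (?m w) = w"
      by (subst (asm) module_diff_eq_zero[of k]) (use w lin_closed[OF F] lin_closed[OF mm] in simp_all)
    from this[symmetric] lin_closed[OF mm w(1)] show "w \<in> ?F ` carrier (N \<boxtimes> T)" by (rule image_eqI)
  qed
  then have "exact_at N ?M ?P ?f ?g"
    by (subst ff_exact) (simp_all add: g)
  moreover have "u \<in> a_kernel ?M ?P ?g"
    using u eq lin_closed[OF g1] lin_closed[OF g2] by (simp add: a_kernel_def' module_diff_eq_zero[of k])
  ultimately obtain n where "n \<in> carrier N" "u = ?f n" unfolding exact_at_def by blast
  then show thesis by (rule that)
qed

end

section \<open>Descending comodule algebras\<close>


lemma k_algebraI:
  assumes M: "module k A"
    and "\<And>x y. x \<in> carrier A \<Longrightarrow> y \<in> carrier A \<Longrightarrow> x \<otimes>\<^bsub>A\<^esub> y \<in> carrier A"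
    and "\<And>x y z. x \<in> carrier A \<Longrightarrow> y \<in> carrier A \<Longrightarrow> z \<in> carrier A \<Longrightarrow> (x \<otimes>\<^bsub>A\<^esub> y) \<otimes>\<^bsub>A\<^esub> z = x \<otimes>\<^bsub>A\<^esub> (y \<otimes>\<^bsub>A\<^esub> z)"
    and "\<one>\<^bsub>A\<^esub> \<in> carrier A" "\<And>x. x \<in> carrier A \<Longrightarrow> \<one>\<^bsub>A\<^esub> \<otimes>\<^bsub>A\<^esub> x = x" "\<And>x. x \<in> carrier A \<Longrightarrow> x \<otimes>\<^bsub>A\<^esub> \<one>\<^bsub>A\<^esub> = x"
    and bil: "bilin k A A A (mult A)"
  shows "k_algebra k A"
proof -
  interpret A: module k A by fact
  have "ring A"
  proof (rule ringI)
    show "monoid A" by (rule monoidI) (use assms in simp_all)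
  qed (simp_all add: A.abelian_group_axioms lin_add[OF bilin_left[OF bil]] lin_add[OF bilin_right[OF bil]])
  then show ?thesis
    by (intro k_algebra.intro M k_algebra_axioms.intro)
      (simp_all add: lin_smult[OF bilin_left[OF bil]] lin_smult[OF bilin_right[OF bil]])
qed

lemma lin_map_opp [simp]: "lin_map k (tensor k M (opp N)) P = lin_map k (tensor k M N) P"
   "lin_map k P (tensor k M (opp N)) = lin_map k P (tensor k M N)"
  by (auto simp: lin_map_def base_ring.tensor_opp_sel tensor_def tensor_module_def tensor_rel_def tensor_rel_gens_def tensor_free_def tensor_coset_def Let_def opp_def)

text \<open>
  \<open>X\<close> is a comodule algebra to be descended along \<open>T\<close>.
\<close>

locale galois_descent = galois_ff k B T \<beta> U + X: right_comodule_algebra k B X \<chi>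
  for k :: "('k, 'r) ring_scheme" (structure) and B :: "('k, 'b, 'x) bialg_scheme"
    and T :: "('k, 't, 'y) module_scheme" and \<beta> :: "'t \<Rightarrow> ('t \<times> 'b \<Rightarrow> 'k) set" and U :: "'u itself"
    and X :: "('k, 's, 'w) module_scheme" and \<chi> :: "'s \<Rightarrow> ('s \<times> 'b \<Rightarrow> 'k) set" +
  assumes small_X [simp]: "small U (carrier X)"
begin

abbreviation "V \<equiv> X \<boxtimes> T"

lemma X_algebra [simp]: "k_algebra k X" by (rule X.right_algebra)
lemmas [simp] = alg_simps[OF X_algebra]
lemma chi_lin [simp]: "\<chi> \<in> lin_map k X (X \<boxtimes> B)" by (rule alg_hom_lin[OF X.right_coaction_hom])
lemmas [simp] = lin_closed[OF chi_lin] lin_comp[OF chi_lin]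

lemma chi_coassoc: "coassoc k X X B B \<chi> \<chi> \<chi> \<Delta>"
  using X.right_coaction_coassoc by (simp add: coassoc_def)

lemma X_smult [simp]: "c \<in> carrier k \<Longrightarrow> x \<in> carrier X \<Longrightarrow> c \<odot>\<^bsub>X\<^esub> x \<in> carrier X"
  by (rule module.smult_closed[OF k_algebra_module[OF X_algebra]])

lemma chi_counit: "x \<in> carrier X \<Longrightarrow> tlift k X B X (\<lambda>t b. \<epsilon> b \<odot>\<^bsub>X\<^esub> t) (\<chi> x) = x"
  using X.right_coaction_counit by (simp add: right_counit_eq[of X B])

text \<open>
  The product of \<open>X \<otimes> T\<^sup>o\<^sup>p\<close>.
\<close>

definition "opp_mult u v = u \<otimes>\<^bsub>X \<boxtimes> opp T\<^esub> v"

lemma E_algebra: "k_algebra k (X \<boxtimes> opp T)"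
  by (rule tensor_algebra[OF X_algebra opp_algebra[OF T_algebra]])

lemma opp_mult_bilin: "bilin k V V V opp_mult"
  using mult_bilin[OF E_algebra] unfolding bilin_def opp_mult_def[abs_def] by simp

lemmas opp_mult_simps [simp] = bilin_closed[OF opp_mult_bilin] lin_bilin_left[OF opp_mult_bilin] lin_bilin_right[OF opp_mult_bilin]

lemma opp_mult_assoc: "u \<in> carrier V \<Longrightarrow> v \<in> carrier V \<Longrightarrow> w \<in> carrier V \<Longrightarrow> opp_mult (opp_mult u v) w = opp_mult u (opp_mult v w)"
  unfolding opp_mult_def by (rule mult_assoc[OF E_algebra]) simp_all

lemma opp_mult_pure [simp]: "x \<in> carrier X \<Longrightarrow> y \<in> carrier T \<Longrightarrow> x' \<in> carrier X \<Longrightarrow> y' \<in> carrier T \<Longrightarrow>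
    opp_mult (pure k X T x y) (pure k X T x' y') = pure k X T (x \<otimes>\<^bsub>X\<^esub> x') (y' \<cdot> y)"
  using tensor_mult_pure[OF X_algebra opp_algebra[OF T_algebra], of x y x' y'] by (simp add: opp_mult_def)

lemma opp_mult_one: "u \<in> carrier V \<Longrightarrow> opp_mult (pure k X T \<one>\<^bsub>X\<^esub> \<one>\<^bsub>T\<^esub>) u = u" "u \<in> carrier V \<Longrightarrow> opp_mult u (pure k X T \<one>\<^bsub>X\<^esub> \<one>\<^bsub>T\<^esub>) = u"
  using mult_one[OF E_algebra, of u] by (simp_all add: opp_mult_def tensor_one)

text \<open>
  The descent datum \<open>x \<otimes> y \<mapsto> x\<^sub>0 \<otimes> \<tau>(x\<^sub>1) y\<close> on \<open>X \<otimes> T\<close>.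
\<close>

definition "descent u = tlift k X T (V \<boxtimes> T) (\<lambda>x y. tlift k X B (V \<boxtimes> T) (\<lambda>x0 x1.
  tlift k T T (V \<boxtimes> T) (\<lambda>p q. pure k V T (pure k X T x0 p) (q \<cdot> y)) (\<tau> x1)) (\<chi> x)) u"

lemma descent_lin [simp]: "descent \<in> lin_map k V (V \<boxtimes> T)"
  unfolding descent_def[abs_def] by (rule tlift_lin) (simp_all add: bilin_def)

lemmas [simp] = lin_closed[OF descent_lin] lin_comp[OF descent_lin]

lemma descent_pure: "x \<in> carrier X \<Longrightarrow> y \<in> carrier T \<Longrightarrow> descent (pure k X T x y) = tlift k X B (V \<boxtimes> T) (\<lambda>x0 x1.
  tlift k T T (V \<boxtimes> T) (\<lambda>p q. pure k V T (pure k X T x0 p) (q \<cdot> y)) (\<tau> x1)) (\<chi> x)"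
  unfolding descent_def by (simp add: bilin_def)

text \<open>
  \<open>F(X)\<close>; by bijectivity of \<open>can\<close> it consists of the \<open>B\<close>-coinvariants of \<open>X \<otimes> T\<close>.
\<close>

definition "descended = {u \<in> carrier V. descent u = pure k V T u \<one>\<^bsub>T\<^esub>}"

text \<open>
  Multiplication from the right by a descended element \<open>v\<close> commutes with the descent datum. Since \<open>\<tau>\<close> is
  antimultiplicative in its left leg, the factors coming from \<open>v\<close> sit inside those coming from \<open>u\<close>
  and can be collapsed first.
\<close>

lemma descent_opp_mult:
  assumes u: "u \<in> carrier V" and v: "v \<in> descended"
  shows "descent (opp_mult u v) = tlift k V T (V \<boxtimes> T) (\<lambda>m s. pure k V T (opp_mult m v) s) (descent u)"
proof (rule tensor_ext[of X T "V \<boxtimes> T" "\<lambda>u. descent (opp_mult u v)"])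
  have v' [simp]: "v \<in> carrier V" and pv: "descent v = pure k V T v \<one>\<^bsub>T\<^esub>" using v by (auto simp: descended_def)
  fix x y assume [simp]: "x \<in> carrier X" "y \<in> carrier T"
  let ?G = "\<lambda>w. tlift k V T (V \<boxtimes> T) (\<lambda>m s. tlift k X B (V \<boxtimes> T) (\<lambda>x0 x1. tlift k T T (V \<boxtimes> T) (\<lambda>p q.
     pure k V T (opp_mult (pure k X T x0 p) m) (q \<cdot> (s \<cdot> y))) (\<tau> x1)) (\<chi> x)) w"
  have G: "?G \<in> lin_map k (V \<boxtimes> T) (V \<boxtimes> T)" by (rule tlift_lin) (simp_all add: bilin_def)
  have "descent (opp_mult (pure k X T x y) v) = ?G (descent v)"
  proof (rule tensor_ext[of X T "V \<boxtimes> T" "\<lambda>v. descent (opp_mult (pure k X T x y) v)" "\<lambda>v. ?G (descent v)"])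
    fix x' y' assume [simp]: "x' \<in> carrier X" "y' \<in> carrier T"
    have "descent (opp_mult (pure k X T x y) (pure k X T x' y')) =
      tlift k X B (V \<boxtimes> T) (\<lambda>a b. tlift k X B (V \<boxtimes> T) (\<lambda>a' b'. tlift k T T (V \<boxtimes> T) (\<lambda>p q. tlift k T T (V \<boxtimes> T) (\<lambda>p' q'.
        pure k V T (pure k X T (a \<otimes>\<^bsub>X\<^esub> a') (p' \<cdot> p)) (q \<cdot> (q' \<cdot> (y' \<cdot> y)))) (\<tau> b')) (\<tau> b)) (\<chi> x')) (\<chi> x)"
      by (simp add: descent_pure alg_hom_mult_tensor[OF X_algebra X_algebra B_algebra X.right_coaction_hom] tlift_tlift bilin_def tau_mult T_assoc)
    also have "\<dots> = tlift k X B (V \<boxtimes> T) (\<lambda>a' b'. tlift k X B (V \<boxtimes> T) (\<lambda>a b. tlift k T T (V \<boxtimes> T) (\<lambda>p q. tlift k T T (V \<boxtimes> T) (\<lambda>p' q'.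
        pure k V T (pure k X T (a \<otimes>\<^bsub>X\<^esub> a') (p' \<cdot> p)) (q \<cdot> (q' \<cdot> (y' \<cdot> y)))) (\<tau> b')) (\<tau> b)) (\<chi> x)) (\<chi> x')"
      by (rule tlift_swap) simp_all
    also have "\<dots> = tlift k X B (V \<boxtimes> T) (\<lambda>a' b'. tlift k T T (V \<boxtimes> T) (\<lambda>p' q'. tlift k X B (V \<boxtimes> T) (\<lambda>a b. tlift k T T (V \<boxtimes> T) (\<lambda>p q.
        pure k V T (pure k X T (a \<otimes>\<^bsub>X\<^esub> a') (p' \<cdot> p)) (q \<cdot> (q' \<cdot> (y' \<cdot> y)))) (\<tau> b)) (\<chi> x)) (\<tau> b')) (\<chi> x')"
    proof (rule tlift_cong[OF refl])
      fix a' b' assume [simp]: "a' \<in> carrier X" "b' \<in> carrier B"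
      have "tlift k X B (V \<boxtimes> T) (\<lambda>a b. tlift k T T (V \<boxtimes> T) (\<lambda>p q. tlift k T T (V \<boxtimes> T) (\<lambda>p' q'.
        pure k V T (pure k X T (a \<otimes>\<^bsub>X\<^esub> a') (p' \<cdot> p)) (q \<cdot> (q' \<cdot> (y' \<cdot> y)))) (\<tau> b')) (\<tau> b)) (\<chi> x)
        = tlift k X B (V \<boxtimes> T) (\<lambda>a b. tlift k T T (V \<boxtimes> T) (\<lambda>p' q'. tlift k T T (V \<boxtimes> T) (\<lambda>p q.
        pure k V T (pure k X T (a \<otimes>\<^bsub>X\<^esub> a') (p' \<cdot> p)) (q \<cdot> (q' \<cdot> (y' \<cdot> y)))) (\<tau> b)) (\<tau> b')) (\<chi> x)"
        by (rule tlift_cong[OF refl], rule tlift_swap) simp_all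
      also have "\<dots> = tlift k T T (V \<boxtimes> T) (\<lambda>p' q'. tlift k X B (V \<boxtimes> T) (\<lambda>a b. tlift k T T (V \<boxtimes> T) (\<lambda>p q.
        pure k V T (pure k X T (a \<otimes>\<^bsub>X\<^esub> a') (p' \<cdot> p)) (q \<cdot> (q' \<cdot> (y' \<cdot> y)))) (\<tau> b)) (\<chi> x)) (\<tau> b')"
        by (rule tlift_swap) simp_all
      finally show "tlift k X B (V \<boxtimes> T) (\<lambda>a b. tlift k T T (V \<boxtimes> T) (\<lambda>p q. tlift k T T (V \<boxtimes> T) (\<lambda>p' q'.
        pure k V T (pure k X T (a \<otimes>\<^bsub>X\<^esub> a') (p' \<cdot> p)) (q \<cdot> (q' \<cdot> (y' \<cdot> y)))) (\<tau> b')) (\<tau> b)) (\<chi> x) = \<dots>" .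
    qed
    also have "\<dots> = ?G (descent (pure k X T x' y'))"
      by (simp add: descent_pure tlift_tlift bilin_def T_assoc)
    finally show "descent (opp_mult (pure k X T x y) (pure k X T x' y')) = ?G (descent (pure k X T x' y'))" .
  next
    show "(\<lambda>v. ?G (descent v)) \<in> lin_map k V (V \<boxtimes> T)" by (rule lin_comp[OF G descent_lin])
  qed simp_all
  also have "\<dots> = tlift k X B (V \<boxtimes> T) (\<lambda>x0 x1. tlift k T T (V \<boxtimes> T) (\<lambda>p q.
     pure k V T (opp_mult (pure k X T x0 p) v) (q \<cdot> y)) (\<tau> x1)) (\<chi> x)"
    unfolding pv by (simp add: bilin_def)
  also have "\<dots> = tlift k V T (V \<boxtimes> T) (\<lambda>m s. pure k V T (opp_mult m v) s) (descent (pure k X T x y))"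
    by (simp add: descent_pure tlift_tlift bilin_def)
  finally show "descent (opp_mult (pure k X T x y) v) = tlift k V T (V \<boxtimes> T) (\<lambda>m s. pure k V T (opp_mult m v) s) (descent (pure k X T x y))" .
qed (use assms in \<open>simp_all add: bilin_def descended_def\<close>)

lemma descended_opp_mult: "u \<in> descended \<Longrightarrow> v \<in> descended \<Longrightarrow> opp_mult u v \<in> descended"
  using descent_opp_mult[of u v] by (simp add: descended_def bilin_def)

lemma descended_one: "pure k X T \<one>\<^bsub>X\<^esub> \<one>\<^bsub>T\<^esub> \<in> descended"
  by (simp add: descended_def descent_pure alg_hom_one[OF X.right_coaction_hom] tensor_one bilin_def tau_one)

lemma descended_V [simp]: "u \<in> descended \<Longrightarrow> u \<in> carrier V" by (simp add: descended_def)

text \<open>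
  The right action of \<open>T\<close> on the second factor of \<open>X \<otimes> T\<close>.
\<close>

definition "right_act m t = tlift k X T V (\<lambda>x y. pure k X T x (y \<cdot> t)) m"

lemma right_act_bilin: "bilin k V T V right_act"
  unfolding right_act_def[abs_def] by (simp add: bilin_def)

lemmas right_act_simps [simp] = bilin_closed[OF right_act_bilin] lin_bilin_left[OF right_act_bilin] lin_bilin_right[OF right_act_bilin]

lemma right_act_pure [simp]: "x \<in> carrier X \<Longrightarrow> y \<in> carrier T \<Longrightarrow> t \<in> carrier T \<Longrightarrow> right_act (pure k X T x y) t = pure k X T x (y \<cdot> t)"
  by (simp add: right_act_def bilin_def)

lemma right_act_right_act: "m \<in> carrier V \<Longrightarrow> s \<in> carrier T \<Longrightarrow> t \<in> carrier T \<Longrightarrow> right_act (right_act m s) t = right_act m (s \<cdot> t)"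
  by (rule tensor_ext[of X T V "\<lambda>m. right_act (right_act m s) t" "\<lambda>m. right_act m (s \<cdot> t)"]) (simp_all add: T_assoc)

lemma right_act_one: "m \<in> carrier V \<Longrightarrow> right_act m \<one>\<^bsub>T\<^esub> = m"
  by (rule tensor_ext[of X T V "\<lambda>m. right_act m \<one>\<^bsub>T\<^esub>" "\<lambda>m. m"]) simp_all

lemma descent_right_act: "m \<in> carrier V \<Longrightarrow> t \<in> carrier T \<Longrightarrow>
   descent (right_act m t) = tlift k V T (V \<boxtimes> T) (\<lambda>m s. pure k V T m (s \<cdot> t)) (descent m)"
  by (rule tensor_ext[of X T "V \<boxtimes> T" "\<lambda>m. descent (right_act m t)"])
    (simp_all add: bilin_def descent_pure tlift_tlift T_assoc)

end


text \<open>
  \<open>Q\<close> is any record with the algebra structure of \<open>F(X)\<close>. It may have more fields: for \<open>X = T\<close> it is to become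
  a bialgebra whose comultiplication is found only with the help of the results of this locale.
\<close>

locale descended_algebra = galois_descent k B T \<beta> U X \<chi>
  for k :: "('k, 'r) ring_scheme" (structure) and B :: "('k, 'b, 'x) bialg_scheme"
    and T :: "('k, 't, 'y) module_scheme" and \<beta> :: "'t \<Rightarrow> ('t \<times> 'b \<Rightarrow> 'k) set" and U :: "'u itself"
    and X :: "('k, 's, 'w) module_scheme" and \<chi> :: "'s \<Rightarrow> ('s \<times> 'b \<Rightarrow> 'k) set" +
  fixes Q :: "('k, ('s \<times> 't \<Rightarrow> 'k) set, 'q) module_scheme"
  assumes Q_carrier: "carrier Q = descended" and Q_add: "add Q = add V" and Q_zero: "zero Q = zero V"
    and Q_smult: "smult Q = smult V" and Q_mult: "mult Q = opp_mult" and Q_one: "one Q = pure k X T \<one>\<^bsub>X\<^esub> \<one>\<^bsub>T\<^esub>"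
begin

lemma Q_V [simp]: "a \<in> carrier Q \<Longrightarrow> a \<in> carrier V" by (simp add: Q_carrier)

lemma Q_iff: "a \<in> carrier Q \<longleftrightarrow> a \<in> carrier V \<and> descent a = pure k V T a \<one>\<^bsub>T\<^esub>"
  unfolding Q_carrier by (simp only: descended_def mem_Collect_eq)

lemma Q_descent: "a \<in> carrier Q \<Longrightarrow> descent a = pure k V T a \<one>\<^bsub>T\<^esub>" by (simp add: Q_iff)

lemma Q_module [simp]: "module k Q"
proof -
  interpret V: module k V by simp
  interpret VT: module k "V \<boxtimes> T" by simp
  have l: "(\<lambda>a. pure k V T a \<one>\<^bsub>T\<^esub>) \<in> lin_map k V (V \<boxtimes> T)" by simp
  note pl = lin_add[OF l] lin_smult[OF l] lin_zero[OF V.module_axioms VT.module_axioms l] lin_neg[OF V.module_axioms VT.module_axioms l]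
    lin_add[OF descent_lin] lin_smult[OF descent_lin] lin_zero[OF V.module_axioms VT.module_axioms descent_lin] lin_neg[OF V.module_axioms VT.module_axioms descent_lin]
  show ?thesis
  proof (rule moduleI)
    show "abelian_group Q"
    proof (rule abelian_groupI)
      fix x assume x: "x \<in> carrier Q"
      show "\<exists>y\<in>carrier Q. y \<oplus>\<^bsub>Q\<^esub> x = \<zero>\<^bsub>Q\<^esub>"
        by (rule bexI[of _ "\<ominus>\<^bsub>V\<^esub> x"]) (use x in \<open>simp_all add: Q_iff Q_add Q_zero pl V.l_neg del: Q_V descended_V\<close>)
    qed (simp_all add: Q_iff Q_add Q_zero pl V.a_ac del: Q_V descended_V)
  qed (simp_all add: Q_iff Q_add Q_smult pl R.is_cring V.smult_l_distr V.smult_r_distr V.smult_assoc1 del: Q_V descended_V)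
qed

lemma Q_lin_V: "f \<in> lin_map k Q P" if "f \<in> lin_map k V P"
  using that by (simp add: lin_map_def Q_add Q_smult Pi_def)

lemma Q_incl [simp]: "(\<lambda>a. a) \<in> lin_map k Q V" by (rule Q_lin_V) simp

lemma lin_into_Q: "g \<in> lin_map k L V \<Longrightarrow> (\<And>x. x \<in> carrier L \<Longrightarrow> g x \<in> carrier Q) \<Longrightarrow> g \<in> lin_map k L Q"
  by (simp add: lin_map_def Q_add Q_smult)

lemma Q_algebra [simp]: "k_algebra k Q"
proof (rule k_algebraI)
  show "bilin k Q Q Q (mult Q)"
    unfolding bilin_def Q_mult
    by (intro conjI allI impI lin_into_Q lin_bilin_left[OF opp_mult_bilin] lin_bilin_right[OF opp_mult_bilin])
      (simp_all, simp_all add: Q_carrier descended_opp_mult)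
qed (simp_all add: Q_mult opp_mult_assoc Q_one opp_mult_one, simp_all add: Q_carrier descended_opp_mult descended_one)

lemmas [simp] = alg_simps(2-)[OF Q_algebra]

lemma small_Q [simp]: "small U (carrier Q)"
  by (rule small_subset[of U "carrier V"]) (use Q_V in auto)

text \<open>
  The inclusion of \<open>F(X) \<otimes> T\<close> into \<open>(X \<otimes> T) \<otimes> T\<close>, injective by flatness.
\<close>

definition "\<iota> = tensor_map k V T (\<lambda>a. a) id"

lemma iota_lin: "\<iota> \<in> lin_map k (Q \<boxtimes> T) (V \<boxtimes> T)"
  unfolding \<iota>_def by (rule tensor_map_lin) simp_all

lemma iota_pure: "a \<in> carrier Q \<Longrightarrow> t \<in> carrier T \<Longrightarrow> \<iota> (pure k Q T a t) = pure k V T a t"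
  unfolding \<iota>_def by (subst tensor_map_pure[of Q T V T]) simp_all

lemma iota_inj: "inj_on \<iota> (carrier (Q \<boxtimes> T))"
  unfolding \<iota>_def by (subst ff_inj[symmetric]) simp_all

text \<open>
  \<open>F(X) \<otimes> T \<rightarrow> X \<otimes> T\<close>, \<open>a \<otimes> t \<mapsto> a t\<close>.
\<close>

definition "\<Phi> w = tlift k Q T V (\<lambda>a t. right_act a t) w"

lemma right_act_Q_bilin: "bilin k Q T V right_act"
  using right_act_bilin by (auto simp: bilin_def intro: Q_lin_V)

lemma phi_lin: "\<Phi> \<in> lin_map k (Q \<boxtimes> T) V"
  unfolding \<Phi>_def[abs_def] by (rule tlift_lin) (simp_all add: right_act_Q_bilin)

lemma phi_pure: "a \<in> carrier Q \<Longrightarrow> t \<in> carrier T \<Longrightarrow> \<Phi> (pure k Q T a t) = right_act a t"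
  unfolding \<Phi>_def by (simp add: right_act_Q_bilin)

text \<open>
  The descent datum is linear over \<open>T\<close> and sends \<open>a\<close> in \<open>F(X)\<close> to \<open>a \<otimes> 1\<close>; therefore it inverts \<open>\<Phi>\<close> from the left
  up to the inclusion \<open>\<iota>\<close>.
\<close>

lemma descent_phi: "w \<in> carrier (Q \<boxtimes> T) \<Longrightarrow> descent (\<Phi> w) = \<iota> w"
  by (rule tensor_ext[of Q T "V \<boxtimes> T", OF _ _ _ lin_comp[OF descent_lin phi_lin] iota_lin])
    (simp_all add: phi_pure iota_pure descent_right_act Q_descent bilin_def)

definition "act_map = tlift k V T V (\<lambda>m t. right_act m t)"

lemma act_map_lin: "act_map \<in> lin_map k (V \<boxtimes> T) V"
  unfolding act_map_def by (rule tlift_lin) (simp_all add: right_act_bilin)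

lemma act_map_iota: "w \<in> carrier (Q \<boxtimes> T) \<Longrightarrow> act_map (\<iota> w) = \<Phi> w"
  by (rule tensor_ext[of Q T V, OF _ _ _ lin_comp[OF act_map_lin iota_lin] phi_lin])
    (simp_all add: phi_pure iota_pure act_map_def right_act_bilin)

lemma act_map_descent: "m \<in> carrier V \<Longrightarrow> act_map (descent m) = m"
proof (rule tensor_ext[of X T V, OF _ _ _ lin_comp[OF act_map_lin descent_lin] lin_id(1)])
  fix x y assume [simp]: "x \<in> carrier X" "y \<in> carrier T"
  have "act_map (descent (pure k X T x y)) = tlift k X B V (\<lambda>x0 x1. tlift k T T V (\<lambda>p q. pure k X T x0 ((p \<cdot> q) \<cdot> y)) (\<tau> x1)) (\<chi> x)"
    by (simp add: act_map_def descent_pure tlift_tlift right_act_bilin T_assoc)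
  also have "\<dots> = tlift k X B V (\<lambda>x0 x1. pure k X T (\<epsilon> x1 \<odot>\<^bsub>X\<^esub> x0) y) (\<chi> x)"
  proof (rule tlift_cong[OF refl])
    fix x0 x1 assume [simp]: "x0 \<in> carrier X" "x1 \<in> carrier B"
    have "tlift k T T V (\<lambda>p q. pure k X T x0 ((p \<cdot> q) \<cdot> y)) (\<tau> x1) = pure k X T x0 (tlift k T T T (\<lambda>p q. p \<cdot> q) (\<tau> x1) \<cdot> y)"
      by (rule tlift_push[symmetric, where h="\<lambda>z. pure k X T x0 (z \<cdot> y)"]) simp_all
    also have "\<dots> = pure k X T x0 (\<epsilon> x1 \<odot>\<^bsub>T\<^esub> y)"
      by (simp add: tau_mult_map k_algebra.smult_mult_left[OF T_algebra])
    also have "\<dots> = \<epsilon> x1 \<odot>\<^bsub>V\<^esub> pure k X T x0 y" by (rule lin_smult[of "\<lambda>y. pure k X T x0 y" k]) simp_all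
    also have "\<dots> = pure k X T (\<epsilon> x1 \<odot>\<^bsub>X\<^esub> x0) y" by (rule lin_smult[of "\<lambda>x. pure k X T x y" k, symmetric]) simp_all
    finally show "tlift k T T V (\<lambda>p q. pure k X T x0 ((p \<cdot> q) \<cdot> y)) (\<tau> x1) = pure k X T (\<epsilon> x1 \<odot>\<^bsub>X\<^esub> x0) y" .
  qed
  also have "\<dots> = pure k X T (tlift k X B X (\<lambda>t b. \<epsilon> b \<odot>\<^bsub>X\<^esub> t) (\<chi> x)) y"
    by (rule tlift_push[symmetric, where h="\<lambda>z. pure k X T z y"]) simp_all
  finally show "act_map (descent (pure k X T x y)) = pure k X T x y" by (simp add: chi_counit)
qed simp_all

lemma descent_cocycle:
  assumes "m \<in> carrier V"
  shows "tensor_map k (V \<boxtimes> T) T descent id (descent m) = tensor_map k (V \<boxtimes> T) T (\<lambda>m. pure k V T m \<one>\<^bsub>T\<^esub>) id (descent m)"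
proof (rule tensor_ext[of X T "(V \<boxtimes> T) \<boxtimes> T", OF _ _ _ _ _ _ assms])
  let ?W = "(V \<boxtimes> T) \<boxtimes> T"
  have l: "(\<lambda>m. pure k V T m \<one>\<^bsub>T\<^esub>) \<in> lin_map k V (V \<boxtimes> T)" by simp
  have L1: "tensor_map k (V \<boxtimes> T) T descent id \<in> lin_map k (V \<boxtimes> T) ?W" by (rule tensor_map_lin) simp_all
  have L2: "tensor_map k (V \<boxtimes> T) T (\<lambda>m. pure k V T m \<one>\<^bsub>T\<^esub>) id \<in> lin_map k (V \<boxtimes> T) ?W" by (rule tensor_map_lin) simp_all
  show "(\<lambda>m. tensor_map k (V \<boxtimes> T) T descent id (descent m)) \<in> lin_map k V ?W" by (rule lin_comp[OF L1 descent_lin])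
  show "(\<lambda>m. tensor_map k (V \<boxtimes> T) T (\<lambda>m. pure k V T m \<one>\<^bsub>T\<^esub>) id (descent m)) \<in> lin_map k V ?W" by (rule lin_comp[OF L2 descent_lin])
  fix x y assume [simp]: "x \<in> carrier X" "y \<in> carrier T"
  have "tensor_map k (V \<boxtimes> T) T descent id (descent (pure k X T x y)) = tlift k X B ?W (\<lambda>x0 x1. tlift k T T ?W (\<lambda>p q.
     pure k (V \<boxtimes> T) T (descent (pure k X T x0 p)) (q \<cdot> y)) (\<tau> x1)) (\<chi> x)"
    by (simp add: descent_pure[of x y], subst tlift_push[OF _ _ _ _ L1], simp_all, rule tlift_cong[OF refl], subst tlift_push[OF _ _ _ _ L1], simp_all add: tensor_map_pure[of V T "V \<boxtimes> T" T])
  also have "\<dots> = tlift k X B ?W (\<lambda>x0 x1. tlift k X B ?W (\<lambda>x00 x01. tlift k T T ?W (\<lambda>p q. tlift k T T ?W (\<lambda>p' q'.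
     pure k (V \<boxtimes> T) T (pure k V T (pure k X T x00 p') (q' \<cdot> p)) (q \<cdot> y)) (\<tau> x01)) (\<tau> x1)) (\<chi> x0)) (\<chi> x)"
  proof (rule tlift_cong[OF refl])
    fix x0 x1 assume [simp]: "x0 \<in> carrier X" "x1 \<in> carrier B"
    have "tlift k T T ?W (\<lambda>p q. pure k (V \<boxtimes> T) T (descent (pure k X T x0 p)) (q \<cdot> y)) (\<tau> x1) =
      tlift k T T ?W (\<lambda>p q. tlift k X B ?W (\<lambda>x00 x01. tlift k T T ?W (\<lambda>p' q'.
     pure k (V \<boxtimes> T) T (pure k V T (pure k X T x00 p') (q' \<cdot> p)) (q \<cdot> y)) (\<tau> x01)) (\<chi> x0)) (\<tau> x1)"
    proof (rule tlift_cong[OF refl])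
      fix p q assume [simp]: "p \<in> carrier T" "q \<in> carrier T"
      show "pure k (V \<boxtimes> T) T (descent (pure k X T x0 p)) (q \<cdot> y) = tlift k X B ?W (\<lambda>x00 x01. tlift k T T ?W (\<lambda>p' q'.
        pure k (V \<boxtimes> T) T (pure k V T (pure k X T x00 p') (q' \<cdot> p)) (q \<cdot> y)) (\<tau> x01)) (\<chi> x0)"
      proof -
        let ?h = "\<lambda>z. pure k (V \<boxtimes> T) T z (q \<cdot> y)"
        let ?F = "\<lambda>x00 x01. tlift k T T (V \<boxtimes> T) (\<lambda>p' q'. pure k V T (pure k X T x00 p') (q' \<cdot> p)) (\<tau> x01)"
        have "?h (descent (pure k X T x0 p)) = ?h (tlift k X B (V \<boxtimes> T) ?F (\<chi> x0))" by (simp add: descent_pure)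
        also have "\<dots> = tlift k X B ?W (\<lambda>x00 x01. ?h (?F x00 x01)) (\<chi> x0)"
          by (rule tlift_push[where h="?h"]) simp_all
        also have "\<dots> = tlift k X B ?W (\<lambda>x00 x01. tlift k T T ?W (\<lambda>p' q'. ?h (pure k V T (pure k X T x00 p') (q' \<cdot> p))) (\<tau> x01)) (\<chi> x0)"
          by (intro tlift_cong[OF refl] tlift_push[where h="?h"]) simp_all
        finally show ?thesis .
      qed
    qed
    also have "\<dots> = tlift k X B ?W (\<lambda>x00 x01. tlift k T T ?W (\<lambda>p q. tlift k T T ?W (\<lambda>p' q'.
     pure k (V \<boxtimes> T) T (pure k V T (pure k X T x00 p') (q' \<cdot> p)) (q \<cdot> y)) (\<tau> x01)) (\<tau> x1)) (\<chi> x0)"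
      by (rule tlift_swap) simp_all
    finally show "tlift k T T ?W (\<lambda>p q. pure k (V \<boxtimes> T) T (descent (pure k X T x0 p)) (q \<cdot> y)) (\<tau> x1) = \<dots>" .
  qed
  also have "\<dots> = tlift k X B ?W (\<lambda>x0 c. tlift k B B ?W (\<lambda>x01 x1. tlift k T T ?W (\<lambda>p q. tlift k T T ?W (\<lambda>p' q'.
     pure k (V \<boxtimes> T) T (pure k V T (pure k X T x0 p') (q' \<cdot> p)) (q \<cdot> y)) (\<tau> x01)) (\<tau> x1)) (\<Delta> c)) (\<chi> x)"
    by (rule coassocD[OF chi_coassoc]) (simp_all add: bilin_def)
  also have "\<dots> = tlift k X B ?W (\<lambda>x0 c. tlift k B B ?W (\<lambda>x01 x1. tlift k T T ?W (\<lambda>p' q'. tlift k T T ?W (\<lambda>p q.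
     pure k (V \<boxtimes> T) T (pure k V T (pure k X T x0 p') (q' \<cdot> p)) (q \<cdot> y)) (\<tau> x1)) (\<tau> x01)) (\<Delta> c)) (\<chi> x)"
    by (intro tlift_cong[OF refl] tlift_swap) simp_all
  also have "\<dots> = tlift k X B ?W (\<lambda>x0 c. tlift k T T ?W (\<lambda>p q.
     pure k (V \<boxtimes> T) T (pure k V T (pure k X T x0 p) \<one>\<^bsub>T\<^esub>) (q \<cdot> y)) (\<tau> c)) (\<chi> x)"
    by (rule tlift_cong[OF refl], rule tau_cocycle) simp_all
  also have "\<dots> = tensor_map k (V \<boxtimes> T) T (\<lambda>m. pure k V T m \<one>\<^bsub>T\<^esub>) id (descent (pure k X T x y))"
    by (simp add: descent_pure[of x y], subst tlift_push[OF _ _ _ _ L2], simp_all, rule tlift_cong[OF refl], subst tlift_push[OF _ _ _ _ L2], simp_all add: tensor_map_pure[of V T "V \<boxtimes> T" T])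
  finally show "tensor_map k (V \<boxtimes> T) T descent id (descent (pure k X T x y)) = tensor_map k (V \<boxtimes> T) T (\<lambda>m. pure k V T m \<one>\<^bsub>T\<^esub>) id (descent (pure k X T x y))" .
qed simp_all

text \<open>
  By the cocycle condition \<open>descent m\<close> lies in the kernel that, by flatness, is \<open>F(X) \<otimes> T\<close>. The
  element found there is mapped to \<open>m\<close> because multiplying the two factors of \<open>\<tau>\<close> gives the counit.
\<close>

lemma phi_surj:
  assumes m: "m \<in> carrier V"
  obtains w where "w \<in> carrier (Q \<boxtimes> T)" "\<Phi> w = m"
proof -
  let ?d = "\<lambda>m. descent m \<ominus>\<^bsub>V \<boxtimes> T\<^esub> pure k V T m \<one>\<^bsub>T\<^esub>"
  have d: "?d \<in> lin_map k V (V \<boxtimes> T)" by (rule lin_diff) simp_all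
  have "exact_at Q V (V \<boxtimes> T) (\<lambda>a. a) ?d"
  proof -
    have "{x \<in> carrier V. ?d x = \<zero>\<^bsub>V \<boxtimes> T\<^esub>} = descended"
      unfolding descended_def by (intro Collect_cong conj_cong refl module_diff_eq_zero[of k]) simp_all
    then show ?thesis by (simp add: exact_at_def a_kernel_def' Q_carrier)
  qed
  then have e: "exact_at (Q \<boxtimes> T) (V \<boxtimes> T) ((V \<boxtimes> T) \<boxtimes> T) \<iota> (tensor_map k (V \<boxtimes> T) T ?d id)"
    unfolding \<iota>_def by (subst (asm) ff_exact) (simp_all add: d)
  have dd: "tensor_map k (V \<boxtimes> T) T ?d id w = tensor_map k (V \<boxtimes> T) T descent id w \<ominus>\<^bsub>(V \<boxtimes> T) \<boxtimes> T\<^esub> tensor_map k (V \<boxtimes> T) T (\<lambda>m. pure k V T m \<one>\<^bsub>T\<^esub>) id w"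
    if "w \<in> carrier (V \<boxtimes> T)" for w
  proof (rule tensor_ext[OF _ _ _ tensor_map_lin lin_diff[OF _ tensor_map_lin tensor_map_lin] _ that])
    fix m t assume [simp]: "m \<in> carrier V" "t \<in> carrier T"
    have "pure k (V \<boxtimes> T) T (?d m) t = pure k (V \<boxtimes> T) T (descent m) t \<ominus>\<^bsub>(V \<boxtimes> T) \<boxtimes> T\<^esub> pure k (V \<boxtimes> T) T (pure k V T m \<one>\<^bsub>T\<^esub>) t"
      by (rule lin_sub[of k "V \<boxtimes> T" _ "\<lambda>z. pure k (V \<boxtimes> T) T z t"]) simp_all
    then show "tensor_map k (V \<boxtimes> T) T ?d id (pure k V T m t) = tensor_map k (V \<boxtimes> T) T descent id (pure k V T m t) \<ominus>\<^bsub>(V \<boxtimes> T) \<boxtimes> T\<^esub> tensor_map k (V \<boxtimes> T) T (\<lambda>m. pure k V T m \<one>\<^bsub>T\<^esub>) id (pure k V T m t)"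
      by (simp add: tensor_map_pure[of V T "V \<boxtimes> T" T] d)
  qed (simp_all add: d)
  have "tensor_map k (V \<boxtimes> T) T descent id (descent m) \<in> carrier ((V \<boxtimes> T) \<boxtimes> T)"
    by (rule lin_closed[OF tensor_map_lin[of V T]]) (simp_all add: m)
  then have "descent m \<in> a_kernel (V \<boxtimes> T) ((V \<boxtimes> T) \<boxtimes> T) (tensor_map k (V \<boxtimes> T) T ?d id)"
    using m by (simp add: a_kernel_def' dd descent_cocycle module_diff_eq_zero[of k])
  then obtain w where w: "w \<in> carrier (Q \<boxtimes> T)" "descent m = \<iota> w" using e unfolding exact_at_def by blast
  then have "\<Phi> w = m" using act_map_iota[OF w(1)] act_map_descent[OF m] by simp
  then show thesis using that w by blast
qed

lemma phi_bij: "bij_betw \<Phi> (carrier (Q \<boxtimes> T)) (carrier V)"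
proof (rule bij_betw_imageI)
  show "inj_on \<Phi> (carrier (Q \<boxtimes> T))"
  proof (rule inj_onI)
    fix w w' assume w: "w \<in> carrier (Q \<boxtimes> T)" "w' \<in> carrier (Q \<boxtimes> T)" "\<Phi> w = \<Phi> w'"
    then have "\<iota> w = \<iota> w'" by (simp add: descent_phi[symmetric])
    then show "w = w'" by (rule inj_onD[OF iota_inj]) fact+
  qed
  show "\<Phi> ` carrier (Q \<boxtimes> T) = carrier V"
    using phi_surj lin_closed[OF phi_lin] by blast
qed

lemma phi_inj: "\<Phi> w = \<Phi> w' \<Longrightarrow> w \<in> carrier (Q \<boxtimes> T) \<Longrightarrow> w' \<in> carrier (Q \<boxtimes> T) \<Longrightarrow> w = w'"
  using phi_bij by (auto simp: bij_betw_def inj_on_def)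

text \<open>
  The universal map \<open>X \<rightarrow> F(X) \<otimes> T\<close>; as a map to \<open>(X \<otimes> T) \<otimes> T\<close> it is \<open>x \<mapsto> x\<^sub>0 \<otimes> \<tau>(x\<^sub>1)\<close>, see \<open>kappa_sum\<close>.
\<close>

definition "\<kappa> x = inv_into (carrier (Q \<boxtimes> T)) \<Phi> (pure k X T x \<one>\<^bsub>T\<^esub>)"

lemma kappa_lin [simp]: "\<kappa> \<in> lin_map k X (Q \<boxtimes> T)"
  unfolding \<kappa>_def[abs_def] by (rule lin_comp[OF lin_inv_into[OF _ _ phi_lin phi_bij]]) simp_all

lemmas [simp] = lin_closed[OF kappa_lin] lin_comp[OF kappa_lin]

lemma phi_kappa: "x \<in> carrier X \<Longrightarrow> \<Phi> (\<kappa> x) = pure k X T x \<one>\<^bsub>T\<^esub>"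
  unfolding \<kappa>_def using phi_bij by (auto simp: bij_betw_def f_inv_into_f)

lemma kappa_sum:
  assumes P: "module k P" and x: "x \<in> carrier X" and h: "bilin k V T P h"
  shows "tlift k Q T P (\<lambda>a t. h a t) (\<kappa> x) = tlift k X B P (\<lambda>x0 x1. tlift k T T P (\<lambda>p q. h (pure k X T x0 p) q) (\<tau> x1)) (\<chi> x)"
proof -
  note [simp] = P x bilin_closed[OF h] lin_bilin_left[OF h] lin_bilin_right[OF h] h
  have hQ: "bilin k Q T P h" using h by (auto simp: bilin_def intro: Q_lin_V)
  have "tlift k Q T P h w = tlift k V T P h (\<iota> w)" if "w \<in> carrier (Q \<boxtimes> T)" for w
    by (rule tensor_ext[OF _ _ _ tlift_lin lin_comp[OF tlift_lin iota_lin] _ that])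
      (simp_all add: hQ iota_pure)
  then have "tlift k Q T P h (\<kappa> x) = tlift k V T P h (descent (pure k X T x \<one>\<^bsub>T\<^esub>))"
    using descent_phi[of "\<kappa> x"] by (simp add: phi_kappa)
  also have "\<dots> = tlift k X B P (\<lambda>x0 x1. tlift k T T P (\<lambda>p q. h (pure k X T x0 p) q) (\<tau> x1)) (\<chi> x)"
    by (simp add: descent_pure tlift_tlift)
  finally show ?thesis .
qed

lemma phi_rmul: "w \<in> carrier (Q \<boxtimes> T) \<Longrightarrow> y \<in> carrier T \<Longrightarrow>
   \<Phi> (tlift k Q T (Q \<boxtimes> T) (\<lambda>a t. pure k Q T a (t \<cdot> y)) w) = right_act (\<Phi> w) y"
  by (rule tensor_ext[of Q T V "\<lambda>w. \<Phi> (tlift k Q T (Q \<boxtimes> T) (\<lambda>a t. pure k Q T a (t \<cdot> y)) w)" "\<lambda>w. right_act (\<Phi> w) y"])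
    (simp_all add: bilin_def phi_lin lin_comp[OF phi_lin] phi_pure right_act_right_act)

text \<open>
  An element \<open>a = \<Sum> x \<otimes> y\<close> of \<open>F(X)\<close> is recovered from \<open>\<kappa>\<close> by \<open>\<Sum> \<kappa>(x) y = a \<otimes> 1\<close>: both sides
  have the image \<open>a\<close> under \<open>\<Phi>\<close>. This is what makes maps out of \<open>F(X)\<close> determined by \<open>\<kappa>\<close>.
\<close>

lemma Q_expand:
  assumes a: "a \<in> carrier Q"
  shows "tlift k X T (Q \<boxtimes> T) (\<lambda>x y. tlift k Q T (Q \<boxtimes> T) (\<lambda>a t. pure k Q T a (t \<cdot> y)) (\<kappa> x)) a = pure k Q T a \<one>\<^bsub>T\<^esub>"
proof (rule phi_inj)
  note [simp] = a
  have "\<Phi> (tlift k X T (Q \<boxtimes> T) (\<lambda>x y. tlift k Q T (Q \<boxtimes> T) (\<lambda>a t. pure k Q T a (t \<cdot> y)) (\<kappa> x)) a) =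
    tlift k X T V (\<lambda>x y. pure k X T x y) a"
    by (subst tlift_push[OF _ _ _ _ phi_lin]) (simp_all add: phi_rmul phi_kappa)
  then show "\<Phi> (tlift k X T (Q \<boxtimes> T) (\<lambda>x y. tlift k Q T (Q \<boxtimes> T) (\<lambda>a t. pure k Q T a (t \<cdot> y)) (\<kappa> x)) a) = \<Phi> (pure k Q T a \<one>\<^bsub>T\<^esub>)"
    by (simp add: tlift_eta phi_pure right_act_one)
qed (use a in \<open>simp_all add: bilin_def\<close>)

lemma Q_expand':
  assumes P: "module k P" and a: "a \<in> carrier Q" and f: "bilin k Q T P f"
  shows "tlift k X T P (\<lambda>x y. tlift k Q T P (\<lambda>a t. f a (t \<cdot> y)) (\<kappa> x)) a = f a \<one>\<^bsub>T\<^esub>"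
proof -
  note [simp] = P a bilin_closed[OF f] lin_bilin_left[OF f] lin_bilin_right[OF f] f
  have "f a \<one>\<^bsub>T\<^esub> = tlift k Q T P f (tlift k X T (Q \<boxtimes> T) (\<lambda>x y. tlift k Q T (Q \<boxtimes> T) (\<lambda>a t. pure k Q T a (t \<cdot> y)) (\<kappa> x)) a)"
    by (simp add: Q_expand)
  also have "\<dots> = tlift k X T P (\<lambda>x y. tlift k Q T P (\<lambda>a t. f a (t \<cdot> y)) (\<kappa> x)) a"
    by (simp add: tlift_tlift)
  finally show ?thesis ..
qed

end

section \<open>The universal property of the descended algebra\<close>


context descended_algebra begin

lemma opp_mult_right_act: "a \<in> carrier V \<Longrightarrow> m \<in> carrier V \<Longrightarrow> t \<in> carrier T \<Longrightarrow> s \<in> carrier T \<Longrightarrow>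
  right_act (opp_mult a m) (t \<cdot> s) = right_act (opp_mult (right_act a t) m) s"
proof (rule tensor_ext[of X T V "\<lambda>m. right_act (opp_mult a m) (t \<cdot> s)"])
  assume [simp]: "a \<in> carrier V" "t \<in> carrier T" "s \<in> carrier T"
  fix x' y' assume [simp]: "x' \<in> carrier X" "y' \<in> carrier T"
  show "right_act (opp_mult a (pure k X T x' y')) (t \<cdot> s) = right_act (opp_mult (right_act a t) (pure k X T x' y')) s"
    by (rule tensor_ext[of X T V "\<lambda>a. right_act (opp_mult a (pure k X T x' y')) (t \<cdot> s)" "\<lambda>a. right_act (opp_mult (right_act a t) (pure k X T x' y')) s"])
      (simp_all add: T_assoc)
qed simp_all

lemma Q_mult_bilin: "bilin k Q Q Q opp_mult"
  using mult_bilin[OF Q_algebra] by (simp add: Q_mult)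

lemma Q_opp_mult [simp]: "a \<in> carrier Q \<Longrightarrow> b \<in> carrier Q \<Longrightarrow> opp_mult a b \<in> carrier Q"
  by (rule bilin_closed[OF Q_mult_bilin])

lemma phi_mult:
  assumes w: "w \<in> carrier (Q \<boxtimes> T)" and w': "w' \<in> carrier (Q \<boxtimes> T)"
  shows "\<Phi> (w \<otimes>\<^bsub>Q \<boxtimes> T\<^esub> w') = tlift k Q T V (\<lambda>a' t'. right_act (opp_mult (\<Phi> w) a') t') w'"
proof -
  note [simp] = lin_bilin_left[OF Q_mult_bilin] lin_bilin_right[OF Q_mult_bilin] phi_lin lin_comp[OF phi_lin] lin_closed[OF phi_lin]
    alg_simps[OF tensor_algebra[OF Q_algebra T_algebra]]
  show ?thesis
  proof (rule tensor_ext[OF _ _ _ _ _ _ w, of V "\<lambda>w. \<Phi> (w \<otimes>\<^bsub>Q \<boxtimes> T\<^esub> w')"])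
    fix a t assume [simp]: "a \<in> carrier Q" "t \<in> carrier T"
    show "\<Phi> (pure k Q T a t \<otimes>\<^bsub>Q \<boxtimes> T\<^esub> w') = tlift k Q T V (\<lambda>a' t'. right_act (opp_mult (\<Phi> (pure k Q T a t)) a') t') w'"
      by (rule tensor_ext[OF _ _ _ _ _ _ w', of V "\<lambda>w'. \<Phi> (pure k Q T a t \<otimes>\<^bsub>Q \<boxtimes> T\<^esub> w')"])
        (use w' in \<open>simp_all add: phi_pure bilin_def tensor_mult_pure Q_mult opp_mult_right_act Q_lin_V\<close>)
  qed (use w' in \<open>simp_all add: bilin_def\<close>)
qed

text \<open>
  \<open>\<Phi>\<close> is no algebra map, but \<open>\<Phi>(w w')\<close> depends on \<open>w\<close> only through \<open>\<Phi>(w)\<close>, and left multiplication by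
  \<open>x \<otimes> 1\<close> commutes with the right action of \<open>T\<close>.
\<close>

lemma kappa_hom: "\<kappa> \<in> alg_hom k X (Q \<boxtimes> T)"
proof (rule alg_homI)
  note [simp] = alg_simps[OF tensor_algebra[OF Q_algebra T_algebra]]
  fix x x' assume [simp]: "x \<in> carrier X" "x' \<in> carrier X"
  have e: "right_act (opp_mult (pure k X T x \<one>\<^bsub>T\<^esub>) a') t' = opp_mult (pure k X T x \<one>\<^bsub>T\<^esub>) (right_act a' t')" if "a' \<in> carrier V" "t' \<in> carrier T" for a' t'
    by (rule tensor_ext[OF _ _ _ _ _ _ that(1), of V "\<lambda>a'. right_act (opp_mult (pure k X T x \<one>\<^bsub>T\<^esub>) a') t'"])
      (use that in simp_all)
  have "\<Phi> (\<kappa> x \<otimes>\<^bsub>Q \<boxtimes> T\<^esub> \<kappa> x') = tlift k Q T V (\<lambda>a' t'. opp_mult (pure k X T x \<one>\<^bsub>T\<^esub>) (right_act a' t')) (\<kappa> x')"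
    by (simp add: phi_mult phi_kappa e)
  also have "\<dots> = opp_mult (pure k X T x \<one>\<^bsub>T\<^esub>) (\<Phi> (\<kappa> x'))"
    unfolding \<Phi>_def by (rule tlift_push[symmetric, where h="opp_mult (pure k X T x \<one>\<^bsub>T\<^esub>)"]) (simp_all add: bilin_right[OF opp_mult_bilin])
  also have "\<dots> = \<Phi> (\<kappa> (x \<otimes>\<^bsub>X\<^esub> x'))" by (simp add: phi_kappa)
  finally show "\<kappa> (x \<otimes>\<^bsub>X\<^esub> x') = \<kappa> x \<otimes>\<^bsub>Q \<boxtimes> T\<^esub> \<kappa> x'" by (rule_tac phi_inj) simp_all
next
  show "\<kappa> \<one>\<^bsub>X\<^esub> = \<one>\<^bsub>Q \<boxtimes> T\<^esub>"
    by (rule phi_inj) (simp_all add: phi_kappa tensor_one phi_pure, simp add: Q_one)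
qed simp

text \<open>
  Compare the images under \<open>\<Phi> \<otimes> B\<close>: both are \<open>x\<^sub>0 \<otimes> 1 \<otimes> x\<^sub>1\<close>, by \<open>can(\<tau>(b)) = 1 \<otimes> b\<close>.
\<close>

lemma kappa_colinear: "coassoc k X Q T B \<chi> \<kappa> \<kappa> \<beta>"
proof (rule coassocI[of X T])
  fix x assume x [simp]: "x \<in> carrier X"
  let ?P = "Q \<boxtimes> (T \<boxtimes> B)" and ?R = "X \<boxtimes> (T \<boxtimes> B)"
  (* ?c is Phi (x) B up to associativity, and ?d, which sends x (x) t to kappa(x) t, is its left inverse *)
  let ?c = "tlift k Q (T \<boxtimes> B) ?R (\<lambda>a v. tlift k T B ?R (\<lambda>t b. tlift k X T ?R (\<lambda>x y. pure k X (T \<boxtimes> B) x (pure k T B (y \<cdot> t) b)) a) v)"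
  let ?d = "tlift k X (T \<boxtimes> B) ?P (\<lambda>x v. tlift k T B ?P (\<lambda>t b. tlift k Q T ?P (\<lambda>a s. pure k Q (T \<boxtimes> B) a (pure k T B (s \<cdot> t) b)) (\<kappa> x)) v)"
  have lQ [simp]: "(\<lambda>a. tlift k X T ?R (\<lambda>x y. pure k X (T \<boxtimes> B) x (pure k T B (y \<cdot> t) b)) a) \<in> lin_map k Q ?R"
    if "t \<in> carrier T" "b \<in> carrier B" for t b by (rule Q_lin_V) (use that in \<open>simp add: bilin_def\<close>)
  have bc: "bilin k Q (T \<boxtimes> B) ?R (\<lambda>a v. tlift k T B ?R (\<lambda>t b. tlift k X T ?R (\<lambda>x y. pure k X (T \<boxtimes> B) x (pure k T B (y \<cdot> t) b)) a) v)"
    by (simp add: bilin_def)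
  have bd: "bilin k X (T \<boxtimes> B) ?P (\<lambda>x v. tlift k T B ?P (\<lambda>t b. tlift k Q T ?P (\<lambda>a s. pure k Q (T \<boxtimes> B) a (pure k T B (s \<cdot> t) b)) (\<kappa> x)) v)"
    by (simp add: bilin_def)
  have c: "?c \<in> lin_map k ?P ?R" by (rule tlift_lin) (simp_all add: bc)
  have d: "?d \<in> lin_map k ?R ?P" by (rule tlift_lin) (simp_all add: bd)
  have cp: "?c (pure k Q (T \<boxtimes> B) a (pure k T B t b)) = tlift k X T ?R (\<lambda>x y. pure k X (T \<boxtimes> B) x (pure k T B (y \<cdot> t) b)) a"
    if "a \<in> carrier Q" "t \<in> carrier T" "b \<in> carrier B" for a t b using that by (simp add: bc, simp add: bilin_def)
  have dp: "?d (pure k X (T \<boxtimes> B) x (pure k T B t b)) = tlift k Q T ?P (\<lambda>a s. pure k Q (T \<boxtimes> B) a (pure k T B (s \<cdot> t) b)) (\<kappa> x)"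
    if "x \<in> carrier X" "t \<in> carrier T" "b \<in> carrier B" for x t b using that by (simp add: bd, simp add: bilin_def)
  have dc: "?d (?c w) = w" if "w \<in> carrier ?P" for w
  proof (rule tensor_ext[OF _ _ _ lin_comp[OF d c] lin_id(1) _ that])
    fix a v assume a [simp]: "a \<in> carrier Q" and v: "v \<in> carrier (T \<boxtimes> B)"
    show "?d (?c (pure k Q (T \<boxtimes> B) a v)) = pure k Q (T \<boxtimes> B) a v"
    proof (rule tensor_ext[OF _ _ _ _ _ _ v, of ?P "\<lambda>v. ?d (?c (pure k Q (T \<boxtimes> B) a v))"])
      show "(\<lambda>v. ?d (?c (pure k Q (T \<boxtimes> B) a v))) \<in> lin_map k (T \<boxtimes> B) ?P"
        by (rule lin_comp[OF d], rule lin_comp[OF c]) simp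
      fix t b assume tb [simp]: "t \<in> carrier T" "b \<in> carrier B"
      have "?d (?c (pure k Q (T \<boxtimes> B) a (pure k T B t b))) = ?d (tlift k X T ?R (\<lambda>x y. pure k X (T \<boxtimes> B) x (pure k T B (y \<cdot> t) b)) a)"
        by (subst cp) simp_all
      also have "\<dots> = tlift k X T ?P (\<lambda>x y. tlift k Q T ?P (\<lambda>a s. pure k Q (T \<boxtimes> B) a (pure k T B ((s \<cdot> y) \<cdot> t) b)) (\<kappa> x)) a"
        by (subst tlift_push[OF _ _ _ _ d], simp_all, rule tlift_cong[OF refl], subst dp, simp_all add: T_assoc)
      also have "\<dots> = pure k Q (T \<boxtimes> B) a (pure k T B (\<one>\<^bsub>T\<^esub> \<cdot> t) b)"
        by (rule Q_expand'[where f="\<lambda>a s. pure k Q (T \<boxtimes> B) a (pure k T B (s \<cdot> t) b)"]) (simp_all add: bilin_def)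
      finally show "?d (?c (pure k Q (T \<boxtimes> B) a (pure k T B t b))) = pure k Q (T \<boxtimes> B) a (pure k T B t b)" by simp
    qed simp_all
  qed simp_all
  let ?L = "tlift k X B ?P (\<lambda>x0 z. tlift k Q T ?P (\<lambda>a t. pure k Q (T \<boxtimes> B) a (pure k T B t z)) (\<kappa> x0)) (\<chi> x)"
  let ?S = "tlift k Q T ?P (\<lambda>a t. tlift k T B ?P (\<lambda>y z. pure k Q (T \<boxtimes> B) a (pure k T B y z)) (\<beta> t)) (\<kappa> x)"
  let ?h = "\<lambda>b m t. tlift k X T ?R (\<lambda>x y. pure k X (T \<boxtimes> B) x (pure k T B (y \<cdot> t) b)) m"
  have "?c ?L = tlift k X B ?R (\<lambda>x0 z. tlift k Q T ?R (\<lambda>a t. ?c (pure k Q (T \<boxtimes> B) a (pure k T B t z))) (\<kappa> x0)) (\<chi> x)"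
    by (subst tlift_push[OF _ _ _ _ c], simp_all del: tlift_pure, rule tlift_cong[OF refl], subst tlift_push[OF _ _ _ _ c], simp_all del: tlift_pure)
  also have "\<dots> = tlift k X B ?R (\<lambda>x0 z. tlift k Q T ?R (\<lambda>a t. ?h z a t) (\<kappa> x0)) (\<chi> x)"
    by (intro tlift_cong[OF refl] cp) simp_all
  also have "\<dots> = tlift k X B ?R (\<lambda>x0 z. pure k X (T \<boxtimes> B) x0 (pure k T B \<one>\<^bsub>T\<^esub> z)) (\<chi> x)"
  proof (rule tlift_cong[OF refl])
    fix x0 z assume [simp]: "x0 \<in> carrier X" "z \<in> carrier B"
    have "tlift k Q T ?R (\<lambda>a t. ?h z a t) (\<kappa> x0) = tlift k X T ?R (\<lambda>x y. pure k X (T \<boxtimes> B) x (pure k T B y z)) (\<Phi> (\<kappa> x0))"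
      unfolding \<Phi>_def by (subst tlift_tlift) (simp_all add: bilin_def right_act_def tlift_tlift)
    also have "\<dots> = pure k X (T \<boxtimes> B) x0 (pure k T B \<one>\<^bsub>T\<^esub> z)" by (simp add: phi_kappa bilin_def)
    finally show "tlift k Q T ?R (\<lambda>a t. ?h z a t) (\<kappa> x0) = pure k X (T \<boxtimes> B) x0 (pure k T B \<one>\<^bsub>T\<^esub> z)" .
  qed
  finally have cL: "?c ?L = tlift k X B ?R (\<lambda>x0 z. pure k X (T \<boxtimes> B) x0 (pure k T B \<one>\<^bsub>T\<^esub> z)) (\<chi> x)" .
  have "?c ?S = tlift k Q T ?R (\<lambda>a t. tlift k T B ?R (\<lambda>y z. ?c (pure k Q (T \<boxtimes> B) a (pure k T B y z))) (\<beta> t)) (\<kappa> x)"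
    by (subst tlift_push[OF _ _ _ _ c], simp_all del: tlift_pure, rule tlift_cong[OF refl], subst tlift_push[OF _ _ _ _ c], simp_all del: tlift_pure)
  also have "\<dots> = tlift k Q T ?R (\<lambda>a t. tlift k T B ?R (\<lambda>y z. ?h z a y) (\<beta> t)) (\<kappa> x)"
    by (intro tlift_cong[OF refl] cp) simp_all
  also have "\<dots> = tlift k X B ?R (\<lambda>x0 x1. tlift k T T ?R (\<lambda>p q. tlift k T B ?R (\<lambda>y z. ?h z (pure k X T x0 p) y) (\<beta> q)) (\<tau> x1)) (\<chi> x)"
    by (rule kappa_sum) (simp_all add: bilin_def)
  also have "\<dots> = tlift k X B ?R (\<lambda>x0 x1. tlift k T T ?R (\<lambda>p q. tlift k T B ?R (\<lambda>y z. pure k X (T \<boxtimes> B) x0 (pure k T B (p \<cdot> y) z)) (\<beta> q)) (\<tau> x1)) (\<chi> x)"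
    by (simp add: bilin_def)
  also have "\<dots> = tlift k X B ?R (\<lambda>x0 z. pure k X (T \<boxtimes> B) x0 (pure k T B \<one>\<^bsub>T\<^esub> z)) (\<chi> x)"
    by (intro tlift_cong[OF refl] can_tau') simp_all
  finally have "?c ?L = ?c ?S" using cL by simp
  then have "?d (?c ?L) = ?d (?c ?S)" by (rule arg_cong)
  then show "?L = ?S" by (subst (asm) (1 2) dc) simp_all
qed simp_all

text \<open>
  \<open>f(a) \<otimes> 1\<close> is the image of \<open>\<Sum> \<kappa>(x) y = a \<otimes> 1\<close> under \<open>f \<otimes> T\<close>.
\<close>

lemma kappa_unique:
  assumes N: "module k N" and s: "small U (carrier N)"
    and f: "f \<in> lin_map k Q N" and f': "f' \<in> lin_map k Q N"
    and eq: "\<And>x. x \<in> carrier X \<Longrightarrow> tlift k Q T (N \<boxtimes> T) (\<lambda>a t. pure k N T (f a) t) (\<kappa> x) = tlift k Q T (N \<boxtimes> T) (\<lambda>a t. pure k N T (f' a) t) (\<kappa> x)"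
    and a: "a \<in> carrier Q"
  shows "f a = f' a"
proof (rule pure_one_inj[OF N s])
  note [simp] = N f f' lin_closed[OF f] lin_closed[OF f'] a
  let ?r = "\<lambda>y. tlift k N T (N \<boxtimes> T) (\<lambda>n t. pure k N T n (t \<cdot> y))"
  have r: "?r y \<in> lin_map k (N \<boxtimes> T) (N \<boxtimes> T)" if "y \<in> carrier T" for y
    by (rule tlift_lin) (use that in \<open>simp_all add: bilin_def\<close>)
  have *: "pure k N T (g a) \<one>\<^bsub>T\<^esub> = tlift k X T (N \<boxtimes> T) (\<lambda>x y. ?r y (tlift k Q T (N \<boxtimes> T) (\<lambda>a t. pure k N T (g a) t) (\<kappa> x))) a"
    if g: "g \<in> lin_map k Q N" for g
  proof -
    note [simp] = g lin_closed[OF g]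
    have "pure k N T (g a) \<one>\<^bsub>T\<^esub> = tlift k X T (N \<boxtimes> T) (\<lambda>x y. tlift k Q T (N \<boxtimes> T) (\<lambda>a t. pure k N T (g a) (t \<cdot> y)) (\<kappa> x)) a"
      by (rule Q_expand'[symmetric]) (simp_all add: bilin_def)
    also have "\<dots> = tlift k X T (N \<boxtimes> T) (\<lambda>x y. ?r y (tlift k Q T (N \<boxtimes> T) (\<lambda>a t. pure k N T (g a) t) (\<kappa> x))) a"
      by (rule tlift_cong[OF refl], subst tlift_push[OF _ _ _ _ r]) (simp_all add: bilin_def)
    finally show ?thesis .
  qed
  show "pure k N T (f a) \<one>\<^bsub>T\<^esub> = pure k N T (f' a) \<one>\<^bsub>T\<^esub>"
    unfolding *[OF f] *[OF f'] by (rule tlift_cong[OF refl]) (simp only: eq)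
qed (use lin_closed[OF f a] lin_closed[OF f' a] in simp_all)

text \<open>
  The only candidate is \<open>f(a) \<otimes> 1 = \<Sum> g(x) y\<close> for \<open>a = \<Sum> x \<otimes> y\<close>. Colinearity of \<open>g\<close> and \<open>a \<in> F(X)\<close> show
  that the right-hand side satisfies the descent condition in \<open>N \<otimes> T\<close>.
\<close>

lemma kappa_universal:
  assumes N [simp]: "module k N" and s: "small U (carrier N)" and g [simp]: "g \<in> lin_map k X (N \<boxtimes> T)"
    and co: "coassoc k X N T B \<chi> g g \<beta>"
  obtains f where "f \<in> lin_map k Q N"
    "\<And>x. x \<in> carrier X \<Longrightarrow> tlift k Q T (N \<boxtimes> T) (\<lambda>a t. pure k N T (f a) t) (\<kappa> x) = g x"
    "\<And>a. a \<in> carrier Q \<Longrightarrow> pure k N T (f a) \<one>\<^bsub>T\<^esub> =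
      tlift k X T (N \<boxtimes> T) (\<lambda>x y. tlift k N T (N \<boxtimes> T) (\<lambda>n t. pure k N T n (t \<cdot> y)) (g x)) a"
proof -
  note [simp] = lin_closed[OF g] lin_comp[OF g]
  let ?G = "tlift k X T (N \<boxtimes> T) (\<lambda>x y. tlift k N T (N \<boxtimes> T) (\<lambda>n t. pure k N T n (t \<cdot> y)) (g x))"
  have G [simp]: "?G \<in> lin_map k V (N \<boxtimes> T)" by (rule tlift_lin) (simp_all add: bilin_def)
  have GQ: "?G \<in> lin_map k Q (N \<boxtimes> T)" by (rule Q_lin_V[OF G])
  have Gp: "?G (pure k X T x y) = tlift k N T (N \<boxtimes> T) (\<lambda>n t. pure k N T n (t \<cdot> y)) (g x)"
    if "x \<in> carrier X" "y \<in> carrier T" for x y using that by (simp add: bilin_def)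
  let ?P = "N \<boxtimes> (T \<boxtimes> T)"
  let ?ja = "tlift k N T ?P (\<lambda>n t. pure k N (T \<boxtimes> T) n (pure k T T \<one>\<^bsub>T\<^esub> t))"
  let ?jb = "tlift k N T ?P (\<lambda>n t. pure k N (T \<boxtimes> T) n (pure k T T t \<one>\<^bsub>T\<^esub>))"
  (* ?G sends x (x) y to g(x) y; ?ja and ?jb insert 1 before and after the last factor; ?J applies ?G to the left factor of the descent datum, so that ?ja ?G = ?J descent, while ?J descent = ?jb ?G on F(X) *)
  let ?J = "tlift k V T ?P (\<lambda>m s. tlift k N T ?P (\<lambda>n t. pure k N (T \<boxtimes> T) n (pure k T T t s)) (?G m))"
  have ja: "?ja \<in> lin_map k (N \<boxtimes> T) ?P" and jb: "?jb \<in> lin_map k (N \<boxtimes> T) ?P"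
    by (rule tlift_lin; simp add: bilin_def)+
  have bJ: "bilin k V T ?P (\<lambda>m s. tlift k N T ?P (\<lambda>n t. pure k N (T \<boxtimes> T) n (pure k T T t s)) (?G m))"
    unfolding bilin_def
    by (intro conjI allI impI tlift_lin_arg tlift_lin_fun G lin_closed[OF G]) (simp_all add: bilin_def)
  have J: "?J \<in> lin_map k (V \<boxtimes> T) ?P" by (rule tlift_lin) (simp_all add: bJ)
  have Jpsi: "?J (descent m) = ?ja (?G m)" if "m \<in> carrier V" for m
  proof (rule tensor_ext[OF _ _ _ lin_comp[OF J descent_lin] lin_comp[OF ja G] _ that])
    fix x y assume [simp]: "x \<in> carrier X" "y \<in> carrier T"
    have "?J (descent (pure k X T x y)) = tlift k X B ?P (\<lambda>x0 x1. tlift k T T ?P (\<lambda>p q.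
       tlift k N T ?P (\<lambda>n t. pure k N (T \<boxtimes> T) n (pure k T T t (q \<cdot> y))) (?G (pure k X T x0 p))) (\<tau> x1)) (\<chi> x)"
      by (simp only: descent_pure \<open>x \<in> carrier X\<close> \<open>y \<in> carrier T\<close>, subst tlift_push[OF _ _ _ _ J], simp_all del: tlift_pure,
          rule tlift_cong[OF refl], subst tlift_push[OF _ _ _ _ J], simp_all del: tlift_pure,
          rule tlift_cong[OF refl], rule tlift_pure, simp_all add: bJ)
    also have "\<dots> = tlift k X B ?P (\<lambda>x0 x1. tlift k T T ?P (\<lambda>p q.
       tlift k N T ?P (\<lambda>n t. pure k N (T \<boxtimes> T) n (pure k T T (t \<cdot> p) (q \<cdot> y))) (g x0)) (\<tau> x1)) (\<chi> x)"
      by (intro tlift_cong[OF refl]) (simp add: Gp tlift_tlift bilin_def)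
    also have "\<dots> = tlift k X B ?P (\<lambda>x0 x1. tlift k N T ?P (\<lambda>n t. tlift k T T ?P (\<lambda>p q.
       pure k N (T \<boxtimes> T) n (pure k T T (t \<cdot> p) (q \<cdot> y))) (\<tau> x1)) (g x0)) (\<chi> x)"
      by (intro tlift_cong[OF refl] tlift_swap) simp_all
    also have "\<dots> = tlift k N T ?P (\<lambda>n c. tlift k T B ?P (\<lambda>t x1. tlift k T T ?P (\<lambda>p q.
       pure k N (T \<boxtimes> T) n (pure k T T (t \<cdot> p) (q \<cdot> y))) (\<tau> x1)) (\<beta> c)) (g x)"
      by (rule coassocD[OF co]) (simp_all add: bilin_def)
    also have "\<dots> = tlift k N T ?P (\<lambda>n c. pure k N (T \<boxtimes> T) n (pure k T T \<one>\<^bsub>T\<^esub> (c \<cdot> y))) (g x)"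
      by (rule tlift_cong[OF refl], rule tau_beta') simp_all
    also have "\<dots> = ?ja (?G (pure k X T x y))"
      by (simp add: Gp tlift_tlift bilin_def)
    finally show "?J (descent (pure k X T x y)) = ?ja (?G (pure k X T x y))" .
  qed simp_all
  have ex: "\<exists>n. n \<in> carrier N \<and> ?G a = pure k N T n \<one>\<^bsub>T\<^esub>" if a: "a \<in> carrier Q" for a
  proof -
    have "?ja (?G a) = ?J (descent a)" using Jpsi Q_V[OF a] by simp
    also have "\<dots> = ?J (pure k V T a \<one>\<^bsub>T\<^esub>)" by (simp only: Q_descent[OF a])
    also have "\<dots> = ?jb (?G a)" by (rule tlift_pure) (simp_all add: bJ a)
    finally have "?ja (?G a) = ?jb (?G a)" .
    then obtain n where "n \<in> carrier N" "?G a = pure k N T n \<one>\<^bsub>T\<^esub>"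
      by (rule tensor_descent[OF N s lin_closed[OF GQ a]])
    then show ?thesis by blast
  qed
  define f where "f a = (SOME n. n \<in> carrier N \<and> ?G a = pure k N T n \<one>\<^bsub>T\<^esub>)" for a
  have f: "f a \<in> carrier N" "pure k N T (f a) \<one>\<^bsub>T\<^esub> = ?G a" if "a \<in> carrier Q" for a
    using someI_ex[OF ex[OF that]] by (simp_all add: f_def)
  have l: "(\<lambda>n. pure k N T n \<one>\<^bsub>T\<^esub>) \<in> lin_map k N (N \<boxtimes> T)" by simp
  interpret N: module k N by (rule N)
  interpret Q: module k Q by simp
  have fl: "f \<in> lin_map k Q N"
  proof (rule lin_mapI)
    fix a b assume ab: "a \<in> carrier Q" "b \<in> carrier Q"
    show "f (a \<oplus>\<^bsub>Q\<^esub> b) = f a \<oplus>\<^bsub>N\<^esub> f b"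
      by (rule pure_one_inj[OF N s]) (simp_all only: f ab lin_add[OF l] lin_add[OF GQ] Q.add.m_closed N.add.m_closed)
  next
    fix c a assume ab: "c \<in> carrier k" "a \<in> carrier Q"
    show "f (c \<odot>\<^bsub>Q\<^esub> a) = c \<odot>\<^bsub>N\<^esub> f a"
      by (rule pure_one_inj[OF N s]) (simp_all only: f ab lin_smult[OF l] lin_smult[OF GQ] Q.smult_closed N.smult_closed)
  qed (rule f)
  have "tlift k Q T (N \<boxtimes> T) (\<lambda>a t. pure k N T (f a) t) (\<kappa> x) = g x" if x [simp]: "x \<in> carrier X" for x
  proof -
    have Gr: "tlift k N T (N \<boxtimes> T) (\<lambda>n t'. pure k N T n (t' \<cdot> t)) (?G a) = ?G (right_act a t)" if "a \<in> carrier V" "t \<in> carrier T" for a t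
    proof (rule tensor_ext[OF _ _ _ lin_comp[OF tlift_lin G] lin_comp[OF G] _ that(1)])
      fix x y assume [simp]: "x \<in> carrier X" "y \<in> carrier T"
      show "tlift k N T (N \<boxtimes> T) (\<lambda>n t'. pure k N T n (t' \<cdot> t)) (?G (pure k X T x y)) = ?G (right_act (pure k X T x y) t)"
        using that by (simp add: Gp tlift_tlift bilin_def T_assoc)
    qed (use that in \<open>simp_all add: bilin_def\<close>)
    have "tlift k Q T (N \<boxtimes> T) (\<lambda>a t. pure k N T (f a) t) (\<kappa> x) = tlift k Q T (N \<boxtimes> T) (\<lambda>a t. ?G (right_act a t)) (\<kappa> x)"
    proof (rule tlift_cong[OF refl])
      fix a t assume at [simp]: "a \<in> carrier Q" "t \<in> carrier T"
      have "pure k N T (f a) t = tlift k N T (N \<boxtimes> T) (\<lambda>n t'. pure k N T n (t' \<cdot> t)) (pure k N T (f a) \<one>\<^bsub>T\<^esub>)"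
        by (simp add: f(1) bilin_def)
      also have "\<dots> = ?G (right_act a t)" by (simp only: f(2)[OF at(1)] Gr[OF Q_V[OF at(1)] at(2)])
      finally show "pure k N T (f a) t = ?G (right_act a t)" .
    qed
    also have "\<dots> = ?G (\<Phi> (\<kappa> x))"
      unfolding \<Phi>_def by (rule tlift_push[symmetric, OF _ _ _ _ G]) simp_all
    also have "\<dots> = g x" by (simp add: phi_kappa Gp tlift_eta)
    finally show ?thesis .
  qed
  from that[OF fl this f(2)] show thesis .
qed

text \<open>
  If \<open>a = \<Sum> x \<otimes> y\<close> and \<open>b = \<Sum> x' \<otimes> y'\<close> then \<open>f(ab) \<otimes> 1 = \<Sum> g(x) g(x') y' y = \<Sum> g(x) (f(b) \<otimes> 1) y\<close>, and
  \<open>f(b) \<otimes> 1\<close> commutes with \<open>1 \<otimes> y\<close>.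
\<close>

lemma kappa_universal_hom:
  assumes NA: "k_algebra k N" and s: "small U (carrier N)" and g: "g \<in> alg_hom k X (N \<boxtimes> T)"
    and co: "coassoc k X N T B \<chi> g g \<beta>"
  obtains f where "f \<in> alg_hom k Q N"
    "\<And>x. x \<in> carrier X \<Longrightarrow> tlift k Q T (N \<boxtimes> T) (\<lambda>a t. pure k N T (f a) t) (\<kappa> x) = g x"
proof -
  let ?R = "N \<boxtimes> T"
  have RA: "k_algebra k ?R" by (rule tensor_algebra) (simp_all add: NA)
  have gl: "g \<in> lin_map k X ?R" by (rule alg_hom_lin[OF g])
  note [simp] = alg_simps[OF NA] alg_simps[OF RA] gl lin_closed[OF gl] lin_comp[OF gl]
  obtain f where fl: "f \<in> lin_map k Q N"
    and fk: "\<And>x. x \<in> carrier X \<Longrightarrow> tlift k Q T (N \<boxtimes> T) (\<lambda>a t. pure k N T (f a) t) (\<kappa> x) = g x"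
    and f1: "\<And>a. a \<in> carrier Q \<Longrightarrow> pure k N T (f a) \<one>\<^bsub>T\<^esub> =
      tlift k X T (N \<boxtimes> T) (\<lambda>x y. tlift k N T (N \<boxtimes> T) (\<lambda>n t. pure k N T n (t \<cdot> y)) (g x)) a"
    using kappa_universal[OF k_algebra_module[OF NA] s gl co] by blast
  note [simp] = lin_closed[OF fl]
  have rm: "tlift k N T ?R (\<lambda>n t. pure k N T n (t \<cdot> y)) u = u \<otimes>\<^bsub>?R\<^esub> pure k N T \<one>\<^bsub>N\<^esub> y"
    if "u \<in> carrier ?R" "y \<in> carrier T" for u y
    by (rule tensor_ext[OF _ _ _ _ _ _ that(1), of ?R "\<lambda>u. tlift k N T ?R (\<lambda>n t. pure k N T n (t \<cdot> y)) u"])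
      (use that in \<open>simp_all add: bilin_def tensor_mult_pure NA\<close>)
  let ?G = "tlift k X T ?R (\<lambda>x y. g x \<otimes>\<^bsub>?R\<^esub> pure k N T \<one>\<^bsub>N\<^esub> y)"
  have bG: "bilin k X T ?R (\<lambda>x y. g x \<otimes>\<^bsub>?R\<^esub> pure k N T \<one>\<^bsub>N\<^esub> y)" by (simp add: bilin_def)
  have G: "?G \<in> lin_map k V ?R" by (rule tlift_lin) (simp_all add: bG)
  have f2: "pure k N T (f a) \<one>\<^bsub>T\<^esub> = ?G a" if "a \<in> carrier Q" for a
    unfolding f1[OF that] by (rule tlift_cong[OF refl], rule rm) simp_all
  have Gm: "?G (opp_mult m b) = ?G m \<otimes>\<^bsub>?R\<^esub> pure k N T (f b) \<one>\<^bsub>T\<^esub>" if m: "m \<in> carrier V" and b [simp]: "b \<in> carrier Q" for m b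
  proof (rule tensor_ext[OF _ _ _ _ _ _ m, of ?R "\<lambda>m. ?G (opp_mult m b)"])
    show "(\<lambda>m. ?G (opp_mult m b)) \<in> lin_map k V ?R" by (rule lin_comp[OF G]) simp
    show "(\<lambda>m. ?G m \<otimes>\<^bsub>?R\<^esub> pure k N T (f b) \<one>\<^bsub>T\<^esub>) \<in> lin_map k V ?R" using G by simp
    fix x y assume xy [simp]: "x \<in> carrier X" "y \<in> carrier T"
    have "?G (opp_mult (pure k X T x y) v) = g x \<otimes>\<^bsub>?R\<^esub> (?G v \<otimes>\<^bsub>?R\<^esub> pure k N T \<one>\<^bsub>N\<^esub> y)" if "v \<in> carrier V" for v
    proof (rule tensor_ext[OF _ _ _ _ _ _ that, of ?R "\<lambda>v. ?G (opp_mult (pure k X T x y) v)"])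
      show "(\<lambda>v. ?G (opp_mult (pure k X T x y) v)) \<in> lin_map k V ?R" by (rule lin_comp[OF G]) simp
      show "(\<lambda>v. g x \<otimes>\<^bsub>?R\<^esub> (?G v \<otimes>\<^bsub>?R\<^esub> pure k N T \<one>\<^bsub>N\<^esub> y)) \<in> lin_map k V ?R" using G by simp
      fix x' y' assume [simp]: "x' \<in> carrier X" "y' \<in> carrier T"
      have "pure k N T \<one>\<^bsub>N\<^esub> (y' \<cdot> y) = pure k N T \<one>\<^bsub>N\<^esub> y' \<otimes>\<^bsub>?R\<^esub> pure k N T \<one>\<^bsub>N\<^esub> y"
        by (simp add: tensor_mult_pure NA)
      then show "?G (opp_mult (pure k X T x y) (pure k X T x' y')) = g x \<otimes>\<^bsub>?R\<^esub> (?G (pure k X T x' y') \<otimes>\<^bsub>?R\<^esub> pure k N T \<one>\<^bsub>N\<^esub> y)"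
        by (simp add: bG alg_hom_mult[OF g] mult_assoc[OF RA])
    qed simp_all
    from this[of b] have "?G (opp_mult (pure k X T x y) b) = g x \<otimes>\<^bsub>?R\<^esub> (pure k N T (f b) \<one>\<^bsub>T\<^esub> \<otimes>\<^bsub>?R\<^esub> pure k N T \<one>\<^bsub>N\<^esub> y)"
      by (simp add: f2)
    also have "pure k N T (f b) \<one>\<^bsub>T\<^esub> \<otimes>\<^bsub>?R\<^esub> pure k N T \<one>\<^bsub>N\<^esub> y = pure k N T \<one>\<^bsub>N\<^esub> y \<otimes>\<^bsub>?R\<^esub> pure k N T (f b) \<one>\<^bsub>T\<^esub>"
      by (simp add: tensor_mult_pure NA)
    finally show "?G (opp_mult (pure k X T x y) b) = ?G (pure k X T x y) \<otimes>\<^bsub>?R\<^esub> pure k N T (f b) \<one>\<^bsub>T\<^esub>"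
      by (simp add: bG mult_assoc[OF RA])
  qed simp_all
  have "f \<in> alg_hom k Q N"
  proof (rule alg_homI[OF fl])
    fix a b assume ab [simp]: "a \<in> carrier Q" "b \<in> carrier Q"
    have "pure k N T (f (opp_mult a b)) \<one>\<^bsub>T\<^esub> = pure k N T (f a) \<one>\<^bsub>T\<^esub> \<otimes>\<^bsub>?R\<^esub> pure k N T (f b) \<one>\<^bsub>T\<^esub>"
      by (simp add: f2[of "opp_mult a b"] f2[of a] Gm)
    then have "pure k N T (f (opp_mult a b)) \<one>\<^bsub>T\<^esub> = pure k N T (f a \<otimes>\<^bsub>N\<^esub> f b) \<one>\<^bsub>T\<^esub>"
      by (simp add: tensor_mult_pure NA)
    then show "f (a \<otimes>\<^bsub>Q\<^esub> b) = f a \<otimes>\<^bsub>N\<^esub> f b"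
      unfolding Q_mult by (rule_tac pure_one_inj[OF k_algebra_module[OF NA] s]) simp_all
  next
    have "pure k N T (f \<one>\<^bsub>Q\<^esub>) \<one>\<^bsub>T\<^esub> = pure k N T \<one>\<^bsub>N\<^esub> \<one>\<^bsub>T\<^esub>"
      by (subst f2, simp, simp only: Q_one, simp add: bG alg_hom_one[OF g] tensor_one tensor_mult_pure NA)
    then show "f \<one>\<^bsub>Q\<^esub> = \<one>\<^bsub>N\<^esub>"
      by (rule_tac pure_one_inj[OF k_algebra_module[OF NA] s]) simp_all
  qed
  then show thesis using that fk by blast
qed

end

section \<open>Convolution and antipodes\<close>


text \<open>
  Convolution of \<open>f : M \<rightarrow> R\<close> and \<open>g : N \<rightarrow> R\<close> along \<open>D : C \<rightarrow> M \<otimes> N\<close>. In a cogroupoid it is the composition of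
  a category, associative by \<open>conv_assoc\<close>, with the maps \<open>\<epsilon> 1\<close> as identities.
\<close>

definition conv where
  "conv k M N R D f g c = tlift k M N R (\<lambda>x y. f x \<otimes>\<^bsub>R\<^esub> g y) (D c)"

definition left_counital where
  "left_counital k C M D e \<longleftrightarrow> (\<forall>x \<in> carrier M. tlift k C M M (\<lambda>c y. e c \<odot>\<^bsub>M\<^esub> y) (D x) = x)"

definition right_counital where
  "right_counital k M C D e \<longleftrightarrow> (\<forall>x \<in> carrier M. tlift k M C M (\<lambda>y c. e c \<odot>\<^bsub>M\<^esub> y) (D x) = x)"

lemma conv_cong:
  "(\<And>x. x \<in> carrier M \<Longrightarrow> f x = f' x) \<Longrightarrow> (\<And>y. y \<in> carrier N \<Longrightarrow> g y = g' y) \<Longrightarrow>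
    conv k M N R D f g c = conv k M N R D f' g' c"
  by (simp add: conv_def)

context base_ring begin

lemma conv_lin:
  assumes R: "k_algebra k R" and m: "module k M" "module k N" "D \<in> lin_map k C (M \<boxtimes> N)" "f \<in> lin_map k M R" "g \<in> lin_map k N R"
  shows "(\<lambda>c. conv k M N R D f g c) \<in> lin_map k C R"
proof -
  note [simp] = alg_simps[OF R] m lin_closed[OF m(4)] lin_closed[OF m(5)]
  show ?thesis by (simp add: conv_def bilin_def)
qed

lemma conv_assoc:
  assumes co: "coassoc k X M1 M2 M3 D D1 D' D2" and R: "k_algebra k R"
    and m: "module k A" "module k C" "module k M1" "module k M2" "module k M3"
    and D: "D \<in> lin_map k X (A \<boxtimes> M3)" "D1 \<in> lin_map k A (M1 \<boxtimes> M2)" "D' \<in> lin_map k X (M1 \<boxtimes> C)" "D2 \<in> lin_map k C (M2 \<boxtimes> M3)"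
    and f: "f \<in> lin_map k M1 R" "g \<in> lin_map k M2 R" "h \<in> lin_map k M3 R" and x: "x \<in> carrier X"
  shows "conv k A M3 R D (conv k M1 M2 R D1 f g) h x = conv k M1 C R D' f (conv k M2 M3 R D2 g h) x"
proof -
  note [simp] = alg_simps[OF R] m D f x lin_closed[OF f(1)] lin_closed[OF f(2)] lin_closed[OF f(3)]
    lin_closed[OF D(1)] lin_closed[OF D(2)] lin_closed[OF D(3)] lin_closed[OF D(4)]
  have "conv k A M3 R D (conv k M1 M2 R D1 f g) h x =
    tlift k A M3 R (\<lambda>a z. tlift k M1 M2 R (\<lambda>x y. (f x \<otimes>\<^bsub>R\<^esub> g y) \<otimes>\<^bsub>R\<^esub> h z) (D1 a)) (D x)"
    unfolding conv_def
    by (rule tlift_cong[OF refl], rule tlift_push[where h="\<lambda>r. r \<otimes>\<^bsub>R\<^esub> h _"]) simp_all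
  also have "\<dots> = tlift k M1 C R (\<lambda>x c. tlift k M2 M3 R (\<lambda>y z. (f x \<otimes>\<^bsub>R\<^esub> g y) \<otimes>\<^bsub>R\<^esub> h z) (D2 c)) (D' x)"
    by (rule coassocD[OF co]) simp_all
  also have "\<dots> = tlift k M1 C R (\<lambda>x c. tlift k M2 M3 R (\<lambda>y z. f x \<otimes>\<^bsub>R\<^esub> (g y \<otimes>\<^bsub>R\<^esub> h z)) (D2 c)) (D' x)"
    by (simp add: mult_assoc[OF R])
  also have "\<dots> = conv k M1 C R D' f (conv k M2 M3 R D2 g h) x"
    unfolding conv_def
    by (rule tlift_cong[OF refl], rule tlift_push[symmetric, where h="\<lambda>r. f _ \<otimes>\<^bsub>R\<^esub> r"]) simp_all
  finally show ?thesis .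
qed

lemma conv_hom:
  assumes phi: "\<phi> \<in> alg_hom k R S" and R: "k_algebra k R" and S: "k_algebra k S"
    and m: "module k M" "module k N" "D \<in> lin_map k C (M \<boxtimes> N)" "f \<in> lin_map k M R" "g \<in> lin_map k N R" "c \<in> carrier C"
  shows "\<phi> (conv k M N R D f g c) = conv k M N S D (\<lambda>x. \<phi> (f x)) (\<lambda>y. \<phi> (g y)) c"
proof -
  note [simp] = alg_simps[OF R] alg_simps[OF S] m lin_closed[OF m(3)] lin_closed[OF m(4)] lin_closed[OF m(5)]
  have "\<phi> (conv k M N R D f g c) = tlift k M N S (\<lambda>x y. \<phi> (f x \<otimes>\<^bsub>R\<^esub> g y)) (D c)"
    unfolding conv_def by (rule tlift_push[OF _ _ _ _ alg_hom_lin[OF phi]]) simp_all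
  also have "\<dots> = conv k M N S D (\<lambda>x. \<phi> (f x)) (\<lambda>y. \<phi> (g y)) c"
    unfolding conv_def by (rule tlift_cong[OF refl]) (simp add: alg_hom_mult[OF phi])
  finally show ?thesis .
qed

lemma conv_unit_left:
  assumes l: "left_counital k C M D e" and R: "k_algebra k R"
    and m: "module k C" "module k M" "D \<in> lin_map k M (C \<boxtimes> M)" "e \<in> lin_map k C (base_module k)" "g \<in> lin_map k M R" "x \<in> carrier M"
  shows "conv k C M R D (\<lambda>c. e c \<odot>\<^bsub>R\<^esub> \<one>\<^bsub>R\<^esub>) g x = g x"
proof -
  note [simp] = alg_simps[OF R] m lin_closed[OF m(3)] lin_closed[OF m(4), simplified] lin_closed[OF m(5)]
    module.smult_closed[OF m(2)] module.smult_closed[OF k_algebra_module[OF R]]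
  have "conv k C M R D (\<lambda>c. e c \<odot>\<^bsub>R\<^esub> \<one>\<^bsub>R\<^esub>) g x = tlift k C M R (\<lambda>c y. g (e c \<odot>\<^bsub>M\<^esub> y)) (D x)"
    unfolding conv_def by (rule tlift_cong[OF refl]) (simp add: k_algebra.smult_mult_left[OF R] lin_smult[OF m(5)])
  also have "\<dots> = g (tlift k C M M (\<lambda>c y. e c \<odot>\<^bsub>M\<^esub> y) (D x))"
    by (rule tlift_push[symmetric, OF _ _ _ _ m(5)]) simp_all
  also have "\<dots> = g x" using l by (simp add: left_counital_def)
  finally show ?thesis .
qed

lemma conv_unit_right:
  assumes l: "right_counital k M C D e" and R: "k_algebra k R"
    and m: "module k C" "module k M" "D \<in> lin_map k M (M \<boxtimes> C)" "e \<in> lin_map k C (base_module k)" "g \<in> lin_map k M R" "x \<in> carrier M"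
  shows "conv k M C R D g (\<lambda>c. e c \<odot>\<^bsub>R\<^esub> \<one>\<^bsub>R\<^esub>) x = g x"
proof -
  note [simp] = alg_simps[OF R] m lin_closed[OF m(3)] lin_closed[OF m(4), simplified] lin_closed[OF m(5)]
    module.smult_closed[OF m(2)] module.smult_closed[OF k_algebra_module[OF R]]
  have "conv k M C R D g (\<lambda>c. e c \<odot>\<^bsub>R\<^esub> \<one>\<^bsub>R\<^esub>) x = tlift k M C R (\<lambda>y c. g (e c \<odot>\<^bsub>M\<^esub> y)) (D x)"
    unfolding conv_def by (rule tlift_cong[OF refl]) (simp add: k_algebra.smult_mult_right[OF R] lin_smult[OF m(5)])
  also have "\<dots> = g (tlift k M C M (\<lambda>y c. e c \<odot>\<^bsub>M\<^esub> y) (D x))"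
    by (rule tlift_push[symmetric, OF _ _ _ _ m(5)]) simp_all
  also have "\<dots> = g x" using l by (simp add: right_counital_def)
  finally show ?thesis .
qed

lemma alg_hom_unit: "\<phi> \<in> alg_hom k R S \<Longrightarrow> k_algebra k R \<Longrightarrow> c \<in> carrier k \<Longrightarrow> \<phi> (c \<odot>\<^bsub>R\<^esub> \<one>\<^bsub>R\<^esub>) = c \<odot>\<^bsub>S\<^esub> \<one>\<^bsub>S\<^esub>"
  by (simp add: lin_smult[OF alg_hom_lin] alg_hom_one one_closed)

lemma pure_one_left_hom: "k_algebra k M \<Longrightarrow> k_algebra k N \<Longrightarrow> (\<lambda>x. pure k M N x \<one>\<^bsub>N\<^esub>) \<in> alg_hom k M (M \<boxtimes> N)"
  by (rule alg_homI) (simp_all add: alg_simps tensor_mult_pure tensor_one)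

lemma pure_one_right_hom: "k_algebra k M \<Longrightarrow> k_algebra k N \<Longrightarrow> (\<lambda>x. pure k M N \<one>\<^bsub>M\<^esub> x) \<in> alg_hom k N (M \<boxtimes> N)"
  by (rule alg_homI) (simp_all add: alg_simps tensor_mult_pure tensor_one)

lemma alg_hom_comp: "f \<in> alg_hom k M N \<Longrightarrow> g \<in> alg_hom k L M \<Longrightarrow> (\<lambda>x. f (g x)) \<in> alg_hom k L N"
  by (auto simp: alg_hom_def ring_hom_def lin_comp Pi_def)

text \<open>
  Here \<open>Cxy\<close> stands for a cohom object, \<open>dxyz\<close> for the comultiplication of \<open>C(x,z)\<close> through \<open>y\<close>, written with the
  indices in the order \<open>x\<close>, \<open>z\<close>, \<open>y\<close>, and \<open>D\<close>, \<open>D'\<close> are those of \<open>C(X,W)\<close> and \<open>C(W,X)\<close> through \<open>Y\<close>. With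
  values in \<open>R = C(X,Y) \<otimes> C(Y,W)\<close> the map \<open>D\<close> is the composition of the two inclusions. So its inverse
  is on the one hand the composition of their inverses in reverse order, the left-hand side of the
  claim, and on the other hand \<open>D S\<close>, because \<open>D\<close> is an algebra map.
\<close>

lemma antipode_anticomult:
  fixes CXY :: "('k, 'xy, 'c1) module_scheme" and CYW :: "('k, 'yw, 'c2) module_scheme"
  assumes alg: "k_algebra k CXY" "k_algebra k CYW" "k_algebra k CXW"
    and m: "module k CWX" "module k CWY" "module k CYX" "module k CXX" "module k CYY" "module k CWW"
    and D: "D \<in> alg_hom k CXW (CXY \<boxtimes> CYW)"
    and lin: "D' \<in> lin_map k CWX (CWY \<boxtimes> CYX)" "dXXW \<in> lin_map k CXX (CXW \<boxtimes> CWX)" "dXXY \<in> lin_map k CXX (CXY \<boxtimes> CYX)"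
      "dYXW \<in> lin_map k CYX (CYW \<boxtimes> CWX)" "dYXY \<in> lin_map k CYX (CYY \<boxtimes> CYX)" "dYYW \<in> lin_map k CYY (CYW \<boxtimes> CWY)"
      "dWXW \<in> lin_map k CWX (CWW \<boxtimes> CWX)" "dWXX \<in> lin_map k CWX (CWX \<boxtimes> CXX)" "dWWX \<in> lin_map k CWW (CWX \<boxtimes> CXW)"
    and e: "eX \<in> lin_map k CXX (base_module k)" "eY \<in> lin_map k CYY (base_module k)" "eW \<in> lin_map k CWW (base_module k)"
    and S: "SWX \<in> lin_map k CWX CXW" "SYX \<in> lin_map k CYX CXY" "SWY \<in> lin_map k CWY CYW"
    and co: "coassoc k CXX CXY CYW CWX dXXW D dXXY dYXW"
      "coassoc k CYX CYW CWY CYX dYXY dYYW dYXW D'"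
      "coassoc k CWX CWX CXW CWX dWXW dWWX dWXX dXXW"
    and cu: "left_counital k CYY CYX dYXY eY" "left_counital k CWW CWX dWXW eW" "right_counital k CWX CXX dWXX eX"
    and inv: "\<And>c. c \<in> carrier CWW \<Longrightarrow> conv k CWX CXW CXW dWWX SWX (\<lambda>x. x) c = eW c \<odot>\<^bsub>CXW\<^esub> \<one>\<^bsub>CXW\<^esub>"
      "\<And>c. c \<in> carrier CYY \<Longrightarrow> conv k CYW CWY CYW dYYW (\<lambda>x. x) SWY c = eY c \<odot>\<^bsub>CYW\<^esub> \<one>\<^bsub>CYW\<^esub>"
      "\<And>c. c \<in> carrier CXX \<Longrightarrow> conv k CXY CYX CXY dXXY (\<lambda>x. x) SYX c = eX c \<odot>\<^bsub>CXY\<^esub> \<one>\<^bsub>CXY\<^esub>"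
    and c: "c \<in> carrier CWX"
  shows "tlift k CWY CYX (CXY \<boxtimes> CYW) (\<lambda>a b. pure k CXY CYW (SYX b) (SWY a)) (D' c) = D (SWX c)"
proof -
  let ?R = "CXY \<boxtimes> CYW"
  have R: "k_algebra k ?R" using alg by (intro tensor_algebra)
  have Dl: "D \<in> lin_map k CXW ?R" by (rule alg_hom_lin[OF D])
  note [simp] = alg alg_simps[OF alg(1)] alg_simps[OF alg(2)] alg_simps[OF alg(3)] R alg_simps[OF R] m lin Dl e S
    lin_closed[OF e(1), simplified] lin_closed[OF e(2), simplified] lin_closed[OF e(3), simplified]
    lin_closed[OF S(1)] lin_closed[OF S(2)] lin_closed[OF S(3)] lin_closed[OF Dl] lin_closed[OF lin(1)]
    lin_comp[OF Dl S(1)] tensor_mult_pure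
  let ?i = "\<lambda>x. pure k CXY CYW x \<one>\<^bsub>CYW\<^esub>" and ?j = "\<lambda>x. pure k CXY CYW \<one>\<^bsub>CXY\<^esub> x"
  note ih = pure_one_left_hom[OF alg(1,2)] and jh = pure_one_right_hom[OF alg(1,2)]
  let ?js = "\<lambda>a. ?j (SWY a)" and ?is = "\<lambda>b. ?i (SYX b)"
  let ?E = "conv k CWY CYX ?R D' ?js ?is"
  have E: "?E c = tlift k CWY CYX ?R (\<lambda>a b. pure k CXY CYW (SYX b) (SWY a)) (D' c)"
    unfolding conv_def by (rule tlift_cong[OF refl]) simp
  have El: "?E \<in> lin_map k CWX ?R" by (rule conv_lin[where C=CWX]) simp_all
  have Dc: "D x = conv k CXY CYW ?R D ?i ?j x" if "x \<in> carrier CXW" for x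
    using that by (simp add: conv_def tlift_eta)
  have DE: "conv k CXW CWX ?R dXXW D ?E z = eX z \<odot>\<^bsub>?R\<^esub> \<one>\<^bsub>?R\<^esub>" if z: "z \<in> carrier CXX" for z
  proof -
    have "conv k CXW CWX ?R dXXW D ?E z = conv k CXW CWX ?R dXXW (conv k CXY CYW ?R D ?i ?j) ?E z"
      by (rule conv_cong) (simp_all add: Dc[symmetric])
    also have "\<dots> = conv k CXY CYX ?R dXXY ?i (conv k CYW CWX ?R dYXW ?j ?E) z"
      by (rule conv_assoc[OF co(1)]) (simp_all add: El z)
    also have "\<dots> = conv k CXY CYX ?R dXXY ?i ?is z"
    proof (rule conv_cong[OF refl])
      fix y assume y: "y \<in> carrier CYX"
      have "conv k CYW CWX ?R dYXW ?j ?E y = conv k CYY CYX ?R dYXY (conv k CYW CWY ?R dYYW ?j ?js) ?is y"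
        by (rule conv_assoc[OF co(2), symmetric]) (simp_all add: y)
      also have "\<dots> = conv k CYY CYX ?R dYXY (\<lambda>z. eY z \<odot>\<^bsub>?R\<^esub> \<one>\<^bsub>?R\<^esub>) ?is y"
      proof (rule conv_cong[OF _ refl])
        fix z assume z: "z \<in> carrier CYY"
        have "conv k CYW CWY ?R dYYW ?j ?js z = ?j (conv k CYW CWY CYW dYYW (\<lambda>x. x) SWY z)"
          by (rule conv_hom[OF jh, where C=CYY, symmetric]) (simp_all add: z)
        also have "\<dots> = eY z \<odot>\<^bsub>?R\<^esub> \<one>\<^bsub>?R\<^esub>"
          using alg_hom_unit[OF jh alg(2)] z by (simp add: inv(2))
        finally show "conv k CYW CWY ?R dYYW ?j ?js z = eY z \<odot>\<^bsub>?R\<^esub> \<one>\<^bsub>?R\<^esub>" .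
      qed
      also have "\<dots> = ?is y" by (rule conv_unit_left[OF cu(1)]) (simp_all add: y)
      finally show "conv k CYW CWX ?R dYXW ?j ?E y = ?is y" .
    qed
    also have "\<dots> = ?i (conv k CXY CYX CXY dXXY (\<lambda>x. x) SYX z)"
      by (rule conv_hom[OF ih, where C=CXX, symmetric]) (simp_all add: z)
    also have "\<dots> = eX z \<odot>\<^bsub>?R\<^esub> \<one>\<^bsub>?R\<^esub>"
      using alg_hom_unit[OF ih alg(1)] z by (simp add: inv(3))
    finally show ?thesis .
  qed
  have SD: "conv k CWX CXW ?R dWWX (\<lambda>x. D (SWX x)) D z = eW z \<odot>\<^bsub>?R\<^esub> \<one>\<^bsub>?R\<^esub>" if z: "z \<in> carrier CWW" for z
  proof -
    have "conv k CWX CXW ?R dWWX (\<lambda>x. D (SWX x)) D z = D (conv k CWX CXW CXW dWWX SWX (\<lambda>x. x) z)"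
      by (rule conv_hom[OF D, where C=CWW, symmetric]) (simp_all add: z)
    then show ?thesis using alg_hom_unit[OF D alg(3)] z by (simp add: inv(1))
  qed
  have "D (SWX c) = conv k CWX CXX ?R dWXX (\<lambda>x. D (SWX x)) (\<lambda>z. eX z \<odot>\<^bsub>?R\<^esub> \<one>\<^bsub>?R\<^esub>) c"
    by (rule conv_unit_right[OF cu(3), symmetric]) (simp_all add: c)
  also have "\<dots> = conv k CWX CXX ?R dWXX (\<lambda>x. D (SWX x)) (conv k CXW CWX ?R dXXW D ?E) c"
    by (rule conv_cong) (simp_all add: DE)
  also have "\<dots> = conv k CWW CWX ?R dWXW (conv k CWX CXW ?R dWWX (\<lambda>x. D (SWX x)) D) ?E c"
    by (rule conv_assoc[OF co(3), symmetric]) (simp_all add: c El)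
  also have "\<dots> = conv k CWW CWX ?R dWXW (\<lambda>z. eW z \<odot>\<^bsub>?R\<^esub> \<one>\<^bsub>?R\<^esub>) ?E c"
    by (rule conv_cong) (simp_all add: SD)
  also have "\<dots> = ?E c" by (rule conv_unit_left[OF cu(2)]) (simp_all add: c El)
  finally show ?thesis by (simp add: E)
qed

end

context galois_ff begin

text \<open>
  Roles, for \<open>x\<close> one of the two objects: \<open>P = C(x,2)\<close>, \<open>Q = C(x,1)\<close>, \<open>W = C(1,x)\<close>, \<open>Y = C(2,x)\<close>, \<open>J = C(x,x)\<close>, while
  \<open>A = C(1,1)\<close> and \<open>Z = C(2,1)\<close>. Given are inverses \<open>s\<close> and \<open>SZ\<close> of the identities of \<open>P\<close> and \<open>T\<close>; the map found
  is an inverse of the identity of \<open>Q\<close>. In \<open>Q \<otimes> T\<close> the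
  identity of \<open>Q\<close> is the composition of \<open>\<kappa>\<close> with the inverse of \<open>u = 1 \<otimes> T\<close>, so its inverse there is the
  composition \<open>v\<close> of \<open>u\<close> with \<open>\<kappa> s\<close>. The two algebra maps \<open>Q \<otimes> T \<rightarrow> Q \<otimes> T \<otimes> T\<close> agree on \<open>Q \<otimes> 1\<close>, hence on the
  inverse, so \<open>v\<close> takes values in \<open>Q \<otimes> 1\<close>.
\<close>

lemma antipode_exists:
  assumes alg: "k_algebra k Q" "k_algebra k P" and smQ: "small U (carrier Q)"
    and m: "module k W" "module k Y" "module k J" "module k A" "module k Z"
    and kap: "\<kappa> \<in> alg_hom k P (Q \<boxtimes> T)"
    and lin: "qb \<in> lin_map k Q (P \<boxtimes> Z)" "qa \<in> lin_map k Q (Q \<boxtimes> A)" "w \<in> lin_map k W (T \<boxtimes> Y)" "wl \<in> lin_map k W (A \<boxtimes> W)"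
      "wr \<in> lin_map k W (W \<boxtimes> J)" "ja \<in> lin_map k J (Q \<boxtimes> W)" "jb \<in> lin_map k J (P \<boxtimes> Y)" "aX \<in> lin_map k A (W \<boxtimes> Q)"
      "ab \<in> lin_map k A (T \<boxtimes> Z)" "z \<in> lin_map k Z (Y \<boxtimes> Q)" "zl \<in> lin_map k Z (B \<boxtimes> Z)" "bX \<in> lin_map k B (Y \<boxtimes> P)"
    and e: "eA \<in> lin_map k A (base_module k)" "eJ \<in> lin_map k J (base_module k)"
    and s: "s \<in> lin_map k Y P" "SZ \<in> lin_map k Z T"
    and co: "coassoc k J Q T Y jb \<kappa> ja w" "coassoc k A T Y Q aX w ab z" "coassoc k Q Q T Z qb \<kappa> qa ab"
      "coassoc k Z Y P Z zl bX z qb" "coassoc k W W Q W wl aX wr ja"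
    and cu: "right_counital k Q A qa eA" "left_counital k B Z zl \<epsilon>" "left_counital k A W wl eA" "right_counital k W J wr eJ"
    and inv: "\<And>c. c \<in> carrier J \<Longrightarrow> conv k P Y P jb (\<lambda>x. x) s c = eJ c \<odot>\<^bsub>P\<^esub> \<one>\<^bsub>P\<^esub>"
      "\<And>c. c \<in> carrier B \<Longrightarrow> conv k Y P P bX s (\<lambda>x. x) c = \<epsilon> c \<odot>\<^bsub>P\<^esub> \<one>\<^bsub>P\<^esub>"
      "\<And>c. c \<in> carrier A \<Longrightarrow> conv k T Z T ab (\<lambda>x. x) SZ c = eA c \<odot>\<^bsub>T\<^esub> \<one>\<^bsub>T\<^esub>"
  obtains S where "S \<in> lin_map k W Q"
    "\<And>c. c \<in> carrier J \<Longrightarrow> conv k Q W Q ja (\<lambda>x. x) S c = eJ c \<odot>\<^bsub>Q\<^esub> \<one>\<^bsub>Q\<^esub>"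
    "\<And>c. c \<in> carrier A \<Longrightarrow> conv k W Q Q aX S (\<lambda>x. x) c = eA c \<odot>\<^bsub>Q\<^esub> \<one>\<^bsub>Q\<^esub>"
    "\<And>c. c \<in> carrier W \<Longrightarrow> pure k Q T (S c) \<one>\<^bsub>T\<^esub> =
      conv k T Y (Q \<boxtimes> T) w (\<lambda>t. pure k Q T \<one>\<^bsub>Q\<^esub> t) (\<lambda>y. \<kappa> (s y)) c"
proof -
  let ?R = "Q \<boxtimes> T" and ?RR = "Q \<boxtimes> (T \<boxtimes> T)"
  have R: "k_algebra k ?R" using alg by (intro tensor_algebra) simp_all
  have RR: "k_algebra k ?RR" using alg by (intro tensor_algebra) simp_all
  have kl: "\<kappa> \<in> lin_map k P ?R" by (rule alg_hom_lin[OF kap])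
  note [simp] = alg alg_simps[OF alg(1)] alg_simps[OF alg(2)] R RR alg_simps[OF R] alg_simps[OF RR] m lin kl e s
    lin_closed[OF e(1), simplified] lin_closed[OF e(2), simplified] lin_closed[OF s(1)] lin_closed[OF s(2)] lin_closed[OF kl]
    lin_comp[OF kl s(1)] lin_closed[OF lin(3)]
  let ?i = "\<lambda>x. pure k Q T x \<one>\<^bsub>T\<^esub>" and ?u = "\<lambda>t. pure k Q T \<one>\<^bsub>Q\<^esub> t" and ?u' = "\<lambda>z. pure k Q T \<one>\<^bsub>Q\<^esub> (SZ z)"
  have ih: "?i \<in> alg_hom k Q ?R" by (rule pure_one_left_hom) simp_all
  have uh: "?u \<in> alg_hom k T ?R" by (rule pure_one_right_hom) simp_all
  let ?ks = "\<lambda>y. \<kappa> (s y)"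
  let ?v = "conv k T Y ?R w ?u ?ks"
  have vl: "?v \<in> lin_map k W ?R" by (rule conv_lin[where C=W]) simp_all
  note [simp] = vl lin_closed[OF vl]
  have iu: "conv k Q T ?R \<kappa> ?i ?u p = \<kappa> p" if "p \<in> carrier P" for p
    using that by (simp add: conv_def tensor_mult_pure tlift_eta)
  have uu: "conv k T Z ?R ab ?u ?u' c = eA c \<odot>\<^bsub>?R\<^esub> \<one>\<^bsub>?R\<^esub>" if c: "c \<in> carrier A" for c
  proof -
    have "conv k T Z ?R ab ?u ?u' c = ?u (conv k T Z T ab (\<lambda>x. x) SZ c)"
      by (rule conv_hom[OF uh, where C=A, symmetric]) (simp_all add: c)
    then show ?thesis using alg_hom_unit[OF uh T_algebra] c by (simp add: inv(3))
  qed
  have iv: "conv k Q W ?R ja ?i ?v c = eJ c \<odot>\<^bsub>?R\<^esub> \<one>\<^bsub>?R\<^esub>" if c: "c \<in> carrier J" for c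
  proof -
    have "conv k Q W ?R ja ?i ?v c = conv k P Y ?R jb (conv k Q T ?R \<kappa> ?i ?u) ?ks c"
      by (rule conv_assoc[OF co(1), symmetric]) (simp_all add: c)
    also have "\<dots> = conv k P Y ?R jb \<kappa> ?ks c" by (rule conv_cong) (simp_all add: iu)
    also have "\<dots> = \<kappa> (conv k P Y P jb (\<lambda>x. x) s c)"
      by (rule conv_hom[OF kap, where C=J, symmetric]) (simp_all add: c)
    also have "\<dots> = eJ c \<odot>\<^bsub>?R\<^esub> \<one>\<^bsub>?R\<^esub>" using alg_hom_unit[OF kap alg(2)] c by (simp add: inv(1))
    finally show ?thesis .
  qed
  have iku: "?i q = conv k P Z ?R qb \<kappa> ?u' q" if q: "q \<in> carrier Q" for q
  proof -
    have "?i q = conv k Q A ?R qa ?i (\<lambda>c. eA c \<odot>\<^bsub>?R\<^esub> \<one>\<^bsub>?R\<^esub>) q"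
      by (rule conv_unit_right[OF cu(1), symmetric]) (simp_all add: q)
    also have "\<dots> = conv k Q A ?R qa ?i (conv k T Z ?R ab ?u ?u') q"
      by (rule conv_cong) (simp_all add: uu)
    also have "\<dots> = conv k P Z ?R qb (conv k Q T ?R \<kappa> ?i ?u) ?u' q"
      by (rule conv_assoc[OF co(3), symmetric]) (simp_all add: q)
    also have "\<dots> = conv k P Z ?R qb \<kappa> ?u' q" by (rule conv_cong) (simp_all add: iu)
    finally show ?thesis .
  qed
  have ksi: "conv k Y Q ?R z ?ks ?i c = ?u' c" if c: "c \<in> carrier Z" for c
  proof -
    have "conv k Y Q ?R z ?ks ?i c = conv k Y Q ?R z ?ks (conv k P Z ?R qb \<kappa> ?u') c"
      by (rule conv_cong) (simp_all add: iku)
    also have "\<dots> = conv k B Z ?R zl (conv k Y P ?R bX ?ks \<kappa>) ?u' c"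
      by (rule conv_assoc[OF co(4), symmetric]) (simp_all add: c)
    also have "\<dots> = conv k B Z ?R zl (\<lambda>b. \<epsilon> b \<odot>\<^bsub>?R\<^esub> \<one>\<^bsub>?R\<^esub>) ?u' c"
    proof (rule conv_cong[OF _ refl])
      fix b assume b: "b \<in> carrier B"
      have "conv k Y P ?R bX ?ks \<kappa> b = \<kappa> (conv k Y P P bX s (\<lambda>x. x) b)"
        by (rule conv_hom[OF kap, where C=B, symmetric]) (simp_all add: b)
      then show "conv k Y P ?R bX ?ks \<kappa> b = \<epsilon> b \<odot>\<^bsub>?R\<^esub> \<one>\<^bsub>?R\<^esub>"
        using alg_hom_unit[OF kap alg(2)] b by (simp add: inv(2))
    qed
    also have "\<dots> = ?u' c" by (rule conv_unit_left[OF cu(2)]) (simp_all add: c)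
    finally show ?thesis .
  qed
  have vi: "conv k W Q ?R aX ?v ?i c = eA c \<odot>\<^bsub>?R\<^esub> \<one>\<^bsub>?R\<^esub>" if c: "c \<in> carrier A" for c
  proof -
    have "conv k W Q ?R aX ?v ?i c = conv k T Z ?R ab ?u (conv k Y Q ?R z ?ks ?i) c"
      by (rule conv_assoc[OF co(2)]) (simp_all add: c)
    also have "\<dots> = conv k T Z ?R ab ?u ?u' c" by (rule conv_cong) (simp_all add: ksi)
    finally show ?thesis using uu[OF c] by simp
  qed
  have ex: "\<exists>q. q \<in> carrier Q \<and> ?v c = ?i q" if c: "c \<in> carrier W" for c
  proof -
    let ?fa = "tensor_map k Q (T \<boxtimes> T) (\<lambda>x. x) (\<lambda>t. pure k T T \<one>\<^bsub>T\<^esub> t)" and ?fb = "tensor_map k Q (T \<boxtimes> T) (\<lambda>x. x) (\<lambda>t. pure k T T t \<one>\<^bsub>T\<^esub>)"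
    have hom: "tensor_map k Q (T \<boxtimes> T) (\<lambda>x. x) h \<in> alg_hom k ?R ?RR" if h: "h \<in> alg_hom k T (T \<boxtimes> T)" for h
    proof (rule alg_homI)
      note hl = alg_hom_lin[OF h]
      have TT: "k_algebra k (T \<boxtimes> T)" by (rule tensor_algebra) simp_all
      note [simp] = hl lin_closed[OF hl] TT alg_simps[OF TT]
      have p: "tensor_map k Q (T \<boxtimes> T) (\<lambda>x. x) h (pure k Q T q t) = pure k Q (T \<boxtimes> T) q (h t)" if "q \<in> carrier Q" "t \<in> carrier T" for q t
        by (subst tensor_map_pure[of Q T Q]) (simp_all add: that)
      show l [simp]: "tensor_map k Q (T \<boxtimes> T) (\<lambda>x. x) h \<in> lin_map k ?R ?RR" by (rule tensor_map_lin) simp_all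
      note [simp] = lin_closed[OF l] lin_comp[OF l]
      show "tensor_map k Q (T \<boxtimes> T) (\<lambda>x. x) h (x \<otimes>\<^bsub>?R\<^esub> y) = tensor_map k Q (T \<boxtimes> T) (\<lambda>x. x) h x \<otimes>\<^bsub>?RR\<^esub> tensor_map k Q (T \<boxtimes> T) (\<lambda>x. x) h y"
        if x: "x \<in> carrier ?R" and y: "y \<in> carrier ?R" for x y
      proof (rule tensor_ext[OF _ _ _ _ _ _ x, of ?RR "\<lambda>x. tensor_map k Q (T \<boxtimes> T) (\<lambda>x. x) h (x \<otimes>\<^bsub>?R\<^esub> y)"])
        fix q t assume qt [simp]: "q \<in> carrier Q" "t \<in> carrier T"
        show "tensor_map k Q (T \<boxtimes> T) (\<lambda>x. x) h (pure k Q T q t \<otimes>\<^bsub>?R\<^esub> y) = tensor_map k Q (T \<boxtimes> T) (\<lambda>x. x) h (pure k Q T q t) \<otimes>\<^bsub>?RR\<^esub> tensor_map k Q (T \<boxtimes> T) (\<lambda>x. x) h y"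
          by (rule tensor_ext[OF _ _ _ _ _ _ y, of ?RR "\<lambda>y. tensor_map k Q (T \<boxtimes> T) (\<lambda>x. x) h (pure k Q T q t \<otimes>\<^bsub>?R\<^esub> y)"])
            (simp_all add: p tensor_mult_pure alg_hom_mult[OF h])
      qed (simp_all add: y)
      show "tensor_map k Q (T \<boxtimes> T) (\<lambda>x. x) h \<one>\<^bsub>?R\<^esub> = \<one>\<^bsub>?RR\<^esub>"
        by (simp add: tensor_one[of Q] p alg_hom_one[OF h])
    qed
    have fa: "?fa \<in> alg_hom k ?R ?RR" by (rule hom, rule pure_one_right_hom) simp_all
    have fb: "?fb \<in> alg_hom k ?R ?RR" by (rule hom, rule pure_one_left_hom) simp_all
    have fi: "?fa (?i q) = ?fb (?i q)" if "q \<in> carrier Q" for q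
      using that by (simp add: tensor_map_pure[of Q T Q])
    note fal = alg_hom_lin[OF fa] and fbl = alg_hom_lin[OF fb]
    note [simp] = fal fbl lin_comp[OF fal vl] lin_comp[OF fbl vl] lin_comp[OF fal alg_hom_lin[OF ih]] lin_comp[OF fbl alg_hom_lin[OF ih]]
    have "?fa (?v c) = conv k W J ?RR wr (\<lambda>c. ?fa (?v c)) (\<lambda>c. eJ c \<odot>\<^bsub>?RR\<^esub> \<one>\<^bsub>?RR\<^esub>) c"
      by (rule conv_unit_right[OF cu(4), symmetric]) (simp_all add: c)
    also have "\<dots> = conv k W J ?RR wr (\<lambda>c. ?fa (?v c)) (conv k Q W ?RR ja (\<lambda>q. ?fb (?i q)) (\<lambda>c. ?fb (?v c))) c"
    proof (rule conv_cong[OF refl])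
      fix d assume d: "d \<in> carrier J"
      have "conv k Q W ?RR ja (\<lambda>q. ?fb (?i q)) (\<lambda>c. ?fb (?v c)) d = ?fb (conv k Q W ?R ja ?i ?v d)"
        by (rule conv_hom[OF fb, where C=J, symmetric]) (simp_all add: d)
      then show "eJ d \<odot>\<^bsub>?RR\<^esub> \<one>\<^bsub>?RR\<^esub> = conv k Q W ?RR ja (\<lambda>q. ?fb (?i q)) (\<lambda>c. ?fb (?v c)) d"
        using alg_hom_unit[OF fb R] d by (simp add: iv)
    qed
    also have "\<dots> = conv k A W ?RR wl (conv k W Q ?RR aX (\<lambda>c. ?fa (?v c)) (\<lambda>q. ?fb (?i q))) (\<lambda>c. ?fb (?v c)) c"
      by (rule conv_assoc[OF co(5), symmetric]) (simp_all add: c)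
    also have "\<dots> = conv k A W ?RR wl (\<lambda>c. eA c \<odot>\<^bsub>?RR\<^esub> \<one>\<^bsub>?RR\<^esub>) (\<lambda>c. ?fb (?v c)) c"
    proof (rule conv_cong[OF _ refl])
      fix d assume d: "d \<in> carrier A"
      have "conv k W Q ?RR aX (\<lambda>c. ?fa (?v c)) (\<lambda>q. ?fb (?i q)) d = conv k W Q ?RR aX (\<lambda>c. ?fa (?v c)) (\<lambda>q. ?fa (?i q)) d"
        by (rule conv_cong) (simp_all only: fi)
      also have "\<dots> = ?fa (conv k W Q ?R aX ?v ?i d)"
        by (rule conv_hom[OF fa, where C=A, symmetric]) (simp_all add: d)
      also have "\<dots> = eA d \<odot>\<^bsub>?RR\<^esub> \<one>\<^bsub>?RR\<^esub>"
        using alg_hom_unit[OF fa R] d by (simp add: vi)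
      finally show "conv k W Q ?RR aX (\<lambda>c. ?fa (?v c)) (\<lambda>q. ?fb (?i q)) d = eA d \<odot>\<^bsub>?RR\<^esub> \<one>\<^bsub>?RR\<^esub>" .
    qed
    also have "\<dots> = ?fb (?v c)" by (rule conv_unit_left[OF cu(3)]) (simp_all add: c)
    finally have "?fa (?v c) = ?fb (?v c)" .
    then have "tlift k Q T ?RR (\<lambda>n t. pure k Q (T \<boxtimes> T) n (pure k T T \<one>\<^bsub>T\<^esub> t)) (?v c) =
      tlift k Q T ?RR (\<lambda>n t. pure k Q (T \<boxtimes> T) n (pure k T T t \<one>\<^bsub>T\<^esub>)) (?v c)"
      by (simp add: tensor_map_eq[of Q T Q "T \<boxtimes> T"] c)
    then obtain q where "q \<in> carrier Q" "?v c = ?i q"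
      by (rule tensor_descent[OF _ smQ lin_closed[OF vl c], rotated]) simp_all
    then show ?thesis by blast
  qed
  define S where "S c = (SOME q. q \<in> carrier Q \<and> ?v c = ?i q)" for c
  have SS: "S c \<in> carrier Q \<and> ?v c = ?i (S c)" if "c \<in> carrier W" for c
    unfolding S_def by (rule someI_ex[OF ex[OF that]])
  note S = conjunct1[OF SS] conjunct2[OF SS]
  interpret Q: module k Q by simp
  interpret W: module k W by simp
  note il = alg_hom_lin[OF ih]
  have Sl: "S \<in> lin_map k W Q"
  proof (rule lin_mapI)
    fix a b assume ab: "a \<in> carrier W" "b \<in> carrier W"
    show "S (a \<oplus>\<^bsub>W\<^esub> b) = S a \<oplus>\<^bsub>Q\<^esub> S b"
      by (rule pure_one_inj[OF _ smQ]) (simp_all only: S(1) ab lin_add[OF il] lin_add[OF vl] W.add.m_closed Q.add.m_closed Q.module_axioms S(2)[symmetric])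
  next
    fix c a assume ab: "c \<in> carrier k" "a \<in> carrier W"
    show "S (c \<odot>\<^bsub>W\<^esub> a) = c \<odot>\<^bsub>Q\<^esub> S a"
      by (rule pure_one_inj[OF _ smQ]) (simp_all only: S(1) ab lin_smult[OF il] lin_smult[OF vl] W.smult_closed Q.smult_closed Q.module_axioms S(2)[symmetric])
  qed (rule S)
  note [simp] = Sl lin_closed[OF Sl]
  have r1: "conv k Q W Q ja (\<lambda>x. x) S c = eJ c \<odot>\<^bsub>Q\<^esub> \<one>\<^bsub>Q\<^esub>" if c: "c \<in> carrier J" for c
  proof (rule pure_one_inj[OF _ smQ])
    have "?i (conv k Q W Q ja (\<lambda>x. x) S c) = conv k Q W ?R ja ?i (\<lambda>c. ?i (S c)) c"
      by (rule conv_hom[OF ih, where C=J]) (simp_all add: c)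
    also have "\<dots> = conv k Q W ?R ja ?i ?v c" by (rule conv_cong) (simp_all only: S(2))
    also have "\<dots> = ?i (eJ c \<odot>\<^bsub>Q\<^esub> \<one>\<^bsub>Q\<^esub>)" using alg_hom_unit[OF ih alg(1)] c by (simp add: iv)
    finally show "?i (conv k Q W Q ja (\<lambda>x. x) S c) = ?i (eJ c \<odot>\<^bsub>Q\<^esub> \<one>\<^bsub>Q\<^esub>)" .
  qed (use c in \<open>auto intro!: lin_closed[OF conv_lin[where C=J]]\<close>)
  have r2: "conv k W Q Q aX S (\<lambda>x. x) c = eA c \<odot>\<^bsub>Q\<^esub> \<one>\<^bsub>Q\<^esub>" if c: "c \<in> carrier A" for c
  proof (rule pure_one_inj[OF _ smQ])
    have "?i (conv k W Q Q aX S (\<lambda>x. x) c) = conv k W Q ?R aX (\<lambda>c. ?i (S c)) ?i c"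
      by (rule conv_hom[OF ih, where C=A]) (simp_all add: c)
    also have "\<dots> = conv k W Q ?R aX ?v ?i c" by (rule conv_cong) (simp_all only: S(2))
    also have "\<dots> = ?i (eA c \<odot>\<^bsub>Q\<^esub> \<one>\<^bsub>Q\<^esub>)" using alg_hom_unit[OF ih alg(1)] c by (simp add: vi)
    finally show "?i (conv k W Q Q aX S (\<lambda>x. x) c) = ?i (eA c \<odot>\<^bsub>Q\<^esub> \<one>\<^bsub>Q\<^esub>)" .
  qed (use c in \<open>auto intro!: lin_closed[OF conv_lin[where C=A]]\<close>)
  from that[OF Sl r1 r2 S(2)[symmetric]] show thesis .
qed

end

section \<open>Coalgebra laws from the universal property\<close>

context descended_algebra begin

text \<open>
  Coassociativity along a path ending at object 1 from the one along the path that ends at object 2 instead: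
  by uniqueness both sides may be composed with \<open>\<kappa>\<close>, and then the defining equations of the maps
  \<open>E\<close> move the computation to the maps \<open>D\<close> of \<open>X\<close>.
\<close>

lemma kappa_coassoc_transfer:
  assumes m: "module k CXZ" "module k C1" "module k C2" "module k PY" "module k QY" "module k PZ" "module k QZ"
    and sm: "small U (carrier C1)" "small U (carrier C2)" "small U (carrier QZ)"
    and lin: "EXZ \<in> lin_map k Q (CXZ \<boxtimes> QZ)" "EXY \<in> lin_map k Q (C1 \<boxtimes> QY)" "EYZ \<in> lin_map k QY (C2 \<boxtimes> QZ)" "c \<in> lin_map k CXZ (C1 \<boxtimes> C2)"
      "DXZ \<in> lin_map k X (CXZ \<boxtimes> PZ)" "DXY \<in> lin_map k X (C1 \<boxtimes> PY)" "DYZ \<in> lin_map k PY (C2 \<boxtimes> PZ)"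
      "\<kappa>Y \<in> lin_map k PY (QY \<boxtimes> T)" "\<kappa>Z \<in> lin_map k PZ (QZ \<boxtimes> T)"
    and h1: "coassoc k X CXZ QZ T \<kappa> EXZ DXZ \<kappa>Z" and h2: "coassoc k X C1 QY T \<kappa> EXY DXY \<kappa>Y"
    and h3: "coassoc k PY C2 QZ T \<kappa>Y EYZ DYZ \<kappa>Z" and h4: "coassoc k X C1 C2 PZ DXZ c DXY DYZ"
  shows "coassoc k Q C1 C2 QZ EXZ c EXY EYZ"
proof (rule coassocI[of CXZ QY])
  note [simp] = m sm lin lin_closed[OF lin(1)] lin_closed[OF lin(2)] lin_closed[OF lin(3)] lin_closed[OF lin(4)]
    lin_closed[OF lin(5)] lin_closed[OF lin(6)] lin_closed[OF lin(7)] lin_closed[OF lin(8)] lin_closed[OF lin(9)]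
    lin_comp[OF lin(8)] lin_comp[OF lin(9)]
  fix q assume q: "q \<in> carrier Q"
  let ?N = "C1 \<boxtimes> (C2 \<boxtimes> QZ)"
  let ?p = "\<lambda>x y z. pure k C1 (C2 \<boxtimes> QZ) x (pure k C2 QZ y z)"
  let ?f = "\<lambda>q. tlift k CXZ QZ ?N (\<lambda>a z. tlift k C1 C2 ?N (\<lambda>x y. ?p x y z) (c a)) (EXZ q)"
  let ?g = "\<lambda>q. tlift k C1 QY ?N (\<lambda>x w. tlift k C2 QZ ?N (\<lambda>y z. ?p x y z) (EYZ w)) (EXY q)"
  have f: "?f \<in> lin_map k Q ?N" by (simp add: bilin_def)
  have g: "?g \<in> lin_map k Q ?N" by (simp add: bilin_def)
  show "?f q = ?g q"
  proof (rule kappa_unique[OF _ _ f g _ q])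
    fix x assume [simp]: "x \<in> carrier X"
    have push: "pure k ?N T (tlift k M1 M2 ?N h u) t = tlift k M1 M2 (?N \<boxtimes> T) (\<lambda>a b. pure k ?N T (h a b) t) u"
      if "module k M1" "module k M2" "u \<in> carrier (M1 \<boxtimes> M2)" "t \<in> carrier T" "\<And>a b. a \<in> carrier M1 \<Longrightarrow> b \<in> carrier M2 \<Longrightarrow> h a b \<in> carrier ?N"
      for M1 :: "('k, 'm1, 'm2) module_scheme" and M2 :: "('k, 'm3, 'm4) module_scheme" and h u t
      by (rule tlift_push[where h="\<lambda>n. pure k ?N T n t"]) (use that in simp_all)
    have "tlift k Q T (?N \<boxtimes> T) (\<lambda>a t. pure k ?N T (?f a) t) (\<kappa> x) =
      tlift k Q T (?N \<boxtimes> T) (\<lambda>a t. tlift k CXZ QZ (?N \<boxtimes> T) (\<lambda>u z. tlift k C1 C2 (?N \<boxtimes> T) (\<lambda>x y. pure k ?N T (?p x y z) t) (c u)) (EXZ a)) (\<kappa> x)"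
      by (intro tlift_cong[OF refl]) (simp add: push)
    also have "\<dots> = tlift k CXZ PZ (?N \<boxtimes> T) (\<lambda>u p. tlift k QZ T (?N \<boxtimes> T) (\<lambda>z t. tlift k C1 C2 (?N \<boxtimes> T) (\<lambda>x y. pure k ?N T (?p x y z) t) (c u)) (\<kappa>Z p)) (DXZ x)"
      by (rule coassocD[OF h1]) (simp_all add: bilin_def)
    also have "\<dots> = tlift k CXZ PZ (?N \<boxtimes> T) (\<lambda>u p. tlift k C1 C2 (?N \<boxtimes> T) (\<lambda>x y. tlift k QZ T (?N \<boxtimes> T) (\<lambda>z t. pure k ?N T (?p x y z) t) (\<kappa>Z p)) (c u)) (DXZ x)"
      by (intro tlift_cong[OF refl] tlift_swap) simp_all
    also have "\<dots> = tlift k C1 PY (?N \<boxtimes> T) (\<lambda>x w. tlift k C2 PZ (?N \<boxtimes> T) (\<lambda>y p. tlift k QZ T (?N \<boxtimes> T) (\<lambda>z t. pure k ?N T (?p x y z) t) (\<kappa>Z p)) (DYZ w)) (DXY x)"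
      by (rule coassocD[OF h4]) (simp_all add: bilin_def)
    also have "\<dots> = tlift k C1 PY (?N \<boxtimes> T) (\<lambda>x p. tlift k QY T (?N \<boxtimes> T) (\<lambda>w t. tlift k C2 QZ (?N \<boxtimes> T) (\<lambda>y z. pure k ?N T (?p x y z) t) (EYZ w)) (\<kappa>Y p)) (DXY x)"
      by (rule tlift_cong[OF refl], rule coassocD[OF h3, symmetric]) (simp_all add: bilin_def)
    also have "\<dots> = tlift k Q T (?N \<boxtimes> T) (\<lambda>a t. tlift k C1 QY (?N \<boxtimes> T) (\<lambda>x w. tlift k C2 QZ (?N \<boxtimes> T) (\<lambda>y z. pure k ?N T (?p x y z) t) (EYZ w)) (EXY a)) (\<kappa> x)"
      by (rule coassocD[OF h2, symmetric]) (simp_all add: bilin_def)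
    also have "\<dots> = tlift k Q T (?N \<boxtimes> T) (\<lambda>a t. pure k ?N T (?g a) t) (\<kappa> x)"
      by (intro tlift_cong[OF refl]) (simp add: push)
    finally show "tlift k Q T (?N \<boxtimes> T) (\<lambda>a t. pure k ?N T (?f a) t) (\<kappa> x) = tlift k Q T (?N \<boxtimes> T) (\<lambda>a t. pure k ?N T (?g a) t) (\<kappa> x)" .
  qed simp_all
qed (use m lin in simp_all)

lemma kappa_left_counital:
  assumes m: "module k C" and lin: "E \<in> lin_map k Q (C \<boxtimes> Q)" "D \<in> lin_map k X (C \<boxtimes> X)" and e: "e \<in> lin_map k C (base_module k)"
    and h: "coassoc k X C Q T \<kappa> E D \<kappa>" and cu: "left_counital k C X D e"
  shows "left_counital k C Q E e"
  unfolding left_counital_def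
proof
  have sc: "a \<odot>\<^bsub>Q\<^esub> x \<in> carrier Q" "a \<odot>\<^bsub>X\<^esub> y \<in> carrier X" if "a \<in> carrier k" "x \<in> carrier Q" "y \<in> carrier X" for a x y
    using that module.smult_closed[OF Q_module] by simp_all
  note [simp] = m lin e lin_closed[OF lin(1)] lin_closed[OF lin(2)] lin_closed[OF e, simplified] sc(1) lin_smult_left lin_smult_right
    module.smult_closed[OF Q_module]
  fix q assume q: "q \<in> carrier Q"
  let ?f = "\<lambda>q. tlift k C Q Q (\<lambda>c y. e c \<odot>\<^bsub>Q\<^esub> y) (E q)"
  have f: "?f \<in> lin_map k Q Q" by (simp add: bilin_def)
  show "?f q = q"
  proof (rule kappa_unique[OF _ _ f lin_id(1) _ q])
    fix x assume x [simp]: "x \<in> carrier X"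
    have pe: "pure k Q T (e c \<odot>\<^bsub>Q\<^esub> y) t = e c \<odot>\<^bsub>Q \<boxtimes> T\<^esub> pure k Q T y t" if "c \<in> carrier C" "y \<in> carrier Q" "t \<in> carrier T" for c y t
      by (rule lin_smult[of "\<lambda>y. pure k Q T y t" k]) (use that in simp_all)
    have sc2: "a \<odot>\<^bsub>Q \<boxtimes> T\<^esub> u \<in> carrier (Q \<boxtimes> T)" if "a \<in> carrier k" "u \<in> carrier (Q \<boxtimes> T)" for a u
      by (rule module.smult_closed) (use that in simp_all)
    note [simp] = sc2
    have "tlift k Q T (Q \<boxtimes> T) (\<lambda>a t. pure k Q T (?f a) t) (\<kappa> x) =
      tlift k Q T (Q \<boxtimes> T) (\<lambda>a t. tlift k C Q (Q \<boxtimes> T) (\<lambda>c y. e c \<odot>\<^bsub>Q \<boxtimes> T\<^esub> pure k Q T y t) (E a)) (\<kappa> x)"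
    proof (rule tlift_cong[OF refl])
      fix a t assume [simp]: "a \<in> carrier Q" "t \<in> carrier T"
      have "pure k Q T (?f a) t = tlift k C Q (Q \<boxtimes> T) (\<lambda>c y. pure k Q T (e c \<odot>\<^bsub>Q\<^esub> y) t) (E a)"
        by (rule tlift_push[where h="\<lambda>n. pure k Q T n t"]) simp_all
      then show "pure k Q T (?f a) t = tlift k C Q (Q \<boxtimes> T) (\<lambda>c y. e c \<odot>\<^bsub>Q \<boxtimes> T\<^esub> pure k Q T y t) (E a)" by (simp add: pe)
    qed
    also have "\<dots> = tlift k C X (Q \<boxtimes> T) (\<lambda>c x'. tlift k Q T (Q \<boxtimes> T) (\<lambda>y t. e c \<odot>\<^bsub>Q \<boxtimes> T\<^esub> pure k Q T y t) (\<kappa> x')) (D x)"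
      by (rule coassocD[OF h]) simp_all
    also have "\<dots> = tlift k C X (Q \<boxtimes> T) (\<lambda>c x'. \<kappa> (e c \<odot>\<^bsub>X\<^esub> x')) (D x)"
    proof (rule tlift_cong[OF refl])
      fix c x' assume [simp]: "c \<in> carrier C" "x' \<in> carrier X"
      have "e c \<odot>\<^bsub>Q \<boxtimes> T\<^esub> tlift k Q T (Q \<boxtimes> T) (\<lambda>y t. pure k Q T y t) (\<kappa> x') = tlift k Q T (Q \<boxtimes> T) (\<lambda>y t. e c \<odot>\<^bsub>Q \<boxtimes> T\<^esub> pure k Q T y t) (\<kappa> x')"
        by (rule tlift_push[where h="\<lambda>n. e c \<odot>\<^bsub>Q \<boxtimes> T\<^esub> n"]) simp_all
      then show "tlift k Q T (Q \<boxtimes> T) (\<lambda>y t. e c \<odot>\<^bsub>Q \<boxtimes> T\<^esub> pure k Q T y t) (\<kappa> x') = \<kappa> (e c \<odot>\<^bsub>X\<^esub> x')"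
        by (simp add: tlift_eta lin_smult[OF kappa_lin])
    qed
    also have "\<dots> = \<kappa> (tlift k C X X (\<lambda>c x'. e c \<odot>\<^bsub>X\<^esub> x') (D x))"
      by (rule tlift_push[symmetric, OF _ _ _ _ kappa_lin]) simp_all
    also have "\<dots> = \<kappa> x" using cu by (simp add: left_counital_def)
    finally show "tlift k Q T (Q \<boxtimes> T) (\<lambda>a t. pure k Q T (?f a) t) (\<kappa> x) = tlift k Q T (Q \<boxtimes> T) (\<lambda>a t. pure k Q T a t) (\<kappa> x)"
      by (simp add: tlift_eta)
  qed simp_all
qed

lemma kappa_right_counital:
  assumes m: "module k A" and lin: "E \<in> lin_map k Q (Q \<boxtimes> A)" "\<alpha> \<in> lin_map k T (A \<boxtimes> T)" and e: "e \<in> lin_map k A (base_module k)"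
    and h: "coassoc k X Q A T \<kappa> E \<kappa> \<alpha>" and cu: "left_counital k A T \<alpha> e"
  shows "right_counital k Q A E e"
  unfolding right_counital_def
proof
  note [simp] = m lin e lin_closed[OF lin(1)] lin_closed[OF lin(2)] lin_closed[OF e, simplified] lin_smult_left lin_smult_right
    module.smult_closed[OF Q_module]
  fix q assume q: "q \<in> carrier Q"
  let ?f = "\<lambda>q. tlift k Q A Q (\<lambda>y c. e c \<odot>\<^bsub>Q\<^esub> y) (E q)"
  have f: "?f \<in> lin_map k Q Q" by (simp add: bilin_def)
  show "?f q = q"
  proof (rule kappa_unique[OF _ _ f lin_id(1) _ q])
    fix x assume x [simp]: "x \<in> carrier X"
    have pe: "pure k Q T (e c \<odot>\<^bsub>Q\<^esub> y) t = pure k Q T y (e c \<odot>\<^bsub>T\<^esub> t)" if "c \<in> carrier A" "y \<in> carrier Q" "t \<in> carrier T" for c y t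
      using lin_smult[of "\<lambda>y. pure k Q T y t" k Q "Q \<boxtimes> T" "e c" y] lin_smult[of "\<lambda>t. pure k Q T y t" k T "Q \<boxtimes> T" "e c" t] that by simp
    have "tlift k Q T (Q \<boxtimes> T) (\<lambda>a t. pure k Q T (?f a) t) (\<kappa> x) =
      tlift k Q T (Q \<boxtimes> T) (\<lambda>a t. tlift k Q A (Q \<boxtimes> T) (\<lambda>y c. pure k Q T y (e c \<odot>\<^bsub>T\<^esub> t)) (E a)) (\<kappa> x)"
    proof (rule tlift_cong[OF refl])
      fix a t assume [simp]: "a \<in> carrier Q" "t \<in> carrier T"
      have "pure k Q T (?f a) t = tlift k Q A (Q \<boxtimes> T) (\<lambda>y c. pure k Q T (e c \<odot>\<^bsub>Q\<^esub> y) t) (E a)"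
        by (rule tlift_push[where h="\<lambda>n. pure k Q T n t"]) simp_all
      then show "pure k Q T (?f a) t = tlift k Q A (Q \<boxtimes> T) (\<lambda>y c. pure k Q T y (e c \<odot>\<^bsub>T\<^esub> t)) (E a)" by (simp add: pe)
    qed
    also have "\<dots> = tlift k Q T (Q \<boxtimes> T) (\<lambda>y t. tlift k A T (Q \<boxtimes> T) (\<lambda>c t. pure k Q T y (e c \<odot>\<^bsub>T\<^esub> t)) (\<alpha> t)) (\<kappa> x)"
      by (rule coassocD[OF h]) simp_all
    also have "\<dots> = tlift k Q T (Q \<boxtimes> T) (\<lambda>a t. pure k Q T a t) (\<kappa> x)"
    proof (rule tlift_cong[OF refl])
      fix y t assume [simp]: "y \<in> carrier Q" "t \<in> carrier T"
      have "tlift k A T (Q \<boxtimes> T) (\<lambda>c t. pure k Q T y (e c \<odot>\<^bsub>T\<^esub> t)) (\<alpha> t) = pure k Q T y (tlift k A T T (\<lambda>c t. e c \<odot>\<^bsub>T\<^esub> t) (\<alpha> t))"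
        by (rule tlift_push[symmetric, where h="\<lambda>n. pure k Q T y n"]) simp_all
      then show "tlift k A T (Q \<boxtimes> T) (\<lambda>c t. pure k Q T y (e c \<odot>\<^bsub>T\<^esub> t)) (\<alpha> t) = pure k Q T y t" using cu by (simp add: left_counital_def)
    qed
    finally show "tlift k Q T (Q \<boxtimes> T) (\<lambda>a t. pure k Q T (?f a) t) (\<kappa> x) = tlift k Q T (Q \<boxtimes> T) (\<lambda>a t. pure k Q T a t) (\<kappa> x)" .
  qed simp_all
qed

end


section \<open>The antipode of a Hopf algebra\<close>

context base_ring begin

text \<open>
  Expand \<open>S(b) S(a)\<close> with the factor \<open>\<epsilon>(a\<^sub>1 b\<^sub>1) = S(a\<^sub>1 b\<^sub>1) a\<^sub>2 b\<^sub>2\<close> in front, and cancel \<open>b\<^sub>2 S(b\<^sub>3)\<close> and then \<open>a\<^sub>2 S(a\<^sub>3)\<close>.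
\<close>

lemma antipode_antimult:
  assumes bi: "bialgebra k H" and S: "is_antipode k H S" and a: "a \<in> carrier H" and b: "b \<in> carrier H"
  shows "S (a \<otimes>\<^bsub>H\<^esub> b) = S b \<otimes>\<^bsub>H\<^esub> S a"
proof -
  interpret H: bialgebra k H by fact
  have HA: "k_algebra k H" using bi by (simp add: bialgebra_def)
  let ?D = "comult H" and ?e = "counit H"
  have Sl: "S \<in> lin_map k H H" using S by (simp add: is_antipode_def)
  have Dl: "?D \<in> lin_map k H (H \<boxtimes> H)" by (rule alg_hom_lin[OF H.comult_hom])
  have el: "?e \<in> lin_map k H (base_module k)" by (rule alg_hom_lin[OF H.counit_hom])
  note [simp] = HA alg_simps[OF HA] Sl Dl el lin_closed[OF Sl] lin_closed[OF Dl] lin_closed[OF el, simplified] lin_comp[OF Sl] lin_comp[OF Dl] lin_comp[OF el]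
    module.smult_closed[OF k_algebra_module[OF HA]] a b
  have co: "coassoc k H H H H ?D ?D ?D ?D" using H.coassoc by (simp add: coassoc_def)
  have lc: "left_counital k H H ?D ?e" using H.counit_left by (simp add: left_counital_def left_counit_eq[of H H])
  have rc: "right_counital k H H ?D ?e" using H.counit_right by (simp add: right_counital_def right_counit_eq[of H H])
  have SL: "conv k H H H ?D S (\<lambda>x. x) c = ?e c \<odot>\<^bsub>H\<^esub> \<one>\<^bsub>H\<^esub>" if "c \<in> carrier H" for c
    using S that by (simp add: is_antipode_def mult_map_tensor_map[OF HA, of H H] conv_def unit_map_def)
  have SR: "conv k H H H ?D (\<lambda>x. x) S c = ?e c \<odot>\<^bsub>H\<^esub> \<one>\<^bsub>H\<^esub>" if "c \<in> carrier H" for c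
    using S that by (simp add: is_antipode_def mult_map_tensor_map[OF HA, of H H] conv_def unit_map_def)
  let ?T = "\<lambda>f u. tlift k H H H f u"
  have ee: "(?e x \<odot>\<^bsub>H\<^esub> \<one>\<^bsub>H\<^esub>) \<otimes>\<^bsub>H\<^esub> (?e y \<odot>\<^bsub>H\<^esub> \<one>\<^bsub>H\<^esub>) = ?T (\<lambda>x1 x2. ?T (\<lambda>y1 y2. S (x1 \<otimes>\<^bsub>H\<^esub> y1) \<otimes>\<^bsub>H\<^esub> (x2 \<otimes>\<^bsub>H\<^esub> y2)) (?D y)) (?D x)"
    if [simp]: "x \<in> carrier H" "y \<in> carrier H" for x y
  proof -
    have "(?e x \<odot>\<^bsub>H\<^esub> \<one>\<^bsub>H\<^esub>) \<otimes>\<^bsub>H\<^esub> (?e y \<odot>\<^bsub>H\<^esub> \<one>\<^bsub>H\<^esub>) = (?e x \<otimes> ?e y) \<odot>\<^bsub>H\<^esub> \<one>\<^bsub>H\<^esub>"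
      by (simp add: H.smult_mult_left module.smult_assoc1[OF k_algebra_module[OF HA]])
    also have "\<dots> = conv k H H H ?D S (\<lambda>x. x) (x \<otimes>\<^bsub>H\<^esub> y)"
      by (simp add: SL alg_hom_mult[OF H.counit_hom])
    also have "\<dots> = ?T (\<lambda>x1 x2. ?T (\<lambda>y1 y2. S (x1 \<otimes>\<^bsub>H\<^esub> y1) \<otimes>\<^bsub>H\<^esub> (x2 \<otimes>\<^bsub>H\<^esub> y2)) (?D y)) (?D x)"
      unfolding conv_def by (simp add: alg_hom_mult_tensor[OF HA HA HA H.comult_hom] tlift_tlift bilin_def)
    finally show ?thesis .
  qed
  have "S b \<otimes>\<^bsub>H\<^esub> S a = conv k H H H ?D (\<lambda>c. ?e c \<odot>\<^bsub>H\<^esub> \<one>\<^bsub>H\<^esub>) (\<lambda>a. S b \<otimes>\<^bsub>H\<^esub> S a) a"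
    by (rule conv_unit_left[OF lc, symmetric]) simp_all
  also have "\<dots> = conv k H H H ?D (\<lambda>c. ?e c \<odot>\<^bsub>H\<^esub> \<one>\<^bsub>H\<^esub>) (\<lambda>a. conv k H H H ?D (\<lambda>c. ?e c \<odot>\<^bsub>H\<^esub> \<one>\<^bsub>H\<^esub>) (\<lambda>b. S b \<otimes>\<^bsub>H\<^esub> S a) b) a"
    by (rule conv_cong[OF refl], rule conv_unit_left[OF lc, symmetric]) simp_all
  also have "\<dots> = ?T (\<lambda>a1 a2. ?T (\<lambda>b1 b2. (?e a1 \<odot>\<^bsub>H\<^esub> \<one>\<^bsub>H\<^esub>) \<otimes>\<^bsub>H\<^esub> ((?e b1 \<odot>\<^bsub>H\<^esub> \<one>\<^bsub>H\<^esub>) \<otimes>\<^bsub>H\<^esub> (S b2 \<otimes>\<^bsub>H\<^esub> S a2))) (?D b)) (?D a)"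
    unfolding conv_def by (rule tlift_cong[OF refl], rule tlift_push[where h="\<lambda>z. (?e _ \<odot>\<^bsub>H\<^esub> \<one>\<^bsub>H\<^esub>) \<otimes>\<^bsub>H\<^esub> z"]) simp_all
  also have "\<dots> = ?T (\<lambda>a1 a2. ?T (\<lambda>b1 b2. ?T (\<lambda>x1 x2. ?T (\<lambda>y1 y2. S (x1 \<otimes>\<^bsub>H\<^esub> y1) \<otimes>\<^bsub>H\<^esub> ((x2 \<otimes>\<^bsub>H\<^esub> y2) \<otimes>\<^bsub>H\<^esub> (S b2 \<otimes>\<^bsub>H\<^esub> S a2))) (?D b1)) (?D a1)) (?D b)) (?D a)"
  proof (intro tlift_cong[OF refl])
    fix a1 a2 b1 b2 assume [simp]: "a1 \<in> carrier H" "a2 \<in> carrier H" "b1 \<in> carrier H" "b2 \<in> carrier H"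
    have "(?e a1 \<odot>\<^bsub>H\<^esub> \<one>\<^bsub>H\<^esub>) \<otimes>\<^bsub>H\<^esub> ((?e b1 \<odot>\<^bsub>H\<^esub> \<one>\<^bsub>H\<^esub>) \<otimes>\<^bsub>H\<^esub> (S b2 \<otimes>\<^bsub>H\<^esub> S a2)) =
      ?T (\<lambda>x1 x2. ?T (\<lambda>y1 y2. S (x1 \<otimes>\<^bsub>H\<^esub> y1) \<otimes>\<^bsub>H\<^esub> (x2 \<otimes>\<^bsub>H\<^esub> y2)) (?D b1)) (?D a1) \<otimes>\<^bsub>H\<^esub> (S b2 \<otimes>\<^bsub>H\<^esub> S a2)"
      by (simp add: ee[symmetric] mult_assoc[OF HA])
    also have "\<dots> = ?T (\<lambda>x1 x2. ?T (\<lambda>y1 y2. S (x1 \<otimes>\<^bsub>H\<^esub> y1) \<otimes>\<^bsub>H\<^esub> (x2 \<otimes>\<^bsub>H\<^esub> y2)) (?D b1) \<otimes>\<^bsub>H\<^esub> (S b2 \<otimes>\<^bsub>H\<^esub> S a2)) (?D a1)"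
      by (rule tlift_push[where h="\<lambda>z. z \<otimes>\<^bsub>H\<^esub> (S b2 \<otimes>\<^bsub>H\<^esub> S a2)"]) simp_all
    also have "\<dots> = ?T (\<lambda>x1 x2. ?T (\<lambda>y1 y2. (S (x1 \<otimes>\<^bsub>H\<^esub> y1) \<otimes>\<^bsub>H\<^esub> (x2 \<otimes>\<^bsub>H\<^esub> y2)) \<otimes>\<^bsub>H\<^esub> (S b2 \<otimes>\<^bsub>H\<^esub> S a2)) (?D b1)) (?D a1)"
      by (rule tlift_cong[OF refl], rule tlift_push[where h="\<lambda>z. z \<otimes>\<^bsub>H\<^esub> (S b2 \<otimes>\<^bsub>H\<^esub> S a2)"]) simp_all
    also have "\<dots> = ?T (\<lambda>x1 x2. ?T (\<lambda>y1 y2. S (x1 \<otimes>\<^bsub>H\<^esub> y1) \<otimes>\<^bsub>H\<^esub> ((x2 \<otimes>\<^bsub>H\<^esub> y2) \<otimes>\<^bsub>H\<^esub> (S b2 \<otimes>\<^bsub>H\<^esub> S a2))) (?D b1)) (?D a1)"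
      by (simp add: mult_assoc[OF HA])
    finally show "(?e a1 \<odot>\<^bsub>H\<^esub> \<one>\<^bsub>H\<^esub>) \<otimes>\<^bsub>H\<^esub> ((?e b1 \<odot>\<^bsub>H\<^esub> \<one>\<^bsub>H\<^esub>) \<otimes>\<^bsub>H\<^esub> (S b2 \<otimes>\<^bsub>H\<^esub> S a2)) = \<dots>" .
  qed
  also have "\<dots> = ?T (\<lambda>a1 a2. ?T (\<lambda>x1 x2. ?T (\<lambda>b1 b2. ?T (\<lambda>y1 y2. S (x1 \<otimes>\<^bsub>H\<^esub> y1) \<otimes>\<^bsub>H\<^esub> ((x2 \<otimes>\<^bsub>H\<^esub> y2) \<otimes>\<^bsub>H\<^esub> (S b2 \<otimes>\<^bsub>H\<^esub> S a2))) (?D b1)) (?D b)) (?D a1)) (?D a)"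
    by (rule tlift_cong[OF refl], rule tlift_swap) simp_all
  also have "\<dots> = ?T (\<lambda>a1 a2. ?T (\<lambda>x1 x2. ?T (\<lambda>b1 b2. ?T (\<lambda>y1 y2. S (x1 \<otimes>\<^bsub>H\<^esub> b1) \<otimes>\<^bsub>H\<^esub> ((x2 \<otimes>\<^bsub>H\<^esub> y1) \<otimes>\<^bsub>H\<^esub> (S y2 \<otimes>\<^bsub>H\<^esub> S a2))) (?D b2)) (?D b)) (?D a1)) (?D a)"
    by (rule tlift_cong[OF refl], rule tlift_cong[OF refl], rule coassocD[OF co]) simp_all
  also have "\<dots> = ?T (\<lambda>a1 a2. ?T (\<lambda>x1 x2. ?T (\<lambda>b1 b2. ?T (\<lambda>y1 y2. S (a1 \<otimes>\<^bsub>H\<^esub> b1) \<otimes>\<^bsub>H\<^esub> ((x1 \<otimes>\<^bsub>H\<^esub> y1) \<otimes>\<^bsub>H\<^esub> (S y2 \<otimes>\<^bsub>H\<^esub> S x2))) (?D b2)) (?D b)) (?D a2)) (?D a)"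
    by (rule coassocD[OF co]) simp_all
  also have "\<dots> = ?T (\<lambda>a1 a2. ?T (\<lambda>x1 x2. ?T (\<lambda>b1 b2. S (a1 \<otimes>\<^bsub>H\<^esub> b1) \<otimes>\<^bsub>H\<^esub> (?e b2 \<odot>\<^bsub>H\<^esub> (x1 \<otimes>\<^bsub>H\<^esub> S x2))) (?D b)) (?D a2)) (?D a)"
  proof (intro tlift_cong[OF refl])
    fix a1 x1 x2 b1 b2 assume [simp]: "a1 \<in> carrier H" "x1 \<in> carrier H" "x2 \<in> carrier H" "b1 \<in> carrier H" "b2 \<in> carrier H"
    have l: "(\<lambda>z. S (a1 \<otimes>\<^bsub>H\<^esub> b1) \<otimes>\<^bsub>H\<^esub> ((x1 \<otimes>\<^bsub>H\<^esub> z) \<otimes>\<^bsub>H\<^esub> S x2)) \<in> lin_map k H H" by simp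
    have "?T (\<lambda>y1 y2. S (a1 \<otimes>\<^bsub>H\<^esub> b1) \<otimes>\<^bsub>H\<^esub> ((x1 \<otimes>\<^bsub>H\<^esub> y1) \<otimes>\<^bsub>H\<^esub> (S y2 \<otimes>\<^bsub>H\<^esub> S x2))) (?D b2) =
      ?T (\<lambda>y1 y2. S (a1 \<otimes>\<^bsub>H\<^esub> b1) \<otimes>\<^bsub>H\<^esub> ((x1 \<otimes>\<^bsub>H\<^esub> (y1 \<otimes>\<^bsub>H\<^esub> S y2)) \<otimes>\<^bsub>H\<^esub> S x2)) (?D b2)"
      by (simp add: mult_assoc[OF HA])
    also have "\<dots> = S (a1 \<otimes>\<^bsub>H\<^esub> b1) \<otimes>\<^bsub>H\<^esub> ((x1 \<otimes>\<^bsub>H\<^esub> ?T (\<lambda>y1 y2. y1 \<otimes>\<^bsub>H\<^esub> S y2) (?D b2)) \<otimes>\<^bsub>H\<^esub> S x2)"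
      by (rule tlift_push[OF _ _ _ _ l, symmetric]) simp_all
    also have "\<dots> = S (a1 \<otimes>\<^bsub>H\<^esub> b1) \<otimes>\<^bsub>H\<^esub> (?e b2 \<odot>\<^bsub>H\<^esub> (x1 \<otimes>\<^bsub>H\<^esub> S x2))"
      using SR[of b2] by (simp add: conv_def H.smult_mult_left H.smult_mult_right)
    finally show "?T (\<lambda>y1 y2. S (a1 \<otimes>\<^bsub>H\<^esub> b1) \<otimes>\<^bsub>H\<^esub> ((x1 \<otimes>\<^bsub>H\<^esub> y1) \<otimes>\<^bsub>H\<^esub> (S y2 \<otimes>\<^bsub>H\<^esub> S x2))) (?D b2) = \<dots>" .
  qed
  also have "\<dots> = ?T (\<lambda>a1 a2. ?T (\<lambda>x1 x2. S (a1 \<otimes>\<^bsub>H\<^esub> b) \<otimes>\<^bsub>H\<^esub> (x1 \<otimes>\<^bsub>H\<^esub> S x2)) (?D a2)) (?D a)"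
  proof (intro tlift_cong[OF refl])
    fix a1 x1 x2 assume [simp]: "a1 \<in> carrier H" "x1 \<in> carrier H" "x2 \<in> carrier H"
    have l: "(\<lambda>z. S (a1 \<otimes>\<^bsub>H\<^esub> z) \<otimes>\<^bsub>H\<^esub> (x1 \<otimes>\<^bsub>H\<^esub> S x2)) \<in> lin_map k H H" by simp
    have "?T (\<lambda>b1 b2. S (a1 \<otimes>\<^bsub>H\<^esub> b1) \<otimes>\<^bsub>H\<^esub> (?e b2 \<odot>\<^bsub>H\<^esub> (x1 \<otimes>\<^bsub>H\<^esub> S x2))) (?D b) =
      ?T (\<lambda>b1 b2. S (a1 \<otimes>\<^bsub>H\<^esub> (?e b2 \<odot>\<^bsub>H\<^esub> b1)) \<otimes>\<^bsub>H\<^esub> (x1 \<otimes>\<^bsub>H\<^esub> S x2)) (?D b)"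
      by (rule tlift_cong[OF refl]) (simp add: H.smult_mult_left H.smult_mult_right lin_smult[OF Sl])
    also have "\<dots> = S (a1 \<otimes>\<^bsub>H\<^esub> ?T (\<lambda>b1 b2. ?e b2 \<odot>\<^bsub>H\<^esub> b1) (?D b)) \<otimes>\<^bsub>H\<^esub> (x1 \<otimes>\<^bsub>H\<^esub> S x2)"
      by (rule tlift_push[OF _ _ _ _ l, symmetric]) simp_all
    also have "\<dots> = S (a1 \<otimes>\<^bsub>H\<^esub> b) \<otimes>\<^bsub>H\<^esub> (x1 \<otimes>\<^bsub>H\<^esub> S x2)" using rc by (simp add: right_counital_def)
    finally show "?T (\<lambda>b1 b2. S (a1 \<otimes>\<^bsub>H\<^esub> b1) \<otimes>\<^bsub>H\<^esub> (?e b2 \<odot>\<^bsub>H\<^esub> (x1 \<otimes>\<^bsub>H\<^esub> S x2))) (?D b) = \<dots>" .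
  qed
  also have "\<dots> = conv k H H H ?D (\<lambda>a. S (a \<otimes>\<^bsub>H\<^esub> b)) (conv k H H H ?D (\<lambda>x. x) S) a"
    unfolding conv_def by (rule tlift_cong[OF refl], rule tlift_push[symmetric, where h="\<lambda>z. S (_ \<otimes>\<^bsub>H\<^esub> b) \<otimes>\<^bsub>H\<^esub> z"]) simp_all
  also have "\<dots> = conv k H H H ?D (\<lambda>a. S (a \<otimes>\<^bsub>H\<^esub> b)) (\<lambda>c. ?e c \<odot>\<^bsub>H\<^esub> \<one>\<^bsub>H\<^esub>) a"
    by (rule conv_cong) (simp_all add: SR)
  also have "\<dots> = S (a \<otimes>\<^bsub>H\<^esub> b)" by (rule conv_unit_right[OF rc]) simp_all
  finally show ?thesis ..
qed

lemma antipode_one: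
  assumes bi: "bialgebra k H" and S: "is_antipode k H S"
  shows "S \<one>\<^bsub>H\<^esub> = \<one>\<^bsub>H\<^esub>"
proof -
  interpret H: bialgebra k H by fact
  have HA: "k_algebra k H" using bi by (simp add: bialgebra_def)
  have Sl: "S \<in> lin_map k H H" using S by (simp add: is_antipode_def)
  have el: "counit H \<in> lin_map k H (base_module k)" by (rule alg_hom_lin[OF H.counit_hom])
  note [simp] = HA alg_simps[OF HA] Sl lin_closed[OF Sl] lin_closed[OF alg_hom_lin[OF H.comult_hom]]
  have "mult_map k H (tensor_map k H H S id (comult H \<one>\<^bsub>H\<^esub>)) = unit_map H (counit H \<one>\<^bsub>H\<^esub>)"
    using S by (simp add: is_antipode_def)
  then show ?thesis
    by (simp add: mult_map_tensor_map[OF HA, of H H] unit_map_def alg_hom_one[OF H.comult_hom] alg_hom_one[OF H.counit_hom] tensor_one bilin_def)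
qed

end

section \<open>Structure maps from the universal property\<close>

context descended_algebra begin

text \<open>
  The comultiplication of \<open>Q = C(x,1)\<close> through \<open>y\<close>, with \<open>C = C(x,y)\<close>, \<open>PY = C(y,2)\<close> and \<open>QY = C(y,1)\<close>. The equation to be
  solved says \<open>(E \<otimes> T) \<kappa> = (C \<otimes> \<kappa>Y) D\<close>, and the right-hand side is a colinear algebra map.
\<close>

lemma kappa_comult_exists:
  assumes alg: "k_algebra k C" "k_algebra k PY" "k_algebra k QY"
    and sm: "small U (carrier C)" "small U (carrier QY)"
    and D: "D \<in> alg_hom k X (C \<boxtimes> PY)" and K: "\<kappa>Y \<in> alg_hom k PY (QY \<boxtimes> T)" and cY: "\<chi>Y \<in> lin_map k PY (PY \<boxtimes> B)"
    and co: "coassoc k X C PY B \<chi> D D \<chi>Y" "coassoc k PY QY T B \<chi>Y \<kappa>Y \<kappa>Y \<beta>"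
  obtains E where "E \<in> alg_hom k Q (C \<boxtimes> QY)" "coassoc k X C QY T \<kappa> E D \<kappa>Y"
proof -
  note Dl = alg_hom_lin[OF D] and Kl = alg_hom_lin[OF K]
  note [simp] = alg sm alg_simps[OF alg(1)] alg_simps[OF alg(2)] alg_simps[OF alg(3)] Dl Kl lin_closed[OF Dl] lin_closed[OF Kl] lin_comp[OF Dl] lin_comp[OF Kl]
    cY lin_closed[OF cY] lin_comp[OF cY]
  let ?N = "C \<boxtimes> QY" and ?W = "(C \<boxtimes> QY) \<boxtimes> T"
  have NA: "k_algebra k ?N" and WA: "k_algebra k ?W" by (intro tensor_algebra; simp)+
  note [simp] = NA WA alg_simps[OF NA] alg_simps[OF WA]
  let ?l = "\<lambda>c p. tlift k QY T ?W (\<lambda>q t. pure k ?N T (pure k C QY c q) t) (\<kappa>Y p)"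
  let ?h = "tlift k C PY ?W ?l"
  have bl: "bilin k C PY ?W ?l" by (simp add: bilin_def)
  have hl: "?h \<in> lin_map k (C \<boxtimes> PY) ?W" by (rule tlift_lin) (simp_all add: bl)
  have hp: "?h (pure k C PY c p) = ?l c p" if "c \<in> carrier C" "p \<in> carrier PY" for c p
    using that by (simp add: bl)
  note [simp] = alg_simps[OF tensor_algebra[OF alg(1,2)]]
  have h: "?h \<in> alg_hom k (C \<boxtimes> PY) ?W"
  proof (rule alg_homI[OF hl])
    show "?h \<one>\<^bsub>C \<boxtimes> PY\<^esub> = \<one>\<^bsub>?W\<^esub>"
      by (simp add: tensor_one[of C] tensor_one[of QY] tensor_one[of ?N] bl alg_hom_one[OF K], simp add: bilin_def)
    fix u v assume u: "u \<in> carrier (C \<boxtimes> PY)" and v: "v \<in> carrier (C \<boxtimes> PY)"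
    show "?h (u \<otimes>\<^bsub>C \<boxtimes> PY\<^esub> v) = ?h u \<otimes>\<^bsub>?W\<^esub> ?h v"
    proof (rule tensor_ext[OF _ _ _ _ _ _ u, of ?W "\<lambda>u. ?h (u \<otimes>\<^bsub>C \<boxtimes> PY\<^esub> v)" "\<lambda>u. ?h u \<otimes>\<^bsub>?W\<^esub> ?h v"])
      show "(\<lambda>u. ?h (u \<otimes>\<^bsub>C \<boxtimes> PY\<^esub> v)) \<in> lin_map k (C \<boxtimes> PY) ?W" by (rule lin_comp[OF hl]) (simp add: v)
      show "(\<lambda>u. ?h u \<otimes>\<^bsub>?W\<^esub> ?h v) \<in> lin_map k (C \<boxtimes> PY) ?W" using hl lin_closed[OF hl v] by simp
      fix c p assume cp [simp]: "c \<in> carrier C" "p \<in> carrier PY"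
      show "?h (pure k C PY c p \<otimes>\<^bsub>C \<boxtimes> PY\<^esub> v) = ?h (pure k C PY c p) \<otimes>\<^bsub>?W\<^esub> ?h v"
      proof (rule tensor_ext[OF _ _ _ _ _ _ v, of ?W "\<lambda>v. ?h (pure k C PY c p \<otimes>\<^bsub>C \<boxtimes> PY\<^esub> v)" "\<lambda>v. ?h (pure k C PY c p) \<otimes>\<^bsub>?W\<^esub> ?h v"])
        show "(\<lambda>v. ?h (pure k C PY c p \<otimes>\<^bsub>C \<boxtimes> PY\<^esub> v)) \<in> lin_map k (C \<boxtimes> PY) ?W" by (rule lin_comp[OF hl]) simp
        show "(\<lambda>v. ?h (pure k C PY c p) \<otimes>\<^bsub>?W\<^esub> ?h v) \<in> lin_map k (C \<boxtimes> PY) ?W"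
          using hl lin_closed[OF hl, of "pure k C PY c p"] by simp
        fix c' p' assume [simp]: "c' \<in> carrier C" "p' \<in> carrier PY"
        have "?h (pure k C PY c p \<otimes>\<^bsub>C \<boxtimes> PY\<^esub> pure k C PY c' p') = ?l (c \<otimes>\<^bsub>C\<^esub> c') (p \<otimes>\<^bsub>PY\<^esub> p')"
          by (simp add: tensor_mult_pure bl)
        also have "\<dots> = tlift k QY T ?W (\<lambda>q t. tlift k QY T ?W (\<lambda>q' t'. pure k ?N T (pure k C QY (c \<otimes>\<^bsub>C\<^esub> c') (q \<otimes>\<^bsub>QY\<^esub> q')) (t \<cdot> t')) (\<kappa>Y p')) (\<kappa>Y p)"
          by (simp add: alg_hom_mult_tensor[OF alg(2) alg(3) T_algebra K] tlift_tlift bilin_def)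
        also have "\<dots> = tlift k QY T ?W (\<lambda>q t. pure k ?N T (pure k C QY c q) t \<otimes>\<^bsub>?W\<^esub> ?l c' p') (\<kappa>Y p)"
        proof (rule tlift_cong[OF refl])
          fix q t assume [simp]: "q \<in> carrier QY" "t \<in> carrier T"
          have "pure k ?N T (pure k C QY c q) t \<otimes>\<^bsub>?W\<^esub> ?l c' p' = tlift k QY T ?W (\<lambda>q' t'. pure k ?N T (pure k C QY c q) t \<otimes>\<^bsub>?W\<^esub> pure k ?N T (pure k C QY c' q') t') (\<kappa>Y p')"
            by (rule tlift_push[where h="\<lambda>z. pure k ?N T (pure k C QY c q) t \<otimes>\<^bsub>?W\<^esub> z"]) simp_all
          then show "tlift k QY T ?W (\<lambda>q' t'. pure k ?N T (pure k C QY (c \<otimes>\<^bsub>C\<^esub> c') (q \<otimes>\<^bsub>QY\<^esub> q')) (t \<cdot> t')) (\<kappa>Y p') =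
            pure k ?N T (pure k C QY c q) t \<otimes>\<^bsub>?W\<^esub> ?l c' p'" by (simp add: tensor_mult_pure)
        qed
        also have "\<dots> = ?l c p \<otimes>\<^bsub>?W\<^esub> ?l c' p'"
          by (rule tlift_push[symmetric, where h="\<lambda>z. z \<otimes>\<^bsub>?W\<^esub> ?l c' p'"]) simp_all
        finally show "?h (pure k C PY c p \<otimes>\<^bsub>C \<boxtimes> PY\<^esub> pure k C PY c' p') = ?h (pure k C PY c p) \<otimes>\<^bsub>?W\<^esub> ?h (pure k C PY c' p')"
          by (simp add: bl)
      qed simp_all
    qed simp_all
  qed
  let ?g = "\<lambda>x. ?h (D x)"
  have g: "?g \<in> alg_hom k X ?W" by (rule alg_hom_comp[OF h D])
  have gl: "?g \<in> lin_map k X ?W" by (rule alg_hom_lin[OF g])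
  have "coassoc k X ?N T B \<chi> ?g ?g \<beta>"
  proof (rule coassocI[of X T])
    fix x assume [simp]: "x \<in> carrier X"
    let ?R = "?N \<boxtimes> (T \<boxtimes> B)"
    have b1: "bilin k ?N T ?R (\<lambda>n t. tlift k T B ?R (\<lambda>t b. pure k ?N (T \<boxtimes> B) n (pure k T B t b)) (\<beta> t))" by (simp add: bilin_def)
    have "tlift k X B ?R (\<lambda>a z. tlift k ?N T ?R (\<lambda>n t. pure k ?N (T \<boxtimes> B) n (pure k T B t z)) (?g a)) (\<chi> x)
      = tlift k X B ?R (\<lambda>a z. tlift k C PY ?R (\<lambda>c p. tlift k QY T ?R (\<lambda>q t. pure k ?N (T \<boxtimes> B) (pure k C QY c q) (pure k T B t z)) (\<kappa>Y p)) (D a)) (\<chi> x)"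
      by (rule tlift_cong[OF refl]) (simp add: tlift_tlift bilin_def)
    also have "\<dots> = tlift k C PY ?R (\<lambda>c p. tlift k PY B ?R (\<lambda>p z. tlift k QY T ?R (\<lambda>q t. pure k ?N (T \<boxtimes> B) (pure k C QY c q) (pure k T B t z)) (\<kappa>Y p)) (\<chi>Y p)) (D x)"
      by (rule coassocD[OF co(1)]) (simp_all add: bilin_def)
    also have "\<dots> = tlift k C PY ?R (\<lambda>c p. tlift k QY T ?R (\<lambda>q t. tlift k T B ?R (\<lambda>t z. pure k ?N (T \<boxtimes> B) (pure k C QY c q) (pure k T B t z)) (\<beta> t)) (\<kappa>Y p)) (D x)"
      by (rule tlift_cong[OF refl], rule coassocD[OF co(2)]) simp_all
    also have "\<dots> = tlift k ?N T ?R (\<lambda>n t. tlift k T B ?R (\<lambda>t b. pure k ?N (T \<boxtimes> B) n (pure k T B t b)) (\<beta> t)) (?g x)"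
      by (simp add: tlift_tlift b1)
    finally show "tlift k X B ?R (\<lambda>a z. tlift k ?N T ?R (\<lambda>n t. pure k ?N (T \<boxtimes> B) n (pure k T B t z)) (?g a)) (\<chi> x) =
      tlift k ?N T ?R (\<lambda>n t. tlift k T B ?R (\<lambda>t b. pure k ?N (T \<boxtimes> B) n (pure k T B t b)) (\<beta> t)) (?g x)" .
  qed (simp_all add: gl)
  then obtain E where E: "E \<in> alg_hom k Q ?N" "\<And>x. x \<in> carrier X \<Longrightarrow> tlift k Q T ?W (\<lambda>a t. pure k ?N T (E a) t) (\<kappa> x) = ?g x"
    using kappa_universal_hom[OF NA _ g] by simp blast
  note El = alg_hom_lin[OF E(1)]
  note [simp] = El lin_closed[OF El]
  have "coassoc k X C QY T \<kappa> E D \<kappa>Y"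
  proof (rule coassocI[of Q PY])
    fix x assume x [simp]: "x \<in> carrier X"
    let ?R = "C \<boxtimes> (QY \<boxtimes> T)"
    let ?r = "\<lambda>n t. tlift k C QY ?R (\<lambda>c q. pure k C (QY \<boxtimes> T) c (pure k QY T q t)) n"
    have br: "bilin k ?N T ?R ?r" by (simp add: bilin_def)
    have "tlift k Q T ?R (\<lambda>a t. ?r (E a) t) (\<kappa> x) = tlift k ?N T ?R ?r (tlift k Q T ?W (\<lambda>a t. pure k ?N T (E a) t) (\<kappa> x))"
      by (simp add: tlift_tlift br)
    also have "\<dots> = tlift k ?N T ?R ?r (?g x)" by (simp only: E(2)[OF x])
    also have "\<dots> = tlift k C PY ?R (\<lambda>c p. tlift k QY T ?R (\<lambda>q t. pure k C (QY \<boxtimes> T) c (pure k QY T q t)) (\<kappa>Y p)) (D x)"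
      by (simp add: tlift_tlift br, simp add: bilin_def)
    finally show "tlift k Q T ?R (\<lambda>a t. ?r (E a) t) (\<kappa> x) = \<dots>" .
  qed simp_all
  then show thesis using that E(1) by blast
qed

lemma kappa_counit_exists:
  assumes XT: "D \<in> alg_hom k X T" and co: "\<And>x. x \<in> carrier X \<Longrightarrow> tlift k X B (T \<boxtimes> B) (\<lambda>y b. pure k T B (D y) b) (\<chi> x) = \<beta> (D x)"
  obtains e where "e \<in> alg_hom k Q (base_module k)" "\<And>x. x \<in> carrier X \<Longrightarrow> tlift k Q T T (\<lambda>a t. e a \<odot>\<^bsub>T\<^esub> t) (\<kappa> x) = D x"
proof -
  let ?K = "base_module k"
  note Dl = alg_hom_lin[OF XT]
  note [simp] = Dl lin_closed[OF Dl] lin_comp[OF Dl] base_module_algebra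
  let ?g = "\<lambda>x. pure k ?K T \<one> (D x)"
  have g: "?g \<in> alg_hom k X (?K \<boxtimes> T)"
    by (rule alg_hom_comp[OF _ XT]) (use pure_one_right_hom[OF base_module_algebra T_algebra] in simp)
  have "coassoc k X ?K T B \<chi> ?g ?g \<beta>"
  proof (rule coassocI[of X T])
    fix x assume [simp]: "x \<in> carrier X"
    let ?R = "?K \<boxtimes> (T \<boxtimes> B)"
    have "tlift k X B ?R (\<lambda>a z. pure k ?K (T \<boxtimes> B) \<one> (pure k T B (D a) z)) (\<chi> x) = pure k ?K (T \<boxtimes> B) \<one> (tlift k X B (T \<boxtimes> B) (\<lambda>y b. pure k T B (D y) b) (\<chi> x))"
      by (rule tlift_push[symmetric, where h="\<lambda>z. pure k ?K (T \<boxtimes> B) \<one> z"]) simp_all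
    also have "\<dots> = pure k ?K (T \<boxtimes> B) \<one> (tlift k T B (T \<boxtimes> B) (\<lambda>t b. pure k T B t b) (\<beta> (D x)))"
      by (simp add: co tlift_eta)
    also have "\<dots> = tlift k T B ?R (\<lambda>t b. pure k ?K (T \<boxtimes> B) \<one> (pure k T B t b)) (\<beta> (D x))"
      by (rule tlift_push[where h="\<lambda>z. pure k ?K (T \<boxtimes> B) \<one> z"]) simp_all
    finally show "tlift k X B ?R (\<lambda>a z. tlift k ?K T ?R (\<lambda>x y. pure k ?K (T \<boxtimes> B) x (pure k T B y z)) (?g a)) (\<chi> x) =
      tlift k ?K T ?R (\<lambda>x c. tlift k T B ?R (\<lambda>y z. pure k ?K (T \<boxtimes> B) x (pure k T B y z)) (\<beta> c)) (?g x)"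
      by (simp add: bilin_def)
  qed (simp_all add: alg_hom_lin[OF g])
  then obtain e where e: "e \<in> alg_hom k Q ?K" "\<And>x. x \<in> carrier X \<Longrightarrow> tlift k Q T (?K \<boxtimes> T) (\<lambda>a t. pure k ?K T (e a) t) (\<kappa> x) = ?g x"
    using kappa_universal_hom[OF base_module_algebra _ g] by simp blast
  note el = alg_hom_lin[OF e(1)]
  note [simp] = el lin_closed[OF el, simplified]
  have "tlift k Q T T (\<lambda>a t. e a \<odot>\<^bsub>T\<^esub> t) (\<kappa> x) = D x" if x [simp]: "x \<in> carrier X" for x
  proof -
    have "tlift k Q T T (\<lambda>a t. e a \<odot>\<^bsub>T\<^esub> t) (\<kappa> x) = tlift k ?K T T (\<lambda>c t. c \<odot>\<^bsub>T\<^esub> t) (tlift k Q T (?K \<boxtimes> T) (\<lambda>a t. pure k ?K T (e a) t) (\<kappa> x))"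
      by (simp add: tlift_tlift smult_bilin)
    also have "\<dots> = D x" by (simp only: e(2)[OF x]) (simp add: smult_bilin)
    finally show ?thesis .
  qed
  then show thesis using that e(1) by blast
qed

end

section \<open>The cogroupoid of a Galois object\<close>


text \<open>
  The cogroupoid before the existence of antipodes. The assumed laws are the equations that define the
  structure maps. A law \<open>coassoc_xyzw\<close> is coassociativity along the path from \<open>x\<close> to \<open>w\<close> through \<open>y\<close>
  and \<open>z\<close>, with \<open>C(1,1) = A\<close>, \<open>C(1,2) = T\<close>, \<open>C(2,1) = Z\<close>, \<open>C(2,2) = B\<close>.
\<close>

locale galois_cogroupoid = galois_ff k B T \<beta> U + TA: descended_algebra k B T \<beta> U T \<beta> A + BZ: descended_algebra k B T \<beta> U B "comult B" Z
  for k :: "('k, 'r) ring_scheme" (structure) and B :: "('k, 'b, 'x) bialg_scheme"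
    and T :: "('k, 't, 'y) module_scheme" and \<beta> :: "'t \<Rightarrow> ('t \<times> 'b \<Rightarrow> 'k) set" and U :: "'u itself"
    and A :: "('k, ('t \<times> 't \<Rightarrow> 'k) set, 'q) bialg_scheme" and Z :: "('k, ('b \<times> 't \<Rightarrow> 'k) set, 'z) module_scheme" +
  fixes \<gamma> \<rho> lam
  assumes comultA_hom: "comult A \<in> alg_hom k A (A \<boxtimes> A)" and counitA_hom: "counit A \<in> alg_hom k A (base_module k)"
    and gamma_hom: "\<gamma> \<in> alg_hom k A (T \<boxtimes> Z)" and rho_hom: "\<rho> \<in> alg_hom k Z (Z \<boxtimes> A)" and lam_hom: "lam \<in> alg_hom k Z (B \<boxtimes> Z)"
    and coassoc_1112: "coassoc k T A A T TA.\<kappa> (comult A) TA.\<kappa> TA.\<kappa>"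
    and coassoc_1212: "coassoc k T T Z T TA.\<kappa> \<gamma> \<beta> BZ.\<kappa>"
    and coassoc_2112: "coassoc k B Z A T BZ.\<kappa> \<rho> BZ.\<kappa> TA.\<kappa>"
    and coassoc_2212: "coassoc k B B Z T BZ.\<kappa> lam (comult B) BZ.\<kappa>"
    and counitA: "left_counital k A T TA.\<kappa> (counit A)"
    and B_hopf: "hopf_algebra k B" and nontriv: "\<one> \<noteq> \<zero>"
begin

abbreviation "\<Delta>A \<equiv> comult A"
abbreviation "\<epsilon>A \<equiv> counit A"
abbreviation "\<alpha> \<equiv> TA.\<kappa>"
abbreviation "\<delta> \<equiv> BZ.\<kappa>"

lemmas comultA_lin [simp] = alg_hom_lin[OF comultA_hom]
lemmas counitA_lin [simp] = alg_hom_lin[OF counitA_hom]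
lemmas gamma_lin [simp] = alg_hom_lin[OF gamma_hom]
lemmas rho_lin [simp] = alg_hom_lin[OF rho_hom]
lemmas lam_lin [simp] = alg_hom_lin[OF lam_hom]
lemmas [simp] = lin_closed[OF comultA_lin] lin_closed[OF gamma_lin] lin_closed[OF rho_lin] lin_closed[OF lam_lin] lin_closed[OF counitA_lin, simplified]
  lin_comp[OF comultA_lin] lin_comp[OF gamma_lin] lin_comp[OF rho_lin] lin_comp[OF lam_lin] lin_comp[OF counitA_lin]

lemmas coassoc_1122 = TA.kappa_colinear
lemmas coassoc_1222 = beta_coassoc
lemmas coassoc_2122 = BZ.kappa_colinear
lemmas coassoc_2222 = comult_coassoc

lemma coassoc_1111: "coassoc k A A A A \<Delta>A \<Delta>A \<Delta>A \<Delta>A"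
  by (rule TA.kappa_coassoc_transfer[OF _ _ _ _ _ _ _ _ _ _ _ _ _ _ _ _ _ _ _ coassoc_1112 coassoc_1112 coassoc_1112 coassoc_1112]) simp_all

lemma coassoc_1121: "coassoc k A A T Z \<gamma> \<alpha> \<Delta>A \<gamma>"
  by (rule TA.kappa_coassoc_transfer[OF _ _ _ _ _ _ _ _ _ _ _ _ _ _ _ _ _ _ _ coassoc_1212 coassoc_1112 coassoc_1212 coassoc_1122]) simp_all

lemma coassoc_1211: "coassoc k A T Z A \<Delta>A \<gamma> \<gamma> \<rho>"
  by (rule TA.kappa_coassoc_transfer[OF _ _ _ _ _ _ _ _ _ _ _ _ _ _ _ _ _ _ _ coassoc_1112 coassoc_1212 coassoc_2112 coassoc_1212]) simp_all

lemma coassoc_1221: "coassoc k A T B Z \<gamma> \<beta> \<gamma> lam"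
  by (rule TA.kappa_coassoc_transfer[OF _ _ _ _ _ _ _ _ _ _ _ _ _ _ _ _ _ _ _ coassoc_1212 coassoc_1212 coassoc_2212 coassoc_1222]) simp_all

lemma coassoc_2111: "coassoc k Z Z A A \<rho> \<rho> \<rho> \<Delta>A"
  by (rule BZ.kappa_coassoc_transfer[OF _ _ _ _ _ _ _ _ _ _ _ _ _ _ _ _ _ _ _ coassoc_2112 coassoc_2112 coassoc_1112 coassoc_2112]) simp_all

lemma coassoc_2121: "coassoc k Z Z T Z lam \<delta> \<rho> \<gamma>"
  by (rule BZ.kappa_coassoc_transfer[OF _ _ _ _ _ _ _ _ _ _ _ _ _ _ _ _ _ _ _ coassoc_2212 coassoc_2112 coassoc_1212 coassoc_2122]) simp_all

lemma coassoc_2211: "coassoc k Z B Z A \<rho> lam lam \<rho>"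
  by (rule BZ.kappa_coassoc_transfer[OF _ _ _ _ _ _ _ _ _ _ _ _ _ _ _ _ _ _ _ coassoc_2112 coassoc_2212 coassoc_2112 coassoc_2212]) simp_all

lemma coassoc_2221: "coassoc k Z B B Z lam \<Delta> lam lam"
  by (rule BZ.kappa_coassoc_transfer[OF _ _ _ _ _ _ _ _ _ _ _ _ _ _ _ _ _ _ _ coassoc_2212 coassoc_2212 coassoc_2212 coassoc_2222]) simp_all

lemma lcT: "left_counital k A T \<alpha> \<epsilon>A" by (rule counitA)
lemma rcT: "right_counital k T B \<beta> \<epsilon>" by (simp add: right_counital_def beta_counit)
lemma lcB: "left_counital k B B \<Delta> \<epsilon>" by (simp add: left_counital_def comult_counit_left)
lemma rcB: "right_counital k B B \<Delta> \<epsilon>" by (simp add: right_counital_def comult_counit_right)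
lemma lcA: "left_counital k A A \<Delta>A \<epsilon>A" by (rule TA.kappa_left_counital[OF _ _ _ _ coassoc_1112 lcT]) simp_all
lemma lcZ: "left_counital k B Z lam \<epsilon>" by (rule BZ.kappa_left_counital[OF _ _ _ _ coassoc_2212 lcB]) simp_all
lemma rcA: "right_counital k A A \<Delta>A \<epsilon>A" by (rule TA.kappa_right_counital[OF _ _ _ _ coassoc_1112 lcT]) simp_all
lemma rcZ: "right_counital k Z A \<rho> \<epsilon>A" by (rule BZ.kappa_right_counital[OF _ _ _ _ coassoc_2112 lcT]) simp_all

definition "SZ = tlift k B T T (\<lambda>b t. \<epsilon> b \<odot>\<^bsub>T\<^esub> t)"

lemma SZ_V_lin: "SZ \<in> lin_map k (B \<boxtimes> T) T"
  unfolding SZ_def by (rule tlift_lin) (simp_all add: bilin_def lin_smult_left lin_smult_right)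

lemma SZ_lin [simp]: "SZ \<in> lin_map k Z T" by (rule BZ.Q_lin_V[OF SZ_V_lin])

lemmas [simp] = lin_closed[OF SZ_V_lin] lin_comp[OF SZ_lin]

lemma SZ_pure [simp]: "b \<in> carrier B \<Longrightarrow> t \<in> carrier T \<Longrightarrow> SZ (pure k B T b t) = \<epsilon> b \<odot>\<^bsub>T\<^esub> t"
  unfolding SZ_def by (simp add: bilin_def lin_smult_left lin_smult_right)

lemma SZ_opp_mult:
  assumes "u \<in> carrier (B \<boxtimes> T)" "v \<in> carrier (B \<boxtimes> T)"
  shows "SZ (BZ.opp_mult u v) = SZ v \<cdot> SZ u"
proof -
  note [simp] = SZ_V_lin lin_comp[OF SZ_V_lin]
  show ?thesis
  proof (rule tensor_ext[OF _ _ _ _ _ _ assms(1), of T "\<lambda>u. SZ (BZ.opp_mult u v)"])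
    fix b t assume [simp]: "b \<in> carrier B" "t \<in> carrier T"
    show "SZ (BZ.opp_mult (pure k B T b t) v) = SZ v \<cdot> SZ (pure k B T b t)"
    proof (rule tensor_ext[OF _ _ _ _ _ _ assms(2), of T "\<lambda>v. SZ (BZ.opp_mult (pure k B T b t) v)"])
      fix b' t' assume [simp]: "b' \<in> carrier B" "t' \<in> carrier T"
      show "SZ (BZ.opp_mult (pure k B T b t) (pure k B T b' t')) = SZ (pure k B T b' t') \<cdot> SZ (pure k B T b t)"
        by (simp add: alg_hom_mult[OF counit_hom] k_algebra.smult_mult_left[OF T_algebra] T_smult_mult T.smult_assoc1)
    qed simp_all
  qed (use assms in simp_all)
qed

lemma SZ_hom: "SZ \<in> alg_hom k Z (opp T)"
proof (rule alg_homI)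
  show "SZ \<in> lin_map k Z (opp T)" using SZ_lin by (simp add: lin_map_def)
  show "SZ (x \<otimes>\<^bsub>Z\<^esub> y) = SZ x \<otimes>\<^bsub>opp T\<^esub> SZ y" if "x \<in> carrier Z" "y \<in> carrier Z" for x y
    using that by (simp add: BZ.Q_mult SZ_opp_mult)
  show "SZ \<one>\<^bsub>Z\<^esub> = \<one>\<^bsub>opp T\<^esub>" by (simp add: BZ.Q_one alg_hom_one[OF counit_hom])
qed

text \<open>
  \<open>S\<^sub>Z\<close> turns the action of \<open>T\<close> on \<open>B \<otimes> T\<close> into multiplication, and \<open>\<Phi>(\<delta>(b)) = b \<otimes> 1\<close>.
\<close>

lemma SZ_delta: "b \<in> carrier B \<Longrightarrow> conv k Z T T \<delta> SZ (\<lambda>x. x) b = \<epsilon> b \<odot>\<^bsub>T\<^esub> \<one>\<^bsub>T\<^esub>"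
proof -
  assume b [simp]: "b \<in> carrier B"
  have r: "SZ (BZ.right_act m t) = SZ m \<cdot> t" if "m \<in> carrier (B \<boxtimes> T)" "t \<in> carrier T" for m t
    by (rule tensor_ext[OF _ _ _ lin_comp[OF SZ_V_lin] _ _ that(1), of "\<lambda>m. BZ.right_act m t"])
      (use that SZ_V_lin in \<open>simp_all add: k_algebra.smult_mult_left[OF T_algebra]\<close>)
  have "conv k Z T T \<delta> SZ (\<lambda>x. x) b = tlift k Z T T (\<lambda>z t. SZ (BZ.right_act z t)) (\<delta> b)"
    unfolding conv_def by (rule tlift_cong[OF refl]) (simp add: r)
  also have "\<dots> = SZ (BZ.\<Phi> (\<delta> b))"
    unfolding BZ.\<Phi>_def by (rule tlift_push[symmetric, OF _ _ _ _ SZ_V_lin]) simp_all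
  finally show ?thesis by (simp add: BZ.phi_kappa)
qed

text \<open>
  \<open>(S\<^sub>Z \<otimes> T) \<delta> = \<tau>\<close>, since \<open>\<delta>(b)\<close> is \<open>b\<^sub>1 \<otimes> \<tau>(b\<^sub>2)\<close> and \<open>S\<^sub>Z\<close> applies the counit to \<open>b\<^sub>1\<close>.
\<close>

lemma SZ_tau:
  assumes P: "module k P" and b: "b \<in> carrier B" and f: "bilin k T T P f"
  shows "tlift k Z T P (\<lambda>z t. f (SZ z) t) (\<delta> b) = tlift k T T P f (\<tau> b)"
proof -
  have P' [simp]: "module k P" by (rule P)
  interpret P: module k P by (rule P)
  note [simp] = b bilin_closed[OF f] lin_bilin_left[OF f] lin_bilin_right[OF f] f SZ_V_lin lin_comp[OF SZ_V_lin]
  have "tlift k Z T P (\<lambda>z t. f (SZ z) t) (\<delta> b) = tlift k B B P (\<lambda>b0 b1. tlift k T T P (\<lambda>p q. f (SZ (pure k B T b0 p)) q) (\<tau> b1)) (\<Delta> b)"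
    by (rule BZ.kappa_sum) (simp_all add: bilin_def)
  also have "\<dots> = tlift k B B P (\<lambda>b0 b1. tlift k T T P f (\<tau> (\<epsilon> b0 \<odot>\<^bsub>B\<^esub> b1))) (\<Delta> b)"
  proof (rule tlift_cong[OF refl])
    fix b0 b1 assume [simp]: "b0 \<in> carrier B" "b1 \<in> carrier B"
    have "tlift k T T P f (\<tau> (\<epsilon> b0 \<odot>\<^bsub>B\<^esub> b1)) = \<epsilon> b0 \<odot>\<^bsub>P\<^esub> tlift k T T P f (\<tau> b1)"
      by (rule lin_smult[of "\<lambda>b. tlift k T T P f (\<tau> b)" k]) simp_all
    also have "\<dots> = tlift k T T P (\<lambda>p q. \<epsilon> b0 \<odot>\<^bsub>P\<^esub> f p q) (\<tau> b1)"
      by (rule tlift_push[where h="\<lambda>z. \<epsilon> b0 \<odot>\<^bsub>P\<^esub> z"]) (simp_all add: lin_smult_right)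
    also have "\<dots> = tlift k T T P (\<lambda>p q. f (SZ (pure k B T b0 p)) q) (\<tau> b1)"
      by (rule tlift_cong[OF refl]) (simp add: lin_smult[OF bilin_left[OF f]])
    finally show "tlift k T T P (\<lambda>p q. f (SZ (pure k B T b0 p)) q) (\<tau> b1) = tlift k T T P f (\<tau> (\<epsilon> b0 \<odot>\<^bsub>B\<^esub> b1))" ..
  qed
  also have "\<dots> = tlift k T T P f (\<tau> (tlift k B B B (\<lambda>b0 b1. \<epsilon> b0 \<odot>\<^bsub>B\<^esub> b1) (\<Delta> b)))"
    by (rule tlift_push[symmetric, where h="\<lambda>b. tlift k T T P f (\<tau> b)"]) simp_all
  finally show ?thesis by (simp add: comult_counit_left)
qed

text \<open>
  After composition with \<open>\<alpha>\<close> the claim becomes \<open>\<Sum> x\<^sub>0 \<tau>(x\<^sub>1) = 1 \<otimes> x\<close>.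
\<close>

lemma SZ_gamma:
  assumes a: "a \<in> carrier A"
  shows "conv k T Z T \<gamma> (\<lambda>x. x) SZ a = \<epsilon>A a \<odot>\<^bsub>T\<^esub> \<one>\<^bsub>T\<^esub>"
proof (rule TA.kappa_unique[OF _ _ _ _ _ a, of T "\<lambda>a. conv k T Z T \<gamma> (\<lambda>x. x) SZ a" "\<lambda>a. \<epsilon>A a \<odot>\<^bsub>T\<^esub> \<one>\<^bsub>T\<^esub>"])
  show "(\<lambda>a. conv k T Z T \<gamma> (\<lambda>x. x) SZ a) \<in> lin_map k A T" by (rule conv_lin[where C=A]) simp_all
  show "(\<lambda>a. \<epsilon>A a \<odot>\<^bsub>T\<^esub> \<one>\<^bsub>T\<^esub>) \<in> lin_map k A T" by (rule lin_smult_left) simp_all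
  fix x assume x [simp]: "x \<in> carrier T"
  have "tlift k A T (T \<boxtimes> T) (\<lambda>a t. pure k T T (conv k T Z T \<gamma> (\<lambda>x. x) SZ a) t) (\<alpha> x) =
    tlift k A T (T \<boxtimes> T) (\<lambda>a t. tlift k T Z (T \<boxtimes> T) (\<lambda>s z. pure k T T (s \<cdot> SZ z) t) (\<gamma> a)) (\<alpha> x)"
    unfolding conv_def by (rule tlift_cong[OF refl], rule tlift_push[where h="\<lambda>z. pure k T T z _"]) simp_all
  also have "\<dots> = tlift k T B (T \<boxtimes> T) (\<lambda>s b. tlift k Z T (T \<boxtimes> T) (\<lambda>z t. pure k T T (s \<cdot> SZ z) t) (\<delta> b)) (\<beta> x)"
    by (rule coassocD[OF coassoc_1212]) simp_all
  also have "\<dots> = tlift k T B (T \<boxtimes> T) (\<lambda>s b. tlift k T T (T \<boxtimes> T) (\<lambda>p q. pure k T T (s \<cdot> p) q) (\<tau> b)) (\<beta> x)"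
    by (rule tlift_cong[OF refl], rule SZ_tau[where f="\<lambda>p q. pure k T T (_ \<cdot> p) q"]) (simp_all add: bilin_def)
  also have "\<dots> = pure k T T \<one>\<^bsub>T\<^esub> x" by (rule tau_beta) simp
  also have "\<dots> = pure k T T \<one>\<^bsub>T\<^esub> (tlift k A T T (\<lambda>a t. \<epsilon>A a \<odot>\<^bsub>T\<^esub> t) (\<alpha> x))"
    using lcT by (simp add: left_counital_def)
  also have "\<dots> = tlift k A T (T \<boxtimes> T) (\<lambda>a t. pure k T T \<one>\<^bsub>T\<^esub> (\<epsilon>A a \<odot>\<^bsub>T\<^esub> t)) (\<alpha> x)"
    by (rule tlift_push[where h="\<lambda>z. pure k T T \<one>\<^bsub>T\<^esub> z"]) simp_all
  also have "\<dots> = tlift k A T (T \<boxtimes> T) (\<lambda>a t. pure k T T (\<epsilon>A a \<odot>\<^bsub>T\<^esub> \<one>\<^bsub>T\<^esub>) t) (\<alpha> x)"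
  proof (rule tlift_cong[OF refl])
    fix a t assume [simp]: "a \<in> carrier A" "t \<in> carrier T"
    show "pure k T T \<one>\<^bsub>T\<^esub> (\<epsilon>A a \<odot>\<^bsub>T\<^esub> t) = pure k T T (\<epsilon>A a \<odot>\<^bsub>T\<^esub> \<one>\<^bsub>T\<^esub>) t"
      using lin_smult[of "\<lambda>y. pure k T T y t" k T "T \<boxtimes> T" "\<epsilon>A a" "\<one>\<^bsub>T\<^esub>"] lin_smult[of "\<lambda>y. pure k T T \<one>\<^bsub>T\<^esub> y" k T "T \<boxtimes> T" "\<epsilon>A a" t] by simp
  qed
  finally show "tlift k A T (T \<boxtimes> T) (\<lambda>a t. pure k T T (conv k T Z T \<gamma> (\<lambda>x. x) SZ a) t) (\<alpha> x) =
    tlift k A T (T \<boxtimes> T) (\<lambda>a t. pure k T T (\<epsilon>A a \<odot>\<^bsub>T\<^esub> \<one>\<^bsub>T\<^esub>) t) (\<alpha> x)" .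
qed simp_all

definition "SB = antipode k B"

lemma SB: "is_antipode k B SB"
  using conjunct2[OF B_hopf[unfolded hopf_algebra_def]] unfolding SB_def antipode_def by (rule someI_ex)

lemma SB_lin [simp]: "SB \<in> lin_map k B B" using SB by (simp add: is_antipode_def)
lemmas [simp] = lin_closed[OF SB_lin] lin_comp[OF SB_lin]

lemma SB_inv: "c \<in> carrier B \<Longrightarrow> conv k B B B \<Delta> SB (\<lambda>x. x) c = \<epsilon> c \<odot>\<^bsub>B\<^esub> \<one>\<^bsub>B\<^esub>"
  "c \<in> carrier B \<Longrightarrow> conv k B B B \<Delta> (\<lambda>x. x) SB c = \<epsilon> c \<odot>\<^bsub>B\<^esub> \<one>\<^bsub>B\<^esub>"
  using SB by (simp_all add: is_antipode_def mult_map_tensor_map[of B B B] conv_def unit_map_def)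

lemma ST_exists: "\<exists>S. S \<in> lin_map k T Z \<and>
    (\<forall>c \<in> carrier B. conv k Z T Z \<delta> (\<lambda>x. x) S c = \<epsilon> c \<odot>\<^bsub>Z\<^esub> \<one>\<^bsub>Z\<^esub>) \<and>
    (\<forall>c \<in> carrier A. conv k T Z Z \<gamma> S (\<lambda>x. x) c = \<epsilon>A c \<odot>\<^bsub>Z\<^esub> \<one>\<^bsub>Z\<^esub>) \<and>
    (\<forall>c \<in> carrier T. pure k Z T (S c) \<one>\<^bsub>T\<^esub> = conv k T B (Z \<boxtimes> T) \<beta> (\<lambda>t. pure k Z T \<one>\<^bsub>Z\<^esub> t) (\<lambda>y. \<delta> (SB y)) c)"
  by (rule antipode_exists[where Q=Z and P=B and W=T and Y=B and J=B and A=A and Z=Z and \<kappa>=\<delta> and qb=lam and qa=\<rho> and w=\<beta> and wl=\<alpha> and wr=\<beta>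
      and ja=\<delta> and jb=\<Delta> and aX=\<gamma> and ab=\<gamma> and z=lam and zl=lam and bX=\<Delta> and eA=\<epsilon>A and eJ=\<epsilon> and s=SB and SZ=SZ])
    (auto simp: BZ.kappa_hom coassoc_2122 coassoc_1221 coassoc_2121 coassoc_2221 coassoc_1212 rcZ lcZ lcT rcT SB_inv SZ_gamma)

lemma SA_exists: "\<exists>S. S \<in> lin_map k A A \<and>
    (\<forall>c \<in> carrier A. conv k A A A \<Delta>A (\<lambda>x. x) S c = \<epsilon>A c \<odot>\<^bsub>A\<^esub> \<one>\<^bsub>A\<^esub>) \<and>
    (\<forall>c \<in> carrier A. conv k A A A \<Delta>A S (\<lambda>x. x) c = \<epsilon>A c \<odot>\<^bsub>A\<^esub> \<one>\<^bsub>A\<^esub>)"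
  by (rule antipode_exists[where Q=A and P=T and W=A and Y=Z and J=A and A=A and Z=Z and \<kappa>=\<alpha> and qb=\<gamma> and qa=\<Delta>A and w=\<gamma> and wl=\<Delta>A and wr=\<Delta>A
      and ja=\<Delta>A and jb=\<gamma> and aX=\<Delta>A and ab=\<gamma> and z=\<rho> and zl=lam and bX=\<delta> and eA=\<epsilon>A and eJ=\<epsilon>A and s=SZ and SZ=SZ])
    (auto simp: TA.kappa_hom coassoc_1111 coassoc_1121 coassoc_1211 coassoc_2121 rcA lcZ lcA SZ_gamma SZ_delta)

definition "ST = (SOME S. S \<in> lin_map k T Z \<and>
    (\<forall>c \<in> carrier B. conv k Z T Z \<delta> (\<lambda>x. x) S c = \<epsilon> c \<odot>\<^bsub>Z\<^esub> \<one>\<^bsub>Z\<^esub>) \<and>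
    (\<forall>c \<in> carrier A. conv k T Z Z \<gamma> S (\<lambda>x. x) c = \<epsilon>A c \<odot>\<^bsub>Z\<^esub> \<one>\<^bsub>Z\<^esub>) \<and>
    (\<forall>c \<in> carrier T. pure k Z T (S c) \<one>\<^bsub>T\<^esub> = conv k T B (Z \<boxtimes> T) \<beta> (\<lambda>t. pure k Z T \<one>\<^bsub>Z\<^esub> t) (\<lambda>y. \<delta> (SB y)) c))"

lemma ST_lin [simp]: "ST \<in> lin_map k T Z"
  and ST_delta: "c \<in> carrier B \<Longrightarrow> conv k Z T Z \<delta> (\<lambda>x. x) ST c = \<epsilon> c \<odot>\<^bsub>Z\<^esub> \<one>\<^bsub>Z\<^esub>"
  and ST_gamma: "a \<in> carrier A \<Longrightarrow> conv k T Z Z \<gamma> ST (\<lambda>x. x) a = \<epsilon>A a \<odot>\<^bsub>Z\<^esub> \<one>\<^bsub>Z\<^esub>"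
  and ST_formula: "t \<in> carrier T \<Longrightarrow> pure k Z T (ST t) \<one>\<^bsub>T\<^esub> = conv k T B (Z \<boxtimes> T) \<beta> (\<lambda>t. pure k Z T \<one>\<^bsub>Z\<^esub> t) (\<lambda>y. \<delta> (SB y)) t"
  using someI_ex[OF ST_exists] unfolding ST_def[symmetric] by blast+

lemmas [simp] = lin_closed[OF ST_lin] lin_comp[OF ST_lin]

lemma A_bialgebra: "bialgebra k A"
proof (intro bialgebra.intro bialgebra_axioms.intro)
  show "k_algebra k A" by simp
  show "\<Delta>A \<in> alg_hom k A (A \<boxtimes> A)" by (rule comultA_hom)
  show "\<epsilon>A \<in> alg_hom k A (base_module k)" by (rule counitA_hom)
  show "\<forall>a\<in>carrier A. tensor_assoc k A A A (tensor_map k (A \<boxtimes> A) A \<Delta>A id (\<Delta>A a)) = tensor_map k A (A \<boxtimes> A) id \<Delta>A (\<Delta>A a)"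
    using coassoc_1111 by (simp add: coassoc_def)
  show "\<forall>a\<in>carrier A. left_unitor k A (tensor_map k (base_module k) A \<epsilon>A id (\<Delta>A a)) = a"
    using lcA by (simp add: left_counital_def left_counit_eq[of A A])
  show "\<forall>a\<in>carrier A. right_unitor k A (tensor_map k A (base_module k) id \<epsilon>A (\<Delta>A a)) = a"
    using rcA by (simp add: right_counital_def right_counit_eq[of A A])
qed

definition "SA = antipode k A"

lemma A_hopf: "hopf_algebra k A" and SA: "is_antipode k A SA"
proof -
  obtain S where S: "S \<in> lin_map k A A"
    "\<And>c. c \<in> carrier A \<Longrightarrow> conv k A A A \<Delta>A (\<lambda>x. x) S c = \<epsilon>A c \<odot>\<^bsub>A\<^esub> \<one>\<^bsub>A\<^esub>"
    "\<And>c. c \<in> carrier A \<Longrightarrow> conv k A A A \<Delta>A S (\<lambda>x. x) c = \<epsilon>A c \<odot>\<^bsub>A\<^esub> \<one>\<^bsub>A\<^esub>"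
    using SA_exists by blast
  have "is_antipode k A S"
    using S by (simp add: is_antipode_def mult_map_tensor_map[of A A A] conv_def unit_map_def)
  then show "hopf_algebra k A" using A_bialgebra unfolding hopf_algebra_def by (intro conjI exI)
  from \<open>is_antipode k A S\<close> show "is_antipode k A SA"
    unfolding SA_def antipode_def by (rule someI[of "is_antipode k A"])
qed

lemma SA_lin [simp]: "SA \<in> lin_map k A A" using SA by (simp add: is_antipode_def)
lemmas [simp] = lin_closed[OF SA_lin] lin_comp[OF SA_lin]

lemma SA_inv: "c \<in> carrier A \<Longrightarrow> conv k A A A \<Delta>A SA (\<lambda>x. x) c = \<epsilon>A c \<odot>\<^bsub>A\<^esub> \<one>\<^bsub>A\<^esub>"
  "c \<in> carrier A \<Longrightarrow> conv k A A A \<Delta>A (\<lambda>x. x) SA c = \<epsilon>A c \<odot>\<^bsub>A\<^esub> \<one>\<^bsub>A\<^esub>"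
  using SA by (simp_all add: is_antipode_def mult_map_tensor_map[of A A A] conv_def unit_map_def)

text \<open>
  By construction \<open>S\<^sub>T(t) \<otimes> 1 = \<Sum> (1 \<otimes> t\<^sub>0) \<delta>(S\<^sub>B(t\<^sub>1))\<close>. In the expansion of \<open>S\<^sub>T(st)\<close> the antimultiplicativity of \<open>S\<^sub>B\<close>
  puts the factors of \<open>t\<close> inside those of \<open>s\<close>; they add up to \<open>S\<^sub>T(t) \<otimes> 1\<close>, which commutes with \<open>1 \<otimes> s\<^sub>0\<close>.
\<close>

lemma ST_hom: "ST \<in> alg_hom k T (opp Z)"
proof (rule alg_homI)
  let ?R = "Z \<boxtimes> T"
  have RA: "k_algebra k ?R" by (rule tensor_algebra) simp_all
  note [simp] = RA alg_simps[OF RA]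
  let ?u = "\<lambda>t. pure k Z T \<one>\<^bsub>Z\<^esub> t" and ?i = "\<lambda>z. pure k Z T z \<one>\<^bsub>T\<^esub>"
  show "ST \<in> lin_map k T (opp Z)" using ST_lin by (simp add: lin_map_def)
  have v: "?i (ST x) = tlift k T B ?R (\<lambda>t b. ?u t \<otimes>\<^bsub>?R\<^esub> \<delta> (SB b)) (\<beta> x)" if "x \<in> carrier T" for x
    using ST_formula[OF that] by (simp add: conv_def)
  fix s t assume st [simp]: "s \<in> carrier T" "t \<in> carrier T"
  have bil: "bilin k T B ?R (\<lambda>t b. ?u t \<otimes>\<^bsub>?R\<^esub> \<delta> (SB b))" by (simp add: bilin_def)
  have "?i (ST (s \<cdot> t)) = tlift k T B ?R (\<lambda>s0 s1. tlift k T B ?R (\<lambda>t0 t1. ?u (s0 \<cdot> t0) \<otimes>\<^bsub>?R\<^esub> \<delta> (SB (s1 \<otimes>\<^bsub>B\<^esub> t1))) (\<beta> t)) (\<beta> s)"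
    by (simp add: v alg_hom_mult_tensor[OF T_algebra T_algebra B_algebra right_coaction_hom] tlift_tlift bil)
  also have "\<dots> = tlift k T B ?R (\<lambda>s0 s1. tlift k T B ?R (\<lambda>t0 t1. ?u s0 \<otimes>\<^bsub>?R\<^esub> ((?u t0 \<otimes>\<^bsub>?R\<^esub> \<delta> (SB t1)) \<otimes>\<^bsub>?R\<^esub> \<delta> (SB s1))) (\<beta> t)) (\<beta> s)"
  proof (intro tlift_cong[OF refl])
    fix s0 s1 t0 t1 assume [simp]: "s0 \<in> carrier T" "t0 \<in> carrier T" "s1 \<in> carrier B" "t1 \<in> carrier B"
    have "?u (s0 \<cdot> t0) = ?u s0 \<otimes>\<^bsub>?R\<^esub> ?u t0" by (simp add: tensor_mult_pure)
    then show "?u (s0 \<cdot> t0) \<otimes>\<^bsub>?R\<^esub> \<delta> (SB (s1 \<otimes>\<^bsub>B\<^esub> t1)) = ?u s0 \<otimes>\<^bsub>?R\<^esub> ((?u t0 \<otimes>\<^bsub>?R\<^esub> \<delta> (SB t1)) \<otimes>\<^bsub>?R\<^esub> \<delta> (SB s1))"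
      by (simp add: antipode_antimult[OF right_bialgebra SB] alg_hom_mult[OF BZ.kappa_hom] mult_assoc[OF RA])
  qed
  also have "\<dots> = tlift k T B ?R (\<lambda>s0 s1. ?u s0 \<otimes>\<^bsub>?R\<^esub> (?i (ST t) \<otimes>\<^bsub>?R\<^esub> \<delta> (SB s1))) (\<beta> s)"
  proof (rule tlift_cong[OF refl])
    fix s0 s1 assume [simp]: "s0 \<in> carrier T" "s1 \<in> carrier B"
    have "?u s0 \<otimes>\<^bsub>?R\<^esub> (tlift k T B ?R (\<lambda>t b. ?u t \<otimes>\<^bsub>?R\<^esub> \<delta> (SB b)) (\<beta> t) \<otimes>\<^bsub>?R\<^esub> \<delta> (SB s1)) =
      tlift k T B ?R (\<lambda>t0 t1. ?u s0 \<otimes>\<^bsub>?R\<^esub> ((?u t0 \<otimes>\<^bsub>?R\<^esub> \<delta> (SB t1)) \<otimes>\<^bsub>?R\<^esub> \<delta> (SB s1))) (\<beta> t)"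
      by (rule tlift_push[where h="\<lambda>z. ?u s0 \<otimes>\<^bsub>?R\<^esub> (z \<otimes>\<^bsub>?R\<^esub> \<delta> (SB s1))"]) simp_all
    then show "tlift k T B ?R (\<lambda>t0 t1. ?u s0 \<otimes>\<^bsub>?R\<^esub> ((?u t0 \<otimes>\<^bsub>?R\<^esub> \<delta> (SB t1)) \<otimes>\<^bsub>?R\<^esub> \<delta> (SB s1))) (\<beta> t) = ?u s0 \<otimes>\<^bsub>?R\<^esub> (?i (ST t) \<otimes>\<^bsub>?R\<^esub> \<delta> (SB s1))"
      by (simp only: v[OF st(2)])
  qed
  also have "\<dots> = tlift k T B ?R (\<lambda>s0 s1. ?i (ST t) \<otimes>\<^bsub>?R\<^esub> (?u s0 \<otimes>\<^bsub>?R\<^esub> \<delta> (SB s1))) (\<beta> s)"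
  proof (rule tlift_cong[OF refl])
    fix s0 s1 assume [simp]: "s0 \<in> carrier T" "s1 \<in> carrier B"
    have "?u s0 \<otimes>\<^bsub>?R\<^esub> ?i (ST t) = ?i (ST t) \<otimes>\<^bsub>?R\<^esub> ?u s0" by (simp add: tensor_mult_pure)
    then show "?u s0 \<otimes>\<^bsub>?R\<^esub> (?i (ST t) \<otimes>\<^bsub>?R\<^esub> \<delta> (SB s1)) = ?i (ST t) \<otimes>\<^bsub>?R\<^esub> (?u s0 \<otimes>\<^bsub>?R\<^esub> \<delta> (SB s1))"
      by (simp add: mult_assoc[OF RA, symmetric])
  qed
  also have "\<dots> = ?i (ST t) \<otimes>\<^bsub>?R\<^esub> ?i (ST s)"
    unfolding v[OF st(1)] by (rule tlift_push[symmetric, where h="\<lambda>z. ?i (ST t) \<otimes>\<^bsub>?R\<^esub> z"]) simp_all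
  also have "\<dots> = ?i (ST t \<otimes>\<^bsub>Z\<^esub> ST s)" by (simp add: tensor_mult_pure)
  finally show "ST (s \<cdot> t) = ST s \<otimes>\<^bsub>opp Z\<^esub> ST t"
    by (rule_tac pure_one_inj[of Z]) simp_all
next
  have "pure k Z T (ST \<one>\<^bsub>T\<^esub>) \<one>\<^bsub>T\<^esub> = pure k Z T \<one>\<^bsub>Z\<^esub> \<one>\<^bsub>T\<^esub>"
    using ST_formula[of "\<one>\<^bsub>T\<^esub>"] tensor_algebra[OF BZ.Q_algebra T_algebra]
    by (simp add: conv_def alg_hom_one[OF right_coaction_hom] tensor_one antipode_one[OF right_bialgebra SB]
        alg_hom_one[OF BZ.kappa_hom] tensor_mult_pure bilin_def alg_simps)
  then show "ST \<one>\<^bsub>T\<^esub> = \<one>\<^bsub>opp Z\<^esub>" by (rule_tac pure_one_inj[of Z]) simp_all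
qed

lemma T_nonzero: "carrier T \<noteq> {\<zero>\<^bsub>T\<^esub>}"
proof
  assume "carrier T = {\<zero>\<^bsub>T\<^esub>}"
  then have "unit_map T \<one> = unit_map T \<zero>" using one_closed[OF T_algebra] by (simp add: unit_map_def)
  then show False using coinvariants_base nontriv by (auto simp: bij_betw_def inj_on_def)
qed

lemma B_nonzero: "carrier B \<noteq> {\<zero>\<^bsub>B\<^esub>}"
proof
  assume "carrier B = {\<zero>\<^bsub>B\<^esub>}"
  then have "\<one>\<^bsub>B\<^esub> = \<zero>\<^bsub>B\<^esub>" using one_closed[OF B_algebra] by simp
  then have "\<epsilon> \<one>\<^bsub>B\<^esub> = \<epsilon> \<zero>\<^bsub>B\<^esub>" by simp
  then show False using nontriv lin_zero[OF B_module base_module_module counit_lin] by (simp add: alg_hom_one[OF counit_hom])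
qed

lemma A_nonzero: "carrier A \<noteq> {\<zero>\<^bsub>A\<^esub>}"
proof
  assume "carrier A = {\<zero>\<^bsub>A\<^esub>}"
  then have "\<one>\<^bsub>A\<^esub> = \<zero>\<^bsub>A\<^esub>" using one_closed[OF TA.Q_algebra] by simp
  then have "\<epsilon>A \<one>\<^bsub>A\<^esub> = \<epsilon>A \<zero>\<^bsub>A\<^esub>" by simp
  then show False using nontriv lin_zero[OF TA.Q_module base_module_module counitA_lin] by (simp add: alg_hom_one[OF counitA_hom])
qed

lemma Z_nonzero: "carrier Z \<noteq> {\<zero>\<^bsub>Z\<^esub>}"
proof
  assume "carrier Z = {\<zero>\<^bsub>Z\<^esub>}"
  then have "\<one>\<^bsub>Z\<^esub> = \<zero>\<^bsub>Z\<^esub>" using one_closed[OF BZ.Q_algebra] by simp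
  then have "SZ \<one>\<^bsub>Z\<^esub> = SZ \<zero>\<^bsub>Z\<^esub>" by simp
  then have "\<one>\<^bsub>T\<^esub> = \<zero>\<^bsub>T\<^esub>" using lin_zero[OF BZ.Q_module T_module SZ_lin] alg_hom_one[OF SZ_hom] by simp
  then have "unit_map T \<one> = unit_map T \<zero>" by (simp add: unit_map_def)
  then show False using coinvariants_base nontriv by (auto simp: bij_betw_def inj_on_def)
qed

lemma system_T: "hopf_galois_system k A B T Z \<alpha> \<beta> \<gamma> \<delta> SZ"
proof (intro hopf_galois_system.intro bicomodule_algebra.intro left_comodule_algebra.intro
    bicomodule_algebra_axioms.intro hopf_galois_system_axioms.intro)
  show "right_comodule_algebra k B T \<beta>" by (rule right_comodule_algebra_axioms)
  show "bialgebra k A" by (rule A_bialgebra)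
  show "\<alpha> \<in> alg_hom k T (A \<boxtimes> T)" by (rule TA.kappa_hom)
  show "\<forall>t\<in>carrier T. left_unitor k T (tensor_map k (base_module k) T \<epsilon>A id (\<alpha> t)) = t"
    using lcT by (simp add: left_counital_def left_counit_eq[of T A])
  show "\<delta> \<in> alg_hom k B (Z \<boxtimes> T)" by (rule BZ.kappa_hom)
  show "\<forall>a\<in>carrier A. tensor_map k A (T \<boxtimes> Z) id \<gamma> (\<Delta>A a) = tensor_assoc k A T Z (tensor_map k (A \<boxtimes> T) Z \<alpha> id (\<gamma> a))"
    using coassoc_1121 by (simp add: coassoc_def)
  show "\<forall>a\<in>carrier A. mult_map k T (tensor_map k T T id SZ (\<gamma> a)) = unit_map T (\<epsilon>A a)"
    using SZ_gamma by (simp add: mult_map_tensor_map[of T T Z] conv_def unit_map_def)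
  show "\<forall>b\<in>carrier B. mult_map k T (tensor_map k T T SZ id (\<delta> b)) = unit_map T (\<epsilon> b)"
    using SZ_delta by (simp add: mult_map_tensor_map[of T Z T] conv_def unit_map_def)
qed (use coassoc_1112 coassoc_1122 coassoc_1212 coassoc_2122 gamma_hom T_nonzero A_nonzero B_nonzero Z_nonzero in \<open>simp_all add: coassoc_def\<close>)

lemma system_Z: "hopf_galois_system k B A Z T lam \<rho> \<delta> \<gamma> ST"
proof (intro hopf_galois_system.intro bicomodule_algebra.intro left_comodule_algebra.intro right_comodule_algebra.intro
    bicomodule_algebra_axioms.intro hopf_galois_system_axioms.intro)
  show "bialgebra k A" by (rule A_bialgebra)
  show "bialgebra k B" by (rule right_bialgebra)
  show "lam \<in> alg_hom k Z (B \<boxtimes> Z)" by (rule lam_hom)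
  show "\<rho> \<in> alg_hom k Z (Z \<boxtimes> A)" by (rule rho_hom)
  show "\<forall>t\<in>carrier Z. left_unitor k Z (tensor_map k (base_module k) Z \<epsilon> id (lam t)) = t"
    using lcZ by (simp add: left_counital_def left_counit_eq[of Z B])
  show "\<forall>t\<in>carrier Z. right_unitor k Z (tensor_map k Z (base_module k) id \<epsilon>A (\<rho> t)) = t"
    using rcZ by (simp add: right_counital_def right_counit_eq[of Z A])
  show "\<delta> \<in> alg_hom k B (Z \<boxtimes> T)" by (rule BZ.kappa_hom)
  show "\<forall>a\<in>carrier B. tensor_map k B (Z \<boxtimes> T) id \<delta> (\<Delta> a) = tensor_assoc k B Z T (tensor_map k (B \<boxtimes> Z) T lam id (\<delta> a))"
    using coassoc_2212 by (simp add: coassoc_def)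
  show "\<forall>a\<in>carrier B. mult_map k Z (tensor_map k Z Z id ST (\<delta> a)) = unit_map Z (\<epsilon> a)"
    using ST_delta by (simp add: mult_map_tensor_map[of Z Z T] conv_def unit_map_def)
  show "\<forall>b\<in>carrier A. mult_map k Z (tensor_map k Z Z ST id (\<gamma> b)) = unit_map Z (\<epsilon>A b)"
    using ST_gamma by (simp add: mult_map_tensor_map[of Z T Z] conv_def unit_map_def)
qed (use coassoc_2221 coassoc_2111 coassoc_2211 coassoc_2121 coassoc_1211 gamma_hom T_nonzero A_nonzero B_nonzero Z_nonzero in \<open>simp_all add: coassoc_def\<close>)

lemmas inv_simps = SA_inv SB_inv SZ_gamma SZ_delta ST_gamma ST_delta

lemma complete: "complete_hopf_galois_system k A B T Z \<alpha> \<beta> lam \<rho> \<gamma> \<delta> ST SZ"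
proof (intro complete_hopf_galois_system.intro system_T system_Z)
  note h = comultA_hom comult_hom gamma_hom BZ.kappa_hom TA.kappa_hom right_coaction_hom rho_hom lam_hom
  note cu = lcA lcB lcT lcZ rcA rcB rcT rcZ
  show "\<forall>a\<in>carrier A. tensor_assoc k T B Z (tensor_map k (T \<boxtimes> B) Z \<beta> id (\<gamma> a)) = tensor_map k T (B \<boxtimes> Z) id lam (\<gamma> a)"
    using coassoc_1221 by (simp add: coassoc_def)
  show "\<forall>b\<in>carrier B. tensor_assoc k Z A T (tensor_map k (Z \<boxtimes> A) T \<rho> id (\<delta> b)) = tensor_map k Z (A \<boxtimes> T) id \<alpha> (\<delta> b)"
    using coassoc_2112 by (simp add: coassoc_def)
  show "\<forall>a\<in>carrier A. flip k Z T (tensor_map k Z T ST SZ (\<gamma> a)) = \<gamma> (antipode k A a)"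
  proof
    fix a assume a: "a \<in> carrier A"
    have "tlift k T Z (T \<boxtimes> Z) (\<lambda>x y. pure k T Z (SZ y) (ST x)) (\<gamma> a) = \<gamma> (SA a)"
      by (rule antipode_anticomult[where CXX=A and CWW=A and CYY=B and CXW=A and CWX=A and CXY=T and CYW=Z and CWY=T and CYX=Z
          and D=\<gamma> and D'=\<gamma> and dXXW=\<Delta>A and dXXY=\<gamma> and dYXW=\<rho> and dYXY=lam and dYYW=\<delta> and dWXW=\<Delta>A and dWXX=\<Delta>A and dWWX=\<Delta>A
          and eX=\<epsilon>A and eY=\<epsilon> and eW=\<epsilon>A])
        (simp_all add: a h cu inv_simps coassoc_1211 coassoc_2121 coassoc_1111)
    then show "flip k Z T (tensor_map k Z T ST SZ (\<gamma> a)) = \<gamma> (antipode k A a)"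
      using a by (simp add: flip_tensor_map[of T Z Z T] SA_def)
  qed
  show "\<forall>b\<in>carrier B. flip k T Z (tensor_map k T Z SZ ST (\<delta> b)) = \<delta> (antipode k B b)"
  proof
    fix b assume b: "b \<in> carrier B"
    have "tlift k Z T (Z \<boxtimes> T) (\<lambda>x y. pure k Z T (ST y) (SZ x)) (\<delta> b) = \<delta> (SB b)"
      by (rule antipode_anticomult[where CXX=B and CWW=B and CYY=A and CXW=B and CWX=B and CXY=Z and CYW=T and CWY=Z and CYX=T
          and D=\<delta> and D'=\<delta> and dXXW=\<Delta> and dXXY=\<delta> and dYXW=\<beta> and dYXY=\<alpha> and dYYW=\<gamma> and dWXW=\<Delta> and dWXX=\<Delta> and dWWX=\<Delta>
          and eX=\<epsilon> and eY=\<epsilon>A and eW=\<epsilon>])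
        (simp_all add: b h cu inv_simps coassoc_2122 coassoc_1212 coassoc_2222)
    then show "flip k T Z (tensor_map k T Z SZ ST (\<delta> b)) = \<delta> (antipode k B b)"
      using b by (simp add: flip_tensor_map[of Z T T Z] SB_def)
  qed
  show "\<forall>t\<in>carrier T. flip k A Z (tensor_map k A Z (antipode k A) ST (\<alpha> t)) = \<rho> (ST t)"
  proof
    fix t assume t: "t \<in> carrier T"
    have "tlift k A T (Z \<boxtimes> A) (\<lambda>x y. pure k Z A (ST y) (SA x)) (\<alpha> t) = \<rho> (ST t)"
      by (rule antipode_anticomult[where CXX=B and CWW=A and CYY=A and CXW=Z and CWX=T and CXY=Z and CYW=A and CWY=A and CYX=T
          and D=\<rho> and D'=\<alpha> and dXXW=\<delta> and dXXY=\<delta> and dYXW=\<alpha> and dYXY=\<alpha> and dYYW=\<Delta>A and dWXW=\<alpha> and dWXX=\<beta> and dWWX=\<gamma>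
          and eX=\<epsilon> and eY=\<epsilon>A and eW=\<epsilon>A])
        (simp_all add: t h cu inv_simps coassoc_2112 coassoc_1112 coassoc_1212)
    then show "flip k A Z (tensor_map k A Z (antipode k A) ST (\<alpha> t)) = \<rho> (ST t)"
      using t by (simp add: flip_tensor_map[of A T A Z] SA_def[symmetric])
  qed
  show "\<forall>t\<in>carrier T. flip k Z B (tensor_map k Z B ST (antipode k B) (\<beta> t)) = lam (ST t)"
  proof
    fix t assume t: "t \<in> carrier T"
    have "tlift k T B (B \<boxtimes> Z) (\<lambda>x y. pure k B Z (SB y) (ST x)) (\<beta> t) = lam (ST t)"
      by (rule antipode_anticomult[where CXX=B and CWW=A and CYY=B and CXW=Z and CWX=T and CXY=B and CYW=Z and CWY=T and CYX=B
          and D=lam and D'=\<beta> and dXXW=\<delta> and dXXY=\<Delta> and dYXW=\<delta> and dYXY=\<Delta> and dYYW=\<delta> and dWXW=\<alpha> and dWXX=\<beta> and dWWX=\<gamma>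
          and eX=\<epsilon> and eY=\<epsilon> and eW=\<epsilon>A])
        (simp_all add: t h cu inv_simps coassoc_2212 coassoc_2122 coassoc_1212)
    then show "flip k Z B (tensor_map k Z B ST (antipode k B) (\<beta> t)) = lam (ST t)"
      using t by (simp add: flip_tensor_map[of T B Z B] SB_def[symmetric])
  qed
  show "\<forall>z\<in>carrier Z. flip k B T (tensor_map k B T (antipode k B) SZ (lam z)) = \<beta> (SZ z)"
  proof
    fix z assume z: "z \<in> carrier Z"
    have "tlift k B Z (T \<boxtimes> B) (\<lambda>x y. pure k T B (SZ y) (SB x)) (lam z) = \<beta> (SZ z)"
      by (rule antipode_anticomult[where CXX=A and CWW=B and CYY=B and CXW=T and CWX=Z and CXY=T and CYW=B and CWY=B and CYX=Z
          and D=\<beta> and D'=lam and dXXW=\<gamma> and dXXY=\<gamma> and dYXW=lam and dYXY=lam and dYYW=\<Delta> and dWXW=lam and dWXX=\<rho> and dWWX=\<delta>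
          and eX=\<epsilon>A and eY=\<epsilon> and eW=\<epsilon>])
        (simp_all add: z h cu inv_simps coassoc_1221 coassoc_2221 coassoc_2121)
    then show "flip k B T (tensor_map k B T (antipode k B) SZ (lam z)) = \<beta> (SZ z)"
      using z by (simp add: flip_tensor_map[of B Z B T] SB_def[symmetric])
  qed
  show "\<forall>z\<in>carrier Z. flip k T A (tensor_map k T A SZ (antipode k A) (\<rho> z)) = \<alpha> (SZ z)"
  proof
    fix z assume z: "z \<in> carrier Z"
    have "tlift k Z A (A \<boxtimes> T) (\<lambda>x y. pure k A T (SA y) (SZ x)) (\<rho> z) = \<alpha> (SZ z)"
      by (rule antipode_anticomult[where CXX=A and CWW=B and CYY=A and CXW=T and CWX=Z and CXY=A and CYW=T and CWY=Z and CYX=A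
          and D=\<alpha> and D'=\<rho> and dXXW=\<gamma> and dXXY=\<Delta>A and dYXW=\<gamma> and dYXY=\<Delta>A and dYYW=\<gamma> and dWXW=lam and dWXX=\<rho> and dWWX=\<delta>
          and eX=\<epsilon>A and eY=\<epsilon>A and eW=\<epsilon>])
        (simp_all add: z h cu inv_simps coassoc_1121 coassoc_1211 coassoc_2121)
    then show "flip k T A (tensor_map k T A SZ (antipode k A) (\<rho> z)) = \<alpha> (SZ z)"
      using z by (simp add: flip_tensor_map[of Z A T A] SA_def[symmetric])
  qed
qed

end

section \<open>Existence of the complete Hopf-Galois system\<close>


text \<open>
  Tensor products do not see the coalgebra fields of a record.
\<close>

lemma tensor_upd:
  fixes A :: "('k, 'a) bialg" and N :: "('k, 'n, 'x) module_scheme"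
  shows "tensor k (A\<lparr>comult := D, counit := e\<rparr>) N = tensor k A N" "tensor k N (A\<lparr>comult := D, counit := e\<rparr>) = tensor k N A" "tensor k (A\<lparr>comult := D, counit := e\<rparr>) (A\<lparr>comult := D, counit := e\<rparr>) = tensor k A A"
    "pure k (A\<lparr>comult := D, counit := e\<rparr>) N = pure k A N" "pure k N (A\<lparr>comult := D, counit := e\<rparr>) = pure k N A" "pure k (A\<lparr>comult := D, counit := e\<rparr>) (A\<lparr>comult := D, counit := e\<rparr>) = pure k A A"
    "tensor_lift k (A\<lparr>comult := D, counit := e\<rparr>) = tensor_lift k A"
  by (simp_all add: fun_eq_iff tensor_def tensor_module_def tensor_rel_def tensor_rel_gens_def tensor_free_def tensor_coset_def
    tensor_lift_def finsum_def Let_def pure_def)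

lemma lin_map_upd:
  fixes A :: "('k, 'a) bialg" and N :: "('k, 'n, 'x) module_scheme"
  shows "lin_map k (A\<lparr>comult := D, counit := e\<rparr>) N = lin_map k A N" "lin_map k N (A\<lparr>comult := D, counit := e\<rparr>) = lin_map k N A"
    "alg_hom k (A\<lparr>comult := D, counit := e\<rparr>) N = alg_hom k A N" "alg_hom k N (A\<lparr>comult := D, counit := e\<rparr>) = alg_hom k N A"
  by (simp_all add: lin_map_def alg_hom_def ring_hom_def)

lemma test_carrier_infinite:
  assumes "(x :: 'k) \<noteq> y"
  shows "infinite (UNIV :: ('k, 't, 'b) test_carrier set)"
proof -
  let ?i = "\<lambda>n. {\<lambda>w :: ('t + 'b) list. if length w = n then x else y}"
  have "inj ?i"
  proof (rule injI)
    fix m n assume "?i m = ?i n"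
    then have "(if length w = m then x else y) = (if length w = n then x else y)" for w :: "('t + 'b) list"
      by (simp add: fun_eq_iff)
    from this[of "replicate m undefined"] show "m = n" using assms by (simp split: if_splits)
  qed
  then show ?thesis using infinite_UNIV_nat by (meson finite_imageD finite_subset subset_UNIV)
qed

lemma small_test_carrier:
  assumes "(x :: 'k) \<noteq> y"
  shows "small TYPE(('k, 't, 'b) test_carrier) (S :: 'k set)" "small TYPE(('k, 't, 'b) test_carrier) (S' :: 't set)"
    "small TYPE(('k, 't, 'b) test_carrier) (S'' :: 'b set)"
proof -
  have "inj_on (\<lambda>c. {\<lambda>w :: ('t + 'b) list. c}) S" by (auto simp: inj_on_def fun_eq_iff)
  then show "small TYPE(('k, 't, 'b) test_carrier) S" unfolding small_def by blast
  let ?e = "\<lambda>v. {\<lambda>w :: ('t + 'b) list. if w = v then x else y}"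
  have e: "v = v'" if "?e v = ?e v'" for v v' using that assms by (auto simp: fun_eq_iff split: if_splits)
  have "inj_on (\<lambda>t. ?e [Inl t]) S'" by (rule inj_onI) (use e in blast)
  then show "small TYPE(('k, 't, 'b) test_carrier) S'" unfolding small_def by blast
  have "inj_on (\<lambda>t. ?e [Inr t]) S''" by (rule inj_onI) (use e in blast)
  then show "small TYPE(('k, 't, 'b) test_carrier) S''" unfolding small_def by blast
qed

text \<open>
  Assembly of the cogroupoid from the structure maps of the universal property.
\<close>

lemma (in galois_ff) complete_system_exists:
  assumes hopf: "hopf_algebra k B" and nt: "\<one> \<noteq> \<zero>"
  shows "\<exists>(A :: ('k, ('t \<times> 't \<Rightarrow> 'k) set) bialg) (Z :: ('k, ('b \<times> 't \<Rightarrow> 'k) set) module)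
      \<alpha>\<^sub>T lam\<^sub>Z \<rho>\<^sub>Z \<gamma> \<delta> S\<^sub>T S\<^sub>Z.
    hopf_algebra k A \<and> k_algebra k Z \<and>
    S\<^sub>T \<in> alg_hom k T (opp Z) \<and> S\<^sub>Z \<in> alg_hom k Z (opp T) \<and>
    complete_hopf_galois_system k A B T Z \<alpha>\<^sub>T \<beta> lam\<^sub>Z \<rho>\<^sub>Z \<gamma> \<delta> S\<^sub>T S\<^sub>Z"
proof -
  have BB: "right_comodule_algebra k B B \<Delta>"
    using bialgebra.coassoc[OF right_bialgebra] bialgebra.counit_right[OF right_bialgebra]
    by (intro right_comodule_algebra.intro right_bialgebra B_algebra comult_hom)
  interpret RT: galois_descent k B T \<beta> U T \<beta>
    by (intro galois_descent.intro galois_ff_axioms right_comodule_algebra_axioms galois_descent_axioms.intro small_T)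
  interpret RB: galois_descent k B T \<beta> U B \<Delta>
    by (intro galois_descent.intro galois_ff_axioms BB galois_descent_axioms.intro small_B)
  define Z :: "('k, ('b \<times> 't \<Rightarrow> 'k) set) module" where "Z = \<lparr>carrier = RB.descended, mult = RB.opp_mult,
    one = pure k B T \<one>\<^bsub>B\<^esub> \<one>\<^bsub>T\<^esub>, zero = zero (B \<boxtimes> T), add = add (B \<boxtimes> T), smult = smult (B \<boxtimes> T)\<rparr>"
  (* the coalgebra fields can only be filled in after the universal property is available for this algebra *)
  define A1 :: "('k, ('t \<times> 't \<Rightarrow> 'k) set) bialg" where "A1 = \<lparr>carrier = RT.descended, mult = RT.opp_mult,
    one = pure k T T \<one>\<^bsub>T\<^esub> \<one>\<^bsub>T\<^esub>, zero = zero (T \<boxtimes> T), add = add (T \<boxtimes> T), smult = smult (T \<boxtimes> T),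
    comult = undefined, counit = undefined\<rparr>"
  interpret BZ: descended_algebra k B T \<beta> U B \<Delta> Z
    by (intro descended_algebra.intro RB.galois_descent_axioms descended_algebra_axioms.intro) (simp_all add: Z_def)
  interpret A1: descended_algebra k B T \<beta> U T \<beta> A1
    by (intro descended_algebra.intro RT.galois_descent_axioms descended_algebra_axioms.intro) (simp_all add: A1_def)
  obtain D where D: "D \<in> alg_hom k A1 (A1 \<boxtimes> A1)" "coassoc k T A1 A1 T A1.\<kappa> D A1.\<kappa> A1.\<kappa>"
    by (rule A1.kappa_comult_exists[of A1 T A1 A1.\<kappa> A1.\<kappa> \<beta>])
      (simp_all add: A1.kappa_hom A1.kappa_colinear)
  obtain e where e: "e \<in> alg_hom k A1 (base_module k)" "\<And>x. x \<in> carrier T \<Longrightarrow> tlift k A1 T T (\<lambda>a t. e a \<odot>\<^bsub>T\<^esub> t) (A1.\<kappa> x) = x"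
    by (rule A1.kappa_counit_exists[of "\<lambda>x. x"]) (simp_all add: alg_homI tlift_eta)
  define A where "A = A1\<lparr>comult := D, counit := e\<rparr>"
  have sel: "carrier A = carrier A1" "comult A = D" "counit A = e" by (simp_all add: A_def)
  interpret TA: descended_algebra k B T \<beta> U T \<beta> A
    by (intro descended_algebra.intro RT.galois_descent_axioms descended_algebra_axioms.intro) (simp_all add: A_def A1_def)
  note upd = tensor_upd[where k=k and A=A1 and D=D and e=e, folded A_def] lin_map_upd[where k=k and A=A1 and D=D and e=e, folded A_def]
  have tl: "tlift k A N P = tlift k A1 N P" for N :: "('k, 'n, 'x1) module_scheme" and P :: "('k, 'p, 'x2) module_scheme"
    by (simp add: tlift_def[abs_def] sel)
  have kap: "TA.\<kappa> = A1.\<kappa>"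
    by (simp add: TA.\<kappa>_def[abs_def] A1.\<kappa>_def[abs_def] TA.\<Phi>_def[abs_def] A1.\<Phi>_def[abs_def] upd tl)
  have co: "coassoc k T A A T TA.\<kappa> (comult A) TA.\<kappa> TA.\<kappa>"
    using D(2) by (simp add: coassoc_def kap sel tensor_assoc_def tensor_map_def upd)
  obtain \<gamma> where g: "\<gamma> \<in> alg_hom k A (T \<boxtimes> Z)" "coassoc k T T Z T TA.\<kappa> \<gamma> \<beta> BZ.\<kappa>"
    by (rule TA.kappa_comult_exists[of T B Z \<beta> BZ.\<kappa> \<Delta>])
      (simp_all add: right_coaction_hom BZ.kappa_hom BZ.kappa_colinear beta_coassoc)
  obtain \<rho> where r: "\<rho> \<in> alg_hom k Z (Z \<boxtimes> A)" "coassoc k B Z A T BZ.\<kappa> \<rho> BZ.\<kappa> TA.\<kappa>"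
    by (rule BZ.kappa_comult_exists[of Z T A BZ.\<kappa> TA.\<kappa> \<beta>])
      (simp_all add: BZ.kappa_hom TA.kappa_hom BZ.kappa_colinear TA.kappa_colinear)
  obtain lam where l: "lam \<in> alg_hom k Z (B \<boxtimes> Z)" "coassoc k B B Z T BZ.\<kappa> lam \<Delta> BZ.\<kappa>"
    by (rule BZ.kappa_comult_exists[of B B Z \<Delta> BZ.\<kappa> \<Delta>])
      (simp_all add: comult_hom BZ.kappa_hom BZ.kappa_colinear comult_coassoc)
  interpret G: galois_cogroupoid k B T \<beta> U A Z \<gamma> \<rho> lam
  proof (intro galois_cogroupoid.intro galois_cogroupoid_axioms.intro)
    show "comult A \<in> alg_hom k A (A \<boxtimes> A)" using D(1) by (simp add: sel upd)
    show "counit A \<in> alg_hom k A (base_module k)" using e(1) by (simp add: sel upd)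
    show "left_counital k A T TA.\<kappa> (counit A)" using e(2) by (simp add: left_counital_def sel kap tl)
  qed (fact galois_ff_axioms TA.descended_algebra_axioms BZ.descended_algebra_axioms g r l co hopf nt)+
  show ?thesis
    using G.A_hopf BZ.Q_algebra G.ST_hom G.SZ_hom G.complete by blast
qed

theorem corollary1:
  fixes k :: "'k ring" and B :: "('k, 'b) bialg" and T :: "('k, 't) module"
    and \<beta>\<^sub>T :: "'t \<Rightarrow> ('t \<times> 'b \<Rightarrow> 'k) set"
  assumes "cring k" and "\<one>\<^bsub>k\<^esub> \<noteq> \<zero>\<^bsub>k\<^esub>"
    and "hopf_algebra k B"
    and "galois_extension k B T \<beta>\<^sub>T"
    and "faithfully_flat TYPE(('k, 't, 'b) test_carrier) k T"
  shows "\<exists>(A :: ('k, ('t \<times> 't \<Rightarrow> 'k) set) bialg) (Z :: ('k, ('b \<times> 't \<Rightarrow> 'k) set) module)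
      \<alpha>\<^sub>T lam\<^sub>Z \<rho>\<^sub>Z \<gamma> \<delta> S\<^sub>T S\<^sub>Z.
    hopf_algebra k A \<and> k_algebra k Z \<and>
    S\<^sub>T \<in> alg_hom k T (opp Z) \<and> S\<^sub>Z \<in> alg_hom k Z (opp T) \<and>
    complete_hopf_galois_system k A B T Z \<alpha>\<^sub>T \<beta>\<^sub>T lam\<^sub>Z \<rho>\<^sub>Z \<gamma> \<delta> S\<^sub>T S\<^sub>Z \<and>
    hopf_galois_system k A B T Z \<alpha>\<^sub>T \<beta>\<^sub>T \<gamma> \<delta> S\<^sub>Z \<and>
    hopf_galois_system k B A Z T lam\<^sub>Z \<rho>\<^sub>Z \<delta> \<gamma> S\<^sub>T"
proof -
  interpret galois_ff k B T \<beta>\<^sub>T "TYPE(('k, 't, 'b) test_carrier)"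
  proof (intro galois_ff.intro ff_module.intro ff_module_axioms.intro galois_ff_axioms.intro base_ring.intro)
    show "module k T" using assms(5) by (simp add: faithfully_flat_def)
    show "infinite (UNIV :: ('k, 't, 'b) test_carrier set)" by (rule test_carrier_infinite[OF assms(2)])
  qed (fact assms | rule small_test_carrier[OF assms(2)])+
  show ?thesis
    using complete_system_exists[OF assms(3,2)] complete_hopf_galois_system.system_T complete_hopf_galois_system.system_Z by meson
qed

end
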